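(* Let $k$ be a field and let $H$ be a pointed Hopf $k$-algebra. Let $\{H_n\}_{n\ge 0}$ denote the coradical filtration of $H$ and let $\operatorname{gr}H$ denote the associated graded pointed Hopf algebra with respect to the coradical filtration. Let $S$ and $\overline{S}$ denote the antipodes of $H$ and $\operatorname{gr}H$ respectively. \begin{enumerate} \item[(1)] If $m_H=\infty$ then $|S|=\infty$. \item[(2)] If $m_H<\infty$ then $(S^{2m_H}-\operatorname{id})(H_n)\subseteq H_{n-1}$ for all $n\ge 1$. \item[(3)] Suppose $\operatorname{char}k=0$. If $|S|<\infty$ then either $S=\operatorname{id}$ or $$|S|=2m_H=2m_{\operatorname{gr}H}=|\overline{S}|.$$ \item[(4)] Suppose $\operatorname{char}k=p>0$. If $m_H<\infty$ and $H$ is generated as an algebra by $H_n$ for some $n\ge 0$, then $|S|$ divides $2m_Hp^{l}$, where $l\in\mathbb{N}$ is such that $p^{l}\ge n\ge p^{l-1}$. \end{enumerate}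
   Context: For a Hopf $k$-algebra $H$, $\Delta$, $\epsilon$, $S$ denote the coproduct, counit and antipode. The order $|S|$ is the minimal $n\ge 1$ with $S^n=\operatorname{id}$, and $|S|=\infty$ if there is no such $n$; "$|S|$ divides $N$" (for $N$ a positive integer) means that $|S|$ is finite and divides $N$, i.e. $S^N=\operatorname{id}$. The coradical filtration $\{H_n\}_{n\ge 0}$ is given by: $H_0$ is the sum of the simple subcoalgebras of $H$, and $H_n=\Delta^{-1}(H\otimes H_{n-1}+H_0\otimes H)$ for $n\ge 1$. $G(H)$ is the group of group-like elements ($\Delta(g)=g\otimes g$). $H$ is pointed if $H_0=kG(H)$, equivalently if each simple subcoalgebra is one-dimensional. If $H$ is pointed, the coradical filtration is a Hopf algebra filtration, so $\operatorname{gr}H=\bigoplus_{n\ge 0}H_n/H_{n-1}$ (with $H_{-1}=0$) inherits the structure of a pointed Hopf algebra. Definition of $m_H$ for a pointed Hopf algebra $H$: for $x\in G(H)$ let $P_{x,1}(H)=\{h\in H:\Delta(h)=h\otimes x+1\otimes h\}$, a subspace stable under conjugation by $x$. Let $C_{\langle x\rangle}(P_{x,1}(H))$ be the subgroup of those elements of the cyclic group $\langle x\rangle\le G(H)$ which commute with every element of $P_{x,1}(H)$, and put $a_x=|\langle x\rangle:C_{\langle x\rangle}(P_{x,1}(H))|$ (the index, possibly $\infty$). Then $m_H=\operatorname{lcm}\{a_x:x\in G(H)\}$, with $m_H=\infty$ if some $a_x$ is infinite or if the $a_x$ have no finite common multiple. *)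

theory Defs
  imports
    "HOL-Algebra.Module" "HOL-Algebra.QuotRing" "HOL-Algebra.Subrings"
    "HOL-Algebra.Generated_Groups" Complex_Main "HOL-Library.Extended_Nat"
begin

definition span_of :: "('k,'n) ring_scheme \<Rightarrow> ('k,'v,'m) module_scheme \<Rightarrow> 'v set \<Rightarrow> 'v set" where
  "span_of K V X = (\<lambda>N. submodule N K V) hull X"

definition linear_map ::
  "('k,'n) ring_scheme \<Rightarrow> ('k,'v,'a) module_scheme \<Rightarrow> ('k,'w,'b) module_scheme \<Rightarrow> ('v \<Rightarrow> 'w) \<Rightarrow> bool" where
  "linear_map K V W f \<longleftrightarrow> f \<in> carrier V \<rightarrow> carrier W \<and>
    (\<forall>x\<in>carrier V. \<forall>y\<in>carrier V. f (x \<oplus>\<^bsub>V\<^esub> y) = f x \<oplus>\<^bsub>W\<^esub> f y) \<and>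
    (\<forall>a\<in>carrier K. \<forall>x\<in>carrier V. f (a \<odot>\<^bsub>V\<^esub> x) = a \<odot>\<^bsub>W\<^esub> f x)"

definition scalar_module :: "('k,'n) ring_scheme \<Rightarrow> ('k,'k) module" where
  "scalar_module K = \<lparr>carrier = carrier K, mult = mult K, one = one K, zero = zero K, add = add K,
     smult = mult K\<rparr>"

text \<open>Quotient vector space; as a mere module, it has no meaningful \<^const>\<open>mult\<close> and \<^const>\<open>one\<close>.
  The union in \<^const>\<open>smult\<close> (as in \<^const>\<open>rcoset_mult\<close>) is over representatives of one coset,
  which all yield the same coset.\<close>

definition quot_module :: "('k,'v,'m) module_scheme \<Rightarrow> 'v set \<Rightarrow> ('k,'v set) module" where
  "quot_module V N = \<lparr>carrier = a_rcosets\<^bsub>V\<^esub> N, mult = undefined, one = undefined,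
     zero = N, add = set_add V, smult = (\<lambda>a X. \<Union>x\<in>X. N +>\<^bsub>V\<^esub> (a \<odot>\<^bsub>V\<^esub> x))\<rparr>"

text \<open>\<open>V \<otimes> W\<close> is the free \<open>K\<close>-vector space on \<open>V \<times> W\<close> (finitely supported functions) modulo
  the bilinearity relations.\<close>

definition free_on_pairs ::
  "('k,'n) ring_scheme \<Rightarrow> ('k,'v,'a) module_scheme \<Rightarrow> ('k,'w,'b) module_scheme \<Rightarrow> ('k, 'v \<times> 'w \<Rightarrow> 'k) module" where
  "free_on_pairs K V W = \<lparr>
     carrier = {f. range f \<subseteq> carrier K \<and> finite {p. f p \<noteq> \<zero>\<^bsub>K\<^esub>} \<and>
                   {p. f p \<noteq> \<zero>\<^bsub>K\<^esub>} \<subseteq> carrier V \<times> carrier W},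
     mult = undefined, one = undefined,
     zero = (\<lambda>p. \<zero>\<^bsub>K\<^esub>),
     add = (\<lambda>f g p. f p \<oplus>\<^bsub>K\<^esub> g p),
     smult = (\<lambda>a f p. a \<otimes>\<^bsub>K\<^esub> f p)\<rparr>"

definition pair_basis :: "('k,'n) ring_scheme \<Rightarrow> 'v \<Rightarrow> 'w \<Rightarrow> 'v \<times> 'w \<Rightarrow> 'k" where
  "pair_basis K v w = (\<lambda>p. if p = (v, w) then \<one>\<^bsub>K\<^esub> else \<zero>\<^bsub>K\<^esub>)"

definition bilinear_relations ::
  "('k,'n) ring_scheme \<Rightarrow> ('k,'v,'a) module_scheme \<Rightarrow> ('k,'w,'b) module_scheme \<Rightarrow> ('v \<times> 'w \<Rightarrow> 'k) set" where
  "bilinear_relations K V W = (let F = free_on_pairs K V W; e = pair_basis K in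
     {e (v \<oplus>\<^bsub>V\<^esub> v') w \<ominus>\<^bsub>F\<^esub> (e v w \<oplus>\<^bsub>F\<^esub> e v' w) | v v' w.
        v \<in> carrier V \<and> v' \<in> carrier V \<and> w \<in> carrier W} \<union>
     {e v (w \<oplus>\<^bsub>W\<^esub> w') \<ominus>\<^bsub>F\<^esub> (e v w \<oplus>\<^bsub>F\<^esub> e v w') | v w w'.
        v \<in> carrier V \<and> w \<in> carrier W \<and> w' \<in> carrier W} \<union>
     {e (a \<odot>\<^bsub>V\<^esub> v) w \<ominus>\<^bsub>F\<^esub> (a \<odot>\<^bsub>F\<^esub> e v w) | a v w.
        a \<in> carrier K \<and> v \<in> carrier V \<and> w \<in> carrier W} \<union>
     {e v (a \<odot>\<^bsub>W\<^esub> w) \<ominus>\<^bsub>F\<^esub> (a \<odot>\<^bsub>F\<^esub> e v w) | a v w.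
        a \<in> carrier K \<and> v \<in> carrier V \<and> w \<in> carrier W})"

definition tensor_null ::
  "('k,'n) ring_scheme \<Rightarrow> ('k,'v,'a) module_scheme \<Rightarrow> ('k,'w,'b) module_scheme \<Rightarrow> ('v \<times> 'w \<Rightarrow> 'k) set" where
  "tensor_null K V W = span_of K (free_on_pairs K V W) (bilinear_relations K V W)"

definition tensor ::
  "('k,'n) ring_scheme \<Rightarrow> ('k,'v,'a) module_scheme \<Rightarrow> ('k,'w,'b) module_scheme \<Rightarrow>
   ('k, ('v \<times> 'w \<Rightarrow> 'k) set) module" where
  "tensor K V W = quot_module (free_on_pairs K V W) (tensor_null K V W)"

definition tens ::
  "('k,'n) ring_scheme \<Rightarrow> ('k,'v,'a) module_scheme \<Rightarrow> ('k,'w,'b) module_scheme \<Rightarrow> 'v \<Rightarrow> 'w \<Rightarrow>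
   ('v \<times> 'w \<Rightarrow> 'k) set" where
  "tens K V W v w = tensor_null K V W +>\<^bsub>free_on_pairs K V W\<^esub> pair_basis K v w"

text \<open>\<open>tensor_lift K Z \<beta>\<close> is the linear map \<open>V \<otimes> W \<rightarrow> Z\<close> induced by a bilinear map
  \<open>\<beta> : V \<times> W \<rightarrow> Z\<close>, that is, \<open>\<Sum> c\<^sub>i (v\<^sub>i \<otimes> w\<^sub>i) \<mapsto> \<Sum> c\<^sub>i \<beta>(v\<^sub>i, w\<^sub>i)\<close>. For bilinear \<open>\<beta>\<close> the value does
  not depend on the representative \<open>f\<close> of \<open>T\<close>, so the image below is a singleton.\<close>

definition tensor_lift ::
  "('k,'n) ring_scheme \<Rightarrow> ('k,'z,'c) module_scheme \<Rightarrow> ('v \<Rightarrow> 'w \<Rightarrow> 'z) \<Rightarrow> ('v \<times> 'w \<Rightarrow> 'k) set \<Rightarrow> 'z" where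
  "tensor_lift K Z \<beta> T =
     the_elem ((\<lambda>f. \<Oplus>\<^bsub>Z\<^esub>p\<in>{p. f p \<noteq> \<zero>\<^bsub>K\<^esub>}. f p \<odot>\<^bsub>Z\<^esub> \<beta> (fst p) (snd p)) ` T)"

definition tensor_map ::
  "('k,'n) ring_scheme \<Rightarrow> ('k,'v,'a) module_scheme \<Rightarrow> ('k,'w,'b) module_scheme \<Rightarrow>
   ('x \<Rightarrow> 'v) \<Rightarrow> ('y \<Rightarrow> 'w) \<Rightarrow> ('x \<times> 'y \<Rightarrow> 'k) set \<Rightarrow> ('v \<times> 'w \<Rightarrow> 'k) set" where
  "tensor_map K V W f g = tensor_lift K (tensor K V W) (\<lambda>x y. tens K V W (f x) (g y))"

text \<open>\<open>(U \<otimes> V) \<otimes> W \<rightarrow> U \<otimes> (V \<otimes> W)\<close>\<close>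

definition tensor_assoc ::
  "('k,'n) ring_scheme \<Rightarrow> ('k,'u,'a) module_scheme \<Rightarrow> ('k,'v,'b) module_scheme \<Rightarrow> ('k,'w,'c) module_scheme \<Rightarrow>
   (('u \<times> 'v \<Rightarrow> 'k) set \<times> 'w \<Rightarrow> 'k) set \<Rightarrow> ('u \<times> ('v \<times> 'w \<Rightarrow> 'k) set \<Rightarrow> 'k) set" where
  "tensor_assoc K U V W = (let VW = tensor K V W; Z = tensor K U VW in
     tensor_lift K Z (\<lambda>X w. tensor_lift K Z (\<lambda>u v. tens K U VW u (tens K V W v w)) X))"

definition tensor_algebra ::
  "('k,'n) ring_scheme \<Rightarrow> ('k,'v,'a) module_scheme \<Rightarrow> ('k,'w,'b) module_scheme \<Rightarrow>
   ('k, ('v \<times> 'w \<Rightarrow> 'k) set) module" where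
  "tensor_algebra K A B = (tensor K A B)\<lparr>
     mult := (\<lambda>X Y. tensor_lift K (tensor K A B) (\<lambda>a b.
       tensor_lift K (tensor K A B) (\<lambda>c d. tens K A B (a \<otimes>\<^bsub>A\<^esub> c) (b \<otimes>\<^bsub>B\<^esub> d)) Y) X),
     one := tens K A B \<one>\<^bsub>A\<^esub> \<one>\<^bsub>B\<^esub>\<rparr>"

definition tensor_sub ::
  "('k,'n) ring_scheme \<Rightarrow> ('k,'v,'a) module_scheme \<Rightarrow> 'v set \<Rightarrow> 'v set \<Rightarrow> ('v \<times> 'v \<Rightarrow> 'k) set set" where
  "tensor_sub K V X Y = span_of K (tensor K V V) {tens K V V x y | x y. x \<in> X \<and> y \<in> Y}"

record ('k, 'h) hopf_alg = "('k, 'h) module" +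
  comult :: "'h \<Rightarrow> ('h \<times> 'h \<Rightarrow> 'k) set"
  counit :: "'h \<Rightarrow> 'k"
  antipode :: "'h \<Rightarrow> 'h"

locale assoc_algebra = K?: field K + A?: ring A + module K A
  for K :: "('k,'n) ring_scheme" and A :: "('k,'h,'m) module_scheme" (structure) +
  assumes smult_mult_left: "\<lbrakk>a \<in> carrier K; x \<in> carrier A; y \<in> carrier A\<rbrakk> \<Longrightarrow>
      (a \<odot>\<^bsub>A\<^esub> x) \<otimes>\<^bsub>A\<^esub> y = a \<odot>\<^bsub>A\<^esub> (x \<otimes>\<^bsub>A\<^esub> y)"
    and smult_mult_right: "\<lbrakk>a \<in> carrier K; x \<in> carrier A; y \<in> carrier A\<rbrakk> \<Longrightarrow>
      x \<otimes>\<^bsub>A\<^esub> (a \<odot>\<^bsub>A\<^esub> y) = a \<odot>\<^bsub>A\<^esub> (x \<otimes>\<^bsub>A\<^esub> y)"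

locale coalgebra = K?: field K + module K C
  for K :: "('k,'n) ring_scheme" and C :: "('k,'h,'m) hopf_alg_scheme" (structure) +
  assumes comult_linear: "linear_map K C (tensor K C C) (comult C)"
    and counit_linear: "linear_map K C (scalar_module K) (counit C)"
    and coassoc: "h \<in> carrier C \<Longrightarrow>
      tensor_assoc K C C C (tensor_map K (tensor K C C) C (comult C) (\<lambda>x. x) (comult C h)) =
      tensor_map K C (tensor K C C) (\<lambda>x. x) (comult C) (comult C h)"
    and counit_left: "h \<in> carrier C \<Longrightarrow>
      tensor_lift K C (\<lambda>a b. counit C a \<odot>\<^bsub>C\<^esub> b) (comult C h) = h"
    and counit_right: "h \<in> carrier C \<Longrightarrow>
      tensor_lift K C (\<lambda>a b. counit C b \<odot>\<^bsub>C\<^esub> a) (comult C h) = h"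

locale bialgebra = assoc_algebra K H + coalgebra K H
  for K :: "('k,'n) ring_scheme" and H :: "('k,'h,'m) hopf_alg_scheme" (structure) +
  assumes comult_hom: "comult H \<in> ring_hom H (tensor_algebra K H H)"
    and counit_hom: "counit H \<in> ring_hom H K"

locale hopf_algebra = bialgebra K H
  for K :: "('k,'n) ring_scheme" and H :: "('k,'h,'m) hopf_alg_scheme" (structure) +
  assumes antipode_linear: "linear_map K H H (antipode H)"
    and antipode_left: "h \<in> carrier H \<Longrightarrow>
      tensor_lift K H (\<lambda>a b. antipode H a \<otimes>\<^bsub>H\<^esub> b) (comult H h) = counit H h \<odot>\<^bsub>H\<^esub> \<one>\<^bsub>H\<^esub>"
    and antipode_right: "h \<in> carrier H \<Longrightarrow>
      tensor_lift K H (\<lambda>a b. a \<otimes>\<^bsub>H\<^esub> antipode H b) (comult H h) = counit H h \<odot>\<^bsub>H\<^esub> \<one>\<^bsub>H\<^esub>"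

text \<open>The condition \<open>g \<noteq> 0\<close> excludes the trivial solution \<open>0\<close> of \<open>\<Delta>(g) = g \<otimes> g\<close>.\<close>

definition grouplike_group ::
  "('k,'n) ring_scheme \<Rightarrow> ('k,'h,'m) hopf_alg_scheme \<Rightarrow> 'h monoid" where
  "grouplike_group K H = \<lparr>
     carrier = {g \<in> carrier H. g \<noteq> \<zero>\<^bsub>H\<^esub> \<and> comult H g = tens K H H g g},
     mult = mult H, one = one H\<rparr>"

definition subcoalgebra ::
  "('k,'n) ring_scheme \<Rightarrow> ('k,'h,'m) hopf_alg_scheme \<Rightarrow> 'h set \<Rightarrow> bool" where
  "subcoalgebra K H D \<longleftrightarrow> submodule D K H \<and> (\<forall>d\<in>D. comult H d \<in> tensor_sub K H D D)"

definition simple_subcoalgebra ::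
  "('k,'n) ring_scheme \<Rightarrow> ('k,'h,'m) hopf_alg_scheme \<Rightarrow> 'h set \<Rightarrow> bool" where
  "simple_subcoalgebra K H D \<longleftrightarrow> subcoalgebra K H D \<and> D \<noteq> {\<zero>\<^bsub>H\<^esub>} \<and>
     (\<forall>E. subcoalgebra K H E \<and> E \<subseteq> D \<longrightarrow> E = {\<zero>\<^bsub>H\<^esub>} \<or> E = D)"

definition coradical :: "('k,'n) ring_scheme \<Rightarrow> ('k,'h,'m) hopf_alg_scheme \<Rightarrow> 'h set" where
  "coradical K H = span_of K H (\<Union>{D. simple_subcoalgebra K H D})"

primrec corad_filt ::
  "('k,'n) ring_scheme \<Rightarrow> ('k,'h,'m) hopf_alg_scheme \<Rightarrow> nat \<Rightarrow> 'h set" where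
  "corad_filt K H 0 = coradical K H"
| "corad_filt K H (Suc n) = {h \<in> carrier H. comult H h \<in>
     tensor_sub K H (carrier H) (corad_filt K H n) <+>\<^bsub>tensor K H H\<^esub>
     tensor_sub K H (coradical K H) (carrier H)}"

definition pointed :: "('k,'n) ring_scheme \<Rightarrow> ('k,'h,'m) hopf_alg_scheme \<Rightarrow> bool" where
  "pointed K H \<longleftrightarrow> corad_filt K H 0 = span_of K H (carrier (grouplike_group K H))"

text \<open>\<open>H\<^sub>n\<^sub>-\<^sub>1\<close>, where \<open>H\<^sub>-\<^sub>1 = 0\<close>\<close>

definition corad_below ::
  "('k,'n) ring_scheme \<Rightarrow> ('k,'h,'m) hopf_alg_scheme \<Rightarrow> nat \<Rightarrow> 'h set" where
  "corad_below K H n = (case n of 0 \<Rightarrow> {\<zero>\<^bsub>H\<^esub>} | Suc m \<Rightarrow> corad_filt K H m)"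

definition gr_piece ::
  "('k,'n) ring_scheme \<Rightarrow> ('k,'h,'m) hopf_alg_scheme \<Rightarrow> nat \<Rightarrow> ('k, 'h set) module" where
  "gr_piece K H n = quot_module (H\<lparr>carrier := corad_filt K H n\<rparr>) (corad_below K H n)"

definition gr_piece_mult ::
  "('k,'n) ring_scheme \<Rightarrow> ('k,'h,'m) hopf_alg_scheme \<Rightarrow> nat \<Rightarrow> nat \<Rightarrow> 'h set \<Rightarrow> 'h set \<Rightarrow> 'h set" where
  "gr_piece_mult K H i j X Y = (\<Union>x\<in>X. \<Union>y\<in>Y. corad_below K H (i + j) +>\<^bsub>H\<^esub> (x \<otimes>\<^bsub>H\<^esub> y))"

text \<open>The homogeneous element of degree \<open>n\<close> represented by \<open>h \<in> H\<^sub>n\<close>\<close>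

definition gr_elem ::
  "('k,'n) ring_scheme \<Rightarrow> ('k,'h,'m) hopf_alg_scheme \<Rightarrow> nat \<Rightarrow> 'h \<Rightarrow> nat \<Rightarrow> 'h set" where
  "gr_elem K H n h = (\<lambda>i. if i = n then corad_below K H n +>\<^bsub>H\<^esub> h else corad_below K H i)"

text \<open>An element of the direct sum is the sequence of its homogeneous components.\<close>

definition gr_algebra ::
  "('k,'n) ring_scheme \<Rightarrow> ('k,'h,'m) hopf_alg_scheme \<Rightarrow> ('k, nat \<Rightarrow> 'h set) module" where
  "gr_algebra K H = (let P = gr_piece K H in \<lparr>
     carrier = {u. (\<forall>n. u n \<in> carrier (P n)) \<and> finite {n. u n \<noteq> \<zero>\<^bsub>P n\<^esub>}},
     mult = (\<lambda>u v n. \<Oplus>\<^bsub>P n\<^esub>i\<in>{..n}. gr_piece_mult K H i (n - i) (u i) (v (n - i))),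
     one = gr_elem K H 0 \<one>\<^bsub>H\<^esub>,
     zero = (\<lambda>n. \<zero>\<^bsub>P n\<^esub>),
     add = (\<lambda>u v n. u n \<oplus>\<^bsub>P n\<^esub> v n),
     smult = (\<lambda>a u n. a \<odot>\<^bsub>P n\<^esub> u n)\<rparr>)"

text \<open>The coproduct on degree \<open>n\<close>: if \<open>h \<in> H\<^sub>n\<close> then \<open>\<Delta>(h) \<in> \<Sum>\<^sub>i\<^sub>\<le>\<^sub>n H\<^sub>i \<otimes> H\<^sub>n\<^sub>-\<^sub>i\<close>. Choose
  \<open>t\<^sub>i \<in> H\<^sub>i \<otimes> H\<^sub>n\<^sub>-\<^sub>i\<close> such that \<open>\<Delta>(h)\<close> is the sum of the images of the \<open>t\<^sub>i\<close> in \<open>H \<otimes> H\<close>, and send the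
  class of \<open>h\<close> to the sum of the images of the \<open>t\<^sub>i\<close> under
  \<open>H\<^sub>i \<otimes> H\<^sub>n\<^sub>-\<^sub>i \<rightarrow> H\<^sub>i/H\<^sub>i\<^sub>-\<^sub>1 \<otimes> H\<^sub>n\<^sub>-\<^sub>i/H\<^sub>n\<^sub>-\<^sub>i\<^sub>-\<^sub>1 \<subseteq> gr H \<otimes> gr H\<close>. This sum is the same for all \<open>t\<close> and all
  representatives \<open>h\<close> of the class \<open>X\<close>, so the set below is a singleton.\<close>

definition gr_comult_piece ::
  "('k,'n) ring_scheme \<Rightarrow> ('k,'h,'m) hopf_alg_scheme \<Rightarrow> nat \<Rightarrow> 'h set \<Rightarrow>
   ((nat \<Rightarrow> 'h set) \<times> (nat \<Rightarrow> 'h set) \<Rightarrow> 'k) set" where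
  "gr_comult_piece K H n X = (let G = gr_algebra K H; F = corad_filt K H in
     the_elem {\<Oplus>\<^bsub>tensor K G G\<^esub>i\<in>{..n}. tensor_map K G G (gr_elem K H i) (gr_elem K H (n - i)) (t i) | h t.
       h \<in> X \<and>
       (\<forall>i\<le>n. t i \<in> carrier (tensor K (H\<lparr>carrier := F i\<rparr>) (H\<lparr>carrier := F (n - i)\<rparr>))) \<and>
       comult H h = (\<Oplus>\<^bsub>tensor K H H\<^esub>i\<in>{..n}. tensor_map K H H (\<lambda>x. x) (\<lambda>x. x) (t i))})"

definition gr_comult ::
  "('k,'n) ring_scheme \<Rightarrow> ('k,'h,'m) hopf_alg_scheme \<Rightarrow> (nat \<Rightarrow> 'h set) \<Rightarrow>
   ((nat \<Rightarrow> 'h set) \<times> (nat \<Rightarrow> 'h set) \<Rightarrow> 'k) set" where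
  "gr_comult K H u = (let G = gr_algebra K H in
     \<Oplus>\<^bsub>tensor K G G\<^esub>n\<in>{n. u n \<noteq> \<zero>\<^bsub>gr_piece K H n\<^esub>}. gr_comult_piece K H n (u n))"

text \<open>The counit vanishes in positive degrees; in degree \<open>0\<close>, a class is a singleton as
  \<open>H\<^sub>-\<^sub>1 = 0\<close>. The antipode maps the class of \<open>h \<in> H\<^sub>n\<close> to the class of \<open>S(h)\<close>.\<close>

definition gr ::
  "('k,'n) ring_scheme \<Rightarrow> ('k,'h,'m) hopf_alg_scheme \<Rightarrow> ('k, nat \<Rightarrow> 'h set) hopf_alg" where
  "gr K H = module.extend (gr_algebra K H) (hopf_alg.fields
     (gr_comult K H)
     (\<lambda>u. counit H (the_elem (u 0)))
     (\<lambda>u n. \<Union>h\<in>u n. corad_below K H n +>\<^bsub>H\<^esub> antipode H h))"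

definition map_order :: "'a set \<Rightarrow> ('a \<Rightarrow> 'a) \<Rightarrow> enat" where
  "map_order A f = (if \<exists>n\<ge>1. \<forall>x\<in>A. (f ^^ n) x = x
     then enat (LEAST n. n \<ge> 1 \<and> (\<forall>x\<in>A. (f ^^ n) x = x)) else \<infinity>)"

definition antipode_order :: "('k,'h,'m) hopf_alg_scheme \<Rightarrow> enat" where
  "antipode_order H = map_order (carrier H) (antipode H)"

definition skew_primitives ::
  "('k,'n) ring_scheme \<Rightarrow> ('k,'h,'m) hopf_alg_scheme \<Rightarrow> 'h \<Rightarrow> 'h set" where
  "skew_primitives K H x = {h \<in> carrier H.
     comult H h = tens K H H h x \<oplus>\<^bsub>tensor K H H\<^esub> tens K H H \<one>\<^bsub>H\<^esub> h}"

definition subgroup_index :: "('g,'m) monoid_scheme \<Rightarrow> 'g set \<Rightarrow> enat" where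
  "subgroup_index G C = (if finite (rcosets\<^bsub>G\<^esub> C) then enat (card (rcosets\<^bsub>G\<^esub> C)) else \<infinity>)"

definition conj_index ::
  "('k,'n) ring_scheme \<Rightarrow> ('k,'h,'m) hopf_alg_scheme \<Rightarrow> 'h \<Rightarrow> enat" where
  "conj_index K H x = (let X = generate (grouplike_group K H) {x} in
     subgroup_index ((grouplike_group K H)\<lparr>carrier := X\<rparr>)
       {g \<in> X. \<forall>h\<in>skew_primitives K H x. g \<otimes>\<^bsub>H\<^esub> h = h \<otimes>\<^bsub>H\<^esub> g})"

definition hopf_m :: "('k,'n) ring_scheme \<Rightarrow> ('k,'h,'m) hopf_alg_scheme \<Rightarrow> enat" where
  "hopf_m K H = (let
     common_multiple = (\<lambda>m::nat. m > 0 \<and> (\<forall>x\<in>carrier (grouplike_group K H).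
       \<exists>a. conj_index K H x = enat a \<and> a dvd m))
     in if \<exists>m. common_multiple m then enat (LEAST m. common_multiple m) else \<infinity>)"

definition field_char :: "('k,'n) ring_scheme \<Rightarrow> nat" where
  "field_char K = (if \<exists>n::nat. n > 0 \<and> [n] \<cdot>\<^bsub>K\<^esub> \<one>\<^bsub>K\<^esub> = \<zero>\<^bsub>K\<^esub>
     then LEAST n::nat. n > 0 \<and> [n] \<cdot>\<^bsub>K\<^esub> \<one>\<^bsub>K\<^esub> = \<zero>\<^bsub>K\<^esub> else 0)"

definition generated_as_algebra_by ::
  "('k,'n) ring_scheme \<Rightarrow> ('k,'h,'m) module_scheme \<Rightarrow> 'h set \<Rightarrow> bool" where
  "generated_as_algebra_by K A X \<longleftrightarrow> (\<lambda>B. subring B A \<and> submodule B K A) hull X = carrier A"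

end

(* The filtration is handled through the dual algebra H*: an element lies in the wedge of two
   subspaces iff all convolution products f * g of functionals vanishing on the respective subspaces
   vanish on it, so no basis of H is needed.
   On a skew primitive h with comultiplication h (x) x + 1 (x) h, the square of S is conjugation by x;
   by the theorem of Taft and Wilson the even power S^(2m) is therefore the identity on H_1 exactly if
   m is a common multiple of the indices a_x. A coalgebra endomorphism T that is the identity on H_1
   satisfies (T - id)(H_n) <= H_(n-1). In characteristic 0 a unipotent map of finite order is the
   identity; in characteristic p, T^(p^l) - id = (T - id)^(p^l) kills H_n.
   For gr H, group-like elements live in degree 0 and skew primitive elements in degrees 0 and 1;
   a component of degree 1 need only be skew primitive modulo H_0, which is enough in characteristic 0
   as there S^(2m) - id vanishes on H_1 as soon as it maps H_1 to H_0. *)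
theory Submission
  imports Defs "HOL-Computational_Algebra.Primes"
begin

section \<open>Linear functionals and sums\<close>

text \<open>All arguments about \<Delta> pass through one fact on tensors: a tensor killed by every
  f \<otimes> g with f vanishing on X and g vanishing on Y lies in X \<otimes> W + V \<otimes> Y.
  Coproducts are thus studied through scalars, and coassociativity becomes associativity of
  convolution.

  The step from the H_n to H itself requires that they exhaust H, which is extracted from the
  definition of the coradical as a span of simple subcoalgebras: a minimal subcomodule not contained
  in their union has, modulo the union, a coefficient coalgebra with a group-like element, and this
  pulls the subcomodule back into the union.

  Functionals dual to group-like elements are built as finite convolution products, so \<Delta>(h)
  is confined to a finite set of group-likes beforehand.

  The factor 2 in characteristic 0 comes from odd powers of S reversing products: an odd order makes
  H commutative and then S = id. In characteristic p the bound is p^l \<ge> n because T is already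
  the identity on H_1.

  The coproduct of gr H involves choices; pairing it with homogeneous functionals gives a
  convolution product in H, which determines it.\<close>

definition functional :: "('k,'n) ring_scheme \<Rightarrow> ('k,'v,'m) module_scheme \<Rightarrow> ('v \<Rightarrow> 'k) \<Rightarrow> bool" where
  "functional K V f \<longleftrightarrow> linear_map K V (scalar_module K) f"

lemma scalar_module_simps [simp]:
  "carrier (scalar_module K) = carrier K" "zero (scalar_module K) = zero K"
  "add (scalar_module K) = add K" "smult (scalar_module K) = monoid.mult K"
  by (simp_all add: scalar_module_def)

lemma module_scalar_module:
  assumes "field K" shows "module K (scalar_module K)"
proof -
  interpret field K by fact
  show ?thesis
  proof (rule moduleI)
    show "abelian_group (scalar_module K)"
    proof (rule abelian_groupI)
      fix x assume "x \<in> carrier (scalar_module K)"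
      then show "\<exists>y\<in>carrier (scalar_module K). y \<oplus>\<^bsub>scalar_module K\<^esub> x = \<zero>\<^bsub>scalar_module K\<^esub>"
        by (intro bexI[of _ "\<ominus>\<^bsub>K\<^esub> x"]) (simp_all add: l_neg)
    qed (simp_all add: a_ac)
  qed (simp_all add: cring_axioms l_distr r_distr m_assoc)
qed

lemma linear_mapD:
  assumes "linear_map K V W f"
  shows "x \<in> carrier V \<Longrightarrow> f x \<in> carrier W"
    "\<lbrakk>x \<in> carrier V; y \<in> carrier V\<rbrakk> \<Longrightarrow> f (x \<oplus>\<^bsub>V\<^esub> y) = f x \<oplus>\<^bsub>W\<^esub> f y"
    "\<lbrakk>a \<in> carrier K; x \<in> carrier V\<rbrakk> \<Longrightarrow> f (a \<odot>\<^bsub>V\<^esub> x) = a \<odot>\<^bsub>W\<^esub> f x"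
  using assms by (auto simp: linear_map_def)

lemma linear_mapI:
  assumes "\<And>x. x \<in> carrier V \<Longrightarrow> f x \<in> carrier W"
    "\<And>x y. \<lbrakk>x \<in> carrier V; y \<in> carrier V\<rbrakk> \<Longrightarrow> f (x \<oplus>\<^bsub>V\<^esub> y) = f x \<oplus>\<^bsub>W\<^esub> f y"
    "\<And>a x. \<lbrakk>a \<in> carrier K; x \<in> carrier V\<rbrakk> \<Longrightarrow> f (a \<odot>\<^bsub>V\<^esub> x) = a \<odot>\<^bsub>W\<^esub> f x"
  shows "linear_map K V W f"
  using assms by (auto simp: linear_map_def)

lemma linear_map_zero:
  assumes "module K V" "module K W" "linear_map K V W f"
  shows "f \<zero>\<^bsub>V\<^esub> = \<zero>\<^bsub>W\<^esub>"
proof -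
  interpret V: module K V by fact
  interpret W: module K W by fact
  have "f (\<zero>\<^bsub>K\<^esub> \<odot>\<^bsub>V\<^esub> \<zero>\<^bsub>V\<^esub>) = \<zero>\<^bsub>K\<^esub> \<odot>\<^bsub>W\<^esub> f \<zero>\<^bsub>V\<^esub>"
    by (rule linear_mapD(3)[OF assms(3)]) auto
  moreover have "f \<zero>\<^bsub>V\<^esub> \<in> carrier W" by (rule linear_mapD(1)[OF assms(3)]) auto
  ultimately show ?thesis by simp
qed

lemma linear_map_uminus:
  assumes "module K V" "module K W" "linear_map K V W f" "x \<in> carrier V"
  shows "f (\<ominus>\<^bsub>V\<^esub> x) = \<ominus>\<^bsub>W\<^esub> f x"
proof -
  interpret V: module K V by fact
  interpret W: module K W by fact
  note fD = linear_mapD[OF assms(3)]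
  have "f x \<oplus>\<^bsub>W\<^esub> f (\<ominus>\<^bsub>V\<^esub> x) = f (x \<oplus>\<^bsub>V\<^esub> \<ominus>\<^bsub>V\<^esub> x)" using assms(4) fD by simp
  also have "\<dots> = \<zero>\<^bsub>W\<^esub>" using assms(4) linear_map_zero[OF assms(1-3)] by (simp add: V.M.r_neg)
  finally show ?thesis using assms(4) fD(1) V.M.a_inv_closed
    by (metis W.M.add.inv_comm W.M.minus_equality)
qed

lemma linear_map_minus:
  assumes "module K V" "module K W" "linear_map K V W f" "x \<in> carrier V" "y \<in> carrier V"
  shows "f (x \<ominus>\<^bsub>V\<^esub> y) = f x \<ominus>\<^bsub>W\<^esub> f y"
proof -
  interpret V: module K V by fact
  show ?thesis using assms linear_mapD[OF assms(3)]
    by (simp add: a_minus_def linear_map_uminus)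
qed

lemma linear_map_comp:
  assumes "linear_map K V W f" "linear_map K W Z g"
  shows "linear_map K V Z (\<lambda>x. g (f x))"
  using assms by (auto simp: linear_map_def Pi_iff)

lemma functionalD:
  assumes "functional K V f"
  shows "x \<in> carrier V \<Longrightarrow> f x \<in> carrier K"
    "\<lbrakk>x \<in> carrier V; y \<in> carrier V\<rbrakk> \<Longrightarrow> f (x \<oplus>\<^bsub>V\<^esub> y) = f x \<oplus>\<^bsub>K\<^esub> f y"
    "\<lbrakk>a \<in> carrier K; x \<in> carrier V\<rbrakk> \<Longrightarrow> f (a \<odot>\<^bsub>V\<^esub> x) = a \<otimes>\<^bsub>K\<^esub> f x"
  using assms by (auto simp: functional_def linear_map_def)

lemma functionalI:
  assumes "\<And>x. x \<in> carrier V \<Longrightarrow> f x \<in> carrier K"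
    "\<And>x y. \<lbrakk>x \<in> carrier V; y \<in> carrier V\<rbrakk> \<Longrightarrow> f (x \<oplus>\<^bsub>V\<^esub> y) = f x \<oplus>\<^bsub>K\<^esub> f y"
    "\<And>a x. \<lbrakk>a \<in> carrier K; x \<in> carrier V\<rbrakk> \<Longrightarrow> f (a \<odot>\<^bsub>V\<^esub> x) = a \<otimes>\<^bsub>K\<^esub> f x"
  shows "functional K V f"
  using assms by (auto simp: functional_def linear_map_def)

lemma functional_comp:
  assumes "linear_map K V W f" "functional K W g"
  shows "functional K V (\<lambda>x. g (f x))"
  using assms linear_map_comp unfolding functional_def by blast

lemma submoduleD:
  assumes "module K V" "submodule D K V"
  shows "x \<in> D \<Longrightarrow> x \<in> carrier V" "\<zero>\<^bsub>V\<^esub> \<in> D" "\<lbrakk>x \<in> D; y \<in> D\<rbrakk> \<Longrightarrow> x \<oplus>\<^bsub>V\<^esub> y \<in> D"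
    "x \<in> D \<Longrightarrow> \<ominus>\<^bsub>V\<^esub> x \<in> D" "\<lbrakk>x \<in> D; y \<in> D\<rbrakk> \<Longrightarrow> x \<ominus>\<^bsub>V\<^esub> y \<in> D"
    "\<lbrakk>a \<in> carrier K; x \<in> D\<rbrakk> \<Longrightarrow> a \<odot>\<^bsub>V\<^esub> x \<in> D"
proof -
  interpret V: module K V by fact
  note E = V.submoduleE[OF assms(2)]
  show "x \<in> D \<Longrightarrow> x \<in> carrier V" using E(1) by blast
  show "\<zero>\<^bsub>V\<^esub> \<in> D"
    using subgroup.one_closed[OF submodule.axioms(1)[OF assms(2)]] by simp
  show "\<lbrakk>x \<in> D; y \<in> D\<rbrakk> \<Longrightarrow> x \<oplus>\<^bsub>V\<^esub> y \<in> D" using E by blast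
  show "x \<in> D \<Longrightarrow> \<ominus>\<^bsub>V\<^esub> x \<in> D" using E by blast
  show "\<lbrakk>x \<in> D; y \<in> D\<rbrakk> \<Longrightarrow> x \<ominus>\<^bsub>V\<^esub> y \<in> D" using E by (simp add: a_minus_def)
  show "\<lbrakk>a \<in> carrier K; x \<in> D\<rbrakk> \<Longrightarrow> a \<odot>\<^bsub>V\<^esub> x \<in> D" using E by blast
qed

lemma submoduleI':
  assumes "module K V" "D \<subseteq> carrier V" "\<zero>\<^bsub>V\<^esub> \<in> D"
    "\<And>x y. \<lbrakk>x \<in> D; y \<in> D\<rbrakk> \<Longrightarrow> x \<oplus>\<^bsub>V\<^esub> y \<in> D"
    "\<And>a x. \<lbrakk>a \<in> carrier K; x \<in> D\<rbrakk> \<Longrightarrow> a \<odot>\<^bsub>V\<^esub> x \<in> D"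
  shows "submodule D K V"
proof -
  interpret V: module K V by fact
  show ?thesis
  proof (rule V.submoduleI)
    fix a assume "a \<in> D"
    then have "\<ominus>\<^bsub>V\<^esub> a = (\<ominus>\<^bsub>K\<^esub> \<one>\<^bsub>K\<^esub>) \<odot>\<^bsub>V\<^esub> a"
      using assms(2) by (simp add: V.smult_l_minus subset_iff)
    then show "\<ominus>\<^bsub>V\<^esub> a \<in> D" using assms(5)[of "\<ominus>\<^bsub>K\<^esub> \<one>\<^bsub>K\<^esub>" a] \<open>a \<in> D\<close> by simp
  qed (use assms in auto)
qed

lemma zero_submodule:
  assumes "module K V" shows "submodule {\<zero>\<^bsub>V\<^esub>} K V"
proof -
  interpret V: module K V by fact
  show ?thesis by (rule submoduleI'[OF assms]) auto
qed

lemma submodule_Int: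
  assumes "module K V" "submodule A K V" "submodule B K V"
  shows "submodule (A \<inter> B) K V"
  using submoduleD[OF assms(1,2)] submoduleD[OF assms(1,3)]
  by (intro submoduleI'[OF assms(1)]) auto

lemma kernel_submodule:
  assumes "module K V" "module K W" "linear_map K V W f" "submodule D K W"
  shows "submodule {x \<in> carrier V. f x \<in> D} K V"
proof -
  interpret V: module K V by fact
  show ?thesis
    using submoduleD[OF assms(2,4)] linear_mapD[OF assms(3)] linear_map_zero[OF assms(1-3)]
    by (intro submoduleI'[OF assms(1)]) auto
qed

section \<open>Separating a vector from a subspace by a functional\<close>

definition add_line :: "('k,'n) ring_scheme \<Rightarrow> ('k,'v,'m) module_scheme \<Rightarrow> 'v set \<Rightarrow> 'v \<Rightarrow> 'v set" where
  "add_line K V D v = {d \<oplus>\<^bsub>V\<^esub> c \<odot>\<^bsub>V\<^esub> v | d c. d \<in> D \<and> c \<in> carrier K}"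

lemma add_line:
  assumes "module K V" "submodule D K V" "v \<in> carrier V"
  shows "submodule (add_line K V D v) K V" "D \<subseteq> add_line K V D v" "v \<in> add_line K V D v"
proof -
  interpret V: module K V by fact
  note D = submoduleD[OF assms(1,2)]
  show "submodule (add_line K V D v) K V"
  proof (rule submoduleI'[OF assms(1)])
    show "add_line K V D v \<subseteq> carrier V" using D assms(3) by (auto simp: add_line_def)
    show "\<zero>\<^bsub>V\<^esub> \<in> add_line K V D v" unfolding add_line_def
      using D(2) assms(3) by (auto intro!: exI[of _ "\<zero>\<^bsub>V\<^esub>"] exI[of _ "\<zero>\<^bsub>K\<^esub>"])
  next
    fix x y assume "x \<in> add_line K V D v" "y \<in> add_line K V D v"
    then obtain d c d' c' where *: "x = d \<oplus>\<^bsub>V\<^esub> c \<odot>\<^bsub>V\<^esub> v" "y = d' \<oplus>\<^bsub>V\<^esub> c' \<odot>\<^bsub>V\<^esub> v"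
      "d \<in> D" "d' \<in> D" "c \<in> carrier K" "c' \<in> carrier K" by (auto simp: add_line_def)
    then have "x \<oplus>\<^bsub>V\<^esub> y = (d \<oplus>\<^bsub>V\<^esub> d') \<oplus>\<^bsub>V\<^esub> (c \<oplus>\<^bsub>K\<^esub> c') \<odot>\<^bsub>V\<^esub> v"
      using D(1) assms(3) by (simp add: V.smult_l_distr V.M.a_ac)
    then show "x \<oplus>\<^bsub>V\<^esub> y \<in> add_line K V D v" using * D(3) unfolding add_line_def by blast
  next
    fix a x assume a: "a \<in> carrier K" and "x \<in> add_line K V D v"
    then obtain d c where *: "x = d \<oplus>\<^bsub>V\<^esub> c \<odot>\<^bsub>V\<^esub> v" "d \<in> D" "c \<in> carrier K"
      by (auto simp: add_line_def)
    then have "a \<odot>\<^bsub>V\<^esub> x = a \<odot>\<^bsub>V\<^esub> d \<oplus>\<^bsub>V\<^esub> (a \<otimes>\<^bsub>K\<^esub> c) \<odot>\<^bsub>V\<^esub> v"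
      using D(1) assms(3) a by (simp add: V.smult_r_distr V.smult_assoc1)
    then show "a \<odot>\<^bsub>V\<^esub> x \<in> add_line K V D v" using * D(6) a unfolding add_line_def by blast
  qed
  show "D \<subseteq> add_line K V D v"
  proof
    fix d assume d: "d \<in> D"
    then have "d = d \<oplus>\<^bsub>V\<^esub> \<zero>\<^bsub>K\<^esub> \<odot>\<^bsub>V\<^esub> v" using D(1) assms(3) by simp
    then show "d \<in> add_line K V D v" using d unfolding add_line_def by blast
  qed
  have "v = \<zero>\<^bsub>V\<^esub> \<oplus>\<^bsub>V\<^esub> \<one>\<^bsub>K\<^esub> \<odot>\<^bsub>V\<^esub> v" using assms(3) by simp
  then show "v \<in> add_line K V D v" using D(2) unfolding add_line_def by blast
qed

lemma add_line_least:
  assumes "module K V" "submodule E K V" "D \<subseteq> E" "v \<in> E"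
  shows "add_line K V D v \<subseteq> E"
  using submoduleD[OF assms(1,2)] assms(3,4) by (auto simp: add_line_def)

text \<open>A subspace M maximal among those containing D and avoiding x (Zorn) satisfies M + Kx =
  V: for y outside M the subspace M + Ky contains x, and x = d + cy with c \<noteq> 0 can be solved
  for y modulo M. The coefficient of x modulo M is the functional.\<close>

lemma exists_functional:
  assumes "field K" "module K V" "submodule D K V" "x \<in> carrier V" "x \<notin> D"
  obtains f where "functional K V f" "\<And>d. d \<in> D \<Longrightarrow> f d = \<zero>\<^bsub>K\<^esub>" "f x = \<one>\<^bsub>K\<^esub>"
proof -
  interpret K: field K by fact
  interpret V: module K V by fact
  define A where "A = {M. submodule M K V \<and> D \<subseteq> M \<and> x \<notin> M}"
  have "\<exists>M\<in>A. \<forall>X\<in>A. M \<subseteq> X \<longrightarrow> X = M"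
  proof (rule subset_Zorn_nonempty)
    show "A \<noteq> {}" using assms by (auto simp: A_def)
    fix C assume C: "C \<noteq> {}" "subset.chain A C"
    then have CA: "\<And>M. M \<in> C \<Longrightarrow> submodule M K V \<and> D \<subseteq> M \<and> x \<notin> M"
      unfolding A_def subset_chain_def by blast
    have lin: "\<And>M N. M \<in> C \<Longrightarrow> N \<in> C \<Longrightarrow> M \<subseteq> N \<or> N \<subseteq> M"
      using C(2) by (auto simp: subset_chain_def)
    have "submodule (\<Union>C) K V"
    proof (rule submoduleI'[OF assms(2)])
      show "\<Union>C \<subseteq> carrier V" using CA submoduleD(1)[OF assms(2)] by (meson Union_least subsetI)
      obtain M where "M \<in> C" using C(1) by blast
      then show "\<zero>\<^bsub>V\<^esub> \<in> \<Union>C" using CA submoduleD(2)[OF assms(2)] by (meson UnionI)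
      fix y z assume "y \<in> \<Union>C" "z \<in> \<Union>C"
      then obtain M N where "M \<in> C" "N \<in> C" "y \<in> M" "z \<in> N" by blast
      then obtain L where "L \<in> C" "y \<in> L" "z \<in> L" using lin[of M N] by blast
      then show "y \<oplus>\<^bsub>V\<^esub> z \<in> \<Union>C" using CA submoduleD(3)[OF assms(2)] by (meson UnionI)
    next
      fix a y assume "a \<in> carrier K" "y \<in> \<Union>C"
      then show "a \<odot>\<^bsub>V\<^esub> y \<in> \<Union>C" using CA submoduleD(6)[OF assms(2)] by (meson UnionE UnionI)
    qed
    moreover have "D \<subseteq> \<Union>C" "x \<notin> \<Union>C" using CA C(1) by blast+
    ultimately show "\<Union>C \<in> A" unfolding A_def by blast
  qed
  then obtain M where MA: "M \<in> A" and max: "\<And>X. X \<in> A \<Longrightarrow> M \<subseteq> X \<Longrightarrow> X = M" by meson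
  from MA have M: "submodule M K V" "D \<subseteq> M" "x \<notin> M" unfolding A_def by blast+
  note Md = submoduleD[OF assms(2) M(1)]
  have ex: "\<exists>c\<in>carrier K. y \<ominus>\<^bsub>V\<^esub> c \<odot>\<^bsub>V\<^esub> x \<in> M" if y: "y \<in> carrier V" for y
  proof (cases "y \<in> M")
    case True
    have "y \<ominus>\<^bsub>V\<^esub> \<zero>\<^bsub>K\<^esub> \<odot>\<^bsub>V\<^esub> x = y" using y assms(4) by (simp add: a_minus_def)
    with True show ?thesis by (metis K.zero_closed)
  next
    case False
    note al = add_line[OF assms(2) M(1) y]
    have "add_line K V M y \<notin> A" using max[of "add_line K V M y"] al False by blast
    then have "x \<in> add_line K V M y" using al M(2) by (auto simp: A_def)
    then obtain d c where dc: "x = d \<oplus>\<^bsub>V\<^esub> c \<odot>\<^bsub>V\<^esub> y" "d \<in> M" "c \<in> carrier K"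
      by (auto simp: add_line_def)
    have c0: "c \<noteq> \<zero>\<^bsub>K\<^esub>" using dc M(3) y Md(1) by auto
    then have ci: "inv\<^bsub>K\<^esub> c \<in> carrier K" "inv\<^bsub>K\<^esub> c \<otimes>\<^bsub>K\<^esub> c = \<one>\<^bsub>K\<^esub>"
      using dc(3) K.field_Units by auto
    have "inv\<^bsub>K\<^esub> c \<odot>\<^bsub>V\<^esub> x = inv\<^bsub>K\<^esub> c \<odot>\<^bsub>V\<^esub> d \<oplus>\<^bsub>V\<^esub> y"
      using dc ci y Md(1) by (simp add: V.smult_r_distr V.smult_assoc1[symmetric])
    then have "y \<ominus>\<^bsub>V\<^esub> inv\<^bsub>K\<^esub> c \<odot>\<^bsub>V\<^esub> x = \<ominus>\<^bsub>V\<^esub> (inv\<^bsub>K\<^esub> c \<odot>\<^bsub>V\<^esub> d)"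
      using dc ci y Md(1) by (simp add: a_minus_def V.M.minus_add V.M.a_ac V.M.r_neg V.M.r_neg2)
    then show ?thesis using Md ci dc by metis
  qed
  have uniq: "c = c'" if "y \<in> carrier V" "c \<in> carrier K" "c' \<in> carrier K"
    "y \<ominus>\<^bsub>V\<^esub> c \<odot>\<^bsub>V\<^esub> x \<in> M" "y \<ominus>\<^bsub>V\<^esub> c' \<odot>\<^bsub>V\<^esub> x \<in> M" for y c c'
  proof (rule ccontr)
    assume ne: "c \<noteq> c'"
    have "(y \<ominus>\<^bsub>V\<^esub> c' \<odot>\<^bsub>V\<^esub> x) \<ominus>\<^bsub>V\<^esub> (y \<ominus>\<^bsub>V\<^esub> c \<odot>\<^bsub>V\<^esub> x) = (c \<ominus>\<^bsub>K\<^esub> c') \<odot>\<^bsub>V\<^esub> x"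
    proof -
      have "(y \<ominus>\<^bsub>V\<^esub> c' \<odot>\<^bsub>V\<^esub> x) \<ominus>\<^bsub>V\<^esub> (y \<ominus>\<^bsub>V\<^esub> c \<odot>\<^bsub>V\<^esub> x)
        = (y \<oplus>\<^bsub>V\<^esub> \<ominus>\<^bsub>V\<^esub> y) \<oplus>\<^bsub>V\<^esub> (c \<odot>\<^bsub>V\<^esub> x \<oplus>\<^bsub>V\<^esub> \<ominus>\<^bsub>V\<^esub> (c' \<odot>\<^bsub>V\<^esub> x))"
        using that(1-3) assms(4) by (simp add: a_minus_def V.M.minus_add V.M.a_ac)
      then show ?thesis using that(1-3) assms(4)
        by (simp add: a_minus_def V.M.r_neg V.smult_l_distr V.smult_l_minus)
    qed
    then have in_M: "(c \<ominus>\<^bsub>K\<^esub> c') \<odot>\<^bsub>V\<^esub> x \<in> M" using Md(5) that(4,5) by metis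
    have "c \<ominus>\<^bsub>K\<^esub> c' \<noteq> \<zero>\<^bsub>K\<^esub>" using ne that(2,3) by simp
    then have ci: "inv\<^bsub>K\<^esub> (c \<ominus>\<^bsub>K\<^esub> c') \<in> carrier K" "inv\<^bsub>K\<^esub> (c \<ominus>\<^bsub>K\<^esub> c') \<otimes>\<^bsub>K\<^esub> (c \<ominus>\<^bsub>K\<^esub> c') = \<one>\<^bsub>K\<^esub>"
      using that(2,3) K.field_Units by auto
    have "inv\<^bsub>K\<^esub> (c \<ominus>\<^bsub>K\<^esub> c') \<odot>\<^bsub>V\<^esub> ((c \<ominus>\<^bsub>K\<^esub> c') \<odot>\<^bsub>V\<^esub> x) = x"
      using ci that(2,3) assms(4) by (simp add: V.smult_assoc1[symmetric])
    then show False using Md(6)[OF ci(1) in_M] M(3) by simp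
  qed
  define f where "f y = (THE c. c \<in> carrier K \<and> y \<ominus>\<^bsub>V\<^esub> c \<odot>\<^bsub>V\<^esub> x \<in> M)" for y
  have fI: "f y = c" if "y \<in> carrier V" "c \<in> carrier K" "y \<ominus>\<^bsub>V\<^esub> c \<odot>\<^bsub>V\<^esub> x \<in> M" for y c
    unfolding f_def using that uniq by (intro the_equality) auto
  have fM: "f y \<in> carrier K" "y \<ominus>\<^bsub>V\<^esub> f y \<odot>\<^bsub>V\<^esub> x \<in> M" if "y \<in> carrier V" for y
    using ex[OF that] fI[OF that] by auto
  have "functional K V f"
  proof (rule functionalI)
    fix y assume "y \<in> carrier V" then show "f y \<in> carrier K" by (rule fM)
  next
    fix y z assume yz: "y \<in> carrier V" "z \<in> carrier V"
    have "(y \<oplus>\<^bsub>V\<^esub> z) \<ominus>\<^bsub>V\<^esub> (f y \<oplus>\<^bsub>K\<^esub> f z) \<odot>\<^bsub>V\<^esub> x = (y \<ominus>\<^bsub>V\<^esub> f y \<odot>\<^bsub>V\<^esub> x) \<oplus>\<^bsub>V\<^esub> (z \<ominus>\<^bsub>V\<^esub> f z \<odot>\<^bsub>V\<^esub> x)"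
      using yz fM assms(4) by (simp add: a_minus_def V.smult_l_distr V.M.minus_add V.M.a_ac)
    then show "f (y \<oplus>\<^bsub>V\<^esub> z) = f y \<oplus>\<^bsub>K\<^esub> f z"
      using fI[of "y \<oplus>\<^bsub>V\<^esub> z" "f y \<oplus>\<^bsub>K\<^esub> f z"] fM yz Md(3) by simp
  next
    fix a y assume ay: "a \<in> carrier K" "y \<in> carrier V"
    have "a \<odot>\<^bsub>V\<^esub> y \<ominus>\<^bsub>V\<^esub> (a \<otimes>\<^bsub>K\<^esub> f y) \<odot>\<^bsub>V\<^esub> x = a \<odot>\<^bsub>V\<^esub> (y \<ominus>\<^bsub>V\<^esub> f y \<odot>\<^bsub>V\<^esub> x)"
      using ay fM assms(4) by (simp add: a_minus_def V.smult_r_distr V.smult_r_minus V.smult_assoc1)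
    then show "f (a \<odot>\<^bsub>V\<^esub> y) = a \<otimes>\<^bsub>K\<^esub> f y"
      using fI[of "a \<odot>\<^bsub>V\<^esub> y" "a \<otimes>\<^bsub>K\<^esub> f y"] fM ay Md(6) by simp
  qed
  moreover have "f d = \<zero>\<^bsub>K\<^esub>" if "d \<in> D" for d
  proof (rule fI)
    show d: "d \<in> carrier V" using that M(2) Md(1) by blast
    have "d \<ominus>\<^bsub>V\<^esub> \<zero>\<^bsub>K\<^esub> \<odot>\<^bsub>V\<^esub> x = d" using d assms(4) by (simp add: a_minus_def)
    then show "d \<ominus>\<^bsub>V\<^esub> \<zero>\<^bsub>K\<^esub> \<odot>\<^bsub>V\<^esub> x \<in> M" using that M(2) by auto
  qed simp
  moreover have "f x = \<one>\<^bsub>K\<^esub>"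
    using assms(4) Md(2) by (intro fI) (auto simp: a_minus_def V.M.r_neg)
  ultimately show thesis by (rule that)
qed

text \<open>If f is not zero on D, pick x in D with f(x) = 1. A functional that vanishes on the
  kernel of f and is 1 at x agrees with f on D, since d - f(d) x lies in that kernel.\<close>

lemma functional_extend:
  assumes "field K" "module K V" "submodule D K V" "functional K (V\<lparr>carrier := D\<rparr>) f"
  obtains g where "functional K V g" "\<And>d. d \<in> D \<Longrightarrow> g d = f d"
proof (cases "\<forall>d\<in>D. f d = \<zero>\<^bsub>K\<^esub>")
  case True
  interpret K: field K by fact
  have "functional K V (\<lambda>x. \<zero>\<^bsub>K\<^esub>)" by (rule functionalI) auto
  then show ?thesis by (rule that) (use True in auto)
next
  case False
  interpret K: field K by fact
  interpret V: module K V by fact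
  note D = submoduleD[OF assms(2,3)]
  note fD = functionalD[OF assms(4), simplified]
  from False obtain y where y: "y \<in> D" "f y \<noteq> \<zero>\<^bsub>K\<^esub>" by blast
  define x where "x = inv\<^bsub>K\<^esub> (f y) \<odot>\<^bsub>V\<^esub> y"
  have fy: "inv\<^bsub>K\<^esub> (f y) \<in> carrier K" "inv\<^bsub>K\<^esub> (f y) \<otimes>\<^bsub>K\<^esub> f y = \<one>\<^bsub>K\<^esub>"
    using y fD K.field_Units by auto
  have x: "x \<in> D" "f x = \<one>\<^bsub>K\<^esub>" using y fy fD D by (auto simp: x_def)
  define M where "M = {d \<in> D. f d = \<zero>\<^bsub>K\<^esub>}"
  have "module K (V\<lparr>carrier := D\<rparr>)" by (rule submodule.submodule_is_module[OF assms(3,2)])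
  then have f0: "f \<zero>\<^bsub>V\<^esub> = \<zero>\<^bsub>K\<^esub>"
    using linear_map_zero[of K "V\<lparr>carrier := D\<rparr>" "scalar_module K" f] assms(4)
      module_scalar_module[OF assms(1)] by (simp add: functional_def)
  have "submodule M K V" unfolding M_def
    using D fD f0 by (intro submoduleI'[OF assms(2)]) auto
  moreover have "x \<notin> M" using x by (auto simp: M_def)
  ultimately obtain g where g: "functional K V g" "\<And>d. d \<in> M \<Longrightarrow> g d = \<zero>\<^bsub>K\<^esub>" "g x = \<one>\<^bsub>K\<^esub>"
    using exists_functional[OF assms(1,2)] x(1) D(1) by metis
  have "g d = f d" if d: "d \<in> D" for d
  proof -
    note gD = functionalD[OF g(1)]
    have c: "d \<in> carrier V" "x \<in> carrier V" "f d \<in> carrier K" "\<ominus>\<^bsub>K\<^esub> f d \<in> carrier K"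
      using d x D(1) fD by auto
    have "f (d \<oplus>\<^bsub>V\<^esub> (\<ominus>\<^bsub>K\<^esub> f d) \<odot>\<^bsub>V\<^esub> x) = \<zero>\<^bsub>K\<^esub>"
      using d c x D fD by (simp add: K.r_neg)
    then have "d \<oplus>\<^bsub>V\<^esub> (\<ominus>\<^bsub>K\<^esub> f d) \<odot>\<^bsub>V\<^esub> x \<in> M" using d c x D by (auto simp: M_def)
    then have "g (d \<oplus>\<^bsub>V\<^esub> (\<ominus>\<^bsub>K\<^esub> f d) \<odot>\<^bsub>V\<^esub> x) = \<zero>\<^bsub>K\<^esub>" by (rule g(2))
    then have "g d \<oplus>\<^bsub>K\<^esub> \<ominus>\<^bsub>K\<^esub> f d = \<zero>\<^bsub>K\<^esub>" using c gD g(3) by simp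
    then show ?thesis using c gD(1) by (metis K.minus_equality K.minus_minus)
  qed
  then show ?thesis by (rule that[OF g(1)])
qed

text \<open>Sums over lists, not over finite sets: a tensor is presented by a list of pairs in which
  repetitions matter, and later inductions run on its length.\<close>

primrec lsum :: "('v,'m) ring_scheme \<Rightarrow> ('a \<Rightarrow> 'v) \<Rightarrow> 'a list \<Rightarrow> 'v" where
  "lsum V f [] = \<zero>\<^bsub>V\<^esub>"
| "lsum V f (x # xs) = f x \<oplus>\<^bsub>V\<^esub> lsum V f xs"

lemma lsum_cong:
  "(\<And>x. x \<in> set xs \<Longrightarrow> f x = g x) \<Longrightarrow> lsum V f xs = lsum V g xs"
  by (induction xs) auto

lemma lsum_map: "lsum V f (map g xs) = lsum V (\<lambda>x. f (g x)) xs"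
  by (induction xs) auto

lemma lsum_scalar_module [simp]: "lsum (scalar_module K) f xs = lsum K f xs"
  by (induction xs) auto

lemma (in abelian_monoid) lsum_closed:
  "(\<And>x. x \<in> set xs \<Longrightarrow> f x \<in> carrier G) \<Longrightarrow> lsum G f xs \<in> carrier G"
  by (induction xs) auto

lemma (in abelian_monoid) lsum_append:
  "\<lbrakk>\<And>x. x \<in> set xs \<Longrightarrow> f x \<in> carrier G; \<And>x. x \<in> set ys \<Longrightarrow> f x \<in> carrier G\<rbrakk>
   \<Longrightarrow> lsum G f (xs @ ys) = lsum G f xs \<oplus> lsum G f ys"
  by (induction xs) (auto simp: lsum_closed a_assoc)

lemma (in abelian_monoid) lsum_zero: "(\<And>x. x \<in> set xs \<Longrightarrow> f x = \<zero>) \<Longrightarrow> lsum G f xs = \<zero>"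
  by (induction xs) auto

lemma (in abelian_monoid) lsum_add:
  "\<lbrakk>\<And>x. x \<in> set xs \<Longrightarrow> f x \<in> carrier G; \<And>x. x \<in> set xs \<Longrightarrow> g x \<in> carrier G\<rbrakk>
   \<Longrightarrow> lsum G (\<lambda>x. f x \<oplus> g x) xs = lsum G f xs \<oplus> lsum G g xs"
  by (induction xs) (auto simp: lsum_closed a_ac)

lemma (in abelian_monoid) lsum_swap:
  "(\<And>x y. \<lbrakk>x \<in> set xs; y \<in> set ys\<rbrakk> \<Longrightarrow> f x y \<in> carrier G)
   \<Longrightarrow> lsum G (\<lambda>x. lsum G (f x) ys) xs = lsum G (\<lambda>y. lsum G (\<lambda>x. f x y) xs) ys"
proof (induction xs)
  case Nil
  show ?case by (simp add: lsum_zero)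
next
  case (Cons x xs)
  then show ?case
    using lsum_add[of ys "f x" "\<lambda>y. lsum G (\<lambda>x. f x y) xs"] by (simp add: lsum_closed)
qed

lemma lsum_linear:
  assumes "module K V" "module K W" "linear_map K V W \<phi>" "\<And>x. x \<in> set xs \<Longrightarrow> f x \<in> carrier V"
  shows "\<phi> (lsum V f xs) = lsum W (\<lambda>x. \<phi> (f x)) xs"
proof -
  interpret V: module K V by fact
  show ?thesis using assms(4) linear_map_zero[OF assms(1-3)]
    by (induction xs) (auto simp: linear_mapD[OF assms(3)] V.M.lsum_closed)
qed

lemma lsum_submodule:
  assumes "module K V" "submodule D K V" "\<And>x. x \<in> set xs \<Longrightarrow> f x \<in> D"
  shows "lsum V f xs \<in> D"
  using assms(3) submoduleD[OF assms(1,2)] by (induction xs) auto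

lemma finsum_submodule:
  assumes "module K V" "submodule D K V" "\<And>x. x \<in> A \<Longrightarrow> f x \<in> D"
  shows "finsum V f A \<in> D"
proof -
  interpret V: module K V by fact
  note D = submoduleD[OF assms(1,2)]
  show ?thesis using assms(3)
  proof (induction A rule: infinite_finite_induct)
    case (insert x F)
    then have "finsum V f (insert x F) = f x \<oplus>\<^bsub>V\<^esub> finsum V f F"
      using D(1) by (intro V.M.finsum_insert) auto
    then show ?case using insert D by simp
  qed (use D in auto)
qed

lemma finsum_linear:
  assumes "module K V" "module K W" "linear_map K V W \<phi>" "\<And>x. x \<in> A \<Longrightarrow> f x \<in> carrier V"
  shows "\<phi> (finsum V f A) = finsum W (\<lambda>x. \<phi> (f x)) A"
proof -
  interpret V: module K V by fact
  interpret W: module K W by fact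
  note fD = linear_mapD[OF assms(3)]
  show ?thesis using assms(4)
  proof (induction A rule: infinite_finite_induct)
    case (insert x F)
    then have "finsum V f (insert x F) = f x \<oplus>\<^bsub>V\<^esub> finsum V f F"
      by (intro V.M.finsum_insert) auto
    moreover have "finsum W (\<lambda>x. \<phi> (f x)) (insert x F) = \<phi> (f x) \<oplus>\<^bsub>W\<^esub> finsum W (\<lambda>x. \<phi> (f x)) F"
      using insert fD by (intro W.M.finsum_insert) auto
    moreover have "finsum V f F \<in> carrier V" using insert by (intro V.M.finsum_closed) auto
    ultimately show ?case using insert fD by simp
  qed (auto simp: linear_map_zero[OF assms(1-3)])
qed

section \<open>Quotients and tensor products\<close>

lemma module_minus_simps:
  assumes "module K V"
  shows "x \<in> carrier V \<Longrightarrow> x \<ominus>\<^bsub>V\<^esub> x = \<zero>\<^bsub>V\<^esub>"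
    "\<lbrakk>x \<in> carrier V; y \<in> carrier V\<rbrakk> \<Longrightarrow> \<ominus>\<^bsub>V\<^esub> (x \<ominus>\<^bsub>V\<^esub> y) = y \<ominus>\<^bsub>V\<^esub> x"
    "\<lbrakk>x \<in> carrier V; y \<in> carrier V\<rbrakk> \<Longrightarrow> (x \<ominus>\<^bsub>V\<^esub> y) \<oplus>\<^bsub>V\<^esub> y = x"
    "\<lbrakk>x \<in> carrier V; y \<in> carrier V\<rbrakk> \<Longrightarrow> (x \<oplus>\<^bsub>V\<^esub> y) \<ominus>\<^bsub>V\<^esub> y = x"
    "\<lbrakk>x \<in> carrier V; y \<in> carrier V; z \<in> carrier V\<rbrakk>
      \<Longrightarrow> (x \<ominus>\<^bsub>V\<^esub> y) \<oplus>\<^bsub>V\<^esub> (y \<ominus>\<^bsub>V\<^esub> z) = x \<ominus>\<^bsub>V\<^esub> z"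
    "x \<in> carrier V \<Longrightarrow> x \<ominus>\<^bsub>V\<^esub> \<zero>\<^bsub>V\<^esub> = x"
proof -
  interpret V: module K V by fact
  show "x \<in> carrier V \<Longrightarrow> x \<ominus>\<^bsub>V\<^esub> x = \<zero>\<^bsub>V\<^esub>" by (simp add: a_minus_def V.M.r_neg)
  show "\<lbrakk>x \<in> carrier V; y \<in> carrier V\<rbrakk> \<Longrightarrow> \<ominus>\<^bsub>V\<^esub> (x \<ominus>\<^bsub>V\<^esub> y) = y \<ominus>\<^bsub>V\<^esub> x"
    by (simp add: a_minus_def V.M.minus_add V.M.a_ac)
  show "\<lbrakk>x \<in> carrier V; y \<in> carrier V\<rbrakk> \<Longrightarrow> (x \<ominus>\<^bsub>V\<^esub> y) \<oplus>\<^bsub>V\<^esub> y = x"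
    "\<lbrakk>x \<in> carrier V; y \<in> carrier V\<rbrakk> \<Longrightarrow> (x \<oplus>\<^bsub>V\<^esub> y) \<ominus>\<^bsub>V\<^esub> y = x"
    by (simp_all add: a_minus_def V.M.a_assoc V.M.r_neg V.M.l_neg)
  show "\<lbrakk>x \<in> carrier V; y \<in> carrier V; z \<in> carrier V\<rbrakk>
      \<Longrightarrow> (x \<ominus>\<^bsub>V\<^esub> y) \<oplus>\<^bsub>V\<^esub> (y \<ominus>\<^bsub>V\<^esub> z) = x \<ominus>\<^bsub>V\<^esub> z"
    by (simp add: a_minus_def V.M.a_assoc V.M.r_neg1)
  assume x: "x \<in> carrier V"
  have "x \<ominus>\<^bsub>V\<^esub> \<zero>\<^bsub>V\<^esub> = (x \<ominus>\<^bsub>V\<^esub> \<zero>\<^bsub>V\<^esub>) \<oplus>\<^bsub>V\<^esub> \<zero>\<^bsub>V\<^esub>" using x by simp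
  also have "\<dots> = x" using x by (simp add: a_minus_def V.M.a_assoc V.M.l_neg)
  finally show "x \<ominus>\<^bsub>V\<^esub> \<zero>\<^bsub>V\<^esub> = x" .
qed

lemma coset_mem_iff:
  assumes "module K V" "submodule N K V" "x \<in> carrier V"
  shows "z \<in> N +>\<^bsub>V\<^esub> x \<longleftrightarrow> z \<in> carrier V \<and> z \<ominus>\<^bsub>V\<^esub> x \<in> N"
proof -
  interpret V: module K V by fact
  note N = submoduleD[OF assms(1,2)]
  note ms = module_minus_simps[OF assms(1)]
  show ?thesis
  proof
    assume "z \<in> N +>\<^bsub>V\<^esub> x"
    then obtain n where "n \<in> N" "z = n \<oplus>\<^bsub>V\<^esub> x" by (auto simp: a_r_coset_def')
    then show "z \<in> carrier V \<and> z \<ominus>\<^bsub>V\<^esub> x \<in> N" using N(1) assms(3) by (simp add: ms)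
  next
    assume z: "z \<in> carrier V \<and> z \<ominus>\<^bsub>V\<^esub> x \<in> N"
    then have "z = (z \<ominus>\<^bsub>V\<^esub> x) \<oplus>\<^bsub>V\<^esub> x" using assms(3) by (simp add: ms)
    then show "z \<in> N +>\<^bsub>V\<^esub> x" using z by (auto simp: a_r_coset_def')
  qed
qed

lemma coset_eq_iff:
  assumes "module K V" "submodule N K V" "x \<in> carrier V" "y \<in> carrier V"
  shows "N +>\<^bsub>V\<^esub> x = N +>\<^bsub>V\<^esub> y \<longleftrightarrow> x \<ominus>\<^bsub>V\<^esub> y \<in> N"
proof
  interpret V: module K V by fact
  note N = submoduleD[OF assms(1,2)]
  note mem = coset_mem_iff[OF assms(1,2)]
  have xx: "x \<in> N +>\<^bsub>V\<^esub> x"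
    using assms(3) N(2) by (simp add: mem module_minus_simps[OF assms(1)])
  show "N +>\<^bsub>V\<^esub> x = N +>\<^bsub>V\<^esub> y \<Longrightarrow> x \<ominus>\<^bsub>V\<^esub> y \<in> N" using xx assms by (simp add: mem)
  assume xy: "x \<ominus>\<^bsub>V\<^esub> y \<in> N"
  then have yx: "y \<ominus>\<^bsub>V\<^esub> x \<in> N" using N(4) module_minus_simps(2)[OF assms(1)] assms by metis
  have "z \<ominus>\<^bsub>V\<^esub> x \<in> N \<longleftrightarrow> z \<ominus>\<^bsub>V\<^esub> y \<in> N" if "z \<in> carrier V" for z
    using module_minus_simps(5)[OF assms(1), OF that assms(3,4)]
      module_minus_simps(5)[OF assms(1), OF that assms(4,3)]
      N(3) xy yx by metis
  then show "N +>\<^bsub>V\<^esub> x = N +>\<^bsub>V\<^esub> y" using assms by (auto simp: mem)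
qed

lemma coset_zero:
  assumes "module K V" "submodule N K V"
  shows "N +>\<^bsub>V\<^esub> \<zero>\<^bsub>V\<^esub> = N"
proof -
  interpret V: module K V by fact
  note N = submoduleD[OF assms]
  show ?thesis using N(1) by (auto simp: coset_mem_iff[OF assms] module_minus_simps(6)[OF assms(1)])
qed

lemma coset_self_mem:
  assumes "module K V" "submodule N K V" "x \<in> carrier V"
  shows "x \<in> N +>\<^bsub>V\<^esub> x"
  using coset_mem_iff[OF assms] assms module_minus_simps(1)[OF assms(1)] submoduleD(2)[OF assms(1,2)] by simp

lemma quot_module_add:
  assumes "module K V" "submodule N K V" "x \<in> carrier V" "y \<in> carrier V"
  shows "(N +>\<^bsub>V\<^esub> x) \<oplus>\<^bsub>quot_module V N\<^esub> (N +>\<^bsub>V\<^esub> y) = N +>\<^bsub>V\<^esub> (x \<oplus>\<^bsub>V\<^esub> y)"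
proof -
  interpret V: module K V by fact
  note N = submoduleD[OF assms(1,2)]
  have "(n \<oplus>\<^bsub>V\<^esub> x) \<oplus>\<^bsub>V\<^esub> (n' \<oplus>\<^bsub>V\<^esub> y) = (n \<oplus>\<^bsub>V\<^esub> n') \<oplus>\<^bsub>V\<^esub> (x \<oplus>\<^bsub>V\<^esub> y)" if "n \<in> N" "n' \<in> N" for n n'
    using that N(1) assms by (simp add: V.M.a_ac)
  moreover have "\<exists>n1\<in>N. \<exists>n2\<in>N. n = n1 \<oplus>\<^bsub>V\<^esub> n2" if "n \<in> N" for n
    using that N(1,2) by (intro bexI[of _ n] bexI[of _ "\<zero>\<^bsub>V\<^esub>"]) auto
  ultimately have "(\<Union>h\<in>N +>\<^bsub>V\<^esub> x. \<Union>k\<in>N +>\<^bsub>V\<^esub> y. {h \<oplus>\<^bsub>V\<^esub> k}) = N +>\<^bsub>V\<^esub> (x \<oplus>\<^bsub>V\<^esub> y)"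
    using N(3) by (fastforce simp: a_r_coset_def')
  then show ?thesis by (simp add: quot_module_def set_add_def')
qed

lemma quot_module_smult:
  assumes "module K V" "submodule N K V" "x \<in> carrier V" "a \<in> carrier K"
  shows "a \<odot>\<^bsub>quot_module V N\<^esub> (N +>\<^bsub>V\<^esub> x) = N +>\<^bsub>V\<^esub> (a \<odot>\<^bsub>V\<^esub> x)"
proof -
  interpret V: module K V by fact
  note N = submoduleD[OF assms(1,2)]
  have "N +>\<^bsub>V\<^esub> (a \<odot>\<^bsub>V\<^esub> z) = N +>\<^bsub>V\<^esub> (a \<odot>\<^bsub>V\<^esub> x)" if "z \<in> N +>\<^bsub>V\<^esub> x" for z
  proof -
    from that have z: "z \<in> carrier V" "z \<ominus>\<^bsub>V\<^esub> x \<in> N" using coset_mem_iff[OF assms(1-3)] by auto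
    have "a \<odot>\<^bsub>V\<^esub> z \<ominus>\<^bsub>V\<^esub> a \<odot>\<^bsub>V\<^esub> x = a \<odot>\<^bsub>V\<^esub> (z \<ominus>\<^bsub>V\<^esub> x)"
      using z assms by (simp add: a_minus_def V.smult_r_distr V.smult_r_minus)
    then show ?thesis using z assms N(6) by (simp add: coset_eq_iff[OF assms(1,2)])
  qed
  then have "(\<Union>z\<in>N +>\<^bsub>V\<^esub> x. N +>\<^bsub>V\<^esub> (a \<odot>\<^bsub>V\<^esub> z)) = (\<Union>z\<in>N +>\<^bsub>V\<^esub> x. N +>\<^bsub>V\<^esub> (a \<odot>\<^bsub>V\<^esub> x))"
    by (rule SUP_cong[OF refl])
  also have "\<dots> = N +>\<^bsub>V\<^esub> (a \<odot>\<^bsub>V\<^esub> x)" using coset_self_mem[OF assms(1-3)] by blast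
  finally show ?thesis by (simp add: quot_module_def)
qed

lemma quot_module_simps [simp]:
  "zero (quot_module V N) = N"
  by (simp add: quot_module_def)

lemma quot_carrier: "carrier (quot_module V N) = (\<lambda>x. N +>\<^bsub>V\<^esub> x) ` carrier V"
  by (auto simp: quot_module_def A_RCOSETS_def')

lemma quot_module_module:
  assumes "module K V" "submodule N K V"
  shows "module K (quot_module V N)"
proof -
  interpret V: module K V by fact
  note q = quot_module_add[OF assms] quot_module_smult[OF assms]
  show ?thesis
  proof (rule moduleI)
    show "abelian_group (quot_module V N)"
    proof (rule abelian_groupI)
      fix X Y assume "X \<in> carrier (quot_module V N)" "Y \<in> carrier (quot_module V N)"
      then show "X \<oplus>\<^bsub>quot_module V N\<^esub> Y \<in> carrier (quot_module V N)"
        and "X \<oplus>\<^bsub>quot_module V N\<^esub> Y = Y \<oplus>\<^bsub>quot_module V N\<^esub> X"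
        by (auto simp: quot_carrier q V.M.a_comm)
      fix Z assume "Z \<in> carrier (quot_module V N)"
      then show "X \<oplus>\<^bsub>quot_module V N\<^esub> Y \<oplus>\<^bsub>quot_module V N\<^esub> Z
        = X \<oplus>\<^bsub>quot_module V N\<^esub> (Y \<oplus>\<^bsub>quot_module V N\<^esub> Z)"
        using \<open>X \<in> _\<close> \<open>Y \<in> _\<close> by (auto simp: quot_carrier q V.M.a_assoc)
    next
      show "\<zero>\<^bsub>quot_module V N\<^esub> \<in> carrier (quot_module V N)"
        using coset_zero[OF assms] by (force simp: quot_carrier)
      fix X assume "X \<in> carrier (quot_module V N)"
      then obtain x where x: "x \<in> carrier V" "X = N +>\<^bsub>V\<^esub> x" by (auto simp: quot_carrier)
      have "(N +>\<^bsub>V\<^esub> \<zero>\<^bsub>V\<^esub>) \<oplus>\<^bsub>quot_module V N\<^esub> X = X" using x by (simp add: q)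
      then show "\<zero>\<^bsub>quot_module V N\<^esub> \<oplus>\<^bsub>quot_module V N\<^esub> X = X" by (simp add: coset_zero[OF assms])
      have "(N +>\<^bsub>V\<^esub> (\<ominus>\<^bsub>V\<^esub> x)) \<oplus>\<^bsub>quot_module V N\<^esub> X = \<zero>\<^bsub>quot_module V N\<^esub>"
        using x by (simp add: q V.M.l_neg coset_zero[OF assms])
      then show "\<exists>Y\<in>carrier (quot_module V N). Y \<oplus>\<^bsub>quot_module V N\<^esub> X = \<zero>\<^bsub>quot_module V N\<^esub>"
        using x by (intro bexI[of _ "N +>\<^bsub>V\<^esub> (\<ominus>\<^bsub>V\<^esub> x)"]) (auto simp: quot_carrier)
    qed
  qed (auto simp: quot_carrier q V.R.is_cring V.smult_l_distr V.smult_r_distr V.smult_assoc1)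
qed

lemma quot_map_linear:
  assumes "module K V" "submodule N K V"
  shows "linear_map K V (quot_module V N) (\<lambda>x. N +>\<^bsub>V\<^esub> x)"
  by (rule linear_mapI) (auto simp: quot_carrier quot_module_add[OF assms] quot_module_smult[OF assms])

section \<open>Bilinear maps and the universal property of the tensor product\<close>

definition bilinear_map ::
  "('k,'n) ring_scheme \<Rightarrow> ('k,'v,'a) module_scheme \<Rightarrow> ('k,'w,'b) module_scheme \<Rightarrow> ('k,'z,'c) module_scheme
    \<Rightarrow> ('v \<Rightarrow> 'w \<Rightarrow> 'z) \<Rightarrow> bool" where
  "bilinear_map K V W Z b \<longleftrightarrow>
     (\<forall>w\<in>carrier W. linear_map K V Z (\<lambda>v. b v w)) \<and> (\<forall>v\<in>carrier V. linear_map K W Z (b v))"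

lemma bilinear_mapI:
  assumes "\<And>w. w \<in> carrier W \<Longrightarrow> linear_map K V Z (\<lambda>v. b v w)"
    "\<And>v. v \<in> carrier V \<Longrightarrow> linear_map K W Z (\<lambda>w. b v w)"
  shows "bilinear_map K V W Z b"
  using assms by (auto simp: bilinear_map_def)

lemma bilinear_mapD:
  assumes "bilinear_map K V W Z b"
  shows "w \<in> carrier W \<Longrightarrow> linear_map K V Z (\<lambda>v. b v w)"
    "v \<in> carrier V \<Longrightarrow> linear_map K W Z (\<lambda>w. b v w)"
    "\<lbrakk>v \<in> carrier V; w \<in> carrier W\<rbrakk> \<Longrightarrow> b v w \<in> carrier Z"
    "\<lbrakk>v \<in> carrier V; v' \<in> carrier V; w \<in> carrier W\<rbrakk> \<Longrightarrow> b (v \<oplus>\<^bsub>V\<^esub> v') w = b v w \<oplus>\<^bsub>Z\<^esub> b v' w"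
    "\<lbrakk>v \<in> carrier V; w \<in> carrier W; w' \<in> carrier W\<rbrakk> \<Longrightarrow> b v (w \<oplus>\<^bsub>W\<^esub> w') = b v w \<oplus>\<^bsub>Z\<^esub> b v w'"
    "\<lbrakk>a \<in> carrier K; v \<in> carrier V; w \<in> carrier W\<rbrakk> \<Longrightarrow> b (a \<odot>\<^bsub>V\<^esub> v) w = a \<odot>\<^bsub>Z\<^esub> b v w"
    "\<lbrakk>a \<in> carrier K; v \<in> carrier V; w \<in> carrier W\<rbrakk> \<Longrightarrow> b v (a \<odot>\<^bsub>W\<^esub> w) = a \<odot>\<^bsub>Z\<^esub> b v w"
  using assms by (auto simp: bilinear_map_def linear_map_def Pi_iff)

lemma bilinear_functionals:
  assumes "field K" "functional K V f" "functional K W g"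
  shows "bilinear_map K V W (scalar_module K) (\<lambda>v w. f v \<otimes>\<^bsub>K\<^esub> g w)"
proof -
  interpret K: field K by fact
  show ?thesis
    using functionalD[OF assms(2)] functionalD[OF assms(3)]
    by (intro bilinear_mapI linear_mapI)
       (auto simp: K.l_distr K.r_distr K.m_ac)
qed

lemma span_of_submodule:
  assumes "module K M" "X \<subseteq> carrier M"
  shows "submodule (span_of K M X) K M" "X \<subseteq> span_of K M X"
    "\<And>D. \<lbrakk>submodule D K M; X \<subseteq> D\<rbrakk> \<Longrightarrow> span_of K M X \<subseteq> D"
proof -
  interpret M: module K M by fact
  note sD = submoduleD[OF assms(1)]
  show "X \<subseteq> span_of K M X" "\<And>D. \<lbrakk>submodule D K M; X \<subseteq> D\<rbrakk> \<Longrightarrow> span_of K M X \<subseteq> D"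
    unfolding span_of_def by (auto simp: hull_subset subset_hull hull_minimal)
  show "submodule (span_of K M X) K M"
  proof (rule submoduleI'[OF assms(1)])
    show "span_of K M X \<subseteq> carrier M"
      unfolding span_of_def using M.carrier_is_submodule assms(2) by (simp add: hull_minimal)
  qed (auto simp: span_of_def hull_def intro: sD)
qed

locale tensor_factors =
  fixes K :: "('k,'n) ring_scheme" and V :: "('k,'v,'a) module_scheme" and W :: "('k,'w,'b) module_scheme"
  assumes field_K: "field K" and mod_V: "module K V" and mod_W: "module K W"
begin

abbreviation "F \<equiv> free_on_pairs K V W"
abbreviation "N \<equiv> tensor_null K V W"
abbreviation "e \<equiv> pair_basis K :: 'v \<Rightarrow> 'w \<Rightarrow> _"

interpretation K: field K by (rule field_K)
interpretation V: module K V by (rule mod_V)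
interpretation W: module K W by (rule mod_W)

lemma F_simps:
  "zero F = (\<lambda>p. \<zero>\<^bsub>K\<^esub>)" "add F = (\<lambda>f g p. f p \<oplus>\<^bsub>K\<^esub> g p)" "smult F = (\<lambda>a f p. a \<otimes>\<^bsub>K\<^esub> f p)"
  by (simp_all add: free_on_pairs_def)

lemma F_carrier:
  "f \<in> carrier F \<longleftrightarrow> (\<forall>p. f p \<in> carrier K) \<and> finite {p. f p \<noteq> \<zero>\<^bsub>K\<^esub>} \<and>
     {p. f p \<noteq> \<zero>\<^bsub>K\<^esub>} \<subseteq> carrier V \<times> carrier W"
  by (auto simp: free_on_pairs_def)

lemma F_val: "f \<in> carrier F \<Longrightarrow> f p \<in> carrier K"
  unfolding F_carrier by blast

lemma mod_F: "module K F"
proof -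
  have add: "(\<lambda>p. f p \<oplus>\<^bsub>K\<^esub> g p) \<in> carrier F" if "f \<in> carrier F" "g \<in> carrier F" for f g
  proof -
    have "{p. f p \<oplus>\<^bsub>K\<^esub> g p \<noteq> \<zero>\<^bsub>K\<^esub>} \<subseteq> {p. f p \<noteq> \<zero>\<^bsub>K\<^esub>} \<union> {p. g p \<noteq> \<zero>\<^bsub>K\<^esub>}" by auto
    then show ?thesis using that unfolding F_carrier
      by (meson K.add.m_closed finite_UnI finite_subset le_sup_iff subset_trans)
  qed
  have smult: "(\<lambda>p. a \<otimes>\<^bsub>K\<^esub> f p) \<in> carrier F" if "f \<in> carrier F" "a \<in> carrier K" for f a
  proof -
    have "{p. a \<otimes>\<^bsub>K\<^esub> f p \<noteq> \<zero>\<^bsub>K\<^esub>} \<subseteq> {p. f p \<noteq> \<zero>\<^bsub>K\<^esub>}" using that by auto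
    then show ?thesis using that unfolding F_carrier
      by (meson K.m_closed finite_subset subset_trans)
  qed
  show ?thesis
  proof (rule moduleI)
    show "abelian_group F"
    proof (rule abelian_groupI)
      show "\<zero>\<^bsub>F\<^esub> \<in> carrier F" unfolding F_carrier by (simp add: F_simps)
      fix f assume f: "f \<in> carrier F"
      show "\<zero>\<^bsub>F\<^esub> \<oplus>\<^bsub>F\<^esub> f = f" using f by (intro ext) (simp add: F_simps F_val)
      have "(\<lambda>p. (\<ominus>\<^bsub>K\<^esub> \<one>\<^bsub>K\<^esub>) \<otimes>\<^bsub>K\<^esub> f p) \<oplus>\<^bsub>F\<^esub> f = \<zero>\<^bsub>F\<^esub>"
        using f by (intro ext) (simp add: F_simps F_val K.l_minus K.l_neg)
      then show "\<exists>g\<in>carrier F. g \<oplus>\<^bsub>F\<^esub> f = \<zero>\<^bsub>F\<^esub>"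
        using smult[OF f, of "\<ominus>\<^bsub>K\<^esub> \<one>\<^bsub>K\<^esub>"] by auto
    qed (use add in \<open>simp_all add: F_simps F_val K.a_ac\<close>)
  qed (use smult in \<open>simp_all add: F_simps F_val K.l_distr K.r_distr K.m_assoc K.is_cring\<close>)
qed

interpretation F: module K F by (rule mod_F)

lemma pair_basis_closed: "\<lbrakk>v \<in> carrier V; w \<in> carrier W\<rbrakk> \<Longrightarrow> e v w \<in> carrier F"
  by (auto simp: F_carrier pair_basis_def)

lemma relations_closed: "bilinear_relations K V W \<subseteq> carrier F"
  unfolding bilinear_relations_def Let_def
  by (auto intro!: F.M.minus_closed F.M.a_closed F.smult_closed pair_basis_closed)

lemma sub_N: "submodule N K F"
  unfolding tensor_null_def using span_of_submodule(1)[OF mod_F relations_closed] .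

lemma tensor_module: "module K (tensor K V W)"
  unfolding tensor_def by (rule quot_module_module[OF mod_F sub_N])

lemma relation_in_N: "r \<in> bilinear_relations K V W \<Longrightarrow> r \<in> N"
  unfolding tensor_null_def using span_of_submodule(2)[OF mod_F relations_closed] by blast

lemma tens_bilinear: "bilinear_map K V W (tensor K V W) (tens K V W)"
proof -
  note q = quot_module_add[OF mod_F sub_N, folded tensor_def] quot_module_smult[OF mod_F sub_N, folded tensor_def]
  note ceq = coset_eq_iff[OF mod_F sub_N]
  note cl = pair_basis_closed F.M.a_closed F.smult_closed
  have c: "tens K V W v w \<in> carrier (tensor K V W)" if "v \<in> carrier V" "w \<in> carrier W" for v w
    using cl that by (auto simp: tens_def tensor_def quot_carrier)
  have 1: "tens K V W (v \<oplus>\<^bsub>V\<^esub> v') w = tens K V W v w \<oplus>\<^bsub>tensor K V W\<^esub> tens K V W v' w"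
    if "v \<in> carrier V" "v' \<in> carrier V" "w \<in> carrier W" for v v' w
  proof -
    have "e (v \<oplus>\<^bsub>V\<^esub> v') w \<ominus>\<^bsub>F\<^esub> (e v w \<oplus>\<^bsub>F\<^esub> e v' w) \<in> N"
      by (rule relation_in_N) (use that in \<open>auto simp: bilinear_relations_def Let_def\<close>)
    then show ?thesis unfolding tens_def using that by (simp add: q cl ceq)
  qed
  have 2: "tens K V W v (w \<oplus>\<^bsub>W\<^esub> w') = tens K V W v w \<oplus>\<^bsub>tensor K V W\<^esub> tens K V W v w'"
    if "v \<in> carrier V" "w \<in> carrier W" "w' \<in> carrier W" for v w w'
  proof -
    have "e v (w \<oplus>\<^bsub>W\<^esub> w') \<ominus>\<^bsub>F\<^esub> (e v w \<oplus>\<^bsub>F\<^esub> e v w') \<in> N"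
      by (rule relation_in_N) (use that in \<open>auto simp: bilinear_relations_def Let_def\<close>)
    then show ?thesis unfolding tens_def using that by (simp add: q cl ceq)
  qed
  have 3: "tens K V W (a \<odot>\<^bsub>V\<^esub> v) w = a \<odot>\<^bsub>tensor K V W\<^esub> tens K V W v w"
    if "a \<in> carrier K" "v \<in> carrier V" "w \<in> carrier W" for a v w
  proof -
    have "e (a \<odot>\<^bsub>V\<^esub> v) w \<ominus>\<^bsub>F\<^esub> (a \<odot>\<^bsub>F\<^esub> e v w) \<in> N"
      by (rule relation_in_N) (use that in \<open>auto simp: bilinear_relations_def Let_def\<close>)
    then show ?thesis unfolding tens_def using that by (simp add: q cl ceq)
  qed
  have 4: "tens K V W v (a \<odot>\<^bsub>W\<^esub> w) = a \<odot>\<^bsub>tensor K V W\<^esub> tens K V W v w"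
    if "a \<in> carrier K" "v \<in> carrier V" "w \<in> carrier W" for a v w
  proof -
    have "e v (a \<odot>\<^bsub>W\<^esub> w) \<ominus>\<^bsub>F\<^esub> (a \<odot>\<^bsub>F\<^esub> e v w) \<in> N"
      by (rule relation_in_N) (use that in \<open>auto simp: bilinear_relations_def Let_def\<close>)
    then show ?thesis unfolding tens_def using that by (simp add: q cl ceq)
  qed
  show ?thesis by (intro bilinear_mapI linear_mapI) (simp_all add: c 1 2 3 4)
qed

text \<open>Resetting f to zero at one point of its support removes one multiple of a basis vector;
  the induction is on the support.\<close>

lemma F_induct [consumes 1, case_names zero step]:
  assumes "f \<in> carrier F" "P \<zero>\<^bsub>F\<^esub>"
    "\<And>f c v w. \<lbrakk>f \<in> carrier F; P f; c \<in> carrier K; v \<in> carrier V; w \<in> carrier W\<rbrakk>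
       \<Longrightarrow> P (c \<odot>\<^bsub>F\<^esub> e v w \<oplus>\<^bsub>F\<^esub> f)"
  shows "P f"
proof -
  have "P f" if "finite A" "f \<in> carrier F" "{p. f p \<noteq> \<zero>\<^bsub>K\<^esub>} = A" for A f
    using that
  proof (induction A arbitrary: f rule: finite_induct)
    case empty
    then have "f = \<zero>\<^bsub>F\<^esub>" by (auto simp: F_simps)
    then show ?case using assms(2) by simp
  next
    case (insert p A)
    obtain v w where p: "p = (v, w)" by fastforce
    have c: "f p \<in> carrier K" "v \<in> carrier V" "w \<in> carrier W"
      using insert.prems unfolding F_carrier p by auto
    define g where "g = f(p := \<zero>\<^bsub>K\<^esub>)"
    have gA: "{q. g q \<noteq> \<zero>\<^bsub>K\<^esub>} = A" using insert by (auto simp: g_def)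
    have g: "g \<in> carrier F" unfolding F_carrier gA
      using insert.prems insert.hyps unfolding F_carrier by (auto simp: g_def)
    have "f = f p \<odot>\<^bsub>F\<^esub> e v w \<oplus>\<^bsub>F\<^esub> g"
      using F_val[OF insert.prems(1)]
      by (intro ext) (simp add: F_simps g_def pair_basis_def p)
    then show ?case using assms(3)[OF g insert.IH[OF g gA] c] by simp
  qed
  then show ?thesis using assms(1) unfolding F_carrier by blast
qed

text \<open>The sum in \<open>tensor_lift\<close> for a single representative f. It is linear on the
  free space and kills \<open>N\<close>, which makes it constant on cosets.\<close>

definition free_lift :: "('k,'z,'c) module_scheme \<Rightarrow> ('v \<Rightarrow> 'w \<Rightarrow> 'z) \<Rightarrow> ('v \<times> 'w \<Rightarrow> 'k) \<Rightarrow> 'z" where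
  "free_lift Z b f = (\<Oplus>\<^bsub>Z\<^esub>p\<in>{p. f p \<noteq> \<zero>\<^bsub>K\<^esub>}. f p \<odot>\<^bsub>Z\<^esub> b (fst p) (snd p))"

text \<open>Enlarging the index set beyond the support lets the sums for two functions be taken over
  a common set, which is what additivity of the lift needs.\<close>

lemma free_lift_eq:
  assumes "module K Z" "bilinear_map K V W Z b" "f \<in> carrier F" "finite A" "{p. f p \<noteq> \<zero>\<^bsub>K\<^esub>} \<subseteq> A"
    "A \<subseteq> carrier V \<times> carrier W"
  shows "free_lift Z b f = (\<Oplus>\<^bsub>Z\<^esub>p\<in>A. f p \<odot>\<^bsub>Z\<^esub> b (fst p) (snd p))"
proof -
  interpret Z: module K Z by fact
  note bD = bilinear_mapD(3)[OF assms(2)]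
  show ?thesis unfolding free_lift_def
    using assms(3-6) bD unfolding F_carrier
    by (intro Z.M.add.finprod_mono_neutral_cong_left) auto
qed

lemma free_lift_linear:
  assumes "module K Z" "bilinear_map K V W Z b"
  shows "linear_map K F Z (free_lift Z b)"
proof (rule linear_mapI)
  interpret Z: module K Z by fact
  note bD = bilinear_mapD(3)[OF assms(2)]
  fix f assume f: "f \<in> carrier F"
  have sf: "finite {p. f p \<noteq> \<zero>\<^bsub>K\<^esub>}" "{p. f p \<noteq> \<zero>\<^bsub>K\<^esub>} \<subseteq> carrier V \<times> carrier W" "\<And>p. f p \<in> carrier K"
    using f unfolding F_carrier by auto
  show "free_lift Z b f \<in> carrier Z"
    unfolding free_lift_def using sf bD by (intro Z.M.finsum_closed) auto
  {
    fix g assume g: "g \<in> carrier F"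
    have sg: "finite {p. g p \<noteq> \<zero>\<^bsub>K\<^esub>}" "{p. g p \<noteq> \<zero>\<^bsub>K\<^esub>} \<subseteq> carrier V \<times> carrier W" "\<And>p. g p \<in> carrier K"
      using g unfolding F_carrier by auto
    let ?A = "{p. f p \<noteq> \<zero>\<^bsub>K\<^esub>} \<union> {p. g p \<noteq> \<zero>\<^bsub>K\<^esub>}"
    have A: "finite ?A" "?A \<subseteq> carrier V \<times> carrier W" using sf sg by auto
    have fg: "f \<oplus>\<^bsub>F\<^esub> g \<in> carrier F" using f g by simp
    have sub: "{p. (f \<oplus>\<^bsub>F\<^esub> g) p \<noteq> \<zero>\<^bsub>K\<^esub>} \<subseteq> ?A" by (auto simp: F_simps)
    have "free_lift Z b (f \<oplus>\<^bsub>F\<^esub> g) = (\<Oplus>\<^bsub>Z\<^esub>p\<in>?A. (f \<oplus>\<^bsub>F\<^esub> g) p \<odot>\<^bsub>Z\<^esub> b (fst p) (snd p))"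
      by (rule free_lift_eq[OF assms fg A(1) sub A(2)])
    also have "\<dots> = (\<Oplus>\<^bsub>Z\<^esub>p\<in>?A. f p \<odot>\<^bsub>Z\<^esub> b (fst p) (snd p) \<oplus>\<^bsub>Z\<^esub> g p \<odot>\<^bsub>Z\<^esub> b (fst p) (snd p))"
      using A(2) sf(3) sg(3) bD
      by (intro Z.M.finsum_cong') (auto simp: F_simps Z.smult_l_distr)
    also have "\<dots> = (\<Oplus>\<^bsub>Z\<^esub>p\<in>?A. f p \<odot>\<^bsub>Z\<^esub> b (fst p) (snd p)) \<oplus>\<^bsub>Z\<^esub> (\<Oplus>\<^bsub>Z\<^esub>p\<in>?A. g p \<odot>\<^bsub>Z\<^esub> b (fst p) (snd p))"
      using A(2) sf(3) sg(3) bD by (intro Z.M.finsum_addf) auto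
    also have "\<dots> = free_lift Z b f \<oplus>\<^bsub>Z\<^esub> free_lift Z b g"
      using free_lift_eq[OF assms f A(1) _ A(2)] free_lift_eq[OF assms g A(1) _ A(2)] by simp
    finally show "free_lift Z b (f \<oplus>\<^bsub>F\<^esub> g) = free_lift Z b f \<oplus>\<^bsub>Z\<^esub> free_lift Z b g" .
  }
  fix a assume a: "a \<in> carrier K"
  let ?A = "{p. f p \<noteq> \<zero>\<^bsub>K\<^esub>}"
  have af: "a \<odot>\<^bsub>F\<^esub> f \<in> carrier F" using f a by simp
  have sub: "{p. (a \<odot>\<^bsub>F\<^esub> f) p \<noteq> \<zero>\<^bsub>K\<^esub>} \<subseteq> ?A" using a by (auto simp: F_simps)
  have "free_lift Z b (a \<odot>\<^bsub>F\<^esub> f) = (\<Oplus>\<^bsub>Z\<^esub>p\<in>?A. (a \<odot>\<^bsub>F\<^esub> f) p \<odot>\<^bsub>Z\<^esub> b (fst p) (snd p))"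
    by (rule free_lift_eq[OF assms af sf(1) sub sf(2)])
  also have "\<dots> = (\<Oplus>\<^bsub>Z\<^esub>p\<in>?A. a \<odot>\<^bsub>Z\<^esub> (f p \<odot>\<^bsub>Z\<^esub> b (fst p) (snd p)))"
    using sf a bD by (intro Z.M.finsum_cong') (auto simp: F_simps Z.smult_assoc1)
  also have "\<dots> = a \<odot>\<^bsub>Z\<^esub> free_lift Z b f"
    unfolding free_lift_def using sf a bD by (intro Z.finsum_smult_ldistr[symmetric]) auto
  finally show "free_lift Z b (a \<odot>\<^bsub>F\<^esub> f) = a \<odot>\<^bsub>Z\<^esub> free_lift Z b f" .
qed

lemma free_lift_pair:
  assumes "module K Z" "bilinear_map K V W Z b" "v \<in> carrier V" "w \<in> carrier W"
  shows "free_lift Z b (e v w) = b v w"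
proof -
  interpret Z: module K Z by fact
  note bD = bilinear_mapD(3)[OF assms(2)]
  have s: "{p. e v w p \<noteq> \<zero>\<^bsub>K\<^esub>} = {(v, w)}" by (auto simp: pair_basis_def)
  show ?thesis unfolding free_lift_def s using bD assms(3,4)
    by (simp add: pair_basis_def)
qed

text \<open>The kernel is a subspace and contains the generating relations, each of which expresses
  an identity satisfied by the bilinear b; hence it contains their span.\<close>

lemma free_lift_null:
  assumes "module K Z" "bilinear_map K V W Z b" "n \<in> N"
  shows "free_lift Z b n = \<zero>\<^bsub>Z\<^esub>"
proof -
  interpret Z: module K Z by fact
  note L = free_lift_linear[OF assms(1,2)]
  note LD = linear_mapD[OF L] and Lm = linear_map_minus[OF mod_F assms(1) L]
  note bD = bilinear_mapD[OF assms(2)]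
  note cl = pair_basis_closed F.M.a_closed F.smult_closed
  let ?D = "{x \<in> carrier F. free_lift Z b x \<in> {\<zero>\<^bsub>Z\<^esub>}}"
  have "submodule ?D K F"
    by (rule kernel_submodule[OF mod_F assms(1) L zero_submodule[OF assms(1)]])
  moreover have "bilinear_relations K V W \<subseteq> ?D"
  proof
    fix r assume r: "r \<in> bilinear_relations K V W"
    then have "r \<in> carrier F" using relations_closed by blast
    moreover have "free_lift Z b r = \<zero>\<^bsub>Z\<^esub>"
      using r unfolding bilinear_relations_def Let_def
      by (auto simp: Lm LD cl free_lift_pair[OF assms(1,2)] bD
          module_minus_simps[OF assms(1)])
    ultimately show "r \<in> ?D" by simp
  qed
  ultimately have "N \<subseteq> ?D" unfolding tensor_null_def
    by (rule span_of_submodule(3)[OF mod_F relations_closed])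
  then show ?thesis using assms(3) by blast
qed

lemma tensor_lift_coset:
  assumes "module K Z" "bilinear_map K V W Z b" "f \<in> carrier F"
  shows "tensor_lift K Z b (N +>\<^bsub>F\<^esub> f) = free_lift Z b f"
proof -
  interpret Z: module K Z by fact
  note L = free_lift_linear[OF assms(1,2)]
  note NF = submoduleD[OF mod_F sub_N]
  have "free_lift Z b (n \<oplus>\<^bsub>F\<^esub> f) = free_lift Z b f" if "n \<in> N" for n
    using that linear_mapD[OF L] NF(1) assms(3) free_lift_null[OF assms(1,2)] by simp
  then have "free_lift Z b ` (N +>\<^bsub>F\<^esub> f) \<subseteq> {free_lift Z b f}"
    by (auto simp: a_r_coset_def')
  then have "free_lift Z b ` (N +>\<^bsub>F\<^esub> f) = {free_lift Z b f}"
    using coset_self_mem[OF mod_F sub_N assms(3)] by blast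
  then show ?thesis unfolding tensor_lift_def free_lift_def by simp
qed

lemma tensor_carrier: "carrier (tensor K V W) = (\<lambda>f. N +>\<^bsub>F\<^esub> f) ` carrier F"
  by (simp add: tensor_def quot_carrier)

lemma tensor_lift_linear:
  assumes "module K Z" "bilinear_map K V W Z b"
  shows "linear_map K (tensor K V W) Z (tensor_lift K Z b)"
proof -
  note L = linear_mapD[OF free_lift_linear[OF assms]]
  note q = quot_module_add[OF mod_F sub_N, folded tensor_def] quot_module_smult[OF mod_F sub_N, folded tensor_def]
  show ?thesis
    by (rule linear_mapI) (auto simp: tensor_carrier tensor_lift_coset[OF assms] q L)
qed

lemma tensor_lift_tens:
  assumes "module K Z" "bilinear_map K V W Z b" "v \<in> carrier V" "w \<in> carrier W"
  shows "tensor_lift K Z b (tens K V W v w) = b v w"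
  using assms by (simp add: tens_def tensor_lift_coset pair_basis_closed free_lift_pair)

abbreviation tsum :: "('v \<times> 'w) list \<Rightarrow> ('v \<times> 'w \<Rightarrow> 'k) set" where
  "tsum \<equiv> lsum (tensor K V W) (\<lambda>(v, w). tens K V W v w)"

lemma tsum_closed: "set ts \<subseteq> carrier V \<times> carrier W \<Longrightarrow> tsum ts \<in> carrier (tensor K V W)"
proof -
  interpret T: module K "tensor K V W" by (rule tensor_module)
  show "set ts \<subseteq> carrier V \<times> carrier W \<Longrightarrow> tsum ts \<in> carrier (tensor K V W)"
    using bilinear_mapD(3)[OF tens_bilinear] by (intro T.M.lsum_closed) auto
qed

text \<open>Coefficients are absorbed into the first factor, so a tensor becomes a list of pairs
  without scalars.\<close>

lemma tsum_exists:
  assumes "T \<in> carrier (tensor K V W)"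
  obtains ts where "set ts \<subseteq> carrier V \<times> carrier W" "T = tsum ts"
proof -
  interpret T: module K "tensor K V W" by (rule tensor_module)
  note t = linear_mapD[OF quot_map_linear[OF mod_F sub_N, folded tensor_def]]
  note bD = bilinear_mapD[OF tens_bilinear]
  obtain f where f: "f \<in> carrier F" "T = N +>\<^bsub>F\<^esub> f" using assms by (auto simp: tensor_carrier)
  have "\<exists>ts. set ts \<subseteq> carrier V \<times> carrier W \<and> N +>\<^bsub>F\<^esub> f = tsum ts"
    using f(1)
  proof (induction rule: F_induct)
    case zero
    show ?case by (intro exI[of _ "[]"]) (simp add: coset_zero[OF mod_F sub_N] tensor_def)
  next
    case (step f c v w)
    then obtain ts where ts: "set ts \<subseteq> carrier V \<times> carrier W" "N +>\<^bsub>F\<^esub> f = tsum ts" by blast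
    have "N +>\<^bsub>F\<^esub> (c \<odot>\<^bsub>F\<^esub> e v w \<oplus>\<^bsub>F\<^esub> f) = tsum ((c \<odot>\<^bsub>V\<^esub> v, w) # ts)"
      using step ts by (simp add: t pair_basis_closed bD tens_def[symmetric])
    then show ?case using step ts by (intro exI[of _ "(c \<odot>\<^bsub>V\<^esub> v, w) # ts"]) auto
  qed
  then show thesis using that f(2) by blast
qed

lemma tensor_lift_tsum:
  assumes "module K Z" "bilinear_map K V W Z b" "set ts \<subseteq> carrier V \<times> carrier W"
  shows "tensor_lift K Z b (tsum ts) = lsum Z (\<lambda>(v, w). b v w) ts"
proof -
  have "tensor_lift K Z b (tsum ts) = lsum Z (\<lambda>p. tensor_lift K Z b (case p of (v, w) \<Rightarrow> tens K V W v w)) ts"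
    by (rule lsum_linear[OF tensor_module assms(1) tensor_lift_linear[OF assms(1,2)]])
       (use assms(3) bilinear_mapD(3)[OF tens_bilinear] in auto)
  also have "\<dots> = lsum Z (\<lambda>(v, w). b v w) ts"
    using assms by (intro lsum_cong) (auto simp: tensor_lift_tens)
  finally show ?thesis .
qed

end

section \<open>Finitely generated subspaces and a substitute for dimension\<close>

lemma functional_zero:
  assumes "field K" "module K V" "functional K V f"
  shows "f \<zero>\<^bsub>V\<^esub> = \<zero>\<^bsub>K\<^esub>"
  using linear_map_zero[OF assms(2) module_scalar_module[OF assms(1)] assms(3)[unfolded functional_def]]
  by simp

lemma functional_minus:
  assumes "field K" "module K V" "functional K V f" "x \<in> carrier V" "y \<in> carrier V"
  shows "f (x \<ominus>\<^bsub>V\<^esub> y) = f x \<ominus>\<^bsub>K\<^esub> f y"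
proof -
  interpret K: field K by fact
  interpret V: module K V by fact
  note fD = functionalD[OF assms(3)]
  have "f x = f (x \<ominus>\<^bsub>V\<^esub> y \<oplus>\<^bsub>V\<^esub> y)" using assms module_minus_simps(3)[OF assms(2)] by simp
  also have "\<dots> = f (x \<ominus>\<^bsub>V\<^esub> y) \<oplus>\<^bsub>K\<^esub> f y" using assms by (intro fD) auto
  finally show ?thesis using fD(1) assms(4,5) module_minus_simps(4)[OF module_scalar_module[OF assms(1)]]
    by (simp add: a_minus_def K.a_assoc K.r_neg)
qed

text \<open>A finitely generated extension of D, kept as a list of generators so that the length of
  the list can play the part of dimension.\<close>

primrec adjoin :: "('k,'n) ring_scheme \<Rightarrow> ('k,'v,'m) module_scheme \<Rightarrow> 'v set \<Rightarrow> 'v list \<Rightarrow> 'v set" where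
  "adjoin K V D [] = D"
| "adjoin K V D (v # vs) = add_line K V (adjoin K V D vs) v"

lemma adjoin:
  assumes "module K V" "submodule D K V" "set vs \<subseteq> carrier V"
  shows "submodule (adjoin K V D vs) K V" "D \<subseteq> adjoin K V D vs" "set vs \<subseteq> adjoin K V D vs"
proof -
  have "submodule (adjoin K V D vs) K V \<and> D \<subseteq> adjoin K V D vs \<and> set vs \<subseteq> adjoin K V D vs"
    using assms(3)
  proof (induction vs)
    case (Cons v vs)
    then show ?case using add_line[OF assms(1), of "adjoin K V D vs" v] by auto
  qed (use assms in auto)
  then show "submodule (adjoin K V D vs) K V" "D \<subseteq> adjoin K V D vs" "set vs \<subseteq> adjoin K V D vs"
    by auto
qed

lemma adjoin_least:
  assumes "module K V" "submodule E K V" "D \<subseteq> E" "set vs \<subseteq> E"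
  shows "adjoin K V D vs \<subseteq> E"
  using assms(4) by (induction vs) (use assms in \<open>auto dest: add_line_least[OF assms(1,2)]\<close>)

text \<open>Let A be the span of the tail. If P is not inside A, some y in P has a nonzero
  v-coordinate, and every p in P is a multiple of y plus an element of P \<inter> A, which the
  induction hypothesis generates. The strict inequality for proper subspaces stands in for strict
  monotonicity of dimension and drives the later minimality arguments.\<close>

lemma submodule_of_adjoin:
  assumes "field K" "module K V" "set vs \<subseteq> carrier V" "submodule P K V" "P \<subseteq> adjoin K V {\<zero>\<^bsub>V\<^esub>} vs"
  shows "\<exists>us. length us \<le> length vs \<and> set us \<subseteq> carrier V \<and> P = adjoin K V {\<zero>\<^bsub>V\<^esub>} us \<and>
    (P \<noteq> adjoin K V {\<zero>\<^bsub>V\<^esub>} vs \<longrightarrow> length us < length vs)"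
  using assms(3-5)
proof (induction vs arbitrary: P)
  case Nil
  then have "P = {\<zero>\<^bsub>V\<^esub>}" using submoduleD(2)[OF assms(2)] by auto
  then show ?case by (intro exI[of _ "[]"]) auto
next
  case (Cons v vs)
  interpret K: field K by fact
  interpret V: module K V by fact
  let ?A = "adjoin K V {\<zero>\<^bsub>V\<^esub>} vs"
  note sA = adjoin[OF assms(2) zero_submodule[OF assms(2)], of vs]
  have vs: "set vs \<subseteq> carrier V" "v \<in> carrier V" using Cons.prems by auto
  note A = submoduleD[OF assms(2) sA(1)[OF vs(1)]]
  note P = submoduleD[OF assms(2) Cons.prems(2)]
  show ?case
  proof (cases "P \<subseteq> ?A")
    case True
    then obtain us where us: "length us \<le> length vs" "set us \<subseteq> carrier V" "P = adjoin K V {\<zero>\<^bsub>V\<^esub>} us"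
      using Cons.IH[OF vs(1) Cons.prems(2)] by blast
    then show ?thesis by (intro exI[of _ us]) auto
  next
    case False
    then obtain y where y: "y \<in> P" "y \<notin> ?A" by blast
    have yV: "y \<in> carrier V" using y P by blast
    obtain d c where dc: "y = d \<oplus>\<^bsub>V\<^esub> c \<odot>\<^bsub>V\<^esub> v" "d \<in> ?A" "c \<in> carrier K"
      using y Cons.prems(3) by (auto simp: add_line_def)
    have c0: "c \<noteq> \<zero>\<^bsub>K\<^esub>" using dc y(2) vs A(1) by auto
    define c' where "c' = inv\<^bsub>K\<^esub> c"
    have c': "c' \<in> carrier K" "c' \<otimes>\<^bsub>K\<^esub> c = \<one>\<^bsub>K\<^esub>" "\<And>a. a \<in> carrier K \<Longrightarrow> a \<otimes>\<^bsub>K\<^esub> c' \<otimes>\<^bsub>K\<^esub> c = a"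
      using dc(3) c0 K.field_Units by (auto simp: c'_def K.m_assoc)
    let ?Q = "P \<inter> ?A"
    have sQ: "submodule ?Q K V" by (rule submodule_Int[OF assms(2) Cons.prems(2) sA(1)[OF vs(1)]])
    obtain us where us: "length us \<le> length vs" "set us \<subseteq> carrier V" "?Q = adjoin K V {\<zero>\<^bsub>V\<^esub>} us"
      "?Q \<noteq> ?A \<longrightarrow> length us < length vs"
      using Cons.IH[OF vs(1) sQ] by blast
    have "P \<subseteq> add_line K V ?Q y"
    proof
      fix p assume p: "p \<in> P"
      then obtain d1 c1 where dc1: "p = d1 \<oplus>\<^bsub>V\<^esub> c1 \<odot>\<^bsub>V\<^esub> v" "d1 \<in> ?A" "c1 \<in> carrier K"
        using Cons.prems(3) by (auto simp: add_line_def)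
      define a where "a = c1 \<otimes>\<^bsub>K\<^esub> c'"
      have a: "a \<in> carrier K" "a \<otimes>\<^bsub>K\<^esub> c = c1" using c' dc1 by (auto simp: a_def)
      have "a \<odot>\<^bsub>V\<^esub> y = a \<odot>\<^bsub>V\<^esub> d \<oplus>\<^bsub>V\<^esub> c1 \<odot>\<^bsub>V\<^esub> v"
        using dc a vs A(1) by (simp add: V.smult_r_distr V.smult_assoc1[symmetric])
      then have "p \<ominus>\<^bsub>V\<^esub> a \<odot>\<^bsub>V\<^esub> y = d1 \<ominus>\<^bsub>V\<^esub> a \<odot>\<^bsub>V\<^esub> d"
        using dc1 dc a vs A(1) by (simp add: a_minus_def V.M.minus_add V.M.a_ac V.M.r_neg V.M.r_neg1 V.M.r_neg2)
      moreover have "p \<ominus>\<^bsub>V\<^esub> a \<odot>\<^bsub>V\<^esub> y \<in> P" using P(5)[OF p P(6)[OF a(1) y(1)]] .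
      moreover have "d1 \<ominus>\<^bsub>V\<^esub> a \<odot>\<^bsub>V\<^esub> d \<in> ?A" using A(5)[OF dc1(2) A(6)[OF a(1) dc(2)]] .
      ultimately have "p \<ominus>\<^bsub>V\<^esub> a \<odot>\<^bsub>V\<^esub> y \<in> ?Q" by simp
      moreover have "p = (p \<ominus>\<^bsub>V\<^esub> a \<odot>\<^bsub>V\<^esub> y) \<oplus>\<^bsub>V\<^esub> a \<odot>\<^bsub>V\<^esub> y"
        using P(1)[OF p] a yV module_minus_simps(3)[OF assms(2)] by simp
      ultimately show "p \<in> add_line K V ?Q y" using a(1) unfolding add_line_def by blast
    qed
    moreover have "add_line K V ?Q y \<subseteq> P"
      by (rule add_line_least[OF assms(2) Cons.prems(2)]) (use y in auto)
    ultimately have Peq: "P = adjoin K V {\<zero>\<^bsub>V\<^esub>} (y # us)" using us(3) by simp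
    have "length us < length vs" if ne: "P \<noteq> adjoin K V {\<zero>\<^bsub>V\<^esub>} (v # vs)"
    proof -
      \<comment> \<open>If P contained all of A, solving y = d + cv for v would put v into P and
        make P the whole span.\<close>
      have "?Q \<noteq> ?A"
      proof
        assume "?Q = ?A"
        then have AP: "?A \<subseteq> P" by blast
        have "c' \<odot>\<^bsub>V\<^esub> y = c' \<odot>\<^bsub>V\<^esub> d \<oplus>\<^bsub>V\<^esub> v"
          using dc c' vs A(1) by (simp add: V.smult_r_distr V.smult_assoc1[symmetric])
        then have "v = c' \<odot>\<^bsub>V\<^esub> y \<ominus>\<^bsub>V\<^esub> c' \<odot>\<^bsub>V\<^esub> d"
          using dc c' vs A(1) by (simp add: a_minus_def V.M.a_ac V.M.r_neg V.M.r_neg1 V.M.r_neg2)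
        then have "v \<in> P" using AP dc(2) y(1) P c'(1) by (metis subsetD)
        then have "adjoin K V {\<zero>\<^bsub>V\<^esub>} (v # vs) \<subseteq> P"
          using add_line_least[OF assms(2) Cons.prems(2) AP] by simp
        then show False using ne Cons.prems(3) by blast
      qed
      then show ?thesis using us(4) by blast
    qed
    then show ?thesis using us(1,2) yV Peq by (intro exI[of _ "y # us"]) auto
  qed
qed

section \<open>Pairing tensors with functionals\<close>

definition tensor_pair :: "('k,'n) ring_scheme \<Rightarrow> ('v \<Rightarrow> 'k) \<Rightarrow> ('w \<Rightarrow> 'k) \<Rightarrow> ('v \<times> 'w \<Rightarrow> 'k) set \<Rightarrow> 'k" where
  "tensor_pair K f g = tensor_lift K (scalar_module K) (\<lambda>v w. f v \<otimes>\<^bsub>K\<^esub> g w)"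

context tensor_factors
begin

interpretation K: field K by (rule field_K)
interpretation V: module K V by (rule mod_V)
interpretation W: module K W by (rule mod_W)
interpretation T: module K "tensor K V W" by (rule tensor_module)

lemma tensor_pair_functional:
  assumes "functional K V f" "functional K W g"
  shows "functional K (tensor K V W) (tensor_pair K f g)"
  unfolding tensor_pair_def functional_def
  by (rule tensor_lift_linear[OF module_scalar_module[OF field_K] bilinear_functionals[OF field_K assms]])

lemma tensor_pair_tens:
  assumes "functional K V f" "functional K W g" "v \<in> carrier V" "w \<in> carrier W"
  shows "tensor_pair K f g (tens K V W v w) = f v \<otimes>\<^bsub>K\<^esub> g w"
  unfolding tensor_pair_def
  by (rule tensor_lift_tens[OF module_scalar_module[OF field_K] bilinear_functionals[OF field_K assms(1,2)] assms(3,4)])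

lemma tensor_pair_tsum:
  assumes "functional K V f" "functional K W g" "set ts \<subseteq> carrier V \<times> carrier W"
  shows "tensor_pair K f g (tsum ts) = lsum K (\<lambda>(v, w). f v \<otimes>\<^bsub>K\<^esub> g w) ts"
  unfolding tensor_pair_def
  using tensor_lift_tsum[OF module_scalar_module[OF field_K] bilinear_functionals[OF field_K assms(1,2)] assms(3)]
  by simp

lemma tsum_append:
  assumes "set ts1 \<subseteq> carrier V \<times> carrier W" "set ts2 \<subseteq> carrier V \<times> carrier W"
  shows "tsum (ts1 @ ts2) = tsum ts1 \<oplus>\<^bsub>tensor K V W\<^esub> tsum ts2"
  using assms bilinear_mapD(3)[OF tens_bilinear] by (intro T.M.lsum_append) auto

text \<open>Write v = n + c v1 with v1 the left factor of the next summand. Then v \<otimes> w + v1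
  \<otimes> w1 = n \<otimes> w + v1 \<otimes> (cw + w1): the dependence on v1 moves into the right
  factor and the number of summands is unchanged.\<close>

lemma tsum_absorb:
  assumes "submodule X K V" "submodule V' K V" "submodule W' K W" "X \<subseteq> V'"
  shows "\<lbrakk>set rest \<subseteq> V' \<times> W'; v \<in> adjoin K V X (map fst rest); w \<in> W'\<rbrakk> \<Longrightarrow>
    \<exists>x\<in>X. \<exists>rest'. set rest' \<subseteq> V' \<times> W' \<and> length rest' = length rest \<and>
      tens K V W v w \<oplus>\<^bsub>tensor K V W\<^esub> tsum rest = tens K V W x w \<oplus>\<^bsub>tensor K V W\<^esub> tsum rest'"
proof (induction rest arbitrary: v)
  case Nil
  then show ?case by (intro bexI[of _ v] exI[of _ "[]"]) auto
next
  case (Cons p rest)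
  note V' = submoduleD[OF mod_V assms(2)] and W' = submoduleD[OF mod_W assms(3)]
  note bD = bilinear_mapD[OF tens_bilinear]
  obtain v1 w1 where p: "p = (v1, w1)" by fastforce
  have vw: "v1 \<in> V'" "w1 \<in> W'" "set rest \<subseteq> V' \<times> W'" using Cons.prems p by auto
  have rV: "set (map fst rest) \<subseteq> V'" using vw(3) by auto
  have aV: "adjoin K V X (map fst rest) \<subseteq> V'"
    by (rule adjoin_least[OF mod_V assms(2,4) rV])
  obtain n c where nc: "v = n \<oplus>\<^bsub>V\<^esub> c \<odot>\<^bsub>V\<^esub> v1" "n \<in> adjoin K V X (map fst rest)" "c \<in> carrier K"
    using Cons.prems(2) p by (auto simp: add_line_def)
  obtain x rest' where IH: "x \<in> X" "set rest' \<subseteq> V' \<times> W'" "length rest' = length rest"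
    "tens K V W n w \<oplus>\<^bsub>tensor K V W\<^esub> tsum rest = tens K V W x w \<oplus>\<^bsub>tensor K V W\<^esub> tsum rest'"
    using Cons.IH[OF vw(3) nc(2) Cons.prems(3)] by blast
  have car: "n \<in> carrier V" "x \<in> carrier V" "v1 \<in> carrier V" "w \<in> carrier W" "w1 \<in> carrier W"
    using nc(2) aV V'(1) W'(1) vw(1,2) IH(1) assms(4) Cons.prems(3) by blast+
  have "set rest \<subseteq> carrier V \<times> carrier W" "set rest' \<subseteq> carrier V \<times> carrier W"
    using vw(3) IH(2) V'(1) W'(1) by blast+
  then have tc: "tsum rest \<in> carrier (tensor K V W)" "tsum rest' \<in> carrier (tensor K V W)"
    by (auto intro: tsum_closed)
  have "tens K V W v w \<oplus>\<^bsub>tensor K V W\<^esub> tsum (p # rest)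
    = (tens K V W n w \<oplus>\<^bsub>tensor K V W\<^esub> tsum rest) \<oplus>\<^bsub>tensor K V W\<^esub> tens K V W v1 (c \<odot>\<^bsub>W\<^esub> w \<oplus>\<^bsub>W\<^esub> w1)"
    using car tc nc(1,3) p by (simp add: bD T.M.a_ac)
  also have "\<dots> = tens K V W x w \<oplus>\<^bsub>tensor K V W\<^esub> tsum ((v1, c \<odot>\<^bsub>W\<^esub> w \<oplus>\<^bsub>W\<^esub> w1) # rest')"
    using car tc nc(1,3) by (simp add: IH(4) bD(3) T.M.a_ac)
  finally show ?case
    using IH(1-3) vw Cons.prems(3) W' nc(3)
    by (intro bexI[OF _ IH(1)] exI[of _ "(v1, c \<odot>\<^bsub>W\<^esub> w \<oplus>\<^bsub>W\<^esub> w1) # rest'"]) auto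
qed

text \<open>In a representation of minimal length modulo \<open>X \<otimes> W' + V' \<otimes> Y\<close>, some pair \<open>f \<in> X\<^sup>\<bottom>\<close>,
  \<open>g \<in> Y\<^sup>\<bottom>\<close> isolates a single summand.\<close>

lemma tensor_separate:
  assumes "submodule X K V" "submodule V' K V" "X \<subseteq> V'"
    "submodule Y K W" "submodule W' K W" "Y \<subseteq> W'"
  shows "\<lbrakk>set ts \<subseteq> V' \<times> W';
     \<And>f g. \<lbrakk>functional K V f; functional K W g; \<forall>x\<in>X. f x = \<zero>\<^bsub>K\<^esub>; \<forall>y\<in>Y. g y = \<zero>\<^bsub>K\<^esub>\<rbrakk>
        \<Longrightarrow> tensor_pair K f g (tsum ts) = \<zero>\<^bsub>K\<^esub>\<rbrakk>
   \<Longrightarrow> \<exists>ts1 ts2. set ts1 \<subseteq> X \<times> W' \<and> set ts2 \<subseteq> V' \<times> Y \<and>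
        tsum ts = tsum ts1 \<oplus>\<^bsub>tensor K V W\<^esub> tsum ts2"
proof (induction "length ts" arbitrary: ts)
  case 0
  then show ?case by (intro exI[of _ "[]"]) auto
next
  case (Suc n)
  note V' = submoduleD[OF mod_V assms(2)] and W' = submoduleD[OF mod_W assms(5)]
  note bD = bilinear_mapD[OF tens_bilinear]
  have VW: "V' \<times> W' \<subseteq> carrier V \<times> carrier W" using V'(1) W'(1) by blast
  have tc: "tsum us \<in> carrier (tensor K V W)" if "set us \<subseteq> V' \<times> W'" for us
    using that VW by (intro tsum_closed) blast
  obtain v w rest where ts: "ts = (v, w) # rest" using Suc.hyps(2) by (cases ts) auto
  have n: "n = length rest" using Suc.hyps(2) ts by simp
  have vw: "v \<in> V'" "w \<in> W'" "set rest \<subseteq> V' \<times> W'" using Suc.prems(1) ts by auto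
  have vwc: "v \<in> carrier V" "w \<in> carrier W" using vw V'(1) W'(1) by auto
  have tsn: "tsum ts = tens K V W v w \<oplus>\<^bsub>tensor K V W\<^esub> tsum rest" using ts by simp
  have rV: "set (map fst rest) \<subseteq> V'" using vw(3) by auto
  then have rc: "set (map fst rest) \<subseteq> carrier V" using V'(1) by blast
  note aX = adjoin[OF mod_V assms(1) rc]
  \<comment> \<open>In A the first summand is rewritten so that its left factor lies in X, in B its
    right factor is already in Y; both leave a shorter list to which the hypothesis still applies.
    In C a functional killing X and the other left factors and one killing Y take the value 1 on the
    tensor, contrary to assumption.\<close>
  consider (A) "v \<in> adjoin K V X (map fst rest)" | (B) "w \<in> Y"
    | (C) "v \<notin> adjoin K V X (map fst rest)" "w \<notin> Y" by blast
  then show ?case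
  proof cases
    case A
    obtain x rest' where r: "x \<in> X" "set rest' \<subseteq> V' \<times> W'" "length rest' = length rest"
      "tens K V W v w \<oplus>\<^bsub>tensor K V W\<^esub> tsum rest = tens K V W x w \<oplus>\<^bsub>tensor K V W\<^esub> tsum rest'"
      using tsum_absorb[OF assms(1,2,5,3) vw(3) A vw(2)] by blast
    have xc: "x \<in> carrier V" using r(1) assms(3) V'(1) by blast
    have "tensor_pair K f g (tsum rest') = \<zero>\<^bsub>K\<^esub>"
      if fg: "functional K V f" "functional K W g" "\<forall>x\<in>X. f x = \<zero>\<^bsub>K\<^esub>" "\<forall>y\<in>Y. g y = \<zero>\<^bsub>K\<^esub>" for f g
    proof -
      note pD = functionalD[OF tensor_pair_functional[OF fg(1,2)]]
      have "tensor_pair K f g (tsum ts) = \<zero>\<^bsub>K\<^esub>" using Suc.prems(2) fg by blast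
      then have "f x \<otimes>\<^bsub>K\<^esub> g w \<oplus>\<^bsub>K\<^esub> tensor_pair K f g (tsum rest') = \<zero>\<^bsub>K\<^esub>"
        unfolding tsn r(4) using xc vwc tc[OF r(2)] by (simp add: pD bD tensor_pair_tens[OF fg(1,2)])
      then show ?thesis using fg(3) r(1) pD(1)[OF tc[OF r(2)]] functionalD(1)[OF fg(2) vwc(2)] by simp
    qed
    then obtain ts1 ts2 where t12: "set ts1 \<subseteq> X \<times> W'" "set ts2 \<subseteq> V' \<times> Y"
      "tsum rest' = tsum ts1 \<oplus>\<^bsub>tensor K V W\<^esub> tsum ts2"
      using Suc.hyps(1)[OF _ r(2)] n r(3) by metis
    have "set ts1 \<subseteq> V' \<times> W'" "set ts2 \<subseteq> V' \<times> W'" using t12 assms(3,6) by blast+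
    then have "tsum ts = tsum ((x, w) # ts1) \<oplus>\<^bsub>tensor K V W\<^esub> tsum ts2"
      unfolding tsn r(4) t12(3) using tc xc vwc by (simp add: bD T.M.a_assoc)
    then show ?thesis using t12 r(1) vw(2) by (intro exI[of _ "(x, w) # ts1"] exI[of _ ts2]) auto
  next
    case B
    have "tensor_pair K f g (tsum rest) = \<zero>\<^bsub>K\<^esub>"
      if fg: "functional K V f" "functional K W g" "\<forall>x\<in>X. f x = \<zero>\<^bsub>K\<^esub>" "\<forall>y\<in>Y. g y = \<zero>\<^bsub>K\<^esub>" for f g
    proof -
      note pD = functionalD[OF tensor_pair_functional[OF fg(1,2)]]
      have "tensor_pair K f g (tsum ts) = \<zero>\<^bsub>K\<^esub>" using Suc.prems(2) fg by blast
      then have "f v \<otimes>\<^bsub>K\<^esub> g w \<oplus>\<^bsub>K\<^esub> tensor_pair K f g (tsum rest) = \<zero>\<^bsub>K\<^esub>"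
        unfolding tsn using vwc tc[OF vw(3)] by (simp add: pD bD tensor_pair_tens[OF fg(1,2)])
      then show ?thesis using fg(4) B pD(1)[OF tc[OF vw(3)]] functionalD(1)[OF fg(1) vwc(1)] by simp
    qed
    then obtain ts1 ts2 where t12: "set ts1 \<subseteq> X \<times> W'" "set ts2 \<subseteq> V' \<times> Y"
      "tsum rest = tsum ts1 \<oplus>\<^bsub>tensor K V W\<^esub> tsum ts2"
      using Suc.hyps(1)[OF n vw(3)] by metis
    have "set ts1 \<subseteq> V' \<times> W'" "set ts2 \<subseteq> V' \<times> W'" using t12 assms(3,6) by blast+
    then have "tsum ts = tsum ts1 \<oplus>\<^bsub>tensor K V W\<^esub> tsum ((v, w) # ts2)"
      unfolding tsn t12(3) using tc vwc by (simp add: bD T.M.a_ac)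
    then show ?thesis using t12 B vw(1) by (intro exI[of _ ts1] exI[of _ "(v, w) # ts2"]) auto
  next
    case C
    obtain f where f: "functional K V f" "\<And>d. d \<in> adjoin K V X (map fst rest) \<Longrightarrow> f d = \<zero>\<^bsub>K\<^esub>" "f v = \<one>\<^bsub>K\<^esub>"
      using exists_functional[OF field_K mod_V aX(1) vwc(1) C(1)] by blast
    obtain g where g: "functional K W g" "\<And>d. d \<in> Y \<Longrightarrow> g d = \<zero>\<^bsub>K\<^esub>" "g w = \<one>\<^bsub>K\<^esub>"
      using exists_functional[OF field_K mod_W assms(4) vwc(2) C(2)] by blast
    have gc: "g b \<in> carrier K" if "(a, b) \<in> set rest" for a b
      using that vw(3) W'(1) functionalD(1)[OF g(1)] by blast
    have fa: "f a = \<zero>\<^bsub>K\<^esub>" if "(a, b) \<in> set rest" for a b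
      using f(2) aX(3) that by (force simp: subset_iff)
    have "set ts \<subseteq> carrier V \<times> carrier W" using Suc.prems(1) VW by blast
    then have "tensor_pair K f g (tsum ts) = lsum K (\<lambda>(v, w). f v \<otimes>\<^bsub>K\<^esub> g w) ts"
      by (rule tensor_pair_tsum[OF f(1) g(1)])
    also have "\<dots> = \<one>\<^bsub>K\<^esub> \<oplus>\<^bsub>K\<^esub> lsum K (\<lambda>(v, w). f v \<otimes>\<^bsub>K\<^esub> g w) rest" using f(3) g(3) ts by simp
    also have "lsum K (\<lambda>(v, w). f v \<otimes>\<^bsub>K\<^esub> g w) rest = \<zero>\<^bsub>K\<^esub>"
      by (rule K.lsum_zero) (use fa gc in auto)
    finally have "tensor_pair K f g (tsum ts) = \<one>\<^bsub>K\<^esub>" by simp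
    moreover have "tensor_pair K f g (tsum ts) = \<zero>\<^bsub>K\<^esub>"
      using Suc.prems(2) f(1,2) g(1,2) aX(2) by blast
    ultimately show ?thesis by simp
  qed
qed

lemma tens_zero:
  "v \<in> carrier V \<Longrightarrow> tens K V W v \<zero>\<^bsub>W\<^esub> = \<zero>\<^bsub>tensor K V W\<^esub>"
  "w \<in> carrier W \<Longrightarrow> tens K V W \<zero>\<^bsub>V\<^esub> w = \<zero>\<^bsub>tensor K V W\<^esub>"
  using linear_map_zero[OF mod_W tensor_module bilinear_mapD(2)[OF tens_bilinear]]
    linear_map_zero[OF mod_V tensor_module bilinear_mapD(1)[OF tens_bilinear]] by auto

text \<open>The separation with X = 0 and Y = 0: every remaining summand has a zero factor.\<close>

lemma tensor_nondegenerate: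
  assumes "T \<in> carrier (tensor K V W)"
    "\<And>f g. \<lbrakk>functional K V f; functional K W g\<rbrakk> \<Longrightarrow> tensor_pair K f g T = \<zero>\<^bsub>K\<^esub>"
  shows "T = \<zero>\<^bsub>tensor K V W\<^esub>"
proof -
  obtain ts where ts: "set ts \<subseteq> carrier V \<times> carrier W" "T = tsum ts" using tsum_exists[OF assms(1)] by blast
  obtain ts1 ts2 where "set ts1 \<subseteq> {\<zero>\<^bsub>V\<^esub>} \<times> carrier W" "set ts2 \<subseteq> carrier V \<times> {\<zero>\<^bsub>W\<^esub>}"
    "tsum ts = tsum ts1 \<oplus>\<^bsub>tensor K V W\<^esub> tsum ts2"
    using tensor_separate[OF zero_submodule[OF mod_V] V.carrier_is_submodule _ zero_submodule[OF mod_W]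
        W.carrier_is_submodule _ ts(1)] assms(2)[unfolded ts(2)] by auto
  moreover have "tsum ts1 = \<zero>\<^bsub>tensor K V W\<^esub>" if "set ts1 \<subseteq> {\<zero>\<^bsub>V\<^esub>} \<times> carrier W" for ts1
    by (rule T.M.lsum_zero) (use that in \<open>auto simp: tens_zero\<close>)
  moreover have "tsum ts2 = \<zero>\<^bsub>tensor K V W\<^esub>" if "set ts2 \<subseteq> carrier V \<times> {\<zero>\<^bsub>W\<^esub>}" for ts2
    by (rule T.M.lsum_zero) (use that in \<open>auto simp: tens_zero\<close>)
  ultimately show ?thesis using ts(2) by simp
qed

lemma tensor_eqI:
  assumes "S \<in> carrier (tensor K V W)" "T \<in> carrier (tensor K V W)"
    "\<And>f g. \<lbrakk>functional K V f; functional K W g\<rbrakk> \<Longrightarrow> tensor_pair K f g S = tensor_pair K f g T"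
  shows "S = T"
proof -
  have "S \<ominus>\<^bsub>tensor K V W\<^esub> T = \<zero>\<^bsub>tensor K V W\<^esub>"
  proof (rule tensor_nondegenerate)
    fix f g assume fg: "functional K V f" "functional K W g"
    have "tensor_pair K f g (S \<ominus>\<^bsub>tensor K V W\<^esub> T) = tensor_pair K f g S \<ominus>\<^bsub>K\<^esub> tensor_pair K f g T"
      by (rule functional_minus[OF field_K tensor_module tensor_pair_functional[OF fg] assms(1,2)])
    then show "tensor_pair K f g (S \<ominus>\<^bsub>tensor K V W\<^esub> T) = \<zero>\<^bsub>K\<^esub>"
      using assms(3)[OF fg] functionalD(1)[OF tensor_pair_functional[OF fg] assms(2)] by simp
  qed (use assms in auto)
  then show ?thesis using module_minus_simps(3)[OF tensor_module assms(1,2)] assms(2) by simp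
qed

end

lemma tensor_factorsI: "\<lbrakk>field K; module K V; module K W\<rbrakk> \<Longrightarrow> tensor_factors K V W"
  by (simp add: tensor_factors_def)

text \<open>The list sums form a subspace, scalars being absorbed into the first factor; it contains
  the generators and lies in their span.\<close>

lemma tensor_sub_iff:
  assumes "field K" "module K V" "submodule X K V" "submodule Y K V"
  shows "T \<in> tensor_sub K V X Y \<longleftrightarrow>
    (\<exists>ts. set ts \<subseteq> X \<times> Y \<and> T = lsum (tensor K V V) (\<lambda>(v, w). tens K V V v w) ts)"
proof -
  interpret tensor_factors K V V using assms by (intro tensor_factorsI)
  interpret K: field K by fact
  interpret V: module K V by fact
  interpret T: module K "tensor K V V" by (rule tensor_module)
  note X = submoduleD[OF assms(2,3)] and Y = submoduleD[OF assms(2,4)]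
  note bD = bilinear_mapD[OF tens_bilinear]
  let ?G = "{tens K V V x y |x y. x \<in> X \<and> y \<in> Y}"
  let ?D = "{tsum ts |ts. set ts \<subseteq> X \<times> Y}"
  have XY: "X \<times> Y \<subseteq> carrier V \<times> carrier V" using X(1) Y(1) by blast
  have G: "?G \<subseteq> carrier (tensor K V V)" using X(1) Y(1) bD(3) by blast
  note sp = span_of_submodule[OF tensor_module G]
  have "submodule ?D K (tensor K V V)"
  proof (rule submoduleI'[OF tensor_module])
    show "?D \<subseteq> carrier (tensor K V V)" using tsum_closed XY by blast
    show "\<zero>\<^bsub>tensor K V V\<^esub> \<in> ?D" by (auto intro!: exI[of _ "[]"])
    fix S T assume "S \<in> ?D" "T \<in> ?D"
    then obtain ss ts where *: "S = tsum ss" "set ss \<subseteq> X \<times> Y" "T = tsum ts" "set ts \<subseteq> X \<times> Y" by blast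
    then have "S \<oplus>\<^bsub>tensor K V V\<^esub> T = tsum (ss @ ts)" using XY by (subst tsum_append) auto
    moreover have "set (ss @ ts) \<subseteq> X \<times> Y" using * by auto
    ultimately show "S \<oplus>\<^bsub>tensor K V V\<^esub> T \<in> ?D" by blast
  next
    fix a T assume a: "a \<in> carrier K" and "T \<in> ?D"
    then obtain ts where ts: "T = tsum ts" "set ts \<subseteq> X \<times> Y" by blast
    have lin: "linear_map K (tensor K V V) (tensor K V V) (\<lambda>T. a \<odot>\<^bsub>tensor K V V\<^esub> T)"
      using a by (intro linear_mapI)
        (auto simp: T.smult_r_distr T.smult_assoc1[symmetric] K.m_comm)
    have "a \<odot>\<^bsub>tensor K V V\<^esub> T = lsum (tensor K V V) (\<lambda>p. a \<odot>\<^bsub>tensor K V V\<^esub> (case p of (v, w) \<Rightarrow> tens K V V v w)) ts"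
      unfolding ts(1) using ts(2) XY bD(3) by (intro lsum_linear[OF tensor_module tensor_module lin]) auto
    also have "\<dots> = tsum (map (\<lambda>(v, w). (a \<odot>\<^bsub>V\<^esub> v, w)) ts)"
      unfolding lsum_map
    proof (rule lsum_cong)
      fix p assume "p \<in> set ts"
      then obtain x y where "p = (x, y)" "x \<in> carrier V" "y \<in> carrier V" using ts(2) XY by blast
      then show "a \<odot>\<^bsub>tensor K V V\<^esub> (case p of (v, w) \<Rightarrow> tens K V V v w) =
        (case case p of (v, w) \<Rightarrow> (a \<odot>\<^bsub>V\<^esub> v, w) of (v, w) \<Rightarrow> tens K V V v w)"
        using bD(6)[OF a] by simp
    qed
    finally have "a \<odot>\<^bsub>tensor K V V\<^esub> T = tsum (map (\<lambda>(v, w). (a \<odot>\<^bsub>V\<^esub> v, w)) ts)" .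
    moreover have "set (map (\<lambda>(v, w). (a \<odot>\<^bsub>V\<^esub> v, w)) ts) \<subseteq> X \<times> Y" using ts(2) a X(6) by auto
    ultimately show "a \<odot>\<^bsub>tensor K V V\<^esub> T \<in> ?D" by blast
  qed
  moreover have "?G \<subseteq> ?D"
  proof
    fix T assume "T \<in> ?G"
    then obtain x y where xy: "T = tens K V V x y" "x \<in> X" "y \<in> Y" by blast
    have "tens K V V x y \<in> carrier (tensor K V V)" using xy X(1) Y(1) bD(3) by blast
    then have "T = tsum [(x, y)]" using xy by simp
    then show "T \<in> ?D" using xy by fastforce
  qed
  ultimately have "tensor_sub K V X Y \<subseteq> ?D" unfolding tensor_sub_def by (rule sp(3))
  moreover have "?D \<subseteq> tensor_sub K V X Y"
    unfolding tensor_sub_def using sp(2) by (auto intro!: lsum_submodule[OF tensor_module sp(1)])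
  ultimately show ?thesis by blast
qed

text \<open>Evaluation kills both summands in one direction; the converse is
  \<open>tensor_separate\<close> with all of V as the ambient space on both sides. For T =
  \<Delta>(h) the right side says that convolution products vanish at h.\<close>

lemma wedge_iff:
  assumes "field K" "module K V" "submodule X K V" "submodule Y K V" "T \<in> carrier (tensor K V V)"
  shows "T \<in> tensor_sub K V (carrier V) Y <+>\<^bsub>tensor K V V\<^esub> tensor_sub K V X (carrier V) \<longleftrightarrow>
    (\<forall>f g. functional K V f \<longrightarrow> functional K V g \<longrightarrow> (\<forall>x\<in>X. f x = \<zero>\<^bsub>K\<^esub>) \<longrightarrow> (\<forall>y\<in>Y. g y = \<zero>\<^bsub>K\<^esub>)
      \<longrightarrow> tensor_pair K f g T = \<zero>\<^bsub>K\<^esub>)"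
    (is "_ \<longleftrightarrow> ?R")
proof -
  interpret tensor_factors K V V using assms by (intro tensor_factorsI)
  interpret K: field K by fact
  interpret V: module K V by fact
  interpret T: module K "tensor K V V" by (rule tensor_module)
  note X = submoduleD[OF assms(2,3)] and Y = submoduleD[OF assms(2,4)]
  note iff = tensor_sub_iff[OF assms(1,2)]
  note cs = V.carrier_is_submodule
  show ?thesis
  proof
    assume "T \<in> tensor_sub K V (carrier V) Y <+>\<^bsub>tensor K V V\<^esub> tensor_sub K V X (carrier V)"
    then obtain A B where AB: "T = A \<oplus>\<^bsub>tensor K V V\<^esub> B" "A \<in> tensor_sub K V (carrier V) Y"
      "B \<in> tensor_sub K V X (carrier V)" unfolding set_add_def' by blast
    then obtain ts us where tu: "set ts \<subseteq> carrier V \<times> Y" "A = tsum ts" "set us \<subseteq> X \<times> carrier V" "B = tsum us"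
      unfolding iff[OF cs assms(4)] iff[OF assms(3) cs] by blast
    have sub: "set ts \<subseteq> carrier V \<times> carrier V" "set us \<subseteq> carrier V \<times> carrier V"
      using tu X(1) Y(1) by blast+
    show ?R
    proof (intro allI impI)
      fix f g assume fg: "functional K V f" "functional K V g" and
        z: "\<forall>x\<in>X. f x = \<zero>\<^bsub>K\<^esub>" "\<forall>y\<in>Y. g y = \<zero>\<^bsub>K\<^esub>"
      have "tensor_pair K f g T = tensor_pair K f g (tsum ts) \<oplus>\<^bsub>K\<^esub> tensor_pair K f g (tsum us)"
        unfolding AB(1) tu(2,4)
        by (rule functionalD(2)[OF tensor_pair_functional[OF fg]]) (use sub tsum_closed in auto)
      also have "tensor_pair K f g (tsum ts) = \<zero>\<^bsub>K\<^esub>"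
        unfolding tensor_pair_tsum[OF fg sub(1)]
        by (rule K.lsum_zero) (use tu(1) z(2) functionalD(1)[OF fg(1)] in auto)
      also have "tensor_pair K f g (tsum us) = \<zero>\<^bsub>K\<^esub>"
        unfolding tensor_pair_tsum[OF fg sub(2)]
        by (rule K.lsum_zero) (use tu(3) z(1) functionalD(1)[OF fg(2)] in auto)
      finally show "tensor_pair K f g T = \<zero>\<^bsub>K\<^esub>" by simp
    qed
  next
    assume R: ?R
    obtain ts where ts: "set ts \<subseteq> carrier V \<times> carrier V" "T = tsum ts" using tsum_exists[OF assms(5)] by blast
    obtain ts1 ts2 where t12: "set ts1 \<subseteq> X \<times> carrier V" "set ts2 \<subseteq> carrier V \<times> Y"
      "tsum ts = tsum ts1 \<oplus>\<^bsub>tensor K V V\<^esub> tsum ts2"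
      using tensor_separate[OF assms(3) cs _ assms(4) cs _ ts(1)] R[unfolded ts(2)] X(1) Y(1) by blast
    have "set ts1 \<subseteq> carrier V \<times> carrier V" "set ts2 \<subseteq> carrier V \<times> carrier V"
      using t12 X(1) Y(1) by blast+
    then have "T = tsum ts2 \<oplus>\<^bsub>tensor K V V\<^esub> tsum ts1"
      using ts(2) t12(3) tsum_closed by (simp add: T.M.a_comm)
    moreover have "tsum ts2 \<in> tensor_sub K V (carrier V) Y" "tsum ts1 \<in> tensor_sub K V X (carrier V)"
      using t12 iff[OF cs assms(4)] iff[OF assms(3) cs] by blast+
    ultimately show "T \<in> tensor_sub K V (carrier V) Y <+>\<^bsub>tensor K V V\<^esub> tensor_sub K V X (carrier V)"
      unfolding set_add_def' by blast
  qed
qed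

text \<open>Membership in a subspace is reduced to testing functionals in this form; a vector
  outside X is detected by \<open>exists_functional\<close>.\<close>

lemma perp_perp:
  assumes "field K" "module K V" "submodule X K V" "x \<in> carrier V"
    "\<And>f. \<lbrakk>functional K V f; \<forall>y\<in>X. f y = \<zero>\<^bsub>K\<^esub>\<rbrakk> \<Longrightarrow> f x = \<zero>\<^bsub>K\<^esub>"
  shows "x \<in> X"
proof (rule ccontr)
  assume "x \<notin> X"
  then obtain f where "functional K V f" "\<And>d. d \<in> X \<Longrightarrow> f d = \<zero>\<^bsub>K\<^esub>" "f x = \<one>\<^bsub>K\<^esub>"
    using exists_functional[OF assms(1-4)] by blast
  moreover have "\<one>\<^bsub>K\<^esub> \<noteq> \<zero>\<^bsub>K\<^esub>" using assms(1) by (simp add: domain.one_not_zero field.axioms(1))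
  ultimately show False using assms(5) by metis
qed

section \<open>Sweedler sums and the convolution product\<close>

lemma linear_map_id: "linear_map K V V (\<lambda>x. x)"
  by (simp add: linear_map_def)

lemma linear_map_cong:
  assumes "linear_map K V W f" "\<And>x. x \<in> carrier V \<Longrightarrow> f x = g x" "module K V"
  shows "linear_map K V W g"
proof -
  interpret V: module K V by fact
  show ?thesis using linear_mapD[OF assms(1)] by (intro linear_mapI) (simp_all add: assms(2)[symmetric])
qed

lemma linear_map_bilinear1:
  assumes "bilinear_map K V W Z b" "linear_map K U V f" "w \<in> carrier W"
  shows "linear_map K U Z (\<lambda>x. b (f x) w)"
  using linear_map_comp[OF assms(2) bilinear_mapD(1)[OF assms(1,3)]] .

lemma linear_map_bilinear2:
  assumes "bilinear_map K V W Z b" "linear_map K U W f" "v \<in> carrier V"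
  shows "linear_map K U Z (\<lambda>x. b v (f x))"
  using linear_map_comp[OF assms(2) bilinear_mapD(2)[OF assms(1,3)]] .

lemma lsum_linear_map:
  assumes "module K V" "module K Z" "\<And>x. x \<in> set xs \<Longrightarrow> linear_map K V Z (\<lambda>v. f v x)"
  shows "linear_map K V Z (\<lambda>v. lsum Z (f v) xs)"
proof -
  interpret Z: module K Z by fact
  note fD = linear_mapD[OF assms(3)]
  show ?thesis using fD
  proof (induction xs)
    case Nil
    show ?case by (rule linear_mapI) auto
  next
    case (Cons x xs)
    then have IH: "linear_map K V Z (\<lambda>v. lsum Z (f v) xs)" by simp
    note ID = linear_mapD[OF IH]
    show ?case using Cons.prems ID
      by (intro linear_mapI) (auto simp: Z.M.a_ac Z.smult_r_distr)
  qed
qed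

context tensor_factors
begin

text \<open>Nested Sweedler sums have an inner sum that depends on an outer variable. Linearity in
  this parameter is what makes the inner sum an admissible bilinear integrand.\<close>

lemma tensor_lift_param:
  assumes "module K Z" "module K U" "\<And>x. x \<in> carrier U \<Longrightarrow> bilinear_map K V W Z (b x)"
    "\<And>v w. \<lbrakk>v \<in> carrier V; w \<in> carrier W\<rbrakk> \<Longrightarrow> linear_map K U Z (\<lambda>x. b x v w)"
    "T \<in> carrier (tensor K V W)"
  shows "linear_map K U Z (\<lambda>x. tensor_lift K Z (b x) T)"
proof -
  obtain ts where ts: "set ts \<subseteq> carrier V \<times> carrier W" "T = tsum ts" using tsum_exists[OF assms(5)] by blast
  have "linear_map K U Z (\<lambda>x. lsum Z (\<lambda>(v, w). b x v w) ts)"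
    by (rule lsum_linear_map[OF assms(2,1)]) (use ts(1) assms(4) in auto)
  then show ?thesis
    by (rule linear_map_cong[OF _ _ assms(2)]) (simp add: ts(2) tensor_lift_tsum[OF assms(1,3) ts(1)])
qed

end

text \<open>Sweedler notation: the sum of b(h_1, h_2). The target Z is left open because such sums
  take values in H, in H \<otimes> H and in K.\<close>

definition sweedler ::
  "('k,'n) ring_scheme \<Rightarrow> ('k,'h,'m) hopf_alg_scheme \<Rightarrow> ('k,'z,'c) module_scheme \<Rightarrow> ('h \<Rightarrow> 'h \<Rightarrow> 'z) \<Rightarrow> 'h \<Rightarrow> 'z" where
  "sweedler K C Z b h = tensor_lift K Z b (comult C h)"

definition conv ::
  "('k,'n) ring_scheme \<Rightarrow> ('k,'h,'m) hopf_alg_scheme \<Rightarrow> ('h \<Rightarrow> 'k) \<Rightarrow> ('h \<Rightarrow> 'k) \<Rightarrow> 'h \<Rightarrow> 'k" where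
  "conv K C u v h = tensor_pair K u v (comult C h)"

text \<open>The two actions of the dual algebra on \<open>C\<close>: \<open>hit u h = \<Sum> h\<^sub>1 u(h\<^sub>2)\<close> and
  \<open>hit_right h u = \<Sum> u(h\<^sub>1) h\<^sub>2\<close>.\<close>

definition hit :: "('k,'n) ring_scheme \<Rightarrow> ('k,'h,'m) hopf_alg_scheme \<Rightarrow> ('h \<Rightarrow> 'k) \<Rightarrow> 'h \<Rightarrow> 'h" where
  "hit K C u h = sweedler K C C (\<lambda>a b. u b \<odot>\<^bsub>C\<^esub> a) h"

definition hit_right :: "('k,'n) ring_scheme \<Rightarrow> ('k,'h,'m) hopf_alg_scheme \<Rightarrow> 'h \<Rightarrow> ('h \<Rightarrow> 'k) \<Rightarrow> 'h" where
  "hit_right K C h u = sweedler K C C (\<lambda>a b. u a \<odot>\<^bsub>C\<^esub> b) h"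

context coalgebra
begin

lemma field_K: "field K" by (rule K.field_axioms)
lemma mod_C: "module K C" by (rule module_axioms)
lemma mod_K: "module K (scalar_module K)" by (rule module_scalar_module[OF field_K])

sublocale CC: tensor_factors K C C
  by (rule tensor_factorsI[OF field_K mod_C mod_C])

abbreviation "CC \<equiv> tensor K C C"
abbreviation "sw \<equiv> sweedler K C"
abbreviation "eps \<equiv> counit C"
abbreviation "fnl \<equiv> functional K C"
abbreviation zero_K ("0\<^sub>K") where "0\<^sub>K \<equiv> \<zero>\<^bsub>K\<^esub>"
abbreviation one_K ("1\<^sub>K") where "1\<^sub>K \<equiv> \<one>\<^bsub>K\<^esub>"
abbreviation add_K (infixl "+\<^sub>K" 65) where "a +\<^sub>K b \<equiv> a \<oplus>\<^bsub>K\<^esub> b"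
abbreviation mult_K (infixl "*\<^sub>K" 70) where "a *\<^sub>K b \<equiv> a \<otimes>\<^bsub>K\<^esub> b"

lemma comult_closed: "h \<in> carrier C \<Longrightarrow> comult C h \<in> carrier CC"
  using linear_mapD(1)[OF comult_linear] .

lemma eps_fnl: "fnl eps"
  unfolding functional_def by (rule counit_linear)

lemma comult_rep:
  assumes "h \<in> carrier C"
  obtains ts where "set ts \<subseteq> carrier C \<times> carrier C" "comult C h = CC.tsum ts"
  using CC.tsum_exists[OF comult_closed[OF assms]] by blast

lemma sw_lsum:
  assumes "module K Z" "bilinear_map K C C Z b" "set ts \<subseteq> carrier C \<times> carrier C" "comult C h = CC.tsum ts"
  shows "sw Z b h = lsum Z (\<lambda>(x, y). b x y) ts"
  unfolding sweedler_def assms(4) by (rule CC.tensor_lift_tsum[OF assms(1-3)])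

lemma sw_linear:
  assumes "module K Z" "bilinear_map K C C Z b"
  shows "linear_map K C Z (sw Z b)"
  unfolding sweedler_def by (rule linear_map_comp[OF comult_linear CC.tensor_lift_linear[OF assms]])

lemma sw_param:
  assumes "module K Z" "module K U" "\<And>x. x \<in> carrier U \<Longrightarrow> bilinear_map K C C Z (b x)"
    "\<And>v w. \<lbrakk>v \<in> carrier C; w \<in> carrier C\<rbrakk> \<Longrightarrow> linear_map K U Z (\<lambda>x. b x v w)"
    "h \<in> carrier C"
  shows "linear_map K U Z (\<lambda>x. sw Z (b x) h)"
  unfolding sweedler_def by (rule CC.tensor_lift_param[OF assms(1-4) comult_closed[OF assms(5)]])

text \<open>Integrands are compared on the carrier only, because the algebra laws say nothing
  outside it. Bilinearity is demanded of one integrand and transported to the other.\<close>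

lemma sw_cong:
  assumes "module K Z" "bilinear_map K C C Z b" "h \<in> carrier C"
    "\<And>x y. \<lbrakk>x \<in> carrier C; y \<in> carrier C\<rbrakk> \<Longrightarrow> b x y = b' x y"
  shows "sw Z b h = sw Z b' h"
proof -
  obtain ts where ts: "set ts \<subseteq> carrier C \<times> carrier C" "comult C h = CC.tsum ts"
    by (rule comult_rep[OF assms(3)])
  have b': "bilinear_map K C C Z b'"
  proof (rule bilinear_mapI)
    fix y assume y: "y \<in> carrier C"
    show "linear_map K C Z (\<lambda>x. b' x y)"
      by (rule linear_map_cong[OF bilinear_mapD(1)[OF assms(2) y] _ mod_C]) (rule assms(4)[OF _ y])
    show "linear_map K C Z (b' y)"
      by (rule linear_map_cong[OF bilinear_mapD(2)[OF assms(2) y] _ mod_C]) (rule assms(4)[OF y])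
  qed
  show ?thesis unfolding sw_lsum[OF assms(1,2) ts] sw_lsum[OF assms(1) b' ts]
    by (rule lsum_cong) (use ts(1) assms(4) in \<open>auto simp only: subset_iff split: prod.split\<close>)
qed

lemma sw_map:
  assumes "module K Z" "module K Y" "linear_map K Z Y f" "bilinear_map K C C Z b" "h \<in> carrier C"
  shows "f (sw Z b h) = sw Y (\<lambda>x y. f (b x y)) h"
proof -
  obtain ts where ts: "set ts \<subseteq> carrier C \<times> carrier C" "comult C h = CC.tsum ts"
    by (rule comult_rep[OF assms(5)])
  have b': "bilinear_map K C C Y (\<lambda>x y. f (b x y))"
    using assms(3,4) unfolding bilinear_map_def by (auto intro: linear_map_comp)
  have "f (lsum Z (\<lambda>(x, y). b x y) ts) = lsum Y (\<lambda>p. f (case p of (x, y) \<Rightarrow> b x y)) ts"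
    by (rule lsum_linear[OF assms(1-3)]) (use ts(1) bilinear_mapD(3)[OF assms(4)] in auto)
  also have "\<dots> = lsum Y (\<lambda>(x, y). f (b x y)) ts" by (rule lsum_cong) auto
  finally show ?thesis
    by (simp add: sw_lsum[OF assms(1,4) ts] sw_lsum[OF assms(2) b' ts])
qed

text \<open>With \<Delta>(x) and \<Delta>(y) written as lists, both sides are the same finite double
  sum.\<close>

lemma sw_swap:
  assumes "module K Z" "x \<in> carrier C" "y \<in> carrier C"
    "\<And>c d. \<lbrakk>c \<in> carrier C; d \<in> carrier C\<rbrakk> \<Longrightarrow> bilinear_map K C C Z (\<lambda>a b. q a b c d)"
    "\<And>a b. \<lbrakk>a \<in> carrier C; b \<in> carrier C\<rbrakk> \<Longrightarrow> bilinear_map K C C Z (\<lambda>c d. q a b c d)"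
  shows "sw Z (\<lambda>a b. sw Z (\<lambda>c d. q a b c d) y) x = sw Z (\<lambda>c d. sw Z (\<lambda>a b. q a b c d) x) y"
proof -
  interpret Z: module K Z by fact
  obtain ts where ts: "set ts \<subseteq> carrier C \<times> carrier C" "comult C x = CC.tsum ts"
    by (rule comult_rep[OF assms(2)])
  obtain us where us: "set us \<subseteq> carrier C \<times> carrier C" "comult C y = CC.tsum us"
    by (rule comult_rep[OF assms(3)])
  have 1: "bilinear_map K C C Z (\<lambda>a b. sw Z (\<lambda>c d. q a b c d) y)"
    by (intro bilinear_mapI sw_param[OF assms(1) mod_C] assms(3,5)
        bilinear_mapD(1)[OF assms(4)] bilinear_mapD(2)[OF assms(4)])
  have 2: "bilinear_map K C C Z (\<lambda>c d. sw Z (\<lambda>a b. q a b c d) x)"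
    by (intro bilinear_mapI sw_param[OF assms(1) mod_C] assms(2,4)
        bilinear_mapD(1)[OF assms(5)] bilinear_mapD(2)[OF assms(5)])
  have "sw Z (\<lambda>a b. sw Z (\<lambda>c d. q a b c d) y) x
      = lsum Z (\<lambda>p. lsum Z (\<lambda>r. q (fst p) (snd p) (fst r) (snd r)) us) ts"
    unfolding sw_lsum[OF assms(1) 1 ts]
    by (rule lsum_cong) (use ts us assms(1,5) in \<open>auto simp: sw_lsum split_def\<close>)
  also have "\<dots> = lsum Z (\<lambda>r. lsum Z (\<lambda>p. q (fst p) (snd p) (fst r) (snd r)) ts) us"
    by (rule Z.M.lsum_swap) (use ts us bilinear_mapD(3)[OF assms(4)] in \<open>auto simp: subset_iff\<close>)
  also have "\<dots> = sw Z (\<lambda>c d. sw Z (\<lambda>a b. q a b c d) x) y"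
    unfolding sw_lsum[OF assms(1) 2 us]
    by (rule lsum_cong) (use ts us assms(1,4) in \<open>auto simp: sw_lsum split_def\<close>)
  finally show ?thesis .
qed

section \<open>Coassociativity and counit in Sweedler form\<close>

definition trilinear :: "('k,'z,'c) module_scheme \<Rightarrow> ('h \<Rightarrow> 'h \<Rightarrow> 'h \<Rightarrow> 'z) \<Rightarrow> bool" where
  "trilinear Z t \<longleftrightarrow>
     (\<forall>y\<in>carrier C. \<forall>z\<in>carrier C. linear_map K C Z (\<lambda>x. t x y z)) \<and>
     (\<forall>x\<in>carrier C. \<forall>z\<in>carrier C. linear_map K C Z (\<lambda>y. t x y z)) \<and>
     (\<forall>x\<in>carrier C. \<forall>y\<in>carrier C. linear_map K C Z (\<lambda>z. t x y z))"

lemma trilinearI: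
  assumes "\<And>y z. \<lbrakk>y \<in> carrier C; z \<in> carrier C\<rbrakk> \<Longrightarrow> linear_map K C Z (\<lambda>x. t x y z)"
    "\<And>x z. \<lbrakk>x \<in> carrier C; z \<in> carrier C\<rbrakk> \<Longrightarrow> linear_map K C Z (\<lambda>y. t x y z)"
    "\<And>x y. \<lbrakk>x \<in> carrier C; y \<in> carrier C\<rbrakk> \<Longrightarrow> linear_map K C Z (\<lambda>z. t x y z)"
  shows "trilinear Z t"
  using assms by (auto simp: trilinear_def)

lemma trilinear_bilinear:
  assumes "trilinear Z t"
  shows "z \<in> carrier C \<Longrightarrow> bilinear_map K C C Z (\<lambda>x y. t x y z)"
    "y \<in> carrier C \<Longrightarrow> bilinear_map K C C Z (\<lambda>x z. t x y z)"
    "x \<in> carrier C \<Longrightarrow> bilinear_map K C C Z (\<lambda>y z. t x y z)"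
  using assms by (auto simp: trilinear_def bilinear_map_def)

lemma trilinear_sw:
  assumes "module K Z" "trilinear Z t"
  shows "bilinear_map K C C Z (\<lambda>a b. sw Z (\<lambda>c d. t c d b) a)"
    "bilinear_map K C C Z (\<lambda>a b. sw Z (\<lambda>c d. t a c d) b)"
proof -
  note tb = trilinear_bilinear[OF assms(2)]
  show "bilinear_map K C C Z (\<lambda>a b. sw Z (\<lambda>c d. t c d b) a)"
    using assms(2) by (intro bilinear_mapI sw_linear sw_param[OF assms(1) mod_C] assms(1) tb)
      (auto simp: trilinear_def)
  show "bilinear_map K C C Z (\<lambda>a b. sw Z (\<lambda>c d. t a c d) b)"
    using assms(2) by (intro bilinear_mapI sw_linear sw_param[OF assms(1) mod_C] assms(1) tb)
      (auto simp: trilinear_def)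
qed

text \<open>A trilinear t lifts to a linear map \<open>?Th\<close> on C \<otimes> (C \<otimes> C).
  Applying it to the two sides of the coassociativity axiom turns them into the two nested sums, the
  re-bracketing being undone on pure tensors.\<close>

lemma sw_coassoc:
  assumes Z: "module K Z" and t: "trilinear Z t" and h: "h \<in> carrier C"
  shows "sw Z (\<lambda>a b. sw Z (\<lambda>c d. t c d b) a) h = sw Z (\<lambda>a b. sw Z (\<lambda>c d. t a c d) b) h"
proof -
  have mCC: "module K CC" by (rule CC.tensor_module)
  interpret L: tensor_factors K CC C by (rule tensor_factorsI[OF field_K mCC mod_C])
  interpret R: tensor_factors K C CC by (rule tensor_factorsI[OF field_K mod_C mCC])
  let ?Z = "tensor K C CC" let ?Y = "tensor K CC C"
  note mY = L.tensor_module and mZ = R.tensor_module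
  note tb = trilinear_bilinear[OF t]
  obtain ts where ts: "set ts \<subseteq> carrier C \<times> carrier C" "comult C h = CC.tsum ts"
    by (rule comult_rep[OF h])
  let ?th = "\<lambda>a X. tensor_lift K Z (t a) X"
  have th: "bilinear_map K C CC Z ?th"
    using t by (intro bilinear_mapI CC.tensor_lift_linear[OF Z] CC.tensor_lift_param[OF Z mod_C] tb)
      (auto simp: trilinear_def)
  let ?Th = "tensor_lift K Z ?th"
  have Th: "linear_map K ?Z Z ?Th" by (rule R.tensor_lift_linear[OF Z th])
  have Th_tens: "?Th (tens K C CC u (tens K C C v w)) = t u v w"
    if "u \<in> carrier C" "v \<in> carrier C" "w \<in> carrier C" for u v w
    using that tb(3)[of u] bilinear_mapD(3)[OF CC.tens_bilinear, of v w]
    by (simp add: R.tensor_lift_tens[OF Z th] CC.tensor_lift_tens[OF Z])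
  let ?m = "\<lambda>x y. tens K CC C (comult C x) y"
  have m: "bilinear_map K C C ?Y ?m"
    by (intro bilinear_mapI linear_map_bilinear1[OF L.tens_bilinear comult_linear]
        bilinear_mapD(2)[OF L.tens_bilinear] comult_closed)
  let ?as = "\<lambda>w u v. tens K C CC u (tens K C C v w)"
  have asb: "bilinear_map K C C ?Z (?as w)" if "w \<in> carrier C" for w
    using that by (intro bilinear_mapI bilinear_mapD(1)[OF R.tens_bilinear] bilinear_mapD(3)[OF CC.tens_bilinear]
        linear_map_bilinear2[OF R.tens_bilinear] bilinear_mapD(1)[OF CC.tens_bilinear])
  have asw: "linear_map K C ?Z (\<lambda>w. ?as w u v)" if "u \<in> carrier C" "v \<in> carrier C" for u v
    using that by (intro linear_map_bilinear2[OF R.tens_bilinear] bilinear_mapD(2)[OF CC.tens_bilinear])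
  let ?ass = "\<lambda>X w. tensor_lift K ?Z (?as w) X"
  have ass: "bilinear_map K CC C ?Z ?ass"
    by (intro bilinear_mapI CC.tensor_lift_linear[OF mZ] asb CC.tensor_lift_param[OF mZ mod_C] asw)
  have "?Th (tensor_assoc K C C C (tensor_map K CC C (comult C) (\<lambda>x. x) (comult C h)))
    = lsum Z (\<lambda>(a, b). sw Z (\<lambda>c d. t c d b) a) ts"
  proof -
    have 1: "tensor_map K CC C (comult C) (\<lambda>x. x) (comult C h) = lsum ?Y (\<lambda>(x, y). ?m x y) ts"
      unfolding tensor_map_def ts(2) by (rule CC.tensor_lift_tsum[OF mY m ts(1)])
    have "tensor_assoc K C C C (lsum ?Y (\<lambda>(x, y). ?m x y) ts)
      = tensor_lift K ?Z ?ass (lsum ?Y (\<lambda>(x, y). ?m x y) ts)"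
      by (simp add: tensor_assoc_def Let_def)
    also have "\<dots> = lsum ?Z (\<lambda>p. tensor_lift K ?Z ?ass (case p of (x, y) \<Rightarrow> ?m x y)) ts"
      by (rule lsum_linear[OF mY mZ L.tensor_lift_linear[OF mZ ass]])
         (use ts(1) bilinear_mapD(3)[OF m] in auto)
    finally have 2: "tensor_assoc K C C C (lsum ?Y (\<lambda>(x, y). ?m x y) ts)
      = lsum ?Z (\<lambda>p. tensor_lift K ?Z ?ass (case p of (x, y) \<Rightarrow> ?m x y)) ts" .
    have lin: "linear_map K ?Y ?Z (tensor_lift K ?Z ?ass)" by (rule L.tensor_lift_linear[OF mZ ass])
    have "?Th (lsum ?Z (\<lambda>p. tensor_lift K ?Z ?ass (case p of (x, y) \<Rightarrow> ?m x y)) ts)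
      = lsum Z (\<lambda>p. ?Th (tensor_lift K ?Z ?ass (case p of (x, y) \<Rightarrow> ?m x y))) ts"
      by (rule lsum_linear[OF mZ Z Th])
         (use ts(1) bilinear_mapD(3)[OF m] linear_mapD(1)[OF lin] in auto)
    also have "\<dots> = lsum Z (\<lambda>(a, b). sw Z (\<lambda>c d. t c d b) a) ts"
    proof (rule lsum_cong)
      fix p assume "p \<in> set ts"
      then obtain a b where p: "p = (a, b)" "a \<in> carrier C" "b \<in> carrier C" using ts(1) by blast
      have "tensor_lift K ?Z ?ass (?m a b) = sw ?Z (?as b) a"
        using p by (simp add: L.tensor_lift_tens[OF mZ ass] comult_closed sweedler_def)
      then have "?Th (tensor_lift K ?Z ?ass (?m a b)) = sw Z (\<lambda>x y. ?Th (?as b x y)) a"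
        using sw_map[OF mZ Z Th asb p(2)] p(3) by simp
      also have "\<dots> = sw Z (\<lambda>c d. t c d b) a"
      proof (rule sw_cong[OF Z _ p(2)])
        show "bilinear_map K C C Z (\<lambda>x y. ?Th (?as b x y))"
          using asb[OF p(3)] Th unfolding bilinear_map_def by (auto intro: linear_map_comp)
      qed (simp add: Th_tens p(3))
      finally show "?Th (tensor_lift K ?Z ?ass (case p of (x, y) \<Rightarrow> ?m x y))
        = (case p of (a, b) \<Rightarrow> sw Z (\<lambda>c d. t c d b) a)" using p by simp
    qed
    finally show ?thesis by (simp only: 1 2)
  qed
  moreover have "?Th (tensor_map K C CC (\<lambda>x. x) (comult C) (comult C h))
    = lsum Z (\<lambda>(a, b). sw Z (\<lambda>c d. t a c d) b) ts"
  proof -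
    let ?n = "\<lambda>x y. tens K C CC x (comult C y)"
    have n: "bilinear_map K C C ?Z ?n"
      by (intro bilinear_mapI linear_map_bilinear2[OF R.tens_bilinear comult_linear]
          bilinear_mapD(1)[OF R.tens_bilinear] comult_closed)
    have 1: "tensor_map K C CC (\<lambda>x. x) (comult C) (comult C h) = lsum ?Z (\<lambda>(x, y). ?n x y) ts"
      unfolding tensor_map_def ts(2) by (rule CC.tensor_lift_tsum[OF mZ n ts(1)])
    have "?Th (lsum ?Z (\<lambda>(x, y). ?n x y) ts) = lsum Z (\<lambda>p. ?Th (case p of (x, y) \<Rightarrow> ?n x y)) ts"
      by (rule lsum_linear[OF mZ Z Th]) (use ts(1) bilinear_mapD(3)[OF n] in auto)
    also have "\<dots> = lsum Z (\<lambda>(a, b). sw Z (\<lambda>c d. t a c d) b) ts"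
      by (rule lsum_cong)
         (use ts(1) in \<open>auto simp: R.tensor_lift_tens[OF Z th] comult_closed sweedler_def subset_iff\<close>)
    finally show ?thesis by (simp only: 1)
  qed
  ultimately show ?thesis
    using coassoc[OF h] by (simp add: sw_lsum[OF Z trilinear_sw(1)[OF Z t] ts] sw_lsum[OF Z trilinear_sw(2)[OF Z t] ts])
qed

lemma smult_bilinear1:
  assumes "fnl u" "module K Z" "linear_map K C Z f"
  shows "bilinear_map K C C Z (\<lambda>a b. u a \<odot>\<^bsub>Z\<^esub> f b)"
proof -
  interpret Z: module K Z by fact
  note uD = functionalD[OF assms(1)] and fD = linear_mapD[OF assms(3)]
  show ?thesis using uD fD
    by (intro bilinear_mapI linear_mapI)
      (auto simp: Z.smult_l_distr Z.smult_r_distr Z.smult_assoc1[symmetric] K.m_comm)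
qed

lemma smult_bilinear2:
  assumes "fnl u" "module K Z" "linear_map K C Z f"
  shows "bilinear_map K C C Z (\<lambda>a b. u b \<odot>\<^bsub>Z\<^esub> f a)"
  using smult_bilinear1[OF assms] by (auto simp: bilinear_map_def)

lemma sw_counit:
  assumes "module K Z" "linear_map K C Z f" "h \<in> carrier C"
  shows "sw Z (\<lambda>a b. eps a \<odot>\<^bsub>Z\<^esub> f b) h = f h" "sw Z (\<lambda>a b. eps b \<odot>\<^bsub>Z\<^esub> f a) h = f h"
proof -
  note fD = linear_mapD[OF assms(2)] and eD = functionalD[OF eps_fnl]
  have "f (sw C (\<lambda>a b. eps a \<odot>\<^bsub>C\<^esub> b) h) = sw Z (\<lambda>a b. f (eps a \<odot>\<^bsub>C\<^esub> b)) h"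
    by (rule sw_map[OF mod_C assms(1,2) smult_bilinear1[OF eps_fnl mod_C linear_map_id] assms(3)])
  also have "\<dots> = sw Z (\<lambda>a b. eps a \<odot>\<^bsub>Z\<^esub> f b) h"
    by (rule sw_cong[symmetric, OF assms(1) smult_bilinear1[OF eps_fnl assms(1,2)] assms(3)]) (simp add: fD eD)
  finally show "sw Z (\<lambda>a b. eps a \<odot>\<^bsub>Z\<^esub> f b) h = f h"
    using counit_left[OF assms(3)] by (simp add: sweedler_def)
  have "f (sw C (\<lambda>a b. eps b \<odot>\<^bsub>C\<^esub> a) h) = sw Z (\<lambda>a b. f (eps b \<odot>\<^bsub>C\<^esub> a)) h"
    by (rule sw_map[OF mod_C assms(1,2) smult_bilinear2[OF eps_fnl mod_C linear_map_id] assms(3)])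
  also have "\<dots> = sw Z (\<lambda>a b. eps b \<odot>\<^bsub>Z\<^esub> f a) h"
    by (rule sw_cong[symmetric, OF assms(1) smult_bilinear2[OF eps_fnl assms(1,2)] assms(3)]) (simp add: fD eD)
  finally show "sw Z (\<lambda>a b. eps b \<odot>\<^bsub>Z\<^esub> f a) h = f h"
    using counit_right[OF assms(3)] by (simp add: sweedler_def)
qed

section \<open>The dual algebra with the convolution product\<close>

lemma conv_sw: "conv K C u v h = sw (scalar_module K) (\<lambda>a b. u a *\<^sub>K v b) h"
  by (simp add: conv_def sweedler_def tensor_pair_def)

lemma conv_fnl:
  assumes "fnl u" "fnl v"
  shows "fnl (conv K C u v)"
proof -
  have "conv K C u v = (\<lambda>h. tensor_pair K u v (comult C h))" by (rule ext) (simp add: conv_def)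
  then show ?thesis using functional_comp[OF comult_linear CC.tensor_pair_functional[OF assms]] by simp
qed

lemma fnl_bilinear: "\<lbrakk>fnl u; fnl v\<rbrakk> \<Longrightarrow> bilinear_map K C C (scalar_module K) (\<lambda>a b. u a *\<^sub>K v b)"
  by (rule bilinear_functionals[OF field_K])

lemma conv_lsum:
  assumes "fnl u" "fnl v" "set ts \<subseteq> carrier C \<times> carrier C" "comult C h = CC.tsum ts"
  shows "conv K C u v h = lsum K (\<lambda>(a, b). u a *\<^sub>K v b) ts"
  unfolding conv_def assms(4) by (rule CC.tensor_pair_tsum[OF assms(1-3)])

lemma conv_cong:
  assumes "fnl u" "fnl v" "h \<in> carrier C"
    "\<And>x. x \<in> carrier C \<Longrightarrow> u x = u' x" "\<And>x. x \<in> carrier C \<Longrightarrow> v x = v' x"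
  shows "conv K C u v h = conv K C u' v' h"
  unfolding conv_sw
  by (rule sw_cong[OF mod_K fnl_bilinear[OF assms(1,2)] assms(3)]) (use assms(4,5) in auto)

lemma fnl_trilinear:
  assumes "fnl u" "fnl v" "fnl w"
  shows "trilinear (scalar_module K) (\<lambda>a b c. u a *\<^sub>K v b *\<^sub>K w c)"
  using functionalD[OF assms(1)] functionalD[OF assms(2)] functionalD[OF assms(3)]
  by (intro trilinearI linear_mapI) (auto simp: K.l_distr K.r_distr K.m_ac)

lemma conv_assoc:
  assumes "fnl u" "fnl v" "fnl w" "h \<in> carrier C"
  shows "conv K C (conv K C u v) w h = conv K C u (conv K C v w) h"
proof -
  note D = functionalD[OF assms(1)] functionalD[OF assms(2)] functionalD[OF assms(3)]
  let ?t = "\<lambda>a b c. u a *\<^sub>K v b *\<^sub>K w c"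
  let ?S = "scalar_module K"
  have scl: "linear_map K ?S ?S (\<lambda>x. x *\<^sub>K c)" "linear_map K ?S ?S (\<lambda>x. c *\<^sub>K x)"
    if "c \<in> carrier K" for c
    using that by (auto intro!: linear_mapI simp: K.l_distr K.r_distr K.m_ac)
  have "conv K C (conv K C u v) w h = sw ?S (\<lambda>a b. sw ?S (\<lambda>c d. ?t c d b) a) h"
    unfolding conv_sw[of "conv K C u v"]
  proof (rule sw_cong[OF mod_K fnl_bilinear[OF conv_fnl[OF assms(1,2)] assms(3)] assms(4)])
    fix a b assume ab: "a \<in> carrier C" "b \<in> carrier C"
    show "conv K C u v a *\<^sub>K w b = sw ?S (\<lambda>c d. ?t c d b) a"
      unfolding conv_sw using ab D
      by (intro sw_map[OF mod_K mod_K scl(1) fnl_bilinear[OF assms(1,2)]]) auto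
  qed
  also have "\<dots> = sw ?S (\<lambda>a b. sw ?S (\<lambda>c d. ?t a c d) b) h"
    by (rule sw_coassoc[OF mod_K fnl_trilinear[OF assms(1-3)] assms(4)])
  also have "\<dots> = conv K C u (conv K C v w) h"
    unfolding conv_sw[of u "conv K C v w"]
  proof (rule sw_cong[symmetric, OF mod_K fnl_bilinear[OF assms(1) conv_fnl[OF assms(2,3)]] assms(4)])
    fix a b assume ab: "a \<in> carrier C" "b \<in> carrier C"
    have "u a *\<^sub>K conv K C v w b = sw ?S (\<lambda>c d. u a *\<^sub>K (v c *\<^sub>K w d)) b"
      unfolding conv_sw using ab D
      by (intro sw_map[OF mod_K mod_K scl(2) fnl_bilinear[OF assms(2,3)]]) auto
    also have "\<dots> = sw ?S (\<lambda>c d. ?t a c d) b"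
      using ab D by (intro sw_cong[symmetric, OF mod_K trilinear_bilinear(3)[OF fnl_trilinear[OF assms(1-3)]]])
        (auto simp: K.m_assoc)
    finally show "u a *\<^sub>K conv K C v w b = sw ?S (\<lambda>c d. ?t a c d) b" .
  qed
  finally show ?thesis .
qed

lemma conv_eps:
  assumes "fnl u" "h \<in> carrier C"
  shows "conv K C eps u h = u h" "conv K C u eps h = u h"
proof -
  note u = assms(1)[unfolded functional_def]
  show "conv K C eps u h = u h" using sw_counit(1)[OF mod_K u assms(2)] by (simp add: conv_sw)
  have "conv K C u eps h = sw (scalar_module K) (\<lambda>a b. eps b \<odot>\<^bsub>scalar_module K\<^esub> u a) h"
    unfolding conv_sw
    by (rule sw_cong[OF mod_K fnl_bilinear[OF assms(1) eps_fnl] assms(2)])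
       (simp add: functionalD(1)[OF assms(1)] functionalD(1)[OF eps_fnl] K.m_comm)
  then show "conv K C u eps h = u h" using sw_counit(2)[OF mod_K u assms(2)] by simp
qed

lemma conv_add_left:
  assumes "fnl u" "fnl u'" "fnl v" "h \<in> carrier C"
  shows "conv K C (\<lambda>x. u x +\<^sub>K u' x) v h = conv K C u v h +\<^sub>K conv K C u' v h"
proof -
  note D = functionalD[OF assms(1)] functionalD[OF assms(2)] functionalD[OF assms(3)]
  obtain ts where ts: "set ts \<subseteq> carrier C \<times> carrier C" "comult C h = CC.tsum ts"
    by (rule comult_rep[OF assms(4)])
  have f: "fnl (\<lambda>x. u x +\<^sub>K u' x)" using D by (intro functionalI) (auto simp: K.a_ac K.r_distr)
  have "lsum K (\<lambda>(a, b). (u a +\<^sub>K u' a) *\<^sub>K v b) ts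
    = lsum K (\<lambda>p. (case p of (a, b) \<Rightarrow> u a *\<^sub>K v b) +\<^sub>K (case p of (a, b) \<Rightarrow> u' a *\<^sub>K v b)) ts"
    by (rule lsum_cong) (use ts(1) D in \<open>auto simp: K.l_distr subset_iff\<close>)
  also have "\<dots> = lsum K (\<lambda>(a, b). u a *\<^sub>K v b) ts +\<^sub>K lsum K (\<lambda>(a, b). u' a *\<^sub>K v b) ts"
    by (rule K.lsum_add) (use ts(1) D in auto)
  finally show ?thesis
    by (simp add: conv_lsum[OF f assms(3) ts] conv_lsum[OF assms(1,3) ts] conv_lsum[OF assms(2,3) ts])
qed

lemma conv_add_right:
  assumes "fnl u" "fnl v" "fnl v'" "h \<in> carrier C"
  shows "conv K C u (\<lambda>x. v x +\<^sub>K v' x) h = conv K C u v h +\<^sub>K conv K C u v' h"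
proof -
  note D = functionalD[OF assms(1)] functionalD[OF assms(2)] functionalD[OF assms(3)]
  obtain ts where ts: "set ts \<subseteq> carrier C \<times> carrier C" "comult C h = CC.tsum ts"
    by (rule comult_rep[OF assms(4)])
  have f: "fnl (\<lambda>x. v x +\<^sub>K v' x)" using D by (intro functionalI) (auto simp: K.a_ac K.r_distr)
  have "lsum K (\<lambda>(a, b). u a *\<^sub>K (v b +\<^sub>K v' b)) ts
    = lsum K (\<lambda>p. (case p of (a, b) \<Rightarrow> u a *\<^sub>K v b) +\<^sub>K (case p of (a, b) \<Rightarrow> u a *\<^sub>K v' b)) ts"
    by (rule lsum_cong) (use ts(1) D in \<open>auto simp: K.r_distr subset_iff\<close>)
  also have "\<dots> = lsum K (\<lambda>(a, b). u a *\<^sub>K v b) ts +\<^sub>K lsum K (\<lambda>(a, b). u a *\<^sub>K v' b) ts"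
    by (rule K.lsum_add) (use ts(1) D in auto)
  finally show ?thesis
    by (simp add: conv_lsum[OF assms(1) f ts] conv_lsum[OF assms(1,2) ts] conv_lsum[OF assms(1,3) ts])
qed

lemma fnl_smult: "\<lbrakk>fnl u; c \<in> carrier K\<rbrakk> \<Longrightarrow> fnl (\<lambda>x. c *\<^sub>K u x)"
  using functionalD[of K C u] by (intro functionalI) (auto simp: K.r_distr K.m_ac)

lemma fnl_add: "\<lbrakk>fnl u; fnl v\<rbrakk> \<Longrightarrow> fnl (\<lambda>x. u x +\<^sub>K v x)"
  using functionalD[of K C u] functionalD[of K C v] by (intro functionalI) (auto simp: K.a_ac K.r_distr)

lemma conv_smult_left:
  assumes "fnl u" "fnl v" "c \<in> carrier K" "h \<in> carrier C"
  shows "conv K C (\<lambda>x. c *\<^sub>K u x) v h = c *\<^sub>K conv K C u v h"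
proof -
  note D = functionalD[OF assms(1)] functionalD[OF assms(2)]
  have "linear_map K (scalar_module K) (scalar_module K) (\<lambda>x. c *\<^sub>K x)"
    using assms(3) by (auto intro!: linear_mapI simp: K.r_distr K.m_ac)
  from sw_map[OF mod_K mod_K this fnl_bilinear[OF assms(1,2)] assms(4)]
  have "c *\<^sub>K conv K C u v h = sw (scalar_module K) (\<lambda>a b. c *\<^sub>K (u a *\<^sub>K v b)) h"
    by (simp add: conv_sw)
  also have "\<dots> = conv K C (\<lambda>x. c *\<^sub>K u x) v h"
    unfolding conv_sw
    by (rule sw_cong[symmetric, OF mod_K fnl_bilinear[OF fnl_smult[OF assms(1,3)] assms(2)] assms(4)])
       (use D assms(3) in \<open>auto simp: K.m_assoc\<close>)
  finally show ?thesis by simp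
qed

lemma conv_smult_right:
  assumes "fnl u" "fnl v" "c \<in> carrier K" "h \<in> carrier C"
  shows "conv K C u (\<lambda>x. c *\<^sub>K v x) h = c *\<^sub>K conv K C u v h"
proof -
  note D = functionalD[OF assms(1)] functionalD[OF assms(2)]
  have "linear_map K (scalar_module K) (scalar_module K) (\<lambda>x. c *\<^sub>K x)"
    using assms(3) by (auto intro!: linear_mapI simp: K.r_distr K.m_ac)
  from sw_map[OF mod_K mod_K this fnl_bilinear[OF assms(1,2)] assms(4)]
  have "c *\<^sub>K conv K C u v h = sw (scalar_module K) (\<lambda>a b. c *\<^sub>K (u a *\<^sub>K v b)) h"
    by (simp add: conv_sw)
  also have "\<dots> = conv K C u (\<lambda>x. c *\<^sub>K v x) h"
    unfolding conv_sw
    by (rule sw_cong[symmetric, OF mod_K fnl_bilinear[OF assms(1) fnl_smult[OF assms(2,3)]] assms(4)])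
       (use D assms(3) in \<open>auto simp: K.m_ac\<close>)
  finally show ?thesis by simp
qed

section \<open>The actions of the dual algebra on the coalgebra\<close>

lemma hit_linear: "fnl u \<Longrightarrow> linear_map K C C (hit K C u)"
  unfolding hit_def using sw_linear[OF mod_C smult_bilinear2[OF _ mod_C linear_map_id]] by simp

lemma hit_right_linear: "fnl u \<Longrightarrow> linear_map K C C (\<lambda>h. hit_right K C h u)"
  unfolding hit_right_def using sw_linear[OF mod_C smult_bilinear1[OF _ mod_C linear_map_id]] by simp

lemma hit_closed: "\<lbrakk>fnl u; h \<in> carrier C\<rbrakk> \<Longrightarrow> hit K C u h \<in> carrier C"
  using linear_mapD(1)[OF hit_linear] .

lemma hit_right_closed: "\<lbrakk>fnl u; h \<in> carrier C\<rbrakk> \<Longrightarrow> hit_right K C h u \<in> carrier C"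
  using linear_mapD(1)[OF hit_right_linear] .

text \<open>The action is the transpose of right convolution by u. Since functionals separate
  points, every law of the two actions thereby becomes associativity of \<open>conv\<close>.\<close>

lemma fnl_hit:
  assumes "fnl f" "fnl u" "h \<in> carrier C"
  shows "f (hit K C u h) = conv K C f u h"
proof -
  note f = assms(1)[unfolded functional_def]
  have "f (hit K C u h) = sw (scalar_module K) (\<lambda>a b. f (u b \<odot>\<^bsub>C\<^esub> a)) h"
    unfolding hit_def by (rule sw_map[OF mod_C mod_K f smult_bilinear2[OF assms(2) mod_C linear_map_id] assms(3)])
  also have "\<dots> = conv K C f u h"
    unfolding conv_sw
    by (rule sw_cong[symmetric, OF mod_K fnl_bilinear[OF assms(1,2)] assms(3)])
       (simp add: functionalD[OF assms(1)] functionalD(1)[OF assms(2)] K.m_comm)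
  finally show ?thesis .
qed

lemma fnl_hit_right:
  assumes "fnl f" "fnl u" "h \<in> carrier C"
  shows "f (hit_right K C h u) = conv K C u f h"
proof -
  note f = assms(1)[unfolded functional_def]
  have "f (hit_right K C h u) = sw (scalar_module K) (\<lambda>a b. f (u a \<odot>\<^bsub>C\<^esub> b)) h"
    unfolding hit_right_def by (rule sw_map[OF mod_C mod_K f smult_bilinear1[OF assms(2) mod_C linear_map_id] assms(3)])
  also have "\<dots> = conv K C u f h"
    unfolding conv_sw
    by (rule sw_cong[symmetric, OF mod_K fnl_bilinear[OF assms(2,1)] assms(3)])
       (simp add: functionalD[OF assms(1)] functionalD(1)[OF assms(2)])
  finally show ?thesis .
qed

lemma fnl_eqI:
  assumes "x \<in> carrier C" "y \<in> carrier C" "\<And>f. fnl f \<Longrightarrow> f x = f y"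
  shows "x = y"
proof -
  have "x \<ominus>\<^bsub>C\<^esub> y \<in> {\<zero>\<^bsub>C\<^esub>}"
  proof (rule perp_perp[OF field_K mod_C zero_submodule[OF mod_C]])
    fix f assume f: "fnl f"
    show "f (x \<ominus>\<^bsub>C\<^esub> y) = 0\<^sub>K"
      using functional_minus[OF field_K mod_C f assms(1,2)] assms(3)[OF f] functionalD(1)[OF f assms(2)] by simp
  qed (use assms in auto)
  then show ?thesis using module_minus_simps(3)[OF mod_C assms(1,2)] assms(2) by simp
qed

lemma hit_hit:
  assumes "fnl u" "fnl v" "h \<in> carrier C"
  shows "hit K C u (hit K C v h) = hit K C (conv K C u v) h"
  by (rule fnl_eqI) (auto simp: hit_closed conv_fnl assms fnl_hit conv_assoc)

lemma hit_right_hit_right: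
  assumes "fnl u" "fnl v" "h \<in> carrier C"
  shows "hit_right K C (hit_right K C h u) v = hit_right K C h (conv K C u v)"
  by (rule fnl_eqI) (auto simp: hit_right_closed conv_fnl assms fnl_hit_right conv_assoc)

lemma hit_hit_right:
  assumes "fnl u" "fnl v" "h \<in> carrier C"
  shows "hit K C u (hit_right K C h v) = hit_right K C (hit K C u h) v"
  by (rule fnl_eqI) (auto simp: hit_right_closed hit_closed conv_fnl assms fnl_hit_right fnl_hit conv_assoc)

lemma hit_eps: "h \<in> carrier C \<Longrightarrow> hit K C eps h = h"
  by (rule fnl_eqI) (auto simp: hit_closed eps_fnl fnl_hit conv_eps)

lemma comult_eqI:
  assumes "x \<in> carrier C" "T \<in> carrier CC"
    "\<And>f g. \<lbrakk>fnl f; fnl g\<rbrakk> \<Longrightarrow> conv K C f g x = tensor_pair K f g T"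
  shows "comult C x = T"
  by (rule CC.tensor_eqI[OF comult_closed[OF assms(1)] assms(2)]) (use assms(3) in \<open>simp add: conv_def\<close>)

end

section \<open>The antipode\<close>

context tensor_factors
begin

lemma tensor_linear_eqI:
  assumes "module K Z" "linear_map K (tensor K V W) Z f" "linear_map K (tensor K V W) Z g"
    "\<And>v w. \<lbrakk>v \<in> carrier V; w \<in> carrier W\<rbrakk> \<Longrightarrow> f (tens K V W v w) = g (tens K V W v w)"
    "T \<in> carrier (tensor K V W)"
  shows "f T = g T"
proof -
  obtain ts where ts: "set ts \<subseteq> carrier V \<times> carrier W" "T = tsum ts" using tsum_exists[OF assms(5)] by blast
  have c: "(case p of (v, w) \<Rightarrow> tens K V W v w) \<in> carrier (tensor K V W)" if "p \<in> set ts" for p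
    using that ts(1) bilinear_mapD(3)[OF tens_bilinear] by auto
  have "f T = lsum Z (\<lambda>p. f (case p of (v, w) \<Rightarrow> tens K V W v w)) ts"
    unfolding ts(2) by (rule lsum_linear[OF tensor_module assms(1,2) c])
  also have "\<dots> = lsum Z (\<lambda>p. g (case p of (v, w) \<Rightarrow> tens K V W v w)) ts"
    by (rule lsum_cong) (use ts(1) assms(4) in \<open>auto simp only: subset_iff split: prod.split\<close>)
  also have "\<dots> = g T"
    unfolding ts(2) by (rule lsum_linear[OF tensor_module assms(1,3) c, symmetric])
  finally show ?thesis .
qed

end

section \<open>Sweedler calculus in a bialgebra\<close>

context bialgebra
begin

lemma mult_bilinear: "bilinear_map K H H H (\<lambda>x y. x \<otimes> y)"
  by (intro bilinear_mapI linear_mapI)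
    (auto simp: A.l_distr A.r_distr smult_mult_left smult_mult_right)

lemma mult_linear1: "\<lbrakk>linear_map K U H f; w \<in> carrier H\<rbrakk> \<Longrightarrow> linear_map K U H (\<lambda>x. f x \<otimes> w)"
  by (rule linear_map_bilinear1[OF mult_bilinear])

lemma mult_linear2: "\<lbrakk>linear_map K U H f; w \<in> carrier H\<rbrakk> \<Longrightarrow> linear_map K U H (\<lambda>x. w \<otimes> f x)"
  by (rule linear_map_bilinear2[OF mult_bilinear])

lemma eps_mult: "\<lbrakk>x \<in> carrier H; y \<in> carrier H\<rbrakk> \<Longrightarrow> eps (x \<otimes> y) = eps x *\<^sub>K eps y"
  using ring_hom_mult[OF counit_hom] .

lemma eps_one: "eps \<one> = 1\<^sub>K"
  using ring_hom_one[OF counit_hom] .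

lemma eps_closed: "x \<in> carrier H \<Longrightarrow> eps x \<in> carrier K"
  using functionalD(1)[OF eps_fnl] .

lemma comult_one: "comult H \<one> = tens K H H \<one> \<one>"
  using ring_hom_one[OF comult_hom] by (simp add: tensor_algebra_def)

lemma mod_CC: "module K CC" by (rule CC.tensor_module)

lemma mult4_bilinear:
  assumes "bilinear_map K H H Z b"
  shows "\<lbrakk>a' \<in> carrier H; b' \<in> carrier H\<rbrakk> \<Longrightarrow> bilinear_map K H H Z (\<lambda>c d. b (a' \<otimes> c) (b' \<otimes> d))"
    "\<lbrakk>c \<in> carrier H; d \<in> carrier H\<rbrakk> \<Longrightarrow> bilinear_map K H H Z (\<lambda>a' b'. b (a' \<otimes> c) (b' \<otimes> d))"
  by (intro bilinear_mapI linear_map_bilinear1[OF assms] linear_map_bilinear2[OF assms]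
      mult_linear1 mult_linear2 linear_map_id A.m_closed; assumption)+

lemma comult_mult:
  assumes "x \<in> carrier H" "y \<in> carrier H"
  shows "comult H (x \<otimes> y) = sw CC (\<lambda>a b. sw CC (\<lambda>c d. tens K H H (a \<otimes> c) (b \<otimes> d)) y) x"
  using ring_hom_mult[OF comult_hom assms] by (simp add: tensor_algebra_def sweedler_def)

text \<open>Multiplicativity of \<Delta>, pushed through the linear map that b induces on H
  \<otimes> H.\<close>

lemma sw_mult:
  assumes "module K Z" "bilinear_map K H H Z b" "x \<in> carrier H" "y \<in> carrier H"
  shows "sw Z b (x \<otimes> y) = sw Z (\<lambda>a a'. sw Z (\<lambda>c c'. b (a \<otimes> c) (a' \<otimes> c')) y) x"
proof -
  note t4 = mult4_bilinear[OF CC.tens_bilinear]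
  note L = CC.tensor_lift_linear[OF assms(1,2)]
  have b2: "bilinear_map K H H CC (\<lambda>a a'. sw CC (\<lambda>c c'. tens K H H (a \<otimes> c) (a' \<otimes> c')) y)"
    by (intro bilinear_mapI sw_param[OF mod_CC mod_C] assms(4) t4(1)
        bilinear_mapD(1)[OF t4(2)] bilinear_mapD(2)[OF t4(2)])
  have b3: "bilinear_map K H H Z (\<lambda>a a'. sw Z (\<lambda>c c'. b (a \<otimes> c) (a' \<otimes> c')) y)"
    by (intro bilinear_mapI sw_param[OF assms(1) mod_C] assms(4) mult4_bilinear(1)[OF assms(2)]
        bilinear_mapD(1)[OF mult4_bilinear(2)[OF assms(2)]] bilinear_mapD(2)[OF mult4_bilinear(2)[OF assms(2)]])
  have "sw Z b (x \<otimes> y) = tensor_lift K Z b (sw CC (\<lambda>a a'. sw CC (\<lambda>c c'. tens K H H (a \<otimes> c) (a' \<otimes> c')) y) x)"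
    unfolding sweedler_def[of K H Z b] comult_mult[OF assms(3,4)] ..
  also have "\<dots> = sw Z (\<lambda>a a'. tensor_lift K Z b (sw CC (\<lambda>c c'. tens K H H (a \<otimes> c) (a' \<otimes> c')) y)) x"
    by (rule sw_map[OF mod_CC assms(1) L b2 assms(3)])
  also have "\<dots> = sw Z (\<lambda>a a'. sw Z (\<lambda>c c'. b (a \<otimes> c) (a' \<otimes> c')) y) x"
  proof (rule sw_cong[symmetric, OF assms(1) b3 assms(3)])
    fix a a' assume a: "a \<in> carrier H" "a' \<in> carrier H"
    have "tensor_lift K Z b (sw CC (\<lambda>c c'. tens K H H (a \<otimes> c) (a' \<otimes> c')) y)
      = sw Z (\<lambda>c c'. tensor_lift K Z b (tens K H H (a \<otimes> c) (a' \<otimes> c'))) y"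
      by (rule sw_map[OF mod_CC assms(1) L t4(1)[OF a] assms(4)])
    also have "\<dots> = sw Z (\<lambda>c c'. b (a \<otimes> c) (a' \<otimes> c')) y"
      by (rule sw_cong[symmetric, OF assms(1) mult4_bilinear(1)[OF assms(2) a] assms(4)])
         (simp add: CC.tensor_lift_tens[OF assms(1,2)] a)
    finally show "sw Z (\<lambda>c c'. b (a \<otimes> c) (a' \<otimes> c')) y =
      tensor_lift K Z b (sw CC (\<lambda>c c'. tens K H H (a \<otimes> c) (a' \<otimes> c')) y)" ..
  qed
  finally show ?thesis .
qed

end

context hopf_algebra
begin

abbreviation "S \<equiv> antipode H"

lemma S_linear: "linear_map K H H S" by (rule antipode_linear)
lemma S_closed: "x \<in> carrier H \<Longrightarrow> S x \<in> carrier H" using linear_mapD(1)[OF S_linear] .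

lemma antipode_left_sw: "h \<in> carrier H \<Longrightarrow> sw H (\<lambda>a b. S a \<otimes> b) h = eps h \<odot> \<one>"
  using antipode_left by (simp add: sweedler_def)

lemma antipode_right_sw: "h \<in> carrier H \<Longrightarrow> sw H (\<lambda>a b. a \<otimes> S b) h = eps h \<odot> \<one>"
  using antipode_right by (simp add: sweedler_def)

text \<open>If \<open>F(h\<^sub>1) \<cdot> h\<^sub>2 = G(h)\<close> in a right \<open>H\<close>-module, the antipode cancels the factor \<open>h\<^sub>2\<close>.\<close>

lemma antipode_cancel:
  assumes Z: "module K Z" and act: "bilinear_map K Z H Z act"
    and act_mult: "\<And>z x y. \<lbrakk>z \<in> carrier Z; x \<in> carrier H; y \<in> carrier H\<rbrakk> \<Longrightarrow> act (act z x) y = act z (x \<otimes> y)"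
    and act_one: "\<And>z. z \<in> carrier Z \<Longrightarrow> act z \<one> = z"
    and F: "linear_map K H Z F" and G: "linear_map K H Z G"
    and FG: "\<And>h. h \<in> carrier H \<Longrightarrow> sw Z (\<lambda>a b. act (F a) b) h = G h"
    and h: "h \<in> carrier H"
  shows "F h = sw Z (\<lambda>a b. act (G a) (S b)) h"
proof -
  interpret Z: module K Z by fact
  note aD = bilinear_mapD[OF act] and FD = linear_mapD[OF F] and GD = linear_mapD[OF G]
  note SD = linear_mapD[OF S_linear]
  have bFe: "bilinear_map K H H Z (\<lambda>a b. eps b \<odot>\<^bsub>Z\<^esub> F a)"
    by (rule smult_bilinear2[OF eps_fnl Z F])
  have bF: "bilinear_map K H H Z (\<lambda>a b. act (F a) b)"
    by (intro bilinear_mapI linear_map_bilinear1[OF act F] aD(2) FD(1))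
  have bS: "bilinear_map K H H H (\<lambda>c d. c \<otimes> S d)"
    by (intro bilinear_mapI mult_linear1[OF linear_map_id] mult_linear2[OF S_linear] SD(1))
  have bG: "bilinear_map K H H Z (\<lambda>a b. act (G a) (S b))"
    by (intro bilinear_mapI linear_map_bilinear1[OF act G] linear_map_bilinear2[OF act S_linear] GD(1) SD(1))
  let ?t = "\<lambda>a c d. act (F a) (c \<otimes> S d)"
  have t: "trilinear Z ?t"
    by (intro trilinearI linear_map_bilinear1[OF act F] linear_map_bilinear2[OF act] FD(1) SD(1) A.m_closed
        mult_linear1[OF linear_map_id] mult_linear2[OF S_linear])
  \<comment> \<open>In Sweedler notation: F(h) = F(h_1) \<epsilon>(h_2) = F(h_1) h_2 S(h_3) = G(h_1)
    S(h_2).\<close>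
  have "F h = sw Z (\<lambda>a b. eps b \<odot>\<^bsub>Z\<^esub> F a) h" by (rule sw_counit(2)[OF Z F h, symmetric])
  also have "\<dots> = sw Z (\<lambda>a b. sw Z (\<lambda>c d. ?t a c d) b) h"
  proof (rule sw_cong[OF Z bFe h])
    fix a b assume ab: "a \<in> carrier H" "b \<in> carrier H"
    have "eps b \<odot>\<^bsub>Z\<^esub> F a = act (F a) (eps b \<odot> \<one>)"
      using ab by (simp add: aD FD eps_closed act_one)
    also have "\<dots> = act (F a) (sw H (\<lambda>c d. c \<otimes> S d) b)" using ab by (simp add: antipode_right_sw)
    also have "\<dots> = sw Z (\<lambda>c d. ?t a c d) b"
      by (rule sw_map[OF mod_C Z aD(2)[OF FD(1)[OF ab(1)]] bS ab(2)])
    finally show "eps b \<odot>\<^bsub>Z\<^esub> F a = sw Z (\<lambda>c d. ?t a c d) b" .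
  qed
  also have "\<dots> = sw Z (\<lambda>a b. sw Z (\<lambda>c d. ?t c d b) a) h"
    by (rule sw_coassoc[OF Z t h, symmetric])
  also have "\<dots> = sw Z (\<lambda>a b. act (G a) (S b)) h"
  proof (rule sw_cong[symmetric, OF Z bG h])
    fix a b assume ab: "a \<in> carrier H" "b \<in> carrier H"
    have "act (G a) (S b) = act (sw Z (\<lambda>c d. act (F c) d) a) (S b)" using FG[OF ab(1)] by simp
    also have "\<dots> = sw Z (\<lambda>c d. act (act (F c) d) (S b)) a"
      by (rule sw_map[OF Z Z aD(1)[OF SD(1)[OF ab(2)]] bF ab(1)])
    also have "\<dots> = sw Z (\<lambda>c d. ?t c d b) a"
      using ab by (intro sw_cong[symmetric, OF Z trilinear_bilinear(1)[OF t]])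
        (auto simp: act_mult FD SD)
    finally show "act (G a) (S b) = sw Z (\<lambda>c d. ?t c d b) a" .
  qed
  finally show ?thesis .
qed

section \<open>The antipode reverses products\<close>

lemma smult_linear: "\<lbrakk>module K Z; linear_map K U Z f; c \<in> carrier K\<rbrakk> \<Longrightarrow> linear_map K U Z (\<lambda>x. c \<odot>\<^bsub>Z\<^esub> f x)"
  for Z (structure)
proof -
  assume Z: "module K Z" and f: "linear_map K U Z f" and c: "c \<in> carrier K"
  interpret Z: module K Z by fact
  note fD = linear_mapD[OF f]
  show ?thesis using fD c
    by (intro linear_mapI) (auto simp: Z.smult_r_distr Z.smult_assoc1[symmetric] K.m_comm)
qed

lemma fnl_smult_linear: "\<lbrakk>module K Z; fnl u; z \<in> carrier Z\<rbrakk> \<Longrightarrow> linear_map K H Z (\<lambda>x. u x \<odot>\<^bsub>Z\<^esub> z)"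
  for Z (structure)
proof -
  assume Z: "module K Z" and u: "fnl u" and z: "z \<in> carrier Z"
  interpret Z: module K Z by fact
  note uD = functionalD[OF u]
  show ?thesis using uD z
    by (intro linear_mapI) (auto simp: Z.smult_l_distr Z.smult_assoc1)
qed

text \<open>Cancellation in the variable y: for F(y) = S(x_1 y) x_2 one gets F(y_1) y_2 = S((xy)_1)
  (xy)_2 = \<epsilon>(x) \<epsilon>(y), hence F(y) = \<epsilon>(x) S(y).\<close>

lemma antipode_mult_step:
  assumes "x \<in> carrier H" "y \<in> carrier H"
  shows "sw H (\<lambda>a b. S (a \<otimes> y) \<otimes> b) x = eps x \<odot> S y"
proof -
  note SD = linear_mapD[OF S_linear]
  let ?F = "\<lambda>y. sw H (\<lambda>a b. S (a \<otimes> y) \<otimes> b) x"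
  have Sm: "linear_map K H H (\<lambda>a. S (a \<otimes> z))" "linear_map K H H (\<lambda>a. S (z \<otimes> a))" if "z \<in> carrier H" for z
    using that by (auto intro!: linear_map_comp[OF _ S_linear] mult_linear1[OF linear_map_id] mult_linear2[OF linear_map_id])
  have b1: "bilinear_map K H H H (\<lambda>a b. S (a \<otimes> z) \<otimes> b)" if "z \<in> carrier H" for z
    using that by (intro bilinear_mapI mult_linear1 mult_linear2[OF linear_map_id] Sm SD(1) A.m_closed)
  have F: "linear_map K H H ?F"
    using assms(1) by (intro sw_param[OF mod_C mod_C] b1 mult_linear1 Sm)
  have bS: "bilinear_map K H H H (\<lambda>u v. S u \<otimes> v)"
    by (intro bilinear_mapI mult_linear1[OF S_linear] mult_linear2[OF linear_map_id] SD(1))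
  have G: "linear_map K H H (\<lambda>y. (eps x *\<^sub>K eps y) \<odot> \<one>)"
    using fnl_smult_linear[OF mod_C fnl_smult[OF eps_fnl eps_closed[OF assms(1)]]] by simp
  have "?F y = sw H (\<lambda>a b. ((eps x *\<^sub>K eps a) \<odot> \<one>) \<otimes> S b) y"
  proof (rule antipode_cancel[OF mod_C mult_bilinear _ _ F G _ assms(2)])
    fix y assume y: "y \<in> carrier H"
    have "sw H (\<lambda>c d. ?F c \<otimes> d) y = sw H (\<lambda>c d. sw H (\<lambda>a b. S (a \<otimes> c) \<otimes> (b \<otimes> d)) x) y"
    proof (rule sw_cong[OF mod_C _ y])
      show "bilinear_map K H H H (\<lambda>c d. ?F c \<otimes> d)"
        by (intro bilinear_mapI mult_linear1[OF F] mult_linear2[OF linear_map_id] linear_mapD(1)[OF F])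
      fix c d assume cd: "c \<in> carrier H" "d \<in> carrier H"
      have "?F c \<otimes> d = sw H (\<lambda>a b. (S (a \<otimes> c) \<otimes> b) \<otimes> d) x"
        by (rule sw_map[OF mod_C mod_C mult_linear1[OF linear_map_id cd(2)] b1[OF cd(1)] assms(1)])
      also have "\<dots> = sw H (\<lambda>a b. S (a \<otimes> c) \<otimes> (b \<otimes> d)) x"
      proof (rule sw_cong[OF mod_C _ assms(1)])
        show "bilinear_map K H H H (\<lambda>a b. (S (a \<otimes> c) \<otimes> b) \<otimes> d)"
          using cd by (intro bilinear_mapI mult_linear1 mult_linear2 linear_map_id Sm SD(1) A.m_closed)
      qed (use cd in \<open>simp add: A.m_assoc SD(1)\<close>)
      finally show "?F c \<otimes> d = sw H (\<lambda>a b. S (a \<otimes> c) \<otimes> (b \<otimes> d)) x" .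
    qed
    also have "\<dots> = sw H (\<lambda>a b. sw H (\<lambda>c d. S (a \<otimes> c) \<otimes> (b \<otimes> d)) y) x"
      by (rule sw_swap[OF mod_C y assms(1)]) (auto intro: mult4_bilinear[OF bS])
    also have "\<dots> = sw H (\<lambda>u v. S u \<otimes> v) (x \<otimes> y)"
      by (rule sw_mult[OF mod_C bS assms(1) y, symmetric])
    also have "\<dots> = (eps x *\<^sub>K eps y) \<odot> \<one>" using assms y by (simp add: antipode_left_sw eps_mult)
    finally show "sw H (\<lambda>c d. ?F c \<otimes> d) y = (eps x *\<^sub>K eps y) \<odot> \<one>" .
  qed (auto simp: A.m_assoc)
  also have "\<dots> = sw H (\<lambda>a b. eps a \<odot> (eps x \<odot> S b)) y"
  proof (rule sw_cong[symmetric, OF mod_C smult_bilinear1[OF eps_fnl mod_C smult_linear[OF mod_C S_linear]] assms(2)])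
    fix a b assume ab: "a \<in> carrier H" "b \<in> carrier H"
    show "eps a \<odot> (eps x \<odot> S b) = ((eps x *\<^sub>K eps a) \<odot> \<one>) \<otimes> S b"
      using ab assms by (simp add: smult_mult_left eps_closed SD smult_assoc1[symmetric] K.m_comm)
  qed (use assms eps_closed in auto)
  also have "\<dots> = eps x \<odot> S y"
    using sw_counit(1)[OF mod_C smult_linear[OF mod_C S_linear eps_closed[OF assms(1)]] assms(2)] .
  finally show ?thesis .
qed

text \<open>A second cancellation, now in x, with F(a) = S(ay) and G(a) = \<epsilon>(a) S(y);
  \<open>antipode_mult_step\<close> supplies its premise.\<close>

lemma antipode_mult:
  assumes "x \<in> carrier H" "y \<in> carrier H"
  shows "S (x \<otimes> y) = S y \<otimes> S x"
proof -
  note SD = linear_mapD[OF S_linear]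
  have F: "linear_map K H H (\<lambda>a. S (a \<otimes> y))"
    using assms by (auto intro!: linear_map_comp[OF _ S_linear] mult_linear1[OF linear_map_id])
  have G: "linear_map K H H (\<lambda>a. eps a \<odot> S y)"
    using fnl_smult_linear[OF mod_C eps_fnl SD(1)[OF assms(2)]] .
  have "S (x \<otimes> y) = sw H (\<lambda>a b. (eps a \<odot> S y) \<otimes> S b) x"
    by (rule antipode_cancel[OF mod_C mult_bilinear _ _ F G _ assms(1)])
       (auto simp: A.m_assoc antipode_mult_step assms)
  also have "\<dots> = sw H (\<lambda>a b. eps a \<odot> (S y \<otimes> S b)) x"
    by (rule sw_cong[symmetric, OF mod_C smult_bilinear1[OF eps_fnl mod_C mult_linear2[OF S_linear SD(1)[OF assms(2)]]] assms(1)])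
       (simp add: smult_mult_left eps_closed SD(1) assms)
  also have "\<dots> = S y \<otimes> S x"
    using sw_counit(1)[OF mod_C mult_linear2[OF S_linear SD(1)[OF assms(2)]] assms(1)] .
  finally show ?thesis .
qed

lemma antipode_one: "S \<one> = \<one>"
proof -
  have b: "bilinear_map K H H H (\<lambda>a b. S a \<otimes> b)"
    by (intro bilinear_mapI mult_linear1[OF S_linear] mult_linear2[OF linear_map_id] S_closed)
  have "sw H (\<lambda>a b. S a \<otimes> b) \<one> = S \<one> \<otimes> \<one>"
    unfolding sweedler_def comult_one by (rule CC.tensor_lift_tens[OF mod_C b]) auto
  then show ?thesis using antipode_left_sw[of \<one>] S_closed[of \<one>] by (simp add: eps_one)
qed

section \<open>The antipode reverses coproducts\<close>

definition act_left :: "('h \<times> 'h \<Rightarrow> 'k) set \<Rightarrow> 'h \<Rightarrow> ('h \<times> 'h \<Rightarrow> 'k) set" where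
  "act_left T x = tensor_lift K CC (\<lambda>a b. tens K H H (a \<otimes> x) b) T"

definition act_right :: "('h \<times> 'h \<Rightarrow> 'k) set \<Rightarrow> 'h \<Rightarrow> ('h \<times> 'h \<Rightarrow> 'k) set" where
  "act_right T x = tensor_lift K CC (\<lambda>a b. tens K H H a (b \<otimes> x)) T"

lemma act_aux_bilinear:
  "x \<in> carrier H \<Longrightarrow> bilinear_map K H H CC (\<lambda>a b. tens K H H (a \<otimes> x) b)"
  "x \<in> carrier H \<Longrightarrow> bilinear_map K H H CC (\<lambda>a b. tens K H H a (b \<otimes> x))"
  by (intro bilinear_mapI linear_map_bilinear1[OF CC.tens_bilinear] bilinear_mapD(1,2)[OF CC.tens_bilinear]
      linear_map_bilinear2[OF CC.tens_bilinear] mult_linear1 linear_map_id A.m_closed; assumption)+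

lemma act_tens:
  assumes "a \<in> carrier H" "b \<in> carrier H" "x \<in> carrier H"
  shows "act_left (tens K H H a b) x = tens K H H (a \<otimes> x) b" "act_right (tens K H H a b) x = tens K H H a (b \<otimes> x)"
  unfolding act_left_def act_right_def
  by (rule CC.tensor_lift_tens[OF mod_CC act_aux_bilinear(1)[OF assms(3)] assms(1,2)],
      rule CC.tensor_lift_tens[OF mod_CC act_aux_bilinear(2)[OF assms(3)] assms(1,2)])

lemma act_bilinear: "bilinear_map K CC H CC act_left" "bilinear_map K CC H CC act_right"
  unfolding act_left_def act_right_def
  by (intro bilinear_mapI CC.tensor_lift_linear[OF mod_CC] CC.tensor_lift_param[OF mod_CC mod_C]
      act_aux_bilinear linear_map_bilinear1[OF CC.tens_bilinear]
      linear_map_bilinear2[OF CC.tens_bilinear] mult_linear2 linear_map_id; assumption)+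

lemma act_laws:
  assumes "T \<in> carrier CC" "x \<in> carrier H" "y \<in> carrier H"
  shows "act_left (act_left T x) y = act_left T (x \<otimes> y)" "act_right (act_right T x) y = act_right T (x \<otimes> y)"
proof -
  note lin = bilinear_mapD(1)[OF act_bilinear(1)] bilinear_mapD(1)[OF act_bilinear(2)]
  show "act_left (act_left T x) y = act_left T (x \<otimes> y)"
    by (rule CC.tensor_linear_eqI[OF mod_CC linear_map_comp[OF lin(1) lin(1)] lin(1) _ assms(1)])
       (use assms in \<open>auto simp: act_tens A.m_assoc\<close>)
  show "act_right (act_right T x) y = act_right T (x \<otimes> y)"
    by (rule CC.tensor_linear_eqI[OF mod_CC linear_map_comp[OF lin(2) lin(2)] lin(2) _ assms(1)])
       (use assms in \<open>auto simp: act_tens A.m_assoc\<close>)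
qed

lemma act_one:
  assumes "T \<in> carrier CC"
  shows "act_left T \<one> = T" "act_right T \<one> = T"
proof -
  note lin = bilinear_mapD(1)[OF act_bilinear(1)] bilinear_mapD(1)[OF act_bilinear(2)]
  show "act_left T \<one> = T"
    by (rule CC.tensor_linear_eqI[OF mod_CC lin(1) linear_map_id _ assms(1)]) (auto simp: act_tens)
  show "act_right T \<one> = T"
    by (rule CC.tensor_linear_eqI[OF mod_CC lin(2) linear_map_id _ assms(1)]) (auto simp: act_tens)
qed

text \<open>The right actions of H on the first and on the second factor of H \<otimes> H are kept
  apart so that the antipode can be cancelled in one factor at a time; performed with both legs of y
  they amount to right multiplication by \<Delta>(y).\<close>

lemma comult_mult_act:
  assumes "z \<in> carrier H" "y \<in> carrier H"
  shows "sw CC (\<lambda>c d. act_right (act_left (comult H z) c) d) y = comult H (z \<otimes> y)"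
proof -
  note t4 = mult4_bilinear[OF CC.tens_bilinear]
  note lin = bilinear_mapD(1)[OF act_bilinear(1)] bilinear_mapD(1)[OF act_bilinear(2)]
  have z: "comult H z = sw CC (\<lambda>a b. tens K H H a b) z"
    unfolding sweedler_def
    by (rule CC.tensor_linear_eqI[OF mod_CC linear_map_id CC.tensor_lift_linear[OF mod_CC CC.tens_bilinear] _ comult_closed[OF assms(1)]])
       (simp add: CC.tensor_lift_tens[OF mod_CC CC.tens_bilinear])
  have al: "bilinear_map K H H CC (\<lambda>c d. act_right (act_left (comult H z) c) d)"
    by (intro bilinear_mapI linear_map_comp[OF bilinear_mapD(2)[OF act_bilinear(1)] lin(2)]
        bilinear_mapD(2)[OF act_bilinear(2)] bilinear_mapD(3)[OF act_bilinear(1)] comult_closed assms)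
  have "sw CC (\<lambda>c d. act_right (act_left (comult H z) c) d) y
    = sw CC (\<lambda>c d. sw CC (\<lambda>a b. tens K H H (a \<otimes> c) (b \<otimes> d)) z) y"
  proof (rule sw_cong[OF mod_CC al assms(2)])
    fix c d assume cd: "c \<in> carrier H" "d \<in> carrier H"
    have "act_right (act_left (sw CC (\<lambda>a b. tens K H H a b) z) c) d
      = sw CC (\<lambda>a b. act_right (act_left (tens K H H a b) c) d) z"
      using cd by (intro sw_map[OF mod_CC mod_CC linear_map_comp[OF lin(1) lin(2)] CC.tens_bilinear assms(1)])
    also have "\<dots> = sw CC (\<lambda>a b. tens K H H (a \<otimes> c) (b \<otimes> d)) z"
      by (rule sw_cong[symmetric, OF mod_CC t4(2)[OF cd] assms(1)]) (simp add: act_tens cd)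
    finally show "act_right (act_left (comult H z) c) d = sw CC (\<lambda>a b. tens K H H (a \<otimes> c) (b \<otimes> d)) z"
      by (simp only: z[symmetric])
  qed
  also have "\<dots> = sw CC (\<lambda>a b. sw CC (\<lambda>c d. tens K H H (a \<otimes> c) (b \<otimes> d)) y) z"
    by (rule sw_swap[OF mod_CC assms(2,1)]) (auto intro: t4)
  finally show ?thesis by (simp add: comult_mult assms)
qed

text \<open>Cancellation in the second tensor factor: the sum of \<Delta>(S(h_1)) (h_2 \<otimes>
  h_3) is \<Delta>(S(h_1) h_2) = \<epsilon>(h) 1 \<otimes> 1, so removing h_3 leaves 1 \<otimes>
  S(h).\<close>

lemma comult_antipode_step:
  assumes "h \<in> carrier H"
  shows "sw CC (\<lambda>a b. act_left (comult H (S a)) b) h = tens K H H \<one> (S h)"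
proof -
  note SD = linear_mapD[OF S_linear]
  note lin = bilinear_mapD(1)[OF act_bilinear(1)] bilinear_mapD(1)[OF act_bilinear(2)]
  have cS: "linear_map K H CC (\<lambda>a. comult H (S a))" by (rule linear_map_comp[OF S_linear comult_linear])
  have bF: "bilinear_map K H H CC (\<lambda>a b. act_left (comult H (S a)) b)"
    by (intro bilinear_mapI linear_map_bilinear1[OF act_bilinear(1) cS] bilinear_mapD(2)[OF act_bilinear(1)]
        linear_mapD(1)[OF cS])
  let ?F = "\<lambda>h. sw CC (\<lambda>a b. act_left (comult H (S a)) b) h"
  have F: "linear_map K H CC ?F" by (rule sw_linear[OF mod_CC bF])
  have t11: "tens K H H \<one> \<one> \<in> carrier CC" by (intro bilinear_mapD(3)[OF CC.tens_bilinear]) auto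
  have G: "linear_map K H CC (\<lambda>h. eps h \<odot>\<^bsub>CC\<^esub> tens K H H \<one> \<one>)"
    by (rule fnl_smult_linear[OF mod_CC eps_fnl t11])
  have l1: "linear_map K H CC (\<lambda>b. tens K H H \<one> (S b))"
    by (rule linear_map_bilinear2[OF CC.tens_bilinear S_linear]) auto
  let ?t = "\<lambda>a c d. act_right (act_left (comult H (S a)) c) d"
  have t: "trilinear CC ?t"
    by (intro trilinearI linear_map_comp[OF linear_map_bilinear1[OF act_bilinear(1) cS] lin(2)]
        linear_map_comp[OF bilinear_mapD(2)[OF act_bilinear(1)] lin(2)] bilinear_mapD(2)[OF act_bilinear(2)]
        bilinear_mapD(3)[OF act_bilinear(1)] linear_mapD(1)[OF cS])
  have "?F h = sw CC (\<lambda>a b. act_right (eps a \<odot>\<^bsub>CC\<^esub> tens K H H \<one> \<one>) (S b)) h"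
  proof (rule antipode_cancel[OF mod_CC act_bilinear(2) _ _ F G _ assms])
    fix h assume h: "h \<in> carrier H"
    have "sw CC (\<lambda>a b. act_right (?F a) b) h = sw CC (\<lambda>a b. sw CC (\<lambda>c d. ?t c d b) a) h"
    proof (rule sw_cong[OF mod_CC _ h])
      show "bilinear_map K H H CC (\<lambda>a b. act_right (?F a) b)"
        by (intro bilinear_mapI linear_map_bilinear1[OF act_bilinear(2) F] bilinear_mapD(2)[OF act_bilinear(2)] linear_mapD(1)[OF F])
      fix a b assume ab: "a \<in> carrier H" "b \<in> carrier H"
      show "act_right (?F a) b = sw CC (\<lambda>c d. ?t c d b) a"
        by (rule sw_map[OF mod_CC mod_CC lin(2)[OF ab(2)] bF ab(1)])
    qed
    also have "\<dots> = sw CC (\<lambda>a b. sw CC (\<lambda>c d. ?t a c d) b) h" by (rule sw_coassoc[OF mod_CC t h])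
    also have "\<dots> = sw CC (\<lambda>a b. comult H (S a \<otimes> b)) h"
      by (rule sw_cong[OF mod_CC trilinear_sw(2)[OF mod_CC t] h]) (simp add: comult_mult_act SD(1))
    also have "\<dots> = comult H (sw H (\<lambda>a b. S a \<otimes> b) h)"
      by (rule sw_map[symmetric, OF mod_C mod_CC comult_linear _ h])
         (intro bilinear_mapI mult_linear1[OF S_linear] mult_linear2[OF linear_map_id] SD(1))
    also have "\<dots> = eps h \<odot>\<^bsub>CC\<^esub> tens K H H \<one> \<one>"
      using h by (simp add: antipode_left_sw linear_mapD(3)[OF comult_linear] eps_closed comult_one)
    finally show "sw CC (\<lambda>a b. act_right (?F a) b) h = eps h \<odot>\<^bsub>CC\<^esub> tens K H H \<one> \<one>" .
  qed (auto simp: act_laws act_one)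
  also have "\<dots> = sw CC (\<lambda>a b. eps a \<odot>\<^bsub>CC\<^esub> tens K H H \<one> (S b)) h"
    by (rule sw_cong[symmetric, OF mod_CC smult_bilinear1[OF eps_fnl mod_CC l1] assms])
       (simp add: linear_mapD(3)[OF lin(2)] eps_closed t11 SD(1) act_tens)
  also have "\<dots> = tens K H H \<one> (S h)" using sw_counit(1)[OF mod_CC l1 assms] .
  finally show ?thesis .
qed

text \<open>The remaining cancellation, in the first tensor factor, starting from
  \<open>comult_antipode_step\<close>.\<close>

lemma comult_antipode:
  assumes "h \<in> carrier H"
  shows "comult H (S h) = sw CC (\<lambda>a b. tens K H H (S b) (S a)) h"
proof -
  note SD = linear_mapD[OF S_linear]
  have cS: "linear_map K H CC (\<lambda>a. comult H (S a))" by (rule linear_map_comp[OF S_linear comult_linear])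
  have G: "linear_map K H CC (\<lambda>b. tens K H H \<one> (S b))"
    by (rule linear_map_bilinear2[OF CC.tens_bilinear S_linear]) auto
  have "comult H (S h) = sw CC (\<lambda>a b. act_left (tens K H H \<one> (S a)) (S b)) h"
    by (rule antipode_cancel[OF mod_CC act_bilinear(1) _ _ cS G _ assms])
       (auto simp: act_laws act_one comult_antipode_step)
  also have "\<dots> = sw CC (\<lambda>a b. tens K H H (S b) (S a)) h"
  proof (rule sw_cong[symmetric, OF mod_CC _ assms])
    show "bilinear_map K H H CC (\<lambda>a b. tens K H H (S b) (S a))"
      by (intro bilinear_mapI linear_map_bilinear1[OF CC.tens_bilinear S_linear]
          linear_map_bilinear2[OF CC.tens_bilinear S_linear] SD(1))
  qed (simp add: act_tens SD(1))
  finally show ?thesis .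
qed

lemma fnl_antipode: "fnl f \<Longrightarrow> fnl (\<lambda>x. f (S x))"
  by (rule functional_comp[OF S_linear])

lemma conv_antipode:
  assumes "fnl f" "fnl g" "h \<in> carrier H"
  shows "conv K H f g (S h) = conv K H (\<lambda>x. g (S x)) (\<lambda>x. f (S x)) h"
proof -
  note SD = linear_mapD[OF S_linear]
  have "conv K H f g (S h) = tensor_pair K f g (sw CC (\<lambda>a b. tens K H H (S b) (S a)) h)"
    by (simp add: conv_def comult_antipode assms)
  also have "\<dots> = sw (scalar_module K) (\<lambda>a b. tensor_pair K f g (tens K H H (S b) (S a))) h"
    by (rule sw_map[OF mod_CC mod_K CC.tensor_pair_functional[OF assms(1,2), unfolded functional_def] _ assms(3)])
       (intro bilinear_mapI linear_map_bilinear1[OF CC.tens_bilinear S_linear]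
          linear_map_bilinear2[OF CC.tens_bilinear S_linear] SD(1))
  also have "\<dots> = conv K H (\<lambda>x. g (S x)) (\<lambda>x. f (S x)) h"
    unfolding conv_sw
    by (rule sw_cong[symmetric, OF mod_K fnl_bilinear[OF fnl_antipode fnl_antipode] assms(3)])
       (use assms in \<open>auto simp: CC.tensor_pair_tens SD(1) functionalD(1) K.m_comm\<close>)
  finally show ?thesis .
qed

end

section \<open>The coradical filtration of a pointed Hopf algebra\<close>

lemma span_of_mono:
  assumes "module K M" "X \<subseteq> Y" "Y \<subseteq> carrier M"
  shows "span_of K M X \<subseteq> span_of K M Y"
  using span_of_submodule[OF assms(1,3)] span_of_submodule(3)[OF assms(1), of X "span_of K M Y"] assms(2,3)
  by blast

lemma functional_kernel_submodule:
  assumes "field K" "module K V" "functional K V f"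
  shows "submodule {x \<in> carrier V. f x = \<zero>\<^bsub>K\<^esub>} K V"
  using kernel_submodule[OF assms(2) module_scalar_module[OF assms(1)] assms(3)[unfolded functional_def]
      zero_submodule[OF module_scalar_module[OF assms(1)]]] by simp

lemma functional_span_zero:
  assumes "field K" "module K V" "functional K V f" "X \<subseteq> carrier V" "\<And>x. x \<in> X \<Longrightarrow> f x = \<zero>\<^bsub>K\<^esub>"
    "y \<in> span_of K V X"
  shows "f y = \<zero>\<^bsub>K\<^esub>"
  using span_of_submodule(3)[OF assms(2,4) functional_kernel_submodule[OF assms(1-3)]] assms(4-6) by blast

text \<open>The spans of finite subsets form a directed family, so their union is a
  subspace.\<close>

lemma span_of_finite:
  assumes "module K V" "X \<subseteq> carrier V" "y \<in> span_of K V X"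
  obtains F where "finite F" "F \<subseteq> X" "y \<in> span_of K V F"
proof -
  let ?D = "\<Union>F\<in>{F. finite F \<and> F \<subseteq> X}. span_of K V F"
  have mono: "span_of K V F \<subseteq> span_of K V F'" if "F \<subseteq> F'" "F' \<subseteq> X" for F F'
    using span_of_mono[OF assms(1) that(1)] that(2) assms(2) by blast
  have sub: "submodule (span_of K V F) K V" "F \<subseteq> span_of K V F" if "F \<subseteq> X" for F
    by (rule span_of_submodule(1,2)[OF assms(1) subset_trans[OF that assms(2)]])+
  have "submodule ?D K V"
  proof (rule submoduleI'[OF assms(1)])
    show "?D \<subseteq> carrier V"
    proof (intro UN_least subsetI)
      fix F x assume "F \<in> {F. finite F \<and> F \<subseteq> X}" "x \<in> span_of K V F"
      then show "x \<in> carrier V" using submoduleD(1)[OF assms(1) sub(1)[of F]] by simp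
    qed
    show "\<zero>\<^bsub>V\<^esub> \<in> ?D" using submoduleD(2)[OF assms(1) sub(1)[of "{}"]] by (intro UN_I[of "{}"]) auto
    fix x z assume "x \<in> ?D" "z \<in> ?D"
    then obtain F F' where F: "finite F" "F \<subseteq> X" "x \<in> span_of K V F" "finite F'" "F' \<subseteq> X" "z \<in> span_of K V F'"
      by blast
    then have FF: "finite (F \<union> F')" "F \<union> F' \<subseteq> X" by auto
    have "x \<in> span_of K V (F \<union> F')" "z \<in> span_of K V (F \<union> F')"
      using F(3,6) mono[of F "F \<union> F'"] mono[of F' "F \<union> F'"] FF(2) by auto
    then have "x \<oplus>\<^bsub>V\<^esub> z \<in> span_of K V (F \<union> F')" by (rule submoduleD(3)[OF assms(1) sub(1)[OF FF(2)]])
    then show "x \<oplus>\<^bsub>V\<^esub> z \<in> ?D" using FF by (intro UN_I[of "F \<union> F'"]) auto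
  next
    fix a x assume a: "a \<in> carrier K" and "x \<in> ?D"
    then obtain F where F: "finite F" "F \<subseteq> X" "x \<in> span_of K V F" by blast
    then have "a \<odot>\<^bsub>V\<^esub> x \<in> span_of K V F" using submoduleD(6)[OF assms(1) sub(1)[OF F(2)] a] by simp
    then show "a \<odot>\<^bsub>V\<^esub> x \<in> ?D" using F by (intro UN_I[of F]) auto
  qed
  moreover have "X \<subseteq> ?D"
  proof
    fix x assume "x \<in> X"
    then show "x \<in> ?D" using sub(2)[of "{x}"] by (intro UN_I[of "{x}"]) auto
  qed
  ultimately have "span_of K V X \<subseteq> ?D" by (rule span_of_submodule(3)[OF assms(1,2)])
  then show thesis using assms(3) that by blast
qed

section \<open>Group-like elements\<close>

lemma grouplike_group_simps:
  "monoid.mult (grouplike_group K H) = monoid.mult H" "one (grouplike_group K H) = one H"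
  by (simp_all add: grouplike_group_def)

locale pointed_hopf_algebra = hopf_algebra K H
  for K :: "('k,'n) ring_scheme" and H :: "('k,'h,'m) hopf_alg_scheme" (structure) +
  assumes pointed: "pointed K H"
begin

abbreviation "GL \<equiv> carrier (grouplike_group K H)"
text \<open>\<open>U n\<close> is H_{n-1}, so \<open>U 0\<close> is 0 and \<open>U (Suc 0)\<close>
  is the coradical. With this shift the wedge of \<open>U i\<close> and \<open>U j\<close> is
  \<open>U (i + j)\<close>, the case H_{-1} included.\<close>

abbreviation "U \<equiv> corad_below K H"
abbreviation "cnv \<equiv> conv K H"

lemma GL_iff: "g \<in> GL \<longleftrightarrow> g \<in> carrier H \<and> g \<noteq> \<zero> \<and> comult H g = tens K H H g g"
  by (simp add: grouplike_group_def)

lemma GL_closed: "g \<in> GL \<Longrightarrow> g \<in> carrier H"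
  by (simp add: GL_iff)

lemma GL_sub: "GL \<subseteq> carrier H"
  using GL_closed by blast

lemma sw_GL: "\<lbrakk>module K Z; bilinear_map K H H Z b; g \<in> GL\<rbrakk> \<Longrightarrow> sw Z b g = b g g"
  unfolding sweedler_def by (simp add: GL_iff CC.tensor_lift_tens)

lemma conv_GL: "\<lbrakk>fnl u; fnl v; g \<in> GL\<rbrakk> \<Longrightarrow> cnv u v g = u g *\<^sub>K v g"
  unfolding conv_def by (simp add: GL_iff CC.tensor_pair_tens)

lemma fnl_zero: "fnl f \<Longrightarrow> f \<zero> = 0\<^sub>K"
  by (rule functional_zero[OF field_K mod_C])

text \<open>A functional with f(g) = 1 exists as g \<noteq> 0, and the counit axiom gives f(g) =
  \<epsilon>(g) f(g).\<close>

lemma eps_GL: assumes g: "g \<in> GL" shows "eps g = 1\<^sub>K"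
proof -
  have gc: "g \<in> carrier H" "g \<noteq> \<zero>" using g by (auto simp: GL_iff)
  obtain f where f: "fnl f" "f g = 1\<^sub>K"
    using exists_functional[OF field_K mod_C zero_submodule[OF mod_C] gc(1)] gc(2) by blast
  have "f g = eps g *\<^sub>K f g" using conv_eps(1)[OF f(1) gc(1)] conv_GL[OF eps_fnl f(1) g] by simp
  then show ?thesis using f(2) eps_closed[OF gc(1)] by simp
qed

lemma one_GL: "\<one> \<in> GL"
proof -
  have "\<one> \<noteq> \<zero>"
  proof
    assume "\<one> = \<zero>"
    then have "1\<^sub>K = eps \<zero>" using eps_one by simp
    then show False using fnl_zero[OF eps_fnl] by simp
  qed
  then show ?thesis by (simp add: GL_iff comult_one)
qed

lemma one_not_zero_H: "\<one> \<noteq> \<zero>" using one_GL by (simp add: GL_iff)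

lemma S_GL_inverse:
  assumes "g \<in> GL" shows "S g \<otimes> g = \<one>" "g \<otimes> S g = \<one>"
proof -
  have b: "bilinear_map K H H H (\<lambda>a b. S a \<otimes> b)" "bilinear_map K H H H (\<lambda>a b. a \<otimes> S b)"
    by (intro bilinear_mapI mult_linear1[OF S_linear] mult_linear2[OF linear_map_id]
        mult_linear1[OF linear_map_id] mult_linear2[OF S_linear] S_closed; assumption)+
  show "S g \<otimes> g = \<one>" "g \<otimes> S g = \<one>"
    using antipode_left_sw[OF GL_closed[OF assms]] antipode_right_sw[OF GL_closed[OF assms]]
      sw_GL[OF mod_C b(1) assms] sw_GL[OF mod_C b(2) assms] eps_GL[OF assms] by auto
qed

lemma mult_GL: assumes "g \<in> GL" "g' \<in> GL" shows "g \<otimes> g' \<in> GL"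
proof -
  note c = GL_closed[OF assms(1)] GL_closed[OF assms(2)]
  note t4 = mult4_bilinear[OF CC.tens_bilinear]
  have b: "bilinear_map K H H CC (\<lambda>a b. sw CC (\<lambda>c d. tens K H H (a \<otimes> c) (b \<otimes> d)) g')"
    by (intro bilinear_mapI sw_param[OF mod_CC mod_C] c t4(1)
        bilinear_mapD(1)[OF t4(2)] bilinear_mapD(2)[OF t4(2)])
  have "comult H (g \<otimes> g') = tens K H H (g \<otimes> g') (g \<otimes> g')"
    unfolding comult_mult[OF c] sw_GL[OF mod_CC b assms(1)]
    by (rule sw_GL[OF mod_CC t4(1)[OF c(1) c(1)] assms(2)])
  moreover have "g \<otimes> g' \<noteq> \<zero>"
  proof
    assume "g \<otimes> g' = \<zero>"
    then have "eps g *\<^sub>K eps g' = 0\<^sub>K" using eps_mult[OF c] fnl_zero[OF eps_fnl] by simp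
    then show False using eps_GL assms by simp
  qed
  ultimately show ?thesis using c by (simp add: GL_iff)
qed

lemma S_GL: assumes "g \<in> GL" shows "S g \<in> GL"
proof -
  note c = GL_closed[OF assms]
  have b: "bilinear_map K H H CC (\<lambda>a b. tens K H H (S b) (S a))"
    by (intro bilinear_mapI linear_map_bilinear1[OF CC.tens_bilinear S_linear]
        linear_map_bilinear2[OF CC.tens_bilinear S_linear] S_closed)
  have "comult H (S g) = tens K H H (S g) (S g)"
    unfolding comult_antipode[OF c] by (rule sw_GL[OF mod_CC b assms])
  moreover have "S g \<noteq> \<zero>"
    using S_GL_inverse(1)[OF assms] c one_not_zero_H by auto
  ultimately show ?thesis using S_closed[OF c] by (simp add: GL_iff)
qed

lemma group_GL: "group (grouplike_group K H)"
proof (rule groupI)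
  fix x assume x: "x \<in> GL"
  then have "S x \<otimes> x = \<one>" "S x \<in> GL" using S_GL S_GL_inverse by auto
  then show "\<exists>y\<in>GL. y \<otimes>\<^bsub>grouplike_group K H\<^esub> x = \<one>\<^bsub>grouplike_group K H\<^esub>"
    by (intro bexI[of _ "S x"]) (simp_all add: grouplike_group_simps)
qed (simp_all only: grouplike_group_simps mult_GL one_GL GL_closed A.m_assoc A.l_one)

lemma SS_GL: assumes "g \<in> GL" shows "S (S g) = g"
proof -
  note c = GL_closed[OF assms] S_closed[OF GL_closed[OF assms]] S_closed[OF S_closed[OF GL_closed[OF assms]]]
  have "S (S g) = S (S g) \<otimes> (S g \<otimes> g)" using c S_GL_inverse(1)[OF assms] by simp
  also have "\<dots> = (S (S g) \<otimes> S g) \<otimes> g" using c by (simp add: A.m_assoc)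
  also have "\<dots> = g" using c S_GL_inverse(1)[OF S_GL[OF assms]] by simp
  finally show ?thesis .
qed

section \<open>Annihilators of the filtration and the wedge\<close>

lemma H0_span: "corad_filt K H 0 = span_of K H GL"
  using pointed by (simp add: pointed_def)

lemma U_simps: "U 0 = {\<zero>}" "U (Suc n) = corad_filt K H n"
  by (simp_all add: corad_below_def)

lemma U1_span: "U (Suc 0) = span_of K H GL"
  by (simp add: U_simps H0_span del: corad_filt.simps)

lemma GL_U1: "g \<in> GL \<Longrightarrow> g \<in> U (Suc 0)"
  using span_of_submodule(2)[OF mod_C GL_sub] by (auto simp: U1_span)

definition perp :: "'h set \<Rightarrow> ('h \<Rightarrow> 'k) \<Rightarrow> bool" where
  "perp X f \<longleftrightarrow> fnl f \<and> (\<forall>x\<in>X. f x = 0\<^sub>K)"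

lemma perpD: "perp X f \<Longrightarrow> fnl f" "\<lbrakk>perp X f; x \<in> X\<rbrakk> \<Longrightarrow> f x = 0\<^sub>K"
  by (auto simp: perp_def)

lemma perp_U1: "fnl f \<Longrightarrow> perp (U (Suc 0)) f \<longleftrightarrow> (\<forall>g\<in>GL. f g = 0\<^sub>K)"
  unfolding perp_def using functional_span_zero[OF field_K mod_C _ GL_sub] GL_U1 by (auto simp: U1_span)

text \<open>\<open>wedge_iff\<close> speaks of subspaces, and that the filtration consists of
  subspaces is in turn proved by induction through this equivalence; hence the hypothesis. The
  annihilator of the coradical stands on the left and that of the preceding term on the right, as
  H_0 and H_{n-1} do in H \<otimes> H_{n-1} + H_0 \<otimes> H.\<close>

lemma corad_Suc_iff:
  assumes "submodule (U (Suc n)) K H"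
  shows "h \<in> U (Suc (Suc n)) \<longleftrightarrow> h \<in> carrier H \<and> (\<forall>f g. perp (U (Suc 0)) f \<longrightarrow> perp (U (Suc n)) g \<longrightarrow> cnv f g h = 0\<^sub>K)"
proof -
  have s0: "submodule (coradical K H) K H"
    using span_of_submodule(1)[OF mod_C GL_sub] H0_span by simp
  have c0: "U (Suc 0) = coradical K H" by (simp add: U_simps)
  show ?thesis
  proof (cases "h \<in> carrier H")
    case True
    have "h \<in> U (Suc (Suc n)) \<longleftrightarrow> comult H h \<in> tensor_sub K H (carrier H) (U (Suc n)) <+>\<^bsub>CC\<^esub> tensor_sub K H (coradical K H) (carrier H)"
      using True by (simp add: U_simps)
    also have "\<dots> \<longleftrightarrow> (\<forall>f g. perp (U (Suc 0)) f \<longrightarrow> perp (U (Suc n)) g \<longrightarrow> cnv f g h = 0\<^sub>K)"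
      unfolding wedge_iff[OF field_K mod_C s0 assms comult_closed[OF True]] perp_def conv_def c0 by blast
    finally show ?thesis using True by simp
  qed (simp add: U_simps)
qed

lemma U_submodule: "submodule (U n) K H"
proof -
  have "submodule (U (Suc n)) K H" for n
  proof (induction n)
    case 0
    show ?case using span_of_submodule(1)[OF mod_C GL_sub] by (simp add: U1_span)
  next
    case (Suc n)
    note iff = corad_Suc_iff[OF Suc]
    have fn: "fnl (cnv f g)" if "perp (U (Suc 0)) f" "perp (U (Suc n)) g" for f g
      by (rule conv_fnl[OF perpD(1)[OF that(1)] perpD(1)[OF that(2)]])
    note D = fnl_zero[OF fn] functionalD(2)[OF fn] functionalD(3)[OF fn]
    show ?case
      by (rule submoduleI'[OF mod_C]) (auto simp: iff D)
  qed
  then show ?thesis using zero_submodule[OF mod_C] by (cases n) (auto simp: U_simps(1))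
qed

lemmas U_D = submoduleD[OF mod_C U_submodule]

lemma U_perp_perp: "\<lbrakk>h \<in> carrier H; \<And>f. perp (U n) f \<Longrightarrow> f h = 0\<^sub>K\<rbrakk> \<Longrightarrow> h \<in> U n"
  by (rule perp_perp[OF field_K mod_C U_submodule]) (auto simp: perp_def)

lemma U_Suc_Suc_iff: "h \<in> U (Suc (Suc n)) \<longleftrightarrow>
    h \<in> carrier H \<and> (\<forall>f g. perp (U (Suc 0)) f \<longrightarrow> perp (U (Suc n)) g \<longrightarrow> cnv f g h = 0\<^sub>K)"
  by (rule corad_Suc_iff[OF U_submodule])

text \<open>Evaluation at a group-like element is multiplicative for convolution, and the
  group-likes span H_0; so the annihilator of H_0 is a two-sided ideal of the dual algebra.\<close>

lemma conv_perp1: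
  assumes "perp (U (Suc 0)) f" "fnl g"
  shows "perp (U (Suc 0)) (cnv f g)" "perp (U (Suc 0)) (cnv g f)"
  using assms perp_U1[OF perpD(1)[OF assms(1)]] perp_U1[OF conv_fnl[OF perpD(1)[OF assms(1)] assms(2)]]
    perp_U1[OF conv_fnl[OF assms(2) perpD(1)[OF assms(1)]]]
  by (auto simp: conv_GL perpD(1) functionalD(1)[OF assms(2) GL_closed])

text \<open>Both actions by f preserve the term of the filtration: a * b evaluated at h acted on by
  f is (f * a) * b or a * (b * f) at h, and f * a and b * f still vanish on their subspaces, the
  former because the annihilator of H_0 is an ideal, the latter by induction.\<close>

lemma conv_perp: "\<lbrakk>perp (U n) g; fnl f\<rbrakk> \<Longrightarrow> perp (U n) (cnv f g) \<and> perp (U n) (cnv g f)"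
proof (induction n arbitrary: f g)
  case 0
  have fn: "fnl (cnv f g)" "fnl (cnv g f)"
    using conv_fnl[OF 0(2) perpD(1)[OF 0(1)]] conv_fnl[OF perpD(1)[OF 0(1)] 0(2)] by auto
  show ?case using fn fnl_zero[OF fn(1)] fnl_zero[OF fn(2)] by (simp add: perp_def U_simps(1))
next
  case (Suc n)
  note gf = perpD(1)[OF Suc.prems(1)]
  show ?case
  proof (cases n)
    case 0
    then show ?thesis using conv_perp1 Suc.prems by blast
  next
    case (Suc m)
    have "cnv f g h = 0\<^sub>K \<and> cnv g f h = 0\<^sub>K" if h: "h \<in> U (Suc n)" for h
    proof -
      have hc: "h \<in> carrier H" using U_D(1)[OF h] .
      have z: "cnv a b h = 0\<^sub>K" if "perp (U (Suc 0)) a" "perp (U n) b" for a b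
        using h that unfolding Suc U_Suc_Suc_iff by blast
      have "cnv a b (hit_right K H h f) = 0\<^sub>K \<and> cnv a b (hit K H f h) = 0\<^sub>K"
        if ab: "perp (U (Suc 0)) a" "perp (U n) b" for a b
      proof -
        note fn = perpD(1)[OF ab(1)] perpD(1)[OF ab(2)]
        have "cnv a b (hit_right K H h f) = cnv (cnv f a) b h"
          by (simp add: fnl_hit_right conv_fnl fn Suc.prems(2) hc conv_assoc)
        moreover have "cnv a b (hit K H f h) = cnv a (cnv b f) h"
          by (simp add: fnl_hit conv_fnl fn Suc.prems(2) hc conv_assoc)
        ultimately show ?thesis
          using z conv_perp1[OF ab(1) Suc.prems(2)] Suc.IH[OF ab(2) Suc.prems(2)] ab by metis
      qed
      then have "hit_right K H h f \<in> U (Suc n)" "hit K H f h \<in> U (Suc n)"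
        unfolding Suc U_Suc_Suc_iff using hit_closed hit_right_closed Suc.prems(2) hc by blast+
      then show ?thesis
        using perpD(2)[OF Suc.prems(1)] fnl_hit[OF gf Suc.prems(2) hc] fnl_hit_right[OF gf Suc.prems(2) hc] by simp
    qed
    then show ?thesis using conv_fnl[OF gf Suc.prems(2)] conv_fnl[OF Suc.prems(2) gf] by (simp add: perp_def)
  qed
qed

lemma hit_U:
  assumes "fnl f" "h \<in> U n"
  shows "hit K H f h \<in> U n" "hit_right K H h f \<in> U n"
proof -
  note hc = U_D(1)[OF assms(2)]
  have "g (hit K H f h) = 0\<^sub>K \<and> g (hit_right K H h f) = 0\<^sub>K" if g: "perp (U n) g" for g
    using conv_perp[OF g assms(1)] perpD(2)[OF _ assms(2)]
    by (simp add: fnl_hit[OF perpD(1)[OF g] assms(1) hc] fnl_hit_right[OF perpD(1)[OF g] assms(1) hc])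
  then show "hit K H f h \<in> U n" "hit_right K H h f \<in> U n"
    using hit_closed[OF assms(1) hc] hit_right_closed[OF assms(1) hc] U_perp_perp by blast+
qed

text \<open>This includes H_0 as the wedge of H_0 and H_{-1}: every functional vanishes on
  \<open>U 0\<close>, so g may be \<epsilon> and the condition yields f(h) = 0.\<close>

lemma U_Suc_iff: "h \<in> U (Suc n) \<longleftrightarrow>
    h \<in> carrier H \<and> (\<forall>f g. perp (U (Suc 0)) f \<longrightarrow> perp (U n) g \<longrightarrow> cnv f g h = 0\<^sub>K)"
proof (cases n)
  case 0
  have "perp (U 0) eps" using eps_fnl fnl_zero by (simp add: perp_def U_simps)
  then have "(\<forall>f g. perp (U (Suc 0)) f \<longrightarrow> perp (U 0) g \<longrightarrow> cnv f g h = 0\<^sub>K) \<Longrightarrow> h \<in> U (Suc 0)"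
    if "h \<in> carrier H"
    using that conv_eps(2) perpD(1) by (metis U_perp_perp)
  then show ?thesis using 0 conv_perp U_D(1) perpD by blast
next
  case (Suc m)
  then show ?thesis using U_Suc_Suc_iff by simp
qed

text \<open>\<open>U n\<close> is \<open>H\<^sub>n\<^sub>-\<^sub>1\<close>, so this is \<open>H\<^sub>i\<^sub>+\<^sub>j\<^sub>+\<^sub>1 = H\<^sub>i \<and> H\<^sub>j\<close>.\<close>

lemma U_add_iff: "h \<in> U (i + j) \<longleftrightarrow>
    h \<in> carrier H \<and> (\<forall>f g. perp (U i) f \<longrightarrow> perp (U j) g \<longrightarrow> cnv f g h = 0\<^sub>K)"
proof (induction i arbitrary: h j)
  case 0
  have "perp (U 0) eps" using eps_fnl fnl_zero by (simp add: perp_def U_simps)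
  then have "(\<forall>f g. perp (U 0) f \<longrightarrow> perp (U j) g \<longrightarrow> cnv f g h = 0\<^sub>K) \<Longrightarrow> h \<in> U j"
    if "h \<in> carrier H"
    using that conv_eps(1) perpD(1) by (metis U_perp_perp)
  moreover have "cnv f g h = 0\<^sub>K" if "h \<in> U j" "perp (U 0) f" "perp (U j) g" for f g
    using conv_perp[OF that(3) perpD(1)[OF that(2)]] that(1) perpD(2) by blast
  ultimately show ?case using U_D(1) by auto
next
  case (Suc i)
  show ?case
  proof
    assume h: "h \<in> U (Suc i + j)"
    then have hc: "h \<in> carrier H" by (rule U_D)
    have "cnv f g h = 0\<^sub>K" if fg: "perp (U (Suc i)) f" "perp (U j) g" for f g
    proof -
      note fn = perpD(1)[OF fg(1)] perpD(1)[OF fg(2)]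
      \<comment> \<open>(f * g)(h) is f at h acted on by g, so this element should lie in
        \<open>U (Suc i)\<close>. Testing it with a * b shifts b onto g, and b * g annihilates
        \<open>U (i + j)\<close> by induction.\<close>
      have "hit K H g h \<in> U (Suc i)"
      proof (subst U_Suc_iff, intro conjI allI impI)
        fix a b assume ab: "perp (U (Suc 0)) a" "perp (U i) b"
        note fn' = perpD(1)[OF ab(1)] perpD(1)[OF ab(2)]
        have "cnv b g x = 0\<^sub>K" if "x \<in> U (i + j)" for x
          using that Suc.IH[of x j] ab(2) fg(2) by blast
        then have "perp (U (i + j)) (cnv b g)"
          using conv_fnl[OF fn'(2) fn(2)] by (simp add: perp_def)
        then have "cnv a (cnv b g) h = 0\<^sub>K" using h ab(1) U_Suc_iff[of h "i + j"] by simp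
        then show "cnv a b (hit K H g h) = 0\<^sub>K"
          by (simp add: fnl_hit conv_fnl fn fn' hc conv_assoc)
      qed (use hit_closed fn hc in blast)
      then show ?thesis using perpD(2)[OF fg(1)] fnl_hit[OF fn hc] by simp
    qed
    then show "h \<in> carrier H \<and> (\<forall>f g. perp (U (Suc i)) f \<longrightarrow> perp (U j) g \<longrightarrow> cnv f g h = 0\<^sub>K)"
      using hc by blast
  next
    assume R: "h \<in> carrier H \<and> (\<forall>f g. perp (U (Suc i)) f \<longrightarrow> perp (U j) g \<longrightarrow> cnv f g h = 0\<^sub>K)"
    then have hc: "h \<in> carrier H" by blast
    have "cnv a c h = 0\<^sub>K" if ac: "perp (U (Suc 0)) a" "perp (U (i + j)) c" for a c
    proof -
      note fn = perpD(1)[OF ac(1)] perpD(1)[OF ac(2)]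
      \<comment> \<open>The mirror argument: a is absorbed by b from the left, and a * b annihilates
        \<open>U (Suc i)\<close>.\<close>
      have "hit_right K H h a \<in> U (i + j)"
      proof (subst Suc.IH, intro conjI allI impI)
        fix b g assume bg: "perp (U i) b" "perp (U j) g"
        note fn' = perpD(1)[OF bg(1)] perpD(1)[OF bg(2)]
        have "cnv a b x = 0\<^sub>K" if "x \<in> U (Suc i)" for x
          using that U_Suc_iff[of x i] ac(1) bg(1) by blast
        then have "perp (U (Suc i)) (cnv a b)"
          using conv_fnl[OF fn(1) fn'(1)] by (simp add: perp_def)
        then have "cnv (cnv a b) g h = 0\<^sub>K" using R bg(2) by blast
        then show "cnv b g (hit_right K H h a) = 0\<^sub>K"
          by (simp add: fnl_hit_right conv_fnl fn fn' hc conv_assoc)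
      qed (use hit_right_closed fn hc in blast)
      then show ?thesis using perpD(2)[OF ac(2)] fnl_hit_right[OF fn(2,1) hc] by simp
    qed
    then show "h \<in> U (Suc i + j)" using U_Suc_iff[of h "i + j"] hc by simp
  qed
qed

lemma U_mono_Suc: "h \<in> U n \<Longrightarrow> h \<in> U (Suc n)"
  using U_Suc_iff conv_perp perpD U_D(1) by meson

lemma U_mono: "m \<le> n \<Longrightarrow> U m \<subseteq> U n"
  by (induction rule: dec_induct) (auto intro: U_mono_Suc)

text \<open>The disjunction in \<open>Rc\<close> covers S, which reverses convolution; the wedge of
  H_0 with a term of the filtration may be formed in either order.\<close>

lemma coalgebra_map_U:
  assumes R: "linear_map K H H R"
    and R1: "\<And>h. h \<in> U (Suc 0) \<Longrightarrow> R h \<in> U (Suc 0)"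
    and Rc: "\<And>f g h. \<lbrakk>fnl f; fnl g; h \<in> carrier H\<rbrakk> \<Longrightarrow> cnv f g (R h) = cnv (\<lambda>x. f (R x)) (\<lambda>x. g (R x)) h \<or>
       cnv f g (R h) = cnv (\<lambda>x. g (R x)) (\<lambda>x. f (R x)) h"
  shows "h \<in> U n \<Longrightarrow> R h \<in> U n"
proof (induction n arbitrary: h)
  case 0
  then show ?case using linear_map_zero[OF mod_C mod_C R] by (simp add: U_simps)
next
  case (Suc n)
  note hc = U_D(1)[OF Suc.prems]
  show ?case
  proof (subst U_Suc_iff, intro conjI allI impI)
    show "R h \<in> carrier H" using linear_mapD(1)[OF R hc] .
    fix f g assume fg: "perp (U (Suc 0)) f" "perp (U n) g"
    note fn = perpD(1)[OF fg(1)] perpD(1)[OF fg(2)]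
    have "perp (U (Suc 0)) (\<lambda>x. f (R x))" "perp (U n) (\<lambda>x. g (R x))"
      using functional_comp[OF R fn(1)] functional_comp[OF R fn(2)] fg R1 Suc.IH by (auto simp: perp_def)
    then have "cnv (\<lambda>x. f (R x)) (\<lambda>x. g (R x)) h = 0\<^sub>K" "cnv (\<lambda>x. g (R x)) (\<lambda>x. f (R x)) h = 0\<^sub>K"
      using Suc.prems U_add_iff[of h "Suc 0" n] U_add_iff[of h n "Suc 0"] by auto
    then show "cnv f g (R h) = 0\<^sub>K" using Rc[OF fn hc] by auto
  qed
qed

lemma linear_preserves_U1:
  assumes "linear_map K H H R" "\<And>g. g \<in> GL \<Longrightarrow> R g \<in> U (Suc 0)" "h \<in> U (Suc 0)"
  shows "R h \<in> U (Suc 0)"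
proof -
  have "span_of K H GL \<subseteq> {x \<in> carrier H. R x \<in> U (Suc 0)}"
    by (rule span_of_submodule(3)[OF mod_C GL_sub kernel_submodule[OF mod_C mod_C assms(1) U_submodule]])
       (use assms(2) GL_closed in blast)
  then show ?thesis using assms(3) by (auto simp: U1_span)
qed

lemma S_U: "h \<in> U n \<Longrightarrow> S h \<in> U n"
  by (rule coalgebra_map_U[OF S_linear linear_preserves_U1[OF S_linear GL_U1[OF S_GL]]])
     (use conv_antipode in blast)+

lemma fixed_submodule: "linear_map K H H R \<Longrightarrow> submodule {x \<in> carrier H. R x = x} K H"
  using linear_mapD[of K H H R] linear_map_zero[OF mod_C mod_C]
  by (intro submoduleI'[OF mod_C]) auto

lemma fixed_U1:
  assumes "linear_map K H H R" "\<And>g. g \<in> GL \<Longrightarrow> R g = g" "h \<in> U (Suc 0)"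
  shows "R h = h"
  using span_of_submodule(3)[OF mod_C GL_sub fixed_submodule[OF assms(1)]] assms(2,3) GL_closed
  by (auto simp: U1_span)

text \<open>For a annihilating \<open>U (Suc 0)\<close> and b annihilating \<open>U n\<close>, the
  value of a * b at Rh - h is ((aR - a) * bR)(h) + (a * (bR - b))(h). Here aR - a vanishes on H_1
  because R is the identity there, and bR - b vanishes on \<open>U (Suc n)\<close> by induction, so
  both products vanish at h.\<close>

lemma coalgebra_map_unipotent:
  assumes R: "linear_map K H H R"
    and R2: "\<And>h. h \<in> U (Suc (Suc 0)) \<Longrightarrow> R h = h"
    and Rc: "\<And>f g h. \<lbrakk>fnl f; fnl g; h \<in> carrier H\<rbrakk> \<Longrightarrow> cnv f g (R h) = cnv (\<lambda>x. f (R x)) (\<lambda>x. g (R x)) h"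
  shows "h \<in> U (Suc n) \<Longrightarrow> R h \<ominus> h \<in> U n"
proof (induction n arbitrary: h)
  case 0
  then have "h \<in> U (Suc (Suc 0))" "h \<in> carrier H" using U_mono_Suc U_D(1) by auto
  then show ?case using R2 module_minus_simps(1)[OF mod_C] by (simp add: U_simps(1))
next
  case (Suc n)
  note hc = U_D(1)[OF Suc.prems]
  show ?case
  proof (cases n)
    case 0
    then have "R h \<ominus> h = \<zero>" using R2 Suc.prems hc by simp
    then show ?thesis using U_D(2) by (simp only:)
  next
    case (Suc m)
    have RU: "R h \<in> U k" if "h \<in> U k" for h k
      by (rule coalgebra_map_U[OF R _ _ that]) (use R2 U_mono_Suc Rc in auto)
    note RD = linear_mapD[OF R]
    show ?thesis
    proof (subst U_Suc_iff, intro conjI allI impI)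
      show "R h \<ominus> h \<in> carrier H" using RD(1) hc by auto
      fix a b assume ab: "perp (U (Suc 0)) a" "perp (U n) b"
      note fn = perpD(1)[OF ab(1)] perpD(1)[OF ab(2)]
      note aD = functionalD[OF fn(1)] and bD = functionalD[OF fn(2)]
      let ?a = "\<lambda>x. a (R x)" and ?b = "\<lambda>x. b (R x)"
      have fR: "fnl ?a" "fnl ?b" using functional_comp[OF R] fn by auto
      define da where "da x = a (R x \<ominus> x)" for x
      define db where "db x = b (R x \<ominus> x)" for x
      have lin: "linear_map K H H (\<lambda>x. R x \<ominus> x)"
        using RD by (intro linear_mapI)
          (auto simp: a_minus_def smult_r_distr smult_r_minus A.minus_add A.a_ac)
      have fd: "fnl da" "fnl db" unfolding da_def db_def using functional_comp[OF lin] fn by auto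
      have "perp (U (Suc (Suc 0))) da"
      proof -
        have "da x = 0\<^sub>K" if "x \<in> U (Suc (Suc 0))" for x
        proof -
          have "R x \<ominus> x = \<zero>" using R2[OF that] U_D(1)[OF that] by simp
          then show ?thesis using fnl_zero[OF fn(1)] by (simp only: da_def)
        qed
        then show ?thesis using fd(1) by (simp add: perp_def)
      qed
      moreover have "perp (U n) ?b" using fR ab(2) RU by (auto simp: perp_def)
      moreover have "perp (U (Suc n)) db"
        using fd(2) perpD(2)[OF ab(2)] Suc.IH by (auto simp: perp_def db_def)
      ultimately have z: "cnv da ?b h = 0\<^sub>K" "cnv a db h = 0\<^sub>K"
        using Suc.prems U_add_iff[of h "Suc (Suc 0)" n] U_add_iff[of h "Suc 0" "Suc n"] ab(1) by auto
      have "cnv ?a ?b h = cnv (\<lambda>x. da x +\<^sub>K a x) ?b h"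
      proof (rule conv_cong[OF fR hc])
        fix x assume x: "x \<in> carrier H"
        have "a (R x) = a ((R x \<ominus> x) \<oplus> x)" using x RD module_minus_simps(3)[OF mod_C] by simp
        then show "a (R x) = da x +\<^sub>K a x" using x RD aD by (simp add: da_def)
      qed simp
      also have "\<dots> = cnv a ?b h" using z aD(1) bD(1) RD hc functionalD(1)[OF conv_fnl[OF fn(1) fR(2)] hc]
        by (simp add: conv_add_left[OF fd(1) fn(1) fR(2) hc])
      also have "\<dots> = cnv a (\<lambda>x. db x +\<^sub>K b x) h"
      proof (rule conv_cong[OF fn(1) fR(2) hc])
        fix x assume x: "x \<in> carrier H"
        have "b (R x) = b ((R x \<ominus> x) \<oplus> x)" using x RD module_minus_simps(3)[OF mod_C] by simp
        then show "b (R x) = db x +\<^sub>K b x" using x RD bD by (simp add: db_def)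
      qed simp
      also have "\<dots> = cnv a b h" using z functionalD(1)[OF conv_fnl[OF fn] hc]
        by (simp add: conv_add_right[OF fn(1) fd(2) fn(2) hc])
      finally have "cnv a b (R h) = cnv a b h" using Rc[OF fn hc] by simp
      then show "cnv a b (R h \<ominus> h) = 0\<^sub>K"
        using functional_minus[OF field_K mod_C conv_fnl[OF fn] RD(1)[OF hc] hc] functionalD(1)[OF conv_fnl[OF fn] hc]
        by simp
    qed
  qed
qed

section \<open>Skew primitive elements and the powers of the squared antipode\<close>

lemma finite_support_list:
  assumes "\<And>p. p \<in> set ts \<Longrightarrow> f p \<in> U (Suc 0)"
  shows "\<exists>F. finite F \<and> F \<subseteq> GL \<and> (\<forall>p\<in>set ts. f p \<in> span_of K H F)"
  using assms
proof (induction ts)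
  case Nil
  then show ?case by (intro exI[of _ "{}"]) auto
next
  case (Cons p ts)
  then obtain F where F: "finite F" "F \<subseteq> GL" "\<forall>p\<in>set ts. f p \<in> span_of K H F" by auto
  obtain F' where F': "finite F'" "F' \<subseteq> GL" "f p \<in> span_of K H F'"
    using span_of_finite[OF mod_C GL_sub, of "f p"] Cons.prems[of p] by (auto simp: U1_span)
  have "span_of K H F \<subseteq> span_of K H (F \<union> F')" "span_of K H F' \<subseteq> span_of K H (F \<union> F')"
    using F(2) F'(2) GL_sub by (intro span_of_mono[OF mod_C]; blast)+
  then show ?case using F F' by (intro exI[of _ "F \<union> F'"]) auto
qed

text \<open>The coradical factors in a representation of \<Delta>(h) involve only finitely many
  group-likes. The confinement to F prepares for functionals that are 1 at one group-like and 0 at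
  the others, which are constructed for finite sets.\<close>

lemma U2_finite_support:
  assumes "h \<in> U (Suc (Suc 0))"
  obtains F where "finite F" "F \<subseteq> GL"
    "\<And>f g. \<lbrakk>fnl f; fnl g; \<And>x. x \<in> F \<Longrightarrow> f x = 0\<^sub>K; \<And>x. x \<in> F \<Longrightarrow> g x = 0\<^sub>K\<rbrakk> \<Longrightarrow> cnv f g h = 0\<^sub>K"
proof -
  have hc: "h \<in> carrier H" by (rule U_D(1)[OF assms])
  have c0: "U (Suc 0) = coradical K H" by (simp add: U_simps)
  note s0 = U_submodule[of "Suc 0"]
  note iff = tensor_sub_iff[OF field_K mod_C]
  have "comult H h \<in> tensor_sub K H (carrier H) (U (Suc 0)) <+>\<^bsub>CC\<^esub> tensor_sub K H (U (Suc 0)) (carrier H)"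
    using assms by (simp add: U_simps(2) c0)
  then obtain A B where AB: "comult H h = A \<oplus>\<^bsub>CC\<^esub> B" "A \<in> tensor_sub K H (carrier H) (U (Suc 0))"
    "B \<in> tensor_sub K H (U (Suc 0)) (carrier H)" unfolding set_add_def' by blast
  obtain ts us where tu: "set ts \<subseteq> carrier H \<times> U (Suc 0)" "A = CC.tsum ts"
    "set us \<subseteq> U (Suc 0) \<times> carrier H" "B = CC.tsum us"
    using AB(2,3) unfolding iff[OF carrier_is_submodule s0] iff[OF s0 carrier_is_submodule] by blast
  obtain F where F: "finite F" "F \<subseteq> GL" "\<forall>p\<in>set ts. snd p \<in> span_of K H F"
    using finite_support_list[of ts snd] tu(1) by (metis mem_Sigma_iff prod.collapse subsetD)
  obtain F' where F': "finite F'" "F' \<subseteq> GL" "\<forall>p\<in>set us. fst p \<in> span_of K H F'"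
    using finite_support_list[of us fst] tu(3) by (metis mem_Sigma_iff prod.collapse subsetD)
  let ?X = "span_of K H (F \<union> F')"
  have FH: "F \<union> F' \<subseteq> carrier H" using F F' GL_sub by blast
  have sX: "submodule ?X K H" by (rule span_of_submodule(1)[OF mod_C FH])
  have "span_of K H F \<subseteq> ?X" "span_of K H F' \<subseteq> ?X"
    using FH by (intro span_of_mono[OF mod_C]; blast)+
  then have "set ts \<subseteq> carrier H \<times> ?X" "set us \<subseteq> ?X \<times> carrier H" using F F' tu by auto
  then have "A \<in> tensor_sub K H (carrier H) ?X" "B \<in> tensor_sub K H ?X (carrier H)"
    using tu(2,4) unfolding iff[OF carrier_is_submodule sX] iff[OF sX carrier_is_submodule] by blast+
  then have "comult H h \<in> tensor_sub K H (carrier H) ?X <+>\<^bsub>CC\<^esub> tensor_sub K H ?X (carrier H)"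
    unfolding set_add_def' AB(1) by blast
  then have w: "\<forall>f g. fnl f \<longrightarrow> fnl g \<longrightarrow> (\<forall>x\<in>?X. f x = 0\<^sub>K) \<longrightarrow> (\<forall>y\<in>?X. g y = 0\<^sub>K) \<longrightarrow> tensor_pair K f g (comult H h) = 0\<^sub>K"
    unfolding wedge_iff[OF field_K mod_C sX sX comult_closed[OF hc]] .
  show thesis
  proof (rule that[of "F \<union> F'"])
    fix f g assume fg: "fnl f" "fnl g" "\<And>x. x \<in> F \<union> F' \<Longrightarrow> f x = 0\<^sub>K" "\<And>x. x \<in> F \<union> F' \<Longrightarrow> g x = 0\<^sub>K"
    then show "cnv f g h = 0\<^sub>K"
      using w functional_span_zero[OF field_K mod_C fg(1) FH fg(3)]
        functional_span_zero[OF field_K mod_C fg(2) FH fg(4)] by (simp add: conv_def)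
  qed (use F F' in auto)
qed

text \<open>Group-like elements are characters of the dual algebra, so products of functionals that separate
  two of them are delta functions on a finite set.\<close>

lemma GL_delta:
  assumes "finite F" "F \<subseteq> GL" "g \<in> GL"
  shows "\<exists>e. fnl e \<and> e g = 1\<^sub>K \<and> (\<forall>g'\<in>F. g' \<noteq> g \<longrightarrow> e g' = 0\<^sub>K)"
  using assms(1,2)
proof (induction F rule: finite_induct)
  case empty
  then show ?case using eps_fnl eps_GL[OF assms(3)] by blast
next
  case (insert g' F)
  then obtain e where e: "fnl e" "e g = 1\<^sub>K" "\<forall>g'\<in>F. g' \<noteq> g \<longrightarrow> e g' = 0\<^sub>K" by auto
  show ?case
  proof (cases "g' = g")
    case True
    then show ?thesis using e by blast
  next
    case False
    have gc: "g \<in> carrier H" "g' \<in> carrier H" "g' \<in> GL" using assms(3) insert.prems GL_closed by auto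
    obtain f where f: "fnl f" "f g \<noteq> f g'" using fnl_eqI[OF gc(1,2)] False by blast
    note fD = functionalD[OF f(1)]
    let ?c = "f g +\<^sub>K \<ominus>\<^bsub>K\<^esub> f g'"
    have "?c \<noteq> 0\<^sub>K"
      using f(2) fD(1) gc by (metis K.add.inv_closed K.minus_equality K.minus_minus K.a_comm)
    then have c: "inv\<^bsub>K\<^esub> ?c \<in> carrier K" "inv\<^bsub>K\<^esub> ?c *\<^sub>K ?c = 1\<^sub>K"
      using fD(1) gc K.field_Units by auto
    \<comment> \<open>f - f(g') \<epsilon>, divided by f(g) - f(g'), is 1 at g and 0 at g', as
      \<epsilon> is 1 on group-likes.\<close>
    let ?v = "\<lambda>x. f x +\<^sub>K (\<ominus>\<^bsub>K\<^esub> f g') *\<^sub>K eps x"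
    let ?u = "\<lambda>x. inv\<^bsub>K\<^esub> ?c *\<^sub>K ?v x"
    have v: "fnl ?v" by (intro fnl_add fnl_smult f eps_fnl) (use fD(1) gc in auto)
    have u: "fnl ?u" by (rule fnl_smult[OF v c(1)])
    have u1: "?u g = 1\<^sub>K" "?u g' = 0\<^sub>K"
      using c fD(1) gc eps_GL assms(3) by (auto simp: K.r_neg)
    show ?thesis
    proof (intro exI[of _ "cnv e ?u"] conjI ballI impI)
      show "fnl (cnv e ?u)" by (rule conv_fnl[OF e(1) u])
      show "cnv e ?u g = 1\<^sub>K" using conv_GL[OF e(1) u assms(3)] e(2) u1(1) by simp
      fix y assume y: "y \<in> insert g' F" "y \<noteq> g"
      then have "y \<in> GL" using insert.prems by blast
      then have "cnv e ?u y = e y *\<^sub>K ?u y" "e y \<in> carrier K" "?u y \<in> carrier K"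
        using conv_GL[OF e(1) u] functionalD(1)[OF e(1) GL_closed] functionalD(1)[OF u GL_closed] by auto
      then show "cnv e ?u y = 0\<^sub>K" using y e(3) u1(2) by (cases "y = g'") auto
    qed
  qed
qed

text \<open>The hypothesis \<open>vanish\<close> says \<open>\<Delta>(h) \<in> kF \<otimes> H + H \<otimes> kF\<close>.\<close>

lemma skew_component:
  assumes h: "h \<in> carrier H" and FG: "F \<subseteq> GL"
    and vanish: "\<And>f g. \<lbrakk>fnl f; fnl g; \<And>x. x \<in> F \<Longrightarrow> f x = 0\<^sub>K; \<And>x. x \<in> F \<Longrightarrow> g x = 0\<^sub>K\<rbrakk> \<Longrightarrow> cnv f g h = 0\<^sub>K"
    and g: "g \<in> GL" and e: "fnl e" "\<And>x. \<lbrakk>x \<in> F; x \<noteq> g\<rbrakk> \<Longrightarrow> e x = 0\<^sub>K"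
    and g': "g' \<in> GL" and e': "fnl e'" "\<And>x. \<lbrakk>x \<in> F; x \<noteq> g'\<rbrakk> \<Longrightarrow> e' x = 0\<^sub>K"
  obtains y c where "y \<in> carrier H" "comult H y = tens K H H g y \<oplus>\<^bsub>CC\<^esub> tens K H H y g'"
    "c \<in> carrier K" "hit K H e' (hit_right K H h e) = y \<oplus> c \<odot> g"
proof -
  note eD = functionalD[OF e(1)] and eD' = functionalD[OF e'(1)]
  note gc = GL_closed[OF g] and gc' = GL_closed[OF g']
  \<comment> \<open>\<open>Q a b\<close> is the sum of e(h_1) a(h_2) b(h_3) e'(h_4), which is a * b
    at the component h' of h cut out by e and e'. Keeping the four factors visible allows
    \<open>vanish\<close> to be applied to the two halves.\<close>
  define Q where "Q a b = cnv (cnv e a) (cnv b e') h" for a b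
  have Qc: "Q a b \<in> carrier K" if "fnl a" "fnl b" for a b
    unfolding Q_def using functionalD(1)[OF conv_fnl[OF conv_fnl[OF e(1) that(1)] conv_fnl[OF that(2) e'(1)]] h] .
  have Q1: "Q a b = Q a' b +\<^sub>K r *\<^sub>K Q eps b"
    if "fnl a" "fnl a'" "fnl b" "r \<in> carrier K" "\<And>x. x \<in> carrier H \<Longrightarrow> a x = a' x +\<^sub>K r *\<^sub>K eps x" for a a' b r
  proof -
    note be = conv_fnl[OF that(3) e'(1)] and re = fnl_smult[OF eps_fnl that(4)]
    have "Q a b = cnv (\<lambda>x. cnv e a' x +\<^sub>K r *\<^sub>K cnv e eps x) (cnv b e') h"
      unfolding Q_def
    proof (rule conv_cong[OF conv_fnl[OF e(1) that(1)] be h])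
      fix x assume x: "x \<in> carrier H"
      have "cnv e a x = cnv e (\<lambda>x. a' x +\<^sub>K r *\<^sub>K eps x) x"
        by (rule conv_cong[OF e(1) that(1) x]) (use that(5) in auto)
      then show "cnv e a x = cnv e a' x +\<^sub>K r *\<^sub>K cnv e eps x"
        using conv_add_right[OF e(1) that(2) re x] conv_smult_right[OF e(1) eps_fnl that(4) x] by simp
    qed simp
    also have "\<dots> = Q a' b +\<^sub>K r *\<^sub>K Q eps b"
      unfolding Q_def conv_add_left[OF conv_fnl[OF e(1) that(2)] fnl_smult[OF conv_fnl[OF e(1) eps_fnl] that(4)] be h]
        conv_smult_left[OF conv_fnl[OF e(1) eps_fnl] be that(4) h] ..
    finally show ?thesis .
  qed
  have Q2: "Q a b = Q a b' +\<^sub>K r *\<^sub>K Q a eps"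
    if "fnl a" "fnl b" "fnl b'" "r \<in> carrier K" "\<And>x. x \<in> carrier H \<Longrightarrow> b x = b' x +\<^sub>K r *\<^sub>K eps x" for a b b' r
  proof -
    note ea = conv_fnl[OF e(1) that(1)] and re = fnl_smult[OF eps_fnl that(4)]
    have "Q a b = cnv (cnv e a) (\<lambda>x. cnv b' e' x +\<^sub>K r *\<^sub>K cnv eps e' x) h"
      unfolding Q_def
    proof (rule conv_cong[OF ea conv_fnl[OF that(2) e'(1)] h])
      fix x assume x: "x \<in> carrier H"
      have "cnv b e' x = cnv (\<lambda>x. b' x +\<^sub>K r *\<^sub>K eps x) e' x"
        by (rule conv_cong[OF that(2) e'(1) x]) (use that(5) in auto)
      then show "cnv b e' x = cnv b' e' x +\<^sub>K r *\<^sub>K cnv eps e' x"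
        using conv_add_left[OF that(3) re e'(1) x] conv_smult_left[OF eps_fnl e'(1) that(4) x] by simp
    qed simp
    also have "\<dots> = Q a b' +\<^sub>K r *\<^sub>K Q a eps"
      unfolding Q_def conv_add_right[OF ea conv_fnl[OF that(3) e'(1)] fnl_smult[OF conv_fnl[OF eps_fnl e'(1)] that(4)] h]
        conv_smult_right[OF ea conv_fnl[OF eps_fnl e'(1)] that(4) h] ..
    finally show ?thesis .
  qed
  \<comment> \<open>If a(g) = 0 and b(g') = 0, then e * a and b * e' vanish on all of F.\<close>
  have Q0: "Q a b = 0\<^sub>K" if "fnl a" "fnl b" "a g = 0\<^sub>K" "b g' = 0\<^sub>K" for a b
    unfolding Q_def
  proof (rule vanish[OF conv_fnl[OF e(1) that(1)] conv_fnl[OF that(2) e'(1)]])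
    fix x assume x: "x \<in> F"
    then have xG: "x \<in> GL" using FG by blast
    have c: "a x \<in> carrier K" "b x \<in> carrier K" "e x \<in> carrier K" "e' x \<in> carrier K"
      using functionalD(1)[OF that(1)] functionalD(1)[OF that(2)] eD(1) eD'(1) GL_closed[OF xG] by auto
    show "cnv e a x = 0\<^sub>K" using conv_GL[OF e(1) that(1) xG] e(2)[OF x] that(3) c by (cases "x = g") auto
    show "cnv b e' x = 0\<^sub>K" using conv_GL[OF that(2) e'(1) xG] e'(2)[OF x] that(4) c by (cases "x = g'") auto
  qed
  define h' where "h' = hit K H e' (hit_right K H h e)"
  have h'c: "h' \<in> carrier H" unfolding h'_def by (intro hit_closed hit_right_closed e e' h)
  have fh': "f h' = cnv e (cnv f e') h" if "fnl f" for f
    unfolding h'_def using that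
    by (simp add: fnl_hit[OF that e'(1)] hit_right_closed e(1) h fnl_hit_right[OF conv_fnl[OF that e'(1)] e(1) h])
  have Qeps1: "Q eps v = v h'" if "fnl v" for v
    unfolding Q_def fh'[OF that]
    by (rule conv_cong[OF conv_fnl[OF e(1) eps_fnl] conv_fnl[OF that e'(1)] h])
      (simp_all add: conv_eps(2)[OF e(1)])
  have Qeps2: "Q u eps = u h'" if "fnl u" for u
  proof -
    have "Q u eps = cnv (cnv e u) e' h"
      unfolding Q_def
      by (rule conv_cong[OF conv_fnl[OF e(1) that] conv_fnl[OF eps_fnl e'(1)] h])
        (simp_all add: conv_eps(1)[OF e'(1)])
    then show ?thesis using conv_assoc[OF e(1) that e'(1) h] fh'[OF that] by simp
  qed
  have Qconv: "cnv u v h' = Q u v" if "fnl u" "fnl v" for u v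
  proof -
    have "cnv u v h' = cnv e (cnv (cnv u v) e') h" by (rule fh'[OF conv_fnl[OF that]])
    also have "\<dots> = cnv e (cnv u (cnv v e')) h"
      by (rule conv_cong[OF e(1) conv_fnl[OF conv_fnl[OF that] e'(1)] h]) (simp_all add: conv_assoc that e'(1))
    also have "\<dots> = Q u v"
      unfolding Q_def by (rule conv_assoc[symmetric, OF e(1) that(1) conv_fnl[OF that(2) e'(1)] h])
    finally show ?thesis .
  qed
  \<comment> \<open>c is \<epsilon>(h'). Subtracting c g gives y counit 0, which the skew primitive
    form of \<Delta>(y) demands.\<close>
  define c where "c = Q eps eps"
  have cc: "c \<in> carrier K" unfolding c_def by (rule Qc[OF eps_fnl eps_fnl])
  define y where "y = h' \<ominus> c \<odot> g"
  have yc: "y \<in> carrier H" using h'c cc gc by (simp add: y_def)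
  have tc: "tens K H H g y \<in> carrier CC" "tens K H H y g' \<in> carrier CC"
    using bilinear_mapD(3)[OF CC.tens_bilinear] gc gc' yc by auto
  have "comult H y = tens K H H g y \<oplus>\<^bsub>CC\<^esub> tens K H H y g'"
  proof (rule comult_eqI[OF yc])
    show "tens K H H g y \<oplus>\<^bsub>CC\<^esub> tens K H H y g' \<in> carrier CC"
      using tc module.axioms(2)[OF mod_CC] by (simp add: abelian_group.axioms(1) abelian_monoid.a_closed)
    fix u v assume uv: "fnl u" "fnl v"
    note uD = functionalD[OF uv(1)] and vD = functionalD[OF uv(2)]
    \<comment> \<open>Splitting u = ?u + u(g) \<epsilon> and v = ?v + v(g') \<epsilon> leaves, by
      \<open>Q0\<close>, only terms with \<epsilon> on at least one side.\<close>
    let ?u = "\<lambda>x. u x +\<^sub>K (\<ominus>\<^bsub>K\<^esub> u g) *\<^sub>K eps x" and ?v = "\<lambda>x. v x +\<^sub>K (\<ominus>\<^bsub>K\<^esub> v g') *\<^sub>K eps x"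
    have u0: "fnl ?u" "fnl ?v" using uD vD gc gc' by (auto intro!: fnl_add fnl_smult eps_fnl uv)
    have z: "?u g = 0\<^sub>K" "?v g' = 0\<^sub>K" using uD vD gc gc' eps_GL g g' by (auto simp: K.r_neg)
    have ux: "u x = ?u x +\<^sub>K u g *\<^sub>K eps x" if "x \<in> carrier H" for x
      using uD(1)[OF that] uD(1)[OF gc] eps_closed[OF that] by (simp add: K.a_assoc K.l_minus K.l_neg)
    have vx: "v x = ?v x +\<^sub>K v g' *\<^sub>K eps x" if "x \<in> carrier H" for x
      using vD(1)[OF that] vD(1)[OF gc'] eps_closed[OF that] by (simp add: K.a_assoc K.l_minus K.l_neg)
    have k: "u g \<in> carrier K" "v g' \<in> carrier K" "v g \<in> carrier K" "u h' \<in> carrier K" "v h' \<in> carrier K"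
      "Q ?u eps \<in> carrier K" "cnv u v h' \<in> carrier K" "u y \<in> carrier K" "v y \<in> carrier K"
      using uD(1) vD(1) gc gc' h'c yc Qc u0 eps_fnl functionalD(1)[OF conv_fnl[OF uv] h'c] by auto
    have "u h' = Q ?u eps +\<^sub>K u g *\<^sub>K c"
      using Q1[OF uv(1) u0(1) eps_fnl k(1) ux] Qeps2[OF uv(1)] by (simp add: c_def)
    then have q: "Q ?u eps = u h' \<ominus>\<^bsub>K\<^esub> u g *\<^sub>K c"
      using k cc by (simp add: a_minus_def K.a_assoc K.r_neg)
    have "cnv u v h' = Q ?u v +\<^sub>K u g *\<^sub>K v h'"
      using Q1[OF uv(1) u0(1) uv(2) k(1) ux] Qconv[OF uv] Qeps1[OF uv(2)] by simp
    also have "Q ?u v = v g' *\<^sub>K Q ?u eps"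
      using Q2[OF u0(1) uv(2) u0(2) k(2) vx] Q0[OF u0 z] k by simp
    finally have uvh: "cnv u v h' = v g' *\<^sub>K (u h' \<ominus>\<^bsub>K\<^esub> u g *\<^sub>K c) +\<^sub>K u g *\<^sub>K v h'" by (simp only: q)
    note mn = functional_minus[OF field_K mod_C _ h'c smult_closed[OF cc gc]]
    have "cnv u v y = cnv u v h' \<ominus>\<^bsub>K\<^esub> c *\<^sub>K (u g *\<^sub>K v g)"
      unfolding y_def mn[OF conv_fnl[OF uv]] functionalD(3)[OF conv_fnl[OF uv] cc gc] conv_GL[OF uv g] ..
    moreover have "u y = u h' \<ominus>\<^bsub>K\<^esub> c *\<^sub>K u g" "v y = v h' \<ominus>\<^bsub>K\<^esub> c *\<^sub>K v g"
      unfolding y_def using mn[OF uv(1)] mn[OF uv(2)] uD(3)[OF cc gc] vD(3)[OF cc gc] by auto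
    moreover have "tensor_pair K u v (tens K H H g y \<oplus>\<^bsub>CC\<^esub> tens K H H y g') = u g *\<^sub>K v y +\<^sub>K u y *\<^sub>K v g'"
      using functionalD(2)[OF CC.tensor_pair_functional[OF uv] tc]
        CC.tensor_pair_tens[OF uv gc yc] CC.tensor_pair_tens[OF uv yc gc'] by simp
    ultimately show "cnv u v y = tensor_pair K u v (tens K H H g y \<oplus>\<^bsub>CC\<^esub> tens K H H y g')"
      using k(1-5) cc uvh
      by (simp add: a_minus_def K.r_distr K.l_distr K.r_minus K.l_minus K.minus_add K.m_ac K.a_ac)
  qed
  moreover have "h' = y \<oplus> c \<odot> g" using module_minus_simps(3)[OF mod_C h'c, of "c \<odot> g"] cc gc by (simp add: y_def)
  ultimately show thesis using that yc cc by (simp add: h'_def)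
qed

section \<open>The theorem of Taft and Wilson\<close>

definition fnl_sum :: "('h \<Rightarrow> 'h \<Rightarrow> 'k) \<Rightarrow> 'h list \<Rightarrow> 'h \<Rightarrow> 'k" where
  "fnl_sum e gs = (\<lambda>x. lsum K (\<lambda>g. e g x) gs)"

lemma fnl_sum_fnl: "(\<And>g. g \<in> set gs \<Longrightarrow> fnl (e g)) \<Longrightarrow> fnl (fnl_sum e gs)"
proof (induction gs)
  case Nil
  show ?case by (rule functionalI) (auto simp: fnl_sum_def)
next
  case (Cons g gs)
  then show ?case using fnl_add[of "e g" "fnl_sum e gs"] by (simp add: fnl_sum_def)
qed

lemma fnl_sum_Nil:
  assumes "fnl f" "h \<in> carrier H"
  shows "cnv f (fnl_sum e []) h = 0\<^sub>K" "cnv (fnl_sum e []) f h = 0\<^sub>K"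
proof -
  have z: "fnl (\<lambda>x. 0\<^sub>K)" by (rule functionalI) auto
  show "cnv f (fnl_sum e []) h = 0\<^sub>K" "cnv (fnl_sum e []) f h = 0\<^sub>K"
    using conv_smult_right[OF assms(1) z K.zero_closed assms(2)] conv_smult_left[OF z assms(1) K.zero_closed assms(2)]
      functionalD(1)[OF conv_fnl[OF assms(1) z] assms(2)] functionalD(1)[OF conv_fnl[OF z assms(1)] assms(2)]
    by (simp_all add: fnl_sum_def)
qed

lemma fnl_sum_Cons: "fnl_sum e (g # gs) = (\<lambda>x. e g x +\<^sub>K fnl_sum e gs x)"
  by (simp add: fnl_sum_def)

lemma conv_fnl_sum_right_zero:
  "\<lbrakk>\<And>g. g \<in> set gs \<Longrightarrow> fnl (e g); fnl f; h \<in> carrier H; \<And>g. g \<in> set gs \<Longrightarrow> cnv f (e g) h = 0\<^sub>K\<rbrakk>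
    \<Longrightarrow> cnv f (fnl_sum e gs) h = 0\<^sub>K"
proof (induction gs)
  case (Cons g gs)
  then have "fnl (e g)" "fnl (fnl_sum e gs)" using fnl_sum_fnl[of gs e] by auto
  then show ?case unfolding fnl_sum_Cons using conv_add_right[of f "e g" "fnl_sum e gs" h] Cons by simp
qed (simp add: fnl_sum_Nil)

lemma conv_fnl_sum_left_zero:
  "\<lbrakk>\<And>g. g \<in> set gs \<Longrightarrow> fnl (e g); fnl f; h \<in> carrier H; \<And>g. g \<in> set gs \<Longrightarrow> cnv (e g) f h = 0\<^sub>K\<rbrakk>
    \<Longrightarrow> cnv (fnl_sum e gs) f h = 0\<^sub>K"
proof (induction gs)
  case (Cons g gs)
  then have "fnl (e g)" "fnl (fnl_sum e gs)" using fnl_sum_fnl[of gs e] by auto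
  then show ?case unfolding fnl_sum_Cons using conv_add_left[of "e g" "fnl_sum e gs" f h] Cons by simp
qed (simp add: fnl_sum_Nil)

text \<open>Taft--Wilson: \<open>H\<^sub>1\<close> is spanned by \<open>H\<^sub>0\<close> and the skew primitive elements.\<close>

lemma taft_wilson:
  assumes h: "h \<in> U (Suc (Suc 0))" and D: "submodule D K H" and GD: "GL \<subseteq> D"
    and skew: "\<And>g g' y. \<lbrakk>g \<in> GL; g' \<in> GL; y \<in> carrier H; comult H y = tens K H H g y \<oplus>\<^bsub>CC\<^esub> tens K H H y g'\<rbrakk> \<Longrightarrow> y \<in> D"
  shows "h \<in> D"
proof (rule perp_perp[OF field_K mod_C D])
  have hc: "h \<in> carrier H" by (rule U_D(1)[OF h])
  then show "h \<in> carrier H" .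
  fix f assume f: "fnl f" and fD: "\<forall>y\<in>D. f y = 0\<^sub>K"
  obtain F where F: "finite F" "F \<subseteq> GL"
    and vanish: "\<And>f g. \<lbrakk>fnl f; fnl g; \<And>x. x \<in> F \<Longrightarrow> f x = 0\<^sub>K; \<And>x. x \<in> F \<Longrightarrow> g x = 0\<^sub>K\<rbrakk> \<Longrightarrow> cnv f g h = 0\<^sub>K"
    using U2_finite_support[OF h] by blast
  obtain e where e: "\<And>g. g \<in> F \<Longrightarrow> fnl (e g)" "\<And>g. g \<in> F \<Longrightarrow> e g g = 1\<^sub>K"
    "\<And>g x. \<lbrakk>g \<in> F; x \<in> F; x \<noteq> g\<rbrakk> \<Longrightarrow> e g x = 0\<^sub>K"
    using GL_delta[OF F] F(2) by (metis subsetD)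
  obtain gs where gs: "set gs = F" "distinct gs" using finite_distinct_list[OF F(1)] by blast
  let ?E = "fnl_sum e gs"
  \<comment> \<open>E is the sum of the delta functionals of F, and r = \<epsilon> - E vanishes on
    F, as does f. In f = \<epsilon> * f * \<epsilon> the terms containing r therefore vanish at h,
    and what remains is f on the components cut out by pairs of delta functionals.\<close>
  let ?r = "\<lambda>x. eps x +\<^sub>K (\<ominus>\<^bsub>K\<^esub> 1\<^sub>K) *\<^sub>K ?E x"
  have E: "fnl ?E" using fnl_sum_fnl e(1) gs(1) by blast
  have r: "fnl ?r" by (intro fnl_add fnl_smult eps_fnl E) auto
  have FH: "x \<in> carrier H" if "x \<in> F" for x using that F(2) GL_closed by blast
  have E1: "?E x = 1\<^sub>K" if "x \<in> F" for x
  proof -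
    have "lsum K (\<lambda>g. e g x) gs = (if x \<in> set gs then 1\<^sub>K else 0\<^sub>K)" if "set gs \<subseteq> F" "distinct gs" "x \<in> F" for gs
      using that
    proof (induction gs)
      case (Cons a gs)
      then show ?case using e(2)[of a] e(3)[of a x] by (cases "x = a") auto
    qed simp
    then show ?thesis using gs that by (simp add: fnl_sum_def)
  qed
  have r0: "?r x = 0\<^sub>K" if "x \<in> F" for x
    using E1[OF that] eps_GL that F(2) by (auto simp: K.r_neg subset_iff)
  have epsE: "eps x = ?E x +\<^sub>K ?r x" if "x \<in> carrier H" for x
    using functionalD(1)[OF E that] eps_closed[OF that] by (simp add: K.l_minus K.a_ac K.r_neg K.r_neg1 K.r_neg2)
  have f0: "f x = 0\<^sub>K" if "x \<in> F" for x using that F(2) GD fD by blast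
  have "cnv f (e g') h = 0\<^sub>K" if g': "g' \<in> F" for g'
  proof -
    note fe = conv_fnl[OF f e(1)[OF g']]
    have fe0: "cnv f (e g') x = 0\<^sub>K" if "x \<in> F" for x
      using conv_GL[OF f e(1)[OF g']] that F(2) f0[OF that] functionalD(1)[OF e(1)[OF g'] FH[OF that]] by auto
    have "cnv (e g) (cnv f (e g')) h = 0\<^sub>K" if g: "g \<in> set gs" for g
    proof -
      have gF: "g \<in> F" "g \<in> GL" "g' \<in> GL" using g gs(1) F(2) g' by auto
      obtain y c where y: "y \<in> carrier H" "comult H y = tens K H H g y \<oplus>\<^bsub>CC\<^esub> tens K H H y g'"
        "c \<in> carrier K" "hit K H (e g') (hit_right K H h (e g)) = y \<oplus> c \<odot> g"
        by (rule skew_component[OF hc F(2) vanish gF(2) e(1)[OF gF(1)] e(3)[OF gF(1)] gF(3) e(1)[OF g'] e(3)[OF g']])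
      have "y \<in> D" by (rule skew[OF gF(2,3) y(1,2)])
      moreover have "c \<odot> g \<in> D" by (rule submoduleD(6)[OF mod_C D y(3)]) (use GD gF(2) in blast)
      ultimately have "y \<oplus> c \<odot> g \<in> D" by (rule submoduleD(3)[OF mod_C D])
      then have "f (hit K H (e g') (hit_right K H h (e g))) = 0\<^sub>K" using fD y(4) by simp
      then show ?thesis
        using fnl_hit[OF f e(1)[OF g'] hit_right_closed[OF e(1)[OF gF(1)] hc]] fnl_hit_right[OF fe e(1)[OF gF(1)] hc] by simp
    qed
    then have 1: "cnv ?E (cnv f (e g')) h = 0\<^sub>K"
      using conv_fnl_sum_left_zero[of gs e, OF _ fe hc] e(1) gs(1) by blast
    have 2: "cnv ?r (cnv f (e g')) h = 0\<^sub>K" by (rule vanish[OF r fe r0 fe0])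
    have "cnv f (e g') h = cnv eps (cnv f (e g')) h" by (rule conv_eps(1)[symmetric, OF fe hc])
    also have "\<dots> = cnv (\<lambda>x. ?E x +\<^sub>K ?r x) (cnv f (e g')) h"
      by (rule conv_cong[OF eps_fnl fe hc epsE refl])
    also have "\<dots> = 0\<^sub>K" unfolding conv_add_left[OF E r fe hc] 1 2 by simp
    finally show ?thesis .
  qed
  then have 1: "cnv f ?E h = 0\<^sub>K"
    using conv_fnl_sum_right_zero[of gs e, OF _ f hc] e(1) gs(1) by blast
  have 2: "cnv f ?r h = 0\<^sub>K" by (rule vanish[OF f r f0 r0])
  have "f h = cnv f eps h" by (rule conv_eps(2)[symmetric, OF f hc])
  also have "\<dots> = cnv f (\<lambda>x. ?E x +\<^sub>K ?r x) h" by (rule conv_cong[OF f eps_fnl hc refl epsE])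
  also have "\<dots> = 0\<^sub>K" unfolding conv_add_right[OF f E r hc] 1 2 by simp
  finally show "f h = 0\<^sub>K" .
qed

section \<open>The squared antipode on skew primitive elements\<close>

abbreviation "P \<equiv> skew_primitives K H"

lemma sw_two:
  assumes "module K Z" "bilinear_map K H H Z b" "a \<in> carrier H" "a' \<in> carrier H" "c \<in> carrier H" "c' \<in> carrier H"
    "comult H h = tens K H H a a' \<oplus>\<^bsub>CC\<^esub> tens K H H c c'"
  shows "sw Z b h = b a a' \<oplus>\<^bsub>Z\<^esub> b c c'"
proof -
  note L = linear_mapD[OF CC.tensor_lift_linear[OF assms(1,2)]]
  note t = bilinear_mapD(3)[OF CC.tens_bilinear]
  show ?thesis unfolding sweedler_def assms(7)
    using assms(3-6) by (simp add: L(2) t CC.tensor_lift_tens[OF assms(1,2)])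
qed

lemma skewD: "h \<in> P x \<Longrightarrow> h \<in> carrier H" "h \<in> P x \<Longrightarrow> comult H h = tens K H H h x \<oplus>\<^bsub>CC\<^esub> tens K H H \<one> h"
  by (auto simp: skew_primitives_def)

lemma antipode_skew:
  assumes x: "x \<in> GL" and h: "h \<in> P x"
  shows "S h = \<ominus> (h \<otimes> S x)" "S (S h) = x \<otimes> h \<otimes> S x"
proof -
  note xc = GL_closed[OF x] and hc = skewD(1)[OF h]
  note Sx = S_closed[OF xc] and Sh = S_closed[OF hc]
  have b: "bilinear_map K H H H (\<lambda>a b. S a \<otimes> b)"
    by (intro bilinear_mapI mult_linear1[OF S_linear] mult_linear2[OF linear_map_id] S_closed)
  have be: "bilinear_map K H H H (\<lambda>a b. eps a \<odot> b)"
    by (rule smult_bilinear1[OF eps_fnl mod_C linear_map_id])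
  \<comment> \<open>The counit axiom on \<Delta>(h) = h \<otimes> x + 1 \<otimes> h gives
    \<epsilon>(h) x = 0. So \<epsilon>(h) = 0, and the antipode axiom reads S(h) x + h = 0.\<close>
  have "eps h \<odot> x \<oplus> 1\<^sub>K \<odot> h = h"
    using sw_two[OF mod_C be hc xc A.one_closed hc skewD(2)[OF h]] sw_counit(1)[OF mod_C linear_map_id hc]
    by (simp add: eps_one)
  then have "eps h \<odot> x \<oplus> h = \<zero> \<oplus> h" using hc by simp
  then have "eps h \<odot> x = \<zero>" using hc xc eps_closed[OF hc] A.add.right_cancel[of h "eps h \<odot> x" \<zero>] by simp
  then have "eps (eps h \<odot> x) = 0\<^sub>K" using fnl_zero[OF eps_fnl] by simp
  then have eh: "eps h = 0\<^sub>K"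
    using functionalD(3)[OF eps_fnl eps_closed[OF hc] xc] eps_GL[OF x] eps_closed[OF hc] by simp
  have "S h \<otimes> x \<oplus> h = \<zero>"
    using sw_two[OF mod_C b hc xc A.one_closed hc skewD(2)[OF h]] antipode_left_sw[OF hc] eh hc
    by (simp add: antipode_one)
  then have "S h \<otimes> x = \<ominus> h" using Sh xc hc by (metis A.m_closed A.minus_equality)
  then have "S h \<otimes> x \<otimes> S x = \<ominus> (h \<otimes> S x)" using hc Sx by (simp add: A.l_minus)
  then show S1: "S h = \<ominus> (h \<otimes> S x)"
    using S_GL_inverse(2)[OF x] Sh xc Sx by (simp add: A.m_assoc)
  have "S (S h) = \<ominus> S (h \<otimes> S x)"
    unfolding S1 by (rule linear_map_uminus[OF mod_C mod_C S_linear]) (use hc Sx in auto)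
  also have "\<dots> = \<ominus> (x \<otimes> S h)" using hc Sx by (simp add: antipode_mult SS_GL[OF x])
  also have "\<dots> = x \<otimes> h \<otimes> S x" unfolding S1 using hc Sx xc by (simp add: A.r_minus A.m_assoc)
  finally show "S (S h) = x \<otimes> h \<otimes> S x" .
qed

lemma Spow_linear: "linear_map K H H (S ^^ n)"
proof (induction n)
  case (Suc n)
  then show ?case using linear_map_comp[OF Suc S_linear] by (simp add: o_def)
qed (simp add: linear_map_def)

lemma Spow_closed: "h \<in> carrier H \<Longrightarrow> (S ^^ n) h \<in> carrier H"
  using linear_mapD(1)[OF Spow_linear] .

lemma S2pow_mult: "\<lbrakk>x \<in> carrier H; y \<in> carrier H\<rbrakk> \<Longrightarrow> (S ^^ (2 * m)) (x \<otimes> y) = (S ^^ (2 * m)) x \<otimes> (S ^^ (2 * m)) y"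
  by (induction m) (auto simp: antipode_mult Spow_closed S_closed)

lemma S2pow_GL: "g \<in> GL \<Longrightarrow> (S ^^ (2 * m)) g = g"
  by (induction m) (auto simp: SS_GL)

lemma S2pow_conv:
  "\<lbrakk>fnl f; fnl g; h \<in> carrier H\<rbrakk> \<Longrightarrow>
    cnv f g ((S ^^ (2 * m)) h) = cnv (\<lambda>x. f ((S ^^ (2 * m)) x)) (\<lambda>x. g ((S ^^ (2 * m)) x)) h"
proof (induction m arbitrary: f g)
  case (Suc m)
  have "cnv f g (S (S ((S ^^ (2 * m)) h))) = cnv (\<lambda>x. f (S (S x))) (\<lambda>x. g (S (S x))) ((S ^^ (2 * m)) h)"
    using Suc.prems by (simp add: conv_antipode fnl_antipode Spow_closed S_closed)
  then show ?case
    using Suc.IH[OF fnl_antipode[OF fnl_antipode[OF Suc.prems(1)]] fnl_antipode[OF fnl_antipode[OF Suc.prems(2)]] Suc.prems(3)]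
    by simp
qed simp

lemma pow_GL: "x \<in> GL \<Longrightarrow> x [^] (n::nat) \<in> GL"
  by (induction n) (auto simp: one_GL mult_GL)

text \<open>Inverses of powers of x are written as powers of S(x), so that conjugation can be
  computed with the product of H itself.\<close>

lemma pow_inverse:
  assumes "x \<in> GL"
  shows "x [^] (n::nat) \<otimes> (S x) [^] n = \<one>" "(S x) [^] n \<otimes> x [^] n = \<one>"
proof -
  note c = GL_closed[OF assms] S_closed[OF GL_closed[OF assms]]
  have "x [^] n \<otimes> (S x) [^] n = \<one> \<and> (S x) [^] n \<otimes> x [^] n = \<one>"
  proof (induction n)
    case (Suc n)
    have "x [^] Suc n \<otimes> (S x) [^] Suc n = x [^] n \<otimes> (x \<otimes> S x) \<otimes> (S x) [^] n"
      unfolding A.nat_pow_Suc[of x n] A.nat_pow_Suc2[OF c(2), of n] using c by (simp add: A.m_assoc)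
    moreover have "(S x) [^] Suc n \<otimes> x [^] Suc n = (S x) [^] n \<otimes> (S x \<otimes> x) \<otimes> x [^] n"
      unfolding A.nat_pow_Suc2[OF c(1)] unfolding A.nat_pow_Suc using c by (simp add: A.m_assoc)
    ultimately show ?case using Suc c S_GL_inverse[OF assms] by simp
  qed simp
  then show "x [^] n \<otimes> (S x) [^] n = \<one>" "(S x) [^] n \<otimes> x [^] n = \<one>" by auto
qed

lemma S2pow_skew:
  assumes "x \<in> GL" "h \<in> P x"
  shows "(S ^^ (2 * n)) h = x [^] n \<otimes> h \<otimes> (S x) [^] n"
proof (induction n)
  case (Suc n)
  note xc = GL_closed[OF assms(1)] and hc = skewD(1)[OF assms(2)]
  note Sx = S_closed[OF xc]
  have SS: "S (S (a \<otimes> b)) = S (S a) \<otimes> S (S b)" if "a \<in> carrier H" "b \<in> carrier H" for a b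
    using that by (simp add: antipode_mult S_closed)
  have "(S ^^ (2 * Suc n)) h = S (S (x [^] n \<otimes> h \<otimes> (S x) [^] n))" using Suc by simp
  also have "\<dots> = x [^] n \<otimes> (x \<otimes> h \<otimes> S x) \<otimes> (S x) [^] n"
    using xc hc Sx by (simp add: SS SS_GL[OF pow_GL[OF assms(1)]] SS_GL[OF pow_GL[OF S_GL[OF assms(1)]]] antipode_skew(2)[OF assms])
  also have "\<dots> = x [^] Suc n \<otimes> h \<otimes> (S x) [^] Suc n"
    unfolding A.nat_pow_Suc2[OF Sx] unfolding A.nat_pow_Suc using xc hc Sx by (simp add: A.m_assoc)
  finally show ?case .
qed (use skewD(1)[OF assms(2)] in simp)

lemma S2pow_skew_fixed_iff:
  assumes "x \<in> GL" "h \<in> P x"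
  shows "(S ^^ (2 * n)) h = h \<longleftrightarrow> x [^] n \<otimes> h = h \<otimes> x [^] n"
proof -
  note xc = GL_closed[OF assms(1)] and hc = skewD(1)[OF assms(2)]
  note Sx = S_closed[OF xc]
  show ?thesis unfolding S2pow_skew[OF assms]
  proof
    assume "x [^] n \<otimes> h \<otimes> (S x) [^] n = h"
    then have "h \<otimes> x [^] n = x [^] n \<otimes> h \<otimes> ((S x) [^] n \<otimes> x [^] n)"
      using xc hc Sx by (metis A.m_assoc A.m_closed A.nat_pow_closed)
    then show "x [^] n \<otimes> h = h \<otimes> x [^] n" using pow_inverse(2)[OF assms(1)] xc hc by simp
  next
    assume "x [^] n \<otimes> h = h \<otimes> x [^] n"
    then show "x [^] n \<otimes> h \<otimes> (S x) [^] n = h"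
      using pow_inverse(1)[OF assms(1)] xc hc Sx by (simp add: A.m_assoc)
  qed
qed

text \<open>For m > 0 this says that every index a_x is finite and divides m, by
  \<open>conj_index_dvd_iff\<close>; the least such m is m_H.\<close>

definition commuting_exponent :: "nat \<Rightarrow> bool" where
  "commuting_exponent m \<longleftrightarrow> (\<forall>x\<in>GL. \<forall>h\<in>P x. x [^] m \<otimes> h = h \<otimes> x [^] m)"

lemma commuting_exponent_iff: "commuting_exponent m \<longleftrightarrow> (\<forall>x\<in>GL. \<forall>h\<in>P x. (S ^^ (2 * m)) h = h)"
  using S2pow_skew_fixed_iff by (auto simp: commuting_exponent_def)

lemma S2pow_fixes_U2:
  assumes "commuting_exponent m" "h \<in> U (Suc (Suc 0))"
  shows "(S ^^ (2 * m)) h = h"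
proof -
  let ?T = "S ^^ (2 * m)" and ?D = "{x \<in> carrier H. (S ^^ (2 * m)) x = x}"
  have "h \<in> ?D"
  proof (rule taft_wilson[OF assms(2) fixed_submodule[OF Spow_linear]])
    show "GL \<subseteq> ?D" using S2pow_GL GL_closed by blast
    fix g g' y
    assume g: "g \<in> GL" "g' \<in> GL" and y: "y \<in> carrier H" "comult H y = tens K H H g y \<oplus>\<^bsub>CC\<^esub> tens K H H y g'"
    note c = GL_closed[OF g(1)] GL_closed[OF g(2)] S_closed[OF GL_closed[OF g(1)]]
    note t4 = mult4_bilinear[OF CC.tens_bilinear]
    \<comment> \<open>Translation by S(g), the inverse of g, turns a (g, g')-skew primitive y into
      an element of P_{x,1} with x = S(g) g'. Even powers of S are multiplicative and fix g, so
      fixing z means fixing y = g z.\<close>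
    define z where "z = S g \<otimes> y"
    define x where "x = S g \<otimes> g'"
    have x: "x \<in> GL" unfolding x_def by (intro mult_GL S_GL g)
    have zc: "z \<in> carrier H" using c y by (simp add: z_def)
    have b: "bilinear_map K H H CC (\<lambda>a b. sw CC (\<lambda>c d. tens K H H (a \<otimes> c) (b \<otimes> d)) y)"
      by (intro bilinear_mapI sw_param[OF mod_CC mod_C] y t4(1)
          bilinear_mapD(1)[OF t4(2)] bilinear_mapD(2)[OF t4(2)])
    have "comult H z = tens K H H (S g \<otimes> g) z \<oplus>\<^bsub>CC\<^esub> tens K H H z x"
      unfolding z_def x_def comult_mult[OF c(3) y(1)] sw_GL[OF mod_CC b S_GL[OF g(1)]]
      by (rule sw_two[OF mod_CC t4(1)[OF c(3) c(3)] c(1) y(1) y(1) c(2) y(2)])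
    then have "comult H z = tens K H H z x \<oplus>\<^bsub>CC\<^esub> tens K H H \<one> z"
      using S_GL_inverse(1)[OF g(1)] bilinear_mapD(3)[OF CC.tens_bilinear] zc GL_closed[OF x]
        abelian_monoid.a_comm[OF abelian_group.axioms(1)[OF module.axioms(2)[OF mod_CC]]] by simp
    then have "z \<in> P x" using zc by (simp add: skew_primitives_def)
    then have "?T z = z" using assms(1) x by (auto simp: commuting_exponent_iff)
    moreover have "y = g \<otimes> z" unfolding z_def using c y(1) S_GL_inverse(2)[OF g(1)] by (simp add: A.m_assoc[symmetric])
    ultimately show "y \<in> ?D" using y(1) c(1) zc by (simp add: S2pow_mult S2pow_GL[OF g(1)])
  qed
  then show ?thesis by blast
qed

lemma S2pow_unipotent:
  assumes "commuting_exponent m" "h \<in> U (Suc n)"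
  shows "(S ^^ (2 * m)) h \<ominus> h \<in> U n"
  by (rule coalgebra_map_unipotent[OF Spow_linear S2pow_fixes_U2[OF assms(1)] S2pow_conv assms(2)])

section \<open>The coradical filtration is exhaustive\<close>

definition W :: "'h set" where "W = (\<Union>n. U n)"

lemma W_submodule: "submodule W K H"
proof (rule submoduleI'[OF mod_C])
  show "W \<subseteq> carrier H" using U_D(1) by (auto simp: W_def)
  show "\<zero> \<in> W" using U_D(2) by (auto simp: W_def)
  fix x y assume "x \<in> W" "y \<in> W"
  then obtain m n where "x \<in> U m" "y \<in> U n" by (auto simp: W_def)
  then have "x \<in> U (max m n)" "y \<in> U (max m n)" using U_mono[of m "max m n"] U_mono[of n "max m n"] by auto
  then have "x \<oplus> y \<in> U (max m n)" by (rule U_D)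
  then show "x \<oplus> y \<in> W" unfolding W_def by blast
next
  fix a x assume a: "a \<in> carrier K" and "x \<in> W"
  then obtain m where "x \<in> U m" by (auto simp: W_def)
  then have "a \<odot> x \<in> U m" by (rule U_D(6)[OF a])
  then show "a \<odot> x \<in> W" unfolding W_def by blast
qed

lemmas W_D = submoduleD[OF mod_C W_submodule]

lemma perp_W_conv: assumes "perp W f" "fnl u" shows "perp W (cnv f u)"
proof -
  have "perp (U n) f" for n using assms(1) by (auto simp: perp_def W_def)
  then have "perp (U n) (cnv f u)" for n using conv_perp assms(2) by blast
  then show ?thesis by (auto simp: perp_def W_def)
qed

lemma hit_W: "\<lbrakk>fnl f; x \<in> W\<rbrakk> \<Longrightarrow> hit K H f x \<in> W"
  using hit_U(1) by (auto simp: W_def)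

section \<open>Left ideals of the dual algebra and subcomodules\<close>

lemma hit_add: "\<lbrakk>fnl u; fnl v; h \<in> carrier H\<rbrakk> \<Longrightarrow> hit K H (\<lambda>x. u x +\<^sub>K v x) h = hit K H u h \<oplus> hit K H v h"
  by (rule fnl_eqI) (simp_all add: hit_closed fnl_add fnl_hit conv_add_right functionalD(2))

lemma hit_smult: "\<lbrakk>fnl u; c \<in> carrier K; h \<in> carrier H\<rbrakk> \<Longrightarrow> hit K H (\<lambda>x. c *\<^sub>K u x) h = c \<odot> hit K H u h"
  by (rule fnl_eqI) (simp_all add: hit_closed fnl_smult fnl_hit conv_smult_right functionalD(3))

text \<open>Closed under convolution from the left, so that the orbit of an element under it is
  again a submodule for \<open>hit\<close>.\<close>

definition left_ideal :: "('h \<Rightarrow> 'k) set \<Rightarrow> bool" where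
  "left_ideal L \<longleftrightarrow> (\<forall>l\<in>L. fnl l) \<and> (\<lambda>x. 0\<^sub>K) \<in> L \<and>
     (\<forall>l\<in>L. \<forall>l'\<in>L. (\<lambda>x. l x +\<^sub>K l' x) \<in> L) \<and>
     (\<forall>c\<in>carrier K. \<forall>l\<in>L. (\<lambda>x. c *\<^sub>K l x) \<in> L) \<and>
     (\<forall>v. \<forall>l\<in>L. fnl v \<longrightarrow> cnv v l \<in> L)"

lemma left_idealD:
  assumes "left_ideal L"
  shows "l \<in> L \<Longrightarrow> fnl l" "(\<lambda>x. 0\<^sub>K) \<in> L"
    "\<lbrakk>l \<in> L; l' \<in> L\<rbrakk> \<Longrightarrow> (\<lambda>x. l x +\<^sub>K l' x) \<in> L"
    "\<lbrakk>c \<in> carrier K; l \<in> L\<rbrakk> \<Longrightarrow> (\<lambda>x. c *\<^sub>K l x) \<in> L"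
    "\<lbrakk>fnl v; l \<in> L\<rbrakk> \<Longrightarrow> cnv v l \<in> L"
  using assms by (auto simp: left_ideal_def)

lemma zero_fnl: "fnl (\<lambda>x. 0\<^sub>K)"
  by (rule functionalI) auto

lemma left_ideal_fnl: "left_ideal {f. fnl f}"
  unfolding left_ideal_def using zero_fnl fnl_add fnl_smult conv_fnl by blast

lemma hit_zero: assumes "h \<in> carrier H" shows "hit K H (\<lambda>x. 0\<^sub>K) h = \<zero>"
proof -
  have "(\<lambda>x::'h. 0\<^sub>K) = (\<lambda>x. 0\<^sub>K *\<^sub>K 0\<^sub>K)" by simp
  then show ?thesis using hit_smult[OF zero_fnl K.zero_closed assms] hit_closed[OF zero_fnl assms] by simp
qed

text \<open>These are the right subcomodules of H, \<Delta>(M) \<subseteq> M \<otimes> H, described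
  as submodules over the dual algebra.\<close>

definition stable :: "'h set \<Rightarrow> bool" where
  "stable M \<longleftrightarrow> submodule M K H \<and> (\<forall>f x. fnl f \<longrightarrow> x \<in> M \<longrightarrow> hit K H f x \<in> M)"

lemma stableD: "stable M \<Longrightarrow> submodule M K H" "\<lbrakk>stable M; fnl f; x \<in> M\<rbrakk> \<Longrightarrow> hit K H f x \<in> M"
  by (auto simp: stable_def)

lemma orbit_stable:
  assumes "left_ideal L" "h \<in> carrier H"
  shows "stable ((\<lambda>l. hit K H l h) ` L)"
  unfolding stable_def
proof (intro conjI allI impI)
  note L = left_idealD[OF assms(1)]
  show "submodule ((\<lambda>l. hit K H l h) ` L) K H"
  proof (rule submoduleI'[OF mod_C])
    show "(\<lambda>l. hit K H l h) ` L \<subseteq> carrier H" using L(1) hit_closed assms(2) by blast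
    show "\<zero> \<in> (\<lambda>l. hit K H l h) ` L" unfolding hit_zero[OF assms(2), symmetric] by (rule imageI[OF L(2)])
    fix x y assume "x \<in> (\<lambda>l. hit K H l h) ` L" "y \<in> (\<lambda>l. hit K H l h) ` L"
    then obtain l l' where l: "x = hit K H l h" "y = hit K H l' h" "l \<in> L" "l' \<in> L" by blast
    then show "x \<oplus> y \<in> (\<lambda>l. hit K H l h) ` L"
      unfolding l(1,2) hit_add[OF L(1)[OF l(3)] L(1)[OF l(4)] assms(2), symmetric]
      by (intro imageI L(3))
  next
    fix c x assume c: "c \<in> carrier K" and "x \<in> (\<lambda>l. hit K H l h) ` L"
    then obtain l where l: "x = hit K H l h" "l \<in> L" by blast
    then show "c \<odot> x \<in> (\<lambda>l. hit K H l h) ` L"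
      unfolding l(1) hit_smult[OF L(1)[OF l(2)] c assms(2), symmetric]
      by (intro imageI L(4) c)
  qed
  fix f x assume f: "fnl f" and "x \<in> (\<lambda>l. hit K H l h) ` L"
  then obtain l where l: "x = hit K H l h" "l \<in> L" by blast
  then show "hit K H f x \<in> (\<lambda>l. hit K H l h) ` L"
    unfolding l(1) hit_hit[OF f L(1)[OF l(2)] assms(2)]
    by (intro imageI L(5) f)
qed

text \<open>Local finiteness: the left factors of a list for \<Delta>(h) span a space containing the
  whole orbit of h.\<close>

lemma orbit_finite:
  assumes "h \<in> carrier H"
  obtains vs where "set vs \<subseteq> carrier H" "\<And>f. fnl f \<Longrightarrow> hit K H f h \<in> adjoin K H {\<zero>} vs"
proof -
  obtain ts where ts: "set ts \<subseteq> carrier H \<times> carrier H" "comult H h = CC.tsum ts"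
    by (rule comult_rep[OF assms])
  have vs: "set (map fst ts) \<subseteq> carrier H" using ts(1) by auto
  note ad = adjoin[OF mod_C zero_submodule[OF mod_C] vs]
  have "hit K H f h \<in> adjoin K H {\<zero>} (map fst ts)" if f: "fnl f" for f
    unfolding hit_def sw_lsum[OF mod_C smult_bilinear2[OF f mod_C linear_map_id] ts]
  proof (rule lsum_submodule[OF mod_C ad(1)])
    fix p assume p: "p \<in> set ts"
    then have "fst p \<in> adjoin K H {\<zero>} (map fst ts)" "snd p \<in> carrier H" using ad(3) ts(1) by auto
    then show "(case p of (a, b) \<Rightarrow> f b \<odot> a) \<in> adjoin K H {\<zero>} (map fst ts)"
      using submoduleD(6)[OF mod_C ad(1)] functionalD(1)[OF f] by (auto simp: split_def)
  qed
  then show thesis using vs that by blast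
qed

lemma list_in_W: "set vs \<subseteq> W \<Longrightarrow> \<exists>n. set vs \<subseteq> U n"
proof (induction vs)
  case (Cons v vs)
  then obtain m n where "set vs \<subseteq> U n" "v \<in> U m" by (auto simp: W_def)
  then have "set (v # vs) \<subseteq> U (max m n)" using U_mono[of m "max m n"] U_mono[of n "max m n"] by auto
  then show ?case by blast
qed auto

text \<open>The orbit of p under the annihilator of H_0 is finitely generated, so lying in the union
  \<open>W\<close> it lies in one \<open>U n\<close>; then p is in the wedge of \<open>U n\<close>
  and H_0.\<close>

lemma W_absorbs:
  assumes p: "p \<in> carrier H" and J: "\<And>j. perp (U (Suc 0)) j \<Longrightarrow> hit K H j p \<in> W"
  shows "p \<in> W"
proof -
  let ?J = "{j. perp (U (Suc 0)) j}"
  have L: "left_ideal ?J"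
    unfolding left_ideal_def
  proof (intro conjI ballI allI impI)
    fix v l assume "l \<in> ?J" "fnl v"
    then show "cnv v l \<in> ?J" using conv_perp1(2) by simp
  qed (auto simp: perp_def zero_fnl fnl_add fnl_smult)
  let ?M = "(\<lambda>l. hit K H l p) ` ?J"
  have sM: "submodule ?M K H" by (rule stableD(1)[OF orbit_stable[OF L p]])
  obtain vs where vs: "set vs \<subseteq> carrier H" "\<And>f. fnl f \<Longrightarrow> hit K H f p \<in> adjoin K H {\<zero>} vs"
    using orbit_finite[OF p] by blast
  have "?M \<subseteq> adjoin K H {\<zero>} vs" using vs(2) by (auto dest: perpD(1))
  from submodule_of_adjoin[OF field_K mod_C vs(1) sM this]
  obtain us where us: "set us \<subseteq> carrier H" "?M = adjoin K H {\<zero>} us" by auto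
  have "set us \<subseteq> ?M" using adjoin(3)[OF mod_C zero_submodule[OF mod_C] us(1)] us(2) by simp
  also have "?M \<subseteq> W" using J by blast
  finally have "set us \<subseteq> W" .
  then obtain n where n: "set us \<subseteq> U n" using list_in_W by blast
  have MU: "?M \<subseteq> U n" unfolding us(2)
    using adjoin_least[OF mod_C U_submodule _ n] U_D(2) by simp
  have "p \<in> U (n + Suc 0)"
  proof (subst U_add_iff, intro conjI allI impI)
    fix f g assume fg: "perp (U n) f" "perp (U (Suc 0)) g"
    have "hit K H g p \<in> U n" using MU fg(2) by blast
    then show "cnv f g p = 0\<^sub>K"
      using fnl_hit[OF perpD(1)[OF fg(1)] perpD(1)[OF fg(2)] p] perpD(2)[OF fg(1)] by simp
  qed (rule p)
  then show ?thesis unfolding W_def by blast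
qed

text \<open>The hypothesis \<open>coef\<close> exhibits the group-like \<open>g\<close> as a matrix coefficient of the comodule
  \<open>P / (P \<inter> W)\<close>, which \<open>min\<close> makes simple; the conclusion says that this comodule is the one of \<open>g\<close>,
  so \<open>H\<^sub>0\<^sup>\<bottom>\<close> annihilates it. The induction is on the number of summands of the coefficient.\<close>

lemma grouplike_coefficient:
  assumes M: "stable M" and min: "\<And>M'. \<lbrakk>stable M'; M' \<subseteq> M; \<not> M' \<subseteq> W\<rbrakk> \<Longrightarrow> M' = M" and g: "g \<in> GL"
  shows "\<lbrakk>left_ideal L; \<And>q. q \<in> set ps \<Longrightarrow> fst q \<in> M \<and> perp W (snd q);
    \<And>l. l \<in> L \<Longrightarrow> l g = lsum K (\<lambda>(p, \<phi>). \<phi> (hit K H l p)) ps; \<exists>l\<in>L. l g \<noteq> 0\<^sub>K;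
    perp (U (Suc 0)) j; x \<in> M\<rbrakk> \<Longrightarrow> hit K H j x \<in> W"
proof (induction ps arbitrary: L)
  case Nil
  then show ?case by simp
next
  case (Cons q ps)
  note L = left_idealD[OF Cons.prems(1)]
  obtain p \<phi> where q: "q = (p, \<phi>)" by fastforce
  have p: "p \<in> M" "perp W \<phi>" using Cons.prems(2)[of q] q by auto
  have pc: "p \<in> carrier H" using submoduleD(1)[OF mod_C stableD(1)[OF M]] p by blast
  have gc: "g \<in> carrier H" by (rule GL_closed[OF g])
  have gk: "v g \<in> carrier K" if "fnl v" for v by (rule functionalD(1)[OF that gc])
  note j = perpD(1)[OF Cons.prems(5)]
  \<comment> \<open>The functionals of L that send p into \<open>W\<close>. On them the summand of
    (p, \<phi>) vanishes, so if one of them is nonzero at g, the shorter list still represents g on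
    \<open>?L\<close>.\<close>
  let ?L = "{l \<in> L. hit K H l p \<in> W}"
  have L': "left_ideal ?L"
    unfolding left_ideal_def
  proof (intro conjI ballI allI impI)
    fix v l assume l: "l \<in> ?L" and v: "fnl v"
    then have "hit K H v (hit K H l p) \<in> W" using hit_W by blast
    then show "cnv v l \<in> ?L" using hit_hit[OF v L(1) pc] L(5)[OF v] l by simp
  qed (use L hit_add[OF L(1) L(1) pc] hit_smult[OF L(1) _ pc] W_D(2,3,6) hit_zero[OF pc] in auto)
  show ?case
  proof (cases "\<exists>l\<in>?L. l g \<noteq> 0\<^sub>K")
    case True
    have "l g = lsum K (\<lambda>(p, \<phi>). \<phi> (hit K H l p)) ps" if "l \<in> ?L" for l
    proof -
      have "\<phi> (hit K H l p) = 0\<^sub>K" using that perpD(2)[OF p(2)] by blast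
      moreover have "lsum K (\<lambda>(p, \<phi>). \<phi> (hit K H l p)) ps \<in> carrier K"
      proof (rule K.lsum_closed)
        fix r assume "r \<in> set ps"
        then have r: "fst r \<in> M" "fnl (snd r)" using Cons.prems(2)[of r] perpD(1) by auto
        have "fnl l" using that L(1) by blast
        then have "hit K H l (fst r) \<in> carrier H"
          using hit_closed submoduleD(1)[OF mod_C stableD(1)[OF M] r(1)] by blast
        then show "(case r of (p, \<phi>) \<Rightarrow> \<phi> (hit K H l p)) \<in> carrier K"
          using functionalD(1)[OF r(2)] by (simp add: split_def)
      qed
      ultimately show ?thesis using Cons.prems(3)[of l] that q by simp
    qed
    then show ?thesis using Cons.IH[OF L' _ _ True Cons.prems(5,6)] Cons.prems(2) by simp
  next
    case False
    let ?Y1 = "(\<lambda>l. hit K H l p) ` L"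
    have Y1: "stable ?Y1" by (rule orbit_stable[OF Cons.prems(1) pc])
    have orb: "hit K H l p \<in> M" if "l \<in> L" for l using stableD(2)[OF M L(1)[OF that] p(1)] .
    have "\<not> ?Y1 \<subseteq> W" using False Cons.prems(4) by blast
    then have Y1M: "?Y1 = M" using min[OF Y1] orb by blast
    let ?K = "{l \<in> L. l g = 0\<^sub>K}"
    have K': "left_ideal ?K"
      unfolding left_ideal_def
      using L gk by (auto simp: conv_GL[OF _ _ g])
    let ?Y = "(\<lambda>l. hit K H l p) ` ?K"
    have Y: "stable ?Y" by (rule orbit_stable[OF K' pc])
    \<comment> \<open>Otherwise some l with l(g) \<noteq> 0 and some l' with l'(g) = 0 act equally
      on p; then l - l' sends p to 0 and so belongs to \<open>?L\<close>, with a nonzero value at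
      g.\<close>
    have "?Y \<noteq> M"
    proof
      assume YM: "?Y = M"
      obtain l where l: "l \<in> L" "l g \<noteq> 0\<^sub>K" using Cons.prems(4) by blast
      then obtain l' where l': "l' \<in> L" "l' g = 0\<^sub>K" "hit K H l p = hit K H l' p" using orb[OF l(1)] YM by auto
      let ?d = "\<lambda>x. l x +\<^sub>K (\<ominus>\<^bsub>K\<^esub> 1\<^sub>K) *\<^sub>K l' x"
      have m1: "\<ominus>\<^bsub>K\<^esub> 1\<^sub>K \<in> carrier K" by simp
      have d: "?d \<in> L" by (rule L(3)[OF l(1) L(4)[OF m1 l'(1)]])
      have hc: "hit K H l' p \<in> carrier H" by (rule hit_closed[OF L(1)[OF l'(1)] pc])
      have "hit K H ?d p = hit K H l p \<oplus> (\<ominus>\<^bsub>K\<^esub> 1\<^sub>K) \<odot> hit K H l' p"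
        using hit_add[OF L(1)[OF l(1)] fnl_smult[OF L(1)[OF l'(1)] m1] pc] hit_smult[OF L(1)[OF l'(1)] m1 pc] by simp
      also have "\<dots> = \<zero>" using hc l'(3) by (simp add: smult_l_minus A.r_neg)
      finally have "hit K H ?d p \<in> W" using W_D(2) by (simp only:)
      then have "?d \<in> ?L" using d by blast
      have "\<forall>l\<in>?L. l g = 0\<^sub>K" using False by blast
      from bspec[OF this \<open>?d \<in> ?L\<close>] have "?d g = 0\<^sub>K" .
      then show False using l l'(2) functionalD(1)[OF L(1)[OF l(1)] gc] by simp
    qed
    moreover have "?Y \<subseteq> M" using orb by blast
    ultimately have YW: "?Y \<subseteq> W" using min[OF Y] by blast
    obtain l where l: "l \<in> L" "x = hit K H l p" using Cons.prems(6) Y1M by blast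
    \<comment> \<open>x is l acting on p, and j * l vanishes at g because j does. So j sends x into
      \<open>?Y\<close>, which minimality of M has put inside \<open>W\<close>.\<close>
    have "cnv j l g = 0\<^sub>K"
      using conv_GL[OF j L(1)[OF l(1)] g] perpD(2)[OF Cons.prems(5) GL_U1[OF g]] functionalD(1)[OF L(1)[OF l(1)] gc] by simp
    then have "cnv j l \<in> ?K" using L(5)[OF j l(1)] by blast
    then have "hit K H (cnv j l) p \<in> W" using YW by blast
    then show ?thesis unfolding l(2) hit_hit[OF j L(1)[OF l(1)] pc] .
  qed
qed

section \<open>Subcoalgebras as bimodules over the dual algebra\<close>

definition bistable :: "'h set \<Rightarrow> bool" where
  "bistable E \<longleftrightarrow> stable E \<and> (\<forall>f x. fnl f \<longrightarrow> x \<in> E \<longrightarrow> hit_right K H x f \<in> E)"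

text \<open>Two separations against the zero subspace: stability under \<open>hit\<close> moves the
  left factors of \<Delta>(d) into E, then stability under \<open>hit_right\<close> moves the right
  factors.\<close>

lemma bistable_subcoalgebra:
  assumes E: "bistable E" shows "subcoalgebra K H E"
proof -
  have sE: "submodule E K H" using E by (simp add: bistable_def stable_def)
  note ED = submoduleD[OF mod_C sE]
  note zs = zero_submodule[OF mod_C]
  have "comult H d \<in> tensor_sub K H E E" if d: "d \<in> E" for d
  proof -
    have dc: "d \<in> carrier H" by (rule ED(1)[OF d])
    obtain ts where ts: "set ts \<subseteq> carrier H \<times> carrier H" "comult H d = CC.tsum ts" by (rule comult_rep[OF dc])
    have "tensor_pair K f g (CC.tsum ts) = 0\<^sub>K" if fg: "fnl f" "fnl g" "\<forall>x\<in>E. f x = 0\<^sub>K" for f g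
      using fnl_hit[OF fg(1,2) dc] E fg d unfolding ts(2)[symmetric] conv_def[symmetric]
      by (simp add: bistable_def stable_def)
    then obtain ts1 ts2 where "set ts1 \<subseteq> E \<times> carrier H" "set ts2 \<subseteq> carrier H \<times> {\<zero>}"
      "CC.tsum ts = CC.tsum ts1 \<oplus>\<^bsub>CC\<^esub> CC.tsum ts2"
      using CC.tensor_separate[OF sE carrier_is_submodule _ zs carrier_is_submodule _ ts(1)] ED(1) by blast
    moreover have "CC.tsum ts2 = \<zero>\<^bsub>CC\<^esub>" if "set ts2 \<subseteq> carrier H \<times> {\<zero>}" for ts2
      by (rule abelian_monoid.lsum_zero[OF abelian_group.axioms(1)[OF module.axioms(2)[OF mod_CC]]])
         (use that in \<open>auto simp: CC.tens_zero\<close>)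
    moreover have "CC.tsum ts1 \<in> carrier CC" if "set ts1 \<subseteq> E \<times> carrier H" for ts1
      using that ED(1) by (intro CC.tsum_closed) blast
    ultimately obtain ts1 where ts1: "set ts1 \<subseteq> E \<times> carrier H" "comult H d = CC.tsum ts1"
      using ts(2) abelian_monoid.r_zero[OF abelian_group.axioms(1)[OF module.axioms(2)[OF mod_CC]]] by metis
    have "tensor_pair K f g (CC.tsum ts1) = 0\<^sub>K" if fg: "fnl f" "fnl g" "\<forall>x\<in>E. g x = 0\<^sub>K" for f g
      using fnl_hit_right[OF fg(2,1) dc] E fg d unfolding ts1(2)[symmetric] conv_def[symmetric]
      by (simp add: bistable_def)
    then obtain us1 us2 where "set us1 \<subseteq> {\<zero>} \<times> carrier H" "set us2 \<subseteq> E \<times> E"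
      "CC.tsum ts1 = CC.tsum us1 \<oplus>\<^bsub>CC\<^esub> CC.tsum us2"
      using CC.tensor_separate[OF zs sE _ sE carrier_is_submodule _ ts1(1)] ED(1,2) by blast
    moreover have "CC.tsum us1 = \<zero>\<^bsub>CC\<^esub>" if "set us1 \<subseteq> {\<zero>} \<times> carrier H" for us1
      by (rule abelian_monoid.lsum_zero[OF abelian_group.axioms(1)[OF module.axioms(2)[OF mod_CC]]])
         (use that in \<open>auto simp: CC.tens_zero\<close>)
    moreover have "CC.tsum us2 \<in> carrier CC" if "set us2 \<subseteq> E \<times> E" for us2
      using that ED(1) by (intro CC.tsum_closed) blast
    ultimately have "\<exists>us. set us \<subseteq> E \<times> E \<and> comult H d = CC.tsum us"
      using ts1(2) abelian_monoid.l_zero[OF abelian_group.axioms(1)[OF module.axioms(2)[OF mod_CC]]] by metis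
    then show ?thesis unfolding tensor_sub_iff[OF field_K mod_C sE sE] .
  qed
  then show ?thesis using sE by (simp add: subcoalgebra_def)
qed

lemma subcoalgebra_bistable:
  assumes "subcoalgebra K H E" shows "bistable E"
proof -
  have sE: "submodule E K H" using assms by (simp add: subcoalgebra_def)
  note ED = submoduleD[OF mod_C sE]
  have "hit K H f x \<in> E \<and> hit_right K H x f \<in> E" if f: "fnl f" and x: "x \<in> E" for f x
  proof -
    have "comult H x \<in> tensor_sub K H E E" using assms x by (simp add: subcoalgebra_def)
    then obtain ts where ts: "set ts \<subseteq> E \<times> E" "comult H x = CC.tsum ts"
      unfolding tensor_sub_iff[OF field_K mod_C sE sE] by blast
    then have tc: "set ts \<subseteq> carrier H \<times> carrier H" using ED(1) by blast
    have "lsum H (\<lambda>(a, b). f b \<odot> a) ts \<in> E" "lsum H (\<lambda>(a, b). f a \<odot> b) ts \<in> E"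
      using ts(1) ED(1,6) functionalD(1)[OF f] by (auto intro!: lsum_submodule[OF mod_C sE])
    then show ?thesis
      unfolding hit_def hit_right_def
      by (simp add: sw_lsum[OF mod_C smult_bilinear2[OF f mod_C linear_map_id] tc ts(2)]
          sw_lsum[OF mod_C smult_bilinear1[OF f mod_C linear_map_id] tc ts(2)])
  qed
  then show ?thesis using sE by (simp add: bistable_def stable_def)
qed

text \<open>A nonzero bistable subspace of D with the fewest generators is a simple subcoalgebra,
  hence lies in the coradical, which is spanned by group-likes as H is pointed. If x \<noteq> 0 in
  it is written with the fewest group-likes, a delta functional acting on x returns a nonzero
  multiple of one of them.\<close>

lemma bistable_contains_grouplike:
  assumes D: "bistable D" "D \<noteq> {\<zero>}" and fin: "set vs \<subseteq> carrier H" "D = adjoin K H {\<zero>} vs"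
  obtains g where "g \<in> GL" "g \<in> D"
proof -
  define A where "A n \<longleftrightarrow> (\<exists>us. length us = n \<and> set us \<subseteq> carrier H \<and> bistable (adjoin K H {\<zero>} us) \<and>
    adjoin K H {\<zero>} us \<subseteq> D \<and> adjoin K H {\<zero>} us \<noteq> {\<zero>})" for n
  have "A (length vs)" unfolding A_def using D fin by blast
  then have "A (LEAST n. A n)" by (rule LeastI)
  then obtain us where us: "length us = (LEAST n. A n)" "set us \<subseteq> carrier H" "bistable (adjoin K H {\<zero>} us)"
    "adjoin K H {\<zero>} us \<subseteq> D" "adjoin K H {\<zero>} us \<noteq> {\<zero>}" unfolding A_def by blast
  let ?E = "adjoin K H {\<zero>} us"
  have sE: "submodule ?E K H" using us(3) by (simp add: bistable_def stable_def)
  note ED = submoduleD[OF mod_C sE]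
  have "simple_subcoalgebra K H ?E"
    unfolding simple_subcoalgebra_def
  proof (intro conjI allI impI)
    show "subcoalgebra K H ?E" by (rule bistable_subcoalgebra[OF us(3)])
    fix E' assume E': "subcoalgebra K H E' \<and> E' \<subseteq> ?E"
    then have b: "bistable E'" using subcoalgebra_bistable by blast
    then have s: "submodule E' K H" by (simp add: bistable_def stable_def)
    show "E' = {\<zero>} \<or> E' = ?E"
    proof (rule ccontr)
      assume n: "\<not> (E' = {\<zero>} \<or> E' = ?E)"
      obtain ws where ws: "set ws \<subseteq> carrier H" "E' = adjoin K H {\<zero>} ws" "length ws < length us"
        using submodule_of_adjoin[OF field_K mod_C us(2) s] E' n by blast
      have "A (length ws)" unfolding A_def using ws b n E' us(4) by blast
      then show False using ws(3) us(1) not_less_Least by metis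
    qed
  qed (rule us(5))
  then have "?E \<subseteq> \<Union>{D. simple_subcoalgebra K H D}" by blast
  also have "\<dots> \<subseteq> coradical K H"
    unfolding coradical_def
    by (rule span_of_submodule(2)[OF mod_C])
       (use submoduleD(1)[OF mod_C] in \<open>auto simp: simple_subcoalgebra_def subcoalgebra_def\<close>)
  finally have EU: "?E \<subseteq> span_of K H GL" using H0_span by simp
  obtain x where x: "x \<in> ?E" "x \<noteq> \<zero>" using us(5) ED(2) by blast
  obtain F0 where F0: "finite F0" "F0 \<subseteq> GL" "x \<in> span_of K H F0"
    using span_of_finite[OF mod_C GL_sub] EU x(1) by blast
  define B where "B n \<longleftrightarrow> (\<exists>F. card F = n \<and> finite F \<and> F \<subseteq> GL \<and> x \<in> span_of K H F)" for n
  have "B (card F0)" unfolding B_def using F0 by blast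
  then have "B (LEAST n. B n)" by (rule LeastI)
  then obtain F where F: "card F = (LEAST n. B n)" "finite F" "F \<subseteq> GL" "x \<in> span_of K H F"
    unfolding B_def by blast
  have FH: "F \<subseteq> carrier H" using F(3) GL_sub by blast
  have "F \<noteq> {}"
  proof
    assume "F = {}"
    then have "span_of K H F \<subseteq> {\<zero>}" using span_of_submodule(3)[OF mod_C FH zero_submodule[OF mod_C]] by blast
    then show False using F(4) x(2) by blast
  qed
  then obtain g where g: "g \<in> F" by blast
  have gG: "g \<in> GL" and gc: "g \<in> carrier H" using g F(3) FH by auto
  obtain e where e: "fnl e" "e g = 1\<^sub>K" "\<forall>g'\<in>F. g' \<noteq> g \<longrightarrow> e g' = 0\<^sub>K"
    using GL_delta[OF F(2,3) gG] by blast
  note eD = functionalD[OF e(1)]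
  have xc: "x \<in> carrier H" by (rule ED(1)[OF x(1)])
  let ?F' = "F - {g}"
  have F'H: "?F' \<subseteq> carrier H" using FH by blast
  have sF': "submodule (span_of K H ?F') K H" by (rule span_of_submodule(1)[OF mod_C F'H])
  have "F \<subseteq> add_line K H (span_of K H ?F') g"
    using add_line[OF mod_C sF' gc] span_of_submodule(2)[OF mod_C F'H] by blast
  then have "span_of K H F \<subseteq> add_line K H (span_of K H ?F') g"
    by (rule span_of_submodule(3)[OF mod_C FH add_line(1)[OF mod_C sF' gc]])
  then obtain d c where dc: "x = d \<oplus> c \<odot> g" "d \<in> span_of K H ?F'" "c \<in> carrier K"
    using F(4) by (auto simp: add_line_def)
  have dH: "d \<in> carrier H" by (rule submoduleD(1)[OF mod_C sF' dc(2)])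
  have ed: "e d = 0\<^sub>K" by (rule functional_span_zero[OF field_K mod_C e(1) F'H _ dc(2)]) (use e(3) in auto)
  have ex: "e x = c" using dc(1,3) dH gc eD ed e(2) by simp
  \<comment> \<open>Otherwise x would already lie in the span of F without g, against the minimality
    of F.\<close>
  have "c \<noteq> 0\<^sub>K"
  proof
    assume "c = 0\<^sub>K"
    then have "x = d" using dc(1) dH gc by simp
    then have "B (card ?F')" unfolding B_def using F(2,3) dc(2) by blast
    moreover have "card ?F' < card F" using F(2) g by (metis card_Diff1_less)
    ultimately show False using F(1) not_less_Least by metis
  qed
  then have ci: "inv\<^bsub>K\<^esub> c \<in> carrier K" "inv\<^bsub>K\<^esub> c *\<^sub>K c = 1\<^sub>K" using dc(3) K.field_Units by auto
  have "hit K H e x = c \<odot> g"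
  proof (rule fnl_eqI)
    show "hit K H e x \<in> carrier H" "c \<odot> g \<in> carrier H" using hit_closed[OF e(1) xc] dc(3) gc by auto
    fix u assume u: "fnl u"
    note uD = functionalD[OF u]
    have ue: "fnl (cnv u e)" by (rule conv_fnl[OF u e(1)])
    have "cnv u e y = 0\<^sub>K" if "y \<in> ?F'" for y
    proof -
      have "y \<in> GL" "e y = 0\<^sub>K" using that F(3) e(3) by auto
      then show ?thesis using conv_GL[OF u e(1)] uD(1)[OF GL_closed] by simp
    qed
    then have "cnv u e d = 0\<^sub>K" by (rule functional_span_zero[OF field_K mod_C ue F'H _ dc(2)])
    moreover have "cnv u e g = u g" using conv_GL[OF u e(1) gG] e(2) uD(1)[OF gc] by simp
    ultimately have "cnv u e x = c *\<^sub>K u g"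
      using functionalD[OF ue] dc(1,3) dH gc uD(1)[OF gc] by simp
    then show "u (hit K H e x) = u (c \<odot> g)" using fnl_hit[OF u e(1) xc] uD(3)[OF dc(3) gc] by simp
  qed
  then have "c \<odot> g \<in> ?E" using us(3) e(1) x(1) unfolding bistable_def stable_def by metis
  then have "inv\<^bsub>K\<^esub> c \<odot> (c \<odot> g) \<in> ?E" using ED(6) ci(1) by blast
  moreover have "inv\<^bsub>K\<^esub> c \<odot> (c \<odot> g) = g" using ci dc(3) gc smult_assoc1[OF ci(1) dc(3) gc] by simp
  ultimately have "g \<in> D" using us(4) by auto
  then show thesis using that gG by blast
qed

text \<open>Among the finitely generated stable subspaces not contained in \<open>W\<close>, let M
  have the fewest generators; its proper stable subspaces lie in \<open>W\<close>, so M modulo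
  \<open>W\<close> is a simple comodule. Its coefficient space is a nonzero finitely generated
  subcoalgebra and so contains a group-like; \<open>grouplike_coefficient\<close> and
  \<open>W_absorbs\<close> then force M into \<open>W\<close>.\<close>

lemma exhaustive: "carrier H = W"
proof (rule ccontr)
  assume "carrier H \<noteq> W"
  then obtain h where h: "h \<in> carrier H" "h \<notin> W" using W_D(1) by blast
  obtain vs where vs: "set vs \<subseteq> carrier H" "\<And>f. fnl f \<Longrightarrow> hit K H f h \<in> adjoin K H {\<zero>} vs"
    using orbit_finite[OF h(1)] by blast
  let ?O = "(\<lambda>l. hit K H l h) ` {f. fnl f}"
  have O: "stable ?O" by (rule orbit_stable[OF left_ideal_fnl h(1)])
  have "?O \<subseteq> adjoin K H {\<zero>} vs" using vs(2) by auto
  from submodule_of_adjoin[OF field_K mod_C vs(1) stableD(1)[OF O] this]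
  obtain us where us: "set us \<subseteq> carrier H" "?O = adjoin K H {\<zero>} us" by auto
  have "hit K H eps h \<in> ?O" using eps_fnl by blast
  then have hO: "h \<in> ?O" by (simp only: hit_eps[OF h(1)])
  have uO: "stable (adjoin K H {\<zero>} us)" "\<not> adjoin K H {\<zero>} us \<subseteq> W"
    using O hO h(2) unfolding us(2) by blast+
  define A where "A n \<longleftrightarrow> (\<exists>ws. length ws = n \<and> set ws \<subseteq> carrier H \<and> stable (adjoin K H {\<zero>} ws) \<and>
    \<not> adjoin K H {\<zero>} ws \<subseteq> W)" for n
  have "A (length us)" unfolding A_def using us(1) uO by blast
  then have "A (LEAST n. A n)" by (rule LeastI)
  then obtain ws where ws: "length ws = (LEAST n. A n)" "set ws \<subseteq> carrier H" "stable (adjoin K H {\<zero>} ws)"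
    "\<not> adjoin K H {\<zero>} ws \<subseteq> W" unfolding A_def by blast
  define M where "M = adjoin K H {\<zero>} ws"
  have M: "stable M" "\<not> M \<subseteq> W" using ws by (auto simp: M_def)
  note sM = stableD(1)[OF M(1)]
  note MD = submoduleD[OF mod_C sM]
  have min: "M' = M" if M': "stable M'" "M' \<subseteq> M" "\<not> M' \<subseteq> W" for M'
  proof (rule ccontr)
    assume "M' \<noteq> M"
    then obtain xs where xs: "set xs \<subseteq> carrier H" "M' = adjoin K H {\<zero>} xs" "length xs < length ws"
      using submodule_of_adjoin[OF field_K mod_C ws(2) stableD(1)[OF M'(1)]] M'(2) unfolding M_def by blast
    have "A (length xs)" unfolding A_def using xs M' by blast
    then show False using xs(3) ws(1) not_less_Least by metis
  qed
  \<comment> \<open>The coefficient space of M modulo \<open>W\<close>: sums of elements \<phi>(p_1)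
    p_2 with p in M and \<phi> vanishing on \<open>W\<close>.\<close>
  define D where "D = {lsum H (\<lambda>(p, \<phi>). hit_right K H p \<phi>) ps |ps. \<forall>q\<in>set ps. fst q \<in> M \<and> perp W (snd q)}"
  have gen: "hit_right K H p \<phi> \<in> D" if "p \<in> M" "perp W \<phi>" for p \<phi>
  proof -
    have "hit_right K H p \<phi> = lsum H (\<lambda>(p, \<phi>). hit_right K H p \<phi>) [(p, \<phi>)]"
      using hit_right_closed[OF perpD(1)[OF that(2)] MD(1)[OF that(1)]] by simp
    then show ?thesis unfolding D_def using that by (intro CollectI exI[of _ "[(p, \<phi>)]"]) auto
  qed
  have term_closed: "(case q of (p, \<phi>) \<Rightarrow> hit_right K H p \<phi>) \<in> carrier H" if "fst q \<in> M \<and> perp W (snd q)" for q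
    using that hit_right_closed perpD(1) MD(1) by (auto simp: split_def)
  have sD: "submodule D K H"
  proof (rule submoduleI'[OF mod_C])
    show "D \<subseteq> carrier H" unfolding D_def using term_closed by (auto intro!: A.lsum_closed)
    show "\<zero> \<in> D" unfolding D_def by (intro CollectI exI[of _ "[]"]) auto
    fix x y assume "x \<in> D" "y \<in> D"
    then obtain ps qs where pq: "x = lsum H (\<lambda>(p, \<phi>). hit_right K H p \<phi>) ps" "\<forall>q\<in>set ps. fst q \<in> M \<and> perp W (snd q)"
      "y = lsum H (\<lambda>(p, \<phi>). hit_right K H p \<phi>) qs" "\<forall>q\<in>set qs. fst q \<in> M \<and> perp W (snd q)"
      unfolding D_def by blast
    have "x \<oplus> y = lsum H (\<lambda>(p, \<phi>). hit_right K H p \<phi>) (ps @ qs)"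
      unfolding pq(1,3) by (rule A.lsum_append[symmetric]) (use pq term_closed in blast)+
    moreover have "\<forall>q\<in>set (ps @ qs). fst q \<in> M \<and> perp W (snd q)" using pq(2,4) by auto
    ultimately show "x \<oplus> y \<in> D" unfolding D_def by blast
  next
    fix c x assume c: "c \<in> carrier K" and "x \<in> D"
    then obtain ps where ps: "x = lsum H (\<lambda>(p, \<phi>). hit_right K H p \<phi>) ps" "\<forall>q\<in>set ps. fst q \<in> M \<and> perp W (snd q)"
      unfolding D_def by blast
    let ?qs = "map (\<lambda>(p, \<phi>). (c \<odot> p, \<phi>)) ps"
    have "c \<odot> x = lsum H (\<lambda>q. c \<odot> (case q of (p, \<phi>) \<Rightarrow> hit_right K H p \<phi>)) ps"
      unfolding ps(1) by (rule lsum_linear[OF mod_C mod_C smult_linear[OF mod_C linear_map_id c]]) (use ps(2) term_closed in blast)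
    also have "\<dots> = lsum H (\<lambda>(p, \<phi>). hit_right K H p \<phi>) ?qs"
      unfolding lsum_map
    proof (rule lsum_cong)
      fix q assume "q \<in> set ps"
      then have "fst q \<in> carrier H" "fnl (snd q)" using ps(2) MD(1) perpD(1) by blast+
      then show "c \<odot> (case q of (p, \<phi>) \<Rightarrow> hit_right K H p \<phi>)
        = (case case q of (p, \<phi>) \<Rightarrow> (c \<odot> p, \<phi>) of (p, \<phi>) \<Rightarrow> hit_right K H p \<phi>)"
        using linear_mapD(3)[OF hit_right_linear c] by (simp add: split_def)
    qed
    finally have "c \<odot> x = lsum H (\<lambda>(p, \<phi>). hit_right K H p \<phi>) ?qs" .
    moreover have "\<forall>q\<in>set ?qs. fst q \<in> M \<and> perp W (snd q)" using ps(2) MD(6)[OF c] by auto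
    ultimately show "c \<odot> x \<in> D" unfolding D_def by blast
  qed
  note DD = submoduleD[OF mod_C sD]
  have Dsub: "D \<subseteq> X" if "submodule X K H" "\<And>p \<phi>. \<lbrakk>p \<in> M; perp W \<phi>\<rbrakk> \<Longrightarrow> hit_right K H p \<phi> \<in> X" for X
  proof
    fix x assume "x \<in> D"
    then obtain ps where "x = lsum H (\<lambda>(p, \<phi>). hit_right K H p \<phi>) ps" "\<forall>q\<in>set ps. fst q \<in> M \<and> perp W (snd q)"
      unfolding D_def by blast
    then show "x \<in> X" using that(2) by (auto intro!: lsum_submodule[OF mod_C that(1)])
  qed
  have bD: "bistable D"
    unfolding bistable_def stable_def
  proof (intro conjI allI impI sD)
    fix f x assume f: "fnl f" and x: "x \<in> D"
    have 1: "submodule {x \<in> carrier H. hit K H f x \<in> D} K H"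
      by (rule kernel_submodule[OF mod_C mod_C hit_linear[OF f] sD])
    have "D \<subseteq> {x \<in> carrier H. hit K H f x \<in> D}"
    proof (rule Dsub[OF 1])
      fix p \<phi> assume p: "p \<in> M" "perp W \<phi>"
      note pc = MD(1)[OF p(1)] and ph = perpD(1)[OF p(2)]
      show "hit_right K H p \<phi> \<in> {x \<in> carrier H. hit K H f x \<in> D}"
        using hit_hit_right[OF f ph pc] gen[OF stableD(2)[OF M(1) f p(1)] p(2)] hit_right_closed[OF ph pc] by simp
    qed
    then show "hit K H f x \<in> D" using x by blast
    have 2: "submodule {x \<in> carrier H. hit_right K H x f \<in> D} K H"
      by (rule kernel_submodule[OF mod_C mod_C hit_right_linear[OF f] sD])
    have "D \<subseteq> {x \<in> carrier H. hit_right K H x f \<in> D}"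
    proof (rule Dsub[OF 2])
      fix p \<phi> assume p: "p \<in> M" "perp W \<phi>"
      note pc = MD(1)[OF p(1)] and ph = perpD(1)[OF p(2)]
      show "hit_right K H p \<phi> \<in> {x \<in> carrier H. hit_right K H x f \<in> D}"
        using hit_right_hit_right[OF ph f pc] gen[OF p(1) perp_W_conv[OF p(2) f]] hit_right_closed[OF ph pc] by simp
    qed
    then show "hit_right K H x f \<in> D" using x by blast
  qed
  \<comment> \<open>The right factors of \<Delta>(p), for p running through the generators of M,
    span a finitely generated space that contains D.\<close>
  have "\<exists>ls. set ls \<subseteq> carrier H \<and> (\<forall>p\<in>set vs. \<forall>f. fnl f \<longrightarrow> hit_right K H p f \<in> adjoin K H {\<zero>} ls)"
    if "set vs \<subseteq> carrier H" for vs
    using that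
  proof (induction vs)
    case Nil
    show ?case by (intro exI[of _ "[]"]) auto
  next
    case (Cons p vs)
    then obtain ls where ls: "set ls \<subseteq> carrier H" "\<forall>p\<in>set vs. \<forall>f. fnl f \<longrightarrow> hit_right K H p f \<in> adjoin K H {\<zero>} ls"
      by auto
    have pc: "p \<in> carrier H" using Cons.prems by simp
    obtain ts where ts: "set ts \<subseteq> carrier H \<times> carrier H" "comult H p = CC.tsum ts" by (rule comult_rep[OF pc])
    let ?ls = "map snd ts @ ls"
    have lc: "set ?ls \<subseteq> carrier H" using ts(1) ls(1) by auto
    note ad = adjoin[OF mod_C zero_submodule[OF mod_C] lc]
    have "adjoin K H {\<zero>} ls \<subseteq> adjoin K H {\<zero>} ?ls"
      by (rule adjoin_least[OF mod_C ad(1,2)]) (use ad(3) in auto)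
    moreover have "hit_right K H p f \<in> adjoin K H {\<zero>} ?ls" if f: "fnl f" for f
      unfolding hit_right_def sw_lsum[OF mod_C smult_bilinear1[OF f mod_C linear_map_id] ts]
    proof (rule lsum_submodule[OF mod_C ad(1)])
      fix q assume q: "q \<in> set ts"
      then have "snd q \<in> adjoin K H {\<zero>} ?ls" "fst q \<in> carrier H" using ad(3) ts(1) by auto
      then show "(case q of (a, b) \<Rightarrow> f a \<odot> b) \<in> adjoin K H {\<zero>} ?ls"
        using submoduleD(6)[OF mod_C ad(1)] functionalD(1)[OF f] by (auto simp: split_def)
    qed
    ultimately show ?case using ls lc by (intro exI[of _ ?ls]) auto
  qed
  then obtain ls where ls: "set ls \<subseteq> carrier H" "\<forall>p\<in>set ws. \<forall>f. fnl f \<longrightarrow> hit_right K H p f \<in> adjoin K H {\<zero>} ls"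
    using ws(2) by blast
  note adl = adjoin[OF mod_C zero_submodule[OF mod_C] ls(1)]
  have "D \<subseteq> adjoin K H {\<zero>} ls"
  proof (rule Dsub[OF adl(1)])
    fix p \<phi> assume p: "p \<in> M" "perp W \<phi>"
    note ph = perpD(1)[OF p(2)]
    have s: "submodule {x \<in> carrier H. hit_right K H x \<phi> \<in> adjoin K H {\<zero>} ls} K H" (is "submodule ?X K H")
      by (rule kernel_submodule[OF mod_C mod_C hit_right_linear[OF ph] adl(1)])
    have "M \<subseteq> ?X" unfolding M_def
      by (rule adjoin_least[OF mod_C s]) (use submoduleD(2)[OF mod_C s] ws(2) ls(2) ph in auto)
    then show "hit_right K H p \<phi> \<in> adjoin K H {\<zero>} ls" using p(1) by blast
  qed
  then obtain xs where xs: "set xs \<subseteq> carrier H" "D = adjoin K H {\<zero>} xs"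
    using submodule_of_adjoin[OF field_K mod_C ls(1) sD] by blast
  obtain p where p: "p \<in> M" "p \<notin> W" using M(2) by blast
  have pc: "p \<in> carrier H" by (rule MD(1)[OF p(1)])
  obtain \<phi> where ph: "fnl \<phi>" "\<And>d. d \<in> W \<Longrightarrow> \<phi> d = 0\<^sub>K" "\<phi> p = 1\<^sub>K"
    using exists_functional[OF field_K mod_C W_submodule pc p(2)] by blast
  have "perp W \<phi>" using ph by (simp add: perp_def)
  then have "hit_right K H p \<phi> \<in> D" by (rule gen[OF p(1)])
  \<comment> \<open>The counit of this coefficient is \<phi>(p) = 1, so D is not zero.\<close>
  moreover have "eps (hit_right K H p \<phi>) = 1\<^sub>K"
    using fnl_hit_right[OF eps_fnl ph(1) pc] conv_eps(2)[OF ph(1) pc] ph(3) by simp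
  ultimately have "D \<noteq> {\<zero>}" using fnl_zero[OF eps_fnl] by auto
  then obtain g where g: "g \<in> GL" "g \<in> D" using bistable_contains_grouplike[OF bD _ xs] by blast
  then obtain ps where ps: "g = lsum H (\<lambda>(p, \<phi>). hit_right K H p \<phi>) ps" "\<forall>q\<in>set ps. fst q \<in> M \<and> perp W (snd q)"
    unfolding D_def by blast
  have coef: "l g = lsum K (\<lambda>(p, \<phi>). \<phi> (hit K H l p)) ps" if l: "fnl l" for l
  proof -
    have "l g = lsum (scalar_module K) (\<lambda>q. l (case q of (p, \<phi>) \<Rightarrow> hit_right K H p \<phi>)) ps"
      unfolding ps(1) by (rule lsum_linear[OF mod_C mod_K l[unfolded functional_def]]) (use ps(2) term_closed in blast)
    also have "\<dots> = lsum (scalar_module K) (\<lambda>(p, \<phi>). \<phi> (hit K H l p)) ps"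
    proof (rule lsum_cong)
      fix q assume "q \<in> set ps"
      then have q: "fst q \<in> carrier H" "fnl (snd q)" using ps(2) MD(1) perpD(1) by blast+
      show "l (case q of (p, \<phi>) \<Rightarrow> hit_right K H p \<phi>) = (case q of (p, \<phi>) \<Rightarrow> \<phi> (hit K H l p))"
        using fnl_hit_right[OF l q(2,1)] fnl_hit[OF q(2) l q(1)] by (simp add: split_def)
    qed
    finally show ?thesis by simp
  qed
  have "hit K H j x \<in> W" if "perp (U (Suc 0)) j" "x \<in> M" for j x
  proof (rule grouplike_coefficient[OF M(1) min g(1) left_ideal_fnl _ _ _ that])
    show "\<exists>l\<in>{f. fnl f}. l g \<noteq> 0\<^sub>K" using eps_fnl eps_GL[OF g(1)] by (intro bexI[of _ eps]) auto
  qed (use ps(2) coef in auto)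
  then have "M \<subseteq> W" using W_absorbs MD(1) by blast
  then show False using M(2) by blast
qed

end

section \<open>Indices in cyclic groups\<close>

text \<open>The cosets are represented by powers of x, and x^i, x^j lie in one coset iff x^{i-j} is
  in C. If some positive power is in C, the index is the least such exponent a, and x^m is in C iff
  a divides m; otherwise these cosets are pairwise different and the index is infinite.\<close>

lemma (in group) cyclic_index_dvd_iff:
  assumes x: "x \<in> carrier G" and C: "subgroup C G" "C \<subseteq> generate G {x}" and n: "n > 0"
  shows "(\<exists>a. subgroup_index (G\<lparr>carrier := generate G {x}\<rparr>) C = enat a \<and> a dvd n) \<longleftrightarrow> x [^] (n::nat) \<in> C"
proof -
  define coset where "coset k = C #> (x [^] (k::int))" for k
  let ?R = "rcosets\<^bsub>G\<lparr>carrier := generate G {x}\<rparr>\<^esub> C"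
  have R: "?R = range coset"
    unfolding RCOSETS_def generate_pow[OF x] coset_def r_coset_def by auto
  have pc: "x [^] (k::int) \<in> carrier G" for k using x by simp
  have eq: "coset i = coset j \<longleftrightarrow> x [^] (i - j) \<in> C" for i j
  proof -
    have "coset i = coset j \<longleftrightarrow> x [^] i \<in> C #> (x [^] j)"
      unfolding coset_def using repr_independence[OF _ pc C(1)] repr_independenceD[OF C(1) pc] by metis
    also have "\<dots> \<longleftrightarrow> x [^] i \<otimes> inv (x [^] j) \<in> C"
      by (rule subgroup.rcos_module[OF C(1) is_group pc pc])
    also have "x [^] i \<otimes> inv (x [^] j) = x [^] (i - j)"
      using int_pow_mult[OF x, of i "- j"] int_pow_neg[OF x, of j] by simp
    finally show ?thesis .
  qed
  have least: "\<exists>a>0. card (range coset) = a \<and> finite (range coset) \<and> (\<forall>m::nat. x [^] m \<in> C \<longleftrightarrow> a dvd m)"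
    if ex: "\<exists>m>0. x [^] (m::nat) \<in> C"
  proof -
    define a where "a = (LEAST m. m > 0 \<and> x [^] (m::nat) \<in> C)"
    have a: "a > 0" "x [^] a \<in> C" using LeastI_ex[OF ex] by (auto simp: a_def)
    have min: "a \<le> m" if "m > 0" "x [^] m \<in> C" for m using that by (auto simp: a_def intro: Least_le)
    have ai: "x [^] (int a * k) \<in> C" for k
      using subgroup_int_pow_closed[OF C(1) a(2), of k] int_pow_pow[OF x, of "int a" k] by (simp add: int_pow_int)
    have mod: "coset k = coset (k mod int a)" for k
    proof -
      have "k - k mod int a = int a * (k div int a)" by (simp add: minus_mod_eq_mult_div)
      then show ?thesis using eq ai by simp
    qed
    have "range coset \<subseteq> coset ` {0..<int a}"
    proof
      fix Y assume "Y \<in> range coset"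
      then obtain k where "Y = coset k" by blast
      then have "Y = coset (k mod int a)" using mod by simp
      moreover have "k mod int a \<in> {0..<int a}" using a(1) by simp
      ultimately show "Y \<in> coset ` {0..<int a}" by blast
    qed
    then have r: "range coset = coset ` {0..<int a}" by blast
    have "inj_on coset {0..<int a}"
    proof (rule linorder_inj_onI')
      fix i j assume ij: "i \<in> {0..<int a}" "j \<in> {0..<int a}" "i < j"
      show "coset i \<noteq> coset j"
      proof
        assume "coset i = coset j"
        then have "x [^] (j - i) \<in> C" using eq[of j i] by simp
        then have "x [^] nat (j - i) \<in> C" using ij(3) int_pow_int[of _ x "nat (j - i)"] by simp
        then have "a \<le> nat (j - i)" using ij(3) by (intro min) auto
        then show False using ij by auto
      qed
    qed
    then have "card (range coset) = a" using card_image unfolding r by fastforce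
    moreover have "finite (range coset)" unfolding r by simp
    moreover have "x [^] m \<in> C \<longleftrightarrow> a dvd m" for m :: nat
    proof
      assume m: "x [^] m \<in> C"
      have "coset (int m) = coset 0" using m eq[of "int m" 0] by (simp add: int_pow_int)
      then have "coset (int m mod int a) = coset 0" using mod by simp
      then have "x [^] (int m mod int a) \<in> C" using eq[of "int m mod int a" 0] by simp
      then have c: "x [^] (m mod a) \<in> C" by (metis int_pow_int zmod_int)
      show "a dvd m"
      proof (rule ccontr)
        assume "\<not> a dvd m"
        then have "m mod a > 0" by (simp add: dvd_eq_mod_eq_0)
        then have "a \<le> m mod a" using c min by blast
        then show False using a(1) by (meson mod_less_divisor not_le)
      qed
    next
      assume "a dvd m"
      then obtain k where "m = a * k" by blast
      then show "x [^] m \<in> C" using ai[of "int k"] by (metis int_pow_int of_nat_mult)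
    qed
    ultimately show ?thesis using a(1) by blast
  qed
  show ?thesis
  proof
    assume "\<exists>a. subgroup_index (G\<lparr>carrier := generate G {x}\<rparr>) C = enat a \<and> a dvd n"
    then obtain a where a: "finite (range coset)" "card (range coset) = a" "a dvd n"
      unfolding subgroup_index_def R by (auto split: if_splits)
    \<comment> \<open>Pigeonhole: the a + 1 exponents 0, ..., a cannot give pairwise different
      cosets when there are only a of them.\<close>
    have "\<not> inj_on coset {0..int a}"
    proof
      assume "inj_on coset {0..int a}"
      then have "card (coset ` {0..int a}) = a + 1" by (simp add: card_image)
      moreover have "card (coset ` {0..int a}) \<le> card (range coset)" by (rule card_mono[OF a(1)]) auto
      ultimately show False using a(2) by simp
    qed
    then obtain i j where ij: "coset i = coset j" "i \<noteq> j" unfolding inj_on_def by blast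
    then have "coset (max i j) = coset (min i j)" by (auto simp: max_def min_def)
    then have "x [^] (max i j - min i j) \<in> C" using eq by blast
    moreover have "max i j - min i j = int (nat (max i j - min i j))" by simp
    ultimately have "x [^] nat (max i j - min i j) \<in> C" using int_pow_int by metis
    moreover have "nat (max i j - min i j) > 0" using ij(2) by auto
    ultimately show "x [^] n \<in> C" using least a by blast
  next
    assume "x [^] n \<in> C"
    then show "\<exists>a. subgroup_index (G\<lparr>carrier := generate G {x}\<rparr>) C = enat a \<and> a dvd n"
      using least n unfolding subgroup_index_def R by auto
  qed
qed

section \<open>Orders of maps\<close>

lemma map_order_finite:
  assumes "n \<ge> 1" "\<And>x. x \<in> A \<Longrightarrow> (f ^^ n) x = x"
  obtains d where "map_order A f = enat d" "d \<ge> 1" "\<And>x. x \<in> A \<Longrightarrow> (f ^^ d) x = x" "d \<le> n"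
proof -
  let ?Q = "\<lambda>n. n \<ge> 1 \<and> (\<forall>x\<in>A. (f ^^ n) x = x)"
  have q: "?Q n" using assms by auto
  then have "map_order A f = enat (LEAST n. ?Q n)" unfolding map_order_def by auto
  moreover have "?Q (LEAST n. ?Q n)" by (rule LeastI[of ?Q, OF q])
  moreover have "(LEAST n. ?Q n) \<le> n" by (rule Least_le[of ?Q, OF q])
  ultimately show thesis using that by blast
qed

lemma funpow_mult_fixed: "(f ^^ d) x = x \<Longrightarrow> (f ^^ (d * k)) x = x"
  by (induction k) (simp_all add: funpow_add)

text \<open>Division with remainder: a nonzero n mod d would be a positive exponent smaller than the
  least one.\<close>

lemma map_order_dvd:
  assumes "n \<ge> 1" "\<And>x. x \<in> A \<Longrightarrow> (f ^^ n) x = x" "\<And>x. x \<in> A \<Longrightarrow> f x \<in> A"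
  obtains d where "map_order A f = enat d" "d dvd n"
proof -
  obtain d where d: "map_order A f = enat d" "d \<ge> 1" "\<And>x. x \<in> A \<Longrightarrow> (f ^^ d) x = x" "d \<le> n"
    using map_order_finite[of n A f] assms(1,2) by blast
  have "d dvd n"
  proof (rule ccontr)
    assume "\<not> d dvd n"
    then have r: "n mod d \<ge> 1" by (simp add: dvd_eq_mod_eq_0 Suc_leI)
    have "(f ^^ (n mod d)) x = x" if x: "x \<in> A" for x
    proof -
      have "(f ^^ n) x = (f ^^ (n mod d)) ((f ^^ (d * (n div d))) x)"
        by (metis comp_apply funpow_add mod_mult_div_eq)
      then show ?thesis using funpow_mult_fixed[OF d(3)[OF x], of "n div d"] assms(2)[OF x] by simp
    qed
    then obtain d' where "map_order A f = enat d'" "d' \<le> n mod d"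
      using map_order_finite[of "n mod d" A f] r by blast
    then show False using d(1,2) by (metis enat.inject mod_less_divisor not_le less_le_trans zero_less_one)
  qed
  then show thesis using that d(1) by blast
qed

lemma map_order_enat:
  assumes "map_order A f = enat d"
  shows "d \<ge> 1" "\<And>x. x \<in> A \<Longrightarrow> (f ^^ d) x = x"
proof -
  obtain n where "n \<ge> 1" "\<And>x. x \<in> A \<Longrightarrow> (f ^^ n) x = x"
    using assms unfolding map_order_def by (metis enat.distinct(1))
  then obtain d' where "map_order A f = enat d'" "d' \<ge> 1" "\<And>x. x \<in> A \<Longrightarrow> (f ^^ d') x = x"
    using map_order_finite[of n A f] by metis
  then show "d \<ge> 1" "\<And>x. x \<in> A \<Longrightarrow> (f ^^ d) x = x" using assms by auto
qed

lemma map_order_cong: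
  assumes "\<And>n. (\<forall>x\<in>A. (f ^^ n) x = x) \<longleftrightarrow> (\<forall>x\<in>B. (g ^^ n) x = x)"
  shows "map_order A f = map_order B g"
  unfolding map_order_def assms ..

section \<open>Unipotent operators\<close>

lemma funpow_linear: "linear_map K V V f \<Longrightarrow> linear_map K V V (f ^^ n)"
  by (induction n) (auto simp: linear_map_def Pi_iff)

section \<open>The role of the characteristic\<close>

lemma field_char_zeroD:
  assumes "field_char K = 0" "n > 0" shows "[(n::nat)] \<cdot>\<^bsub>K\<^esub> \<one>\<^bsub>K\<^esub> \<noteq> \<zero>\<^bsub>K\<^esub>"
proof
  assume z: "[n] \<cdot>\<^bsub>K\<^esub> \<one>\<^bsub>K\<^esub> = \<zero>\<^bsub>K\<^esub>"
  let ?Q = "\<lambda>n::nat. n > 0 \<and> [n] \<cdot>\<^bsub>K\<^esub> \<one>\<^bsub>K\<^esub> = \<zero>\<^bsub>K\<^esub>"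
  have ex: "\<exists>n. ?Q n" using z assms(2) by blast
  have "field_char K = (LEAST n. ?Q n)" unfolding field_char_def by (rule if_P[OF ex])
  moreover have "?Q (LEAST n. ?Q n)" by (rule LeastI_ex[OF ex])
  ultimately show False using assms(1) by auto
qed

lemma field_char_pos:
  assumes "field K" "field_char K = p" "p > 0"
  shows "[p] \<cdot>\<^bsub>K\<^esub> \<one>\<^bsub>K\<^esub> = \<zero>\<^bsub>K\<^esub>" "Factorial_Ring.prime p"
proof -
  interpret K: field K by fact
  let ?Q = "\<lambda>n::nat. n > 0 \<and> [n] \<cdot>\<^bsub>K\<^esub> \<one>\<^bsub>K\<^esub> = \<zero>\<^bsub>K\<^esub>"
  have ex: "\<exists>n. ?Q n" using assms(2,3) unfolding field_char_def by (metis less_numeral_extra(3))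
  have p: "p = (LEAST n. ?Q n)" using assms(2) unfolding field_char_def if_P[OF ex] ..
  then have Q: "?Q p" using LeastI_ex[OF ex] by simp
  then show z: "[p] \<cdot>\<^bsub>K\<^esub> \<one>\<^bsub>K\<^esub> = \<zero>\<^bsub>K\<^esub>" by blast
  have min: "p \<le> n" if "?Q n" for n unfolding p by (rule Least_le[of ?Q, OF that])
  have "[(1::nat)] \<cdot>\<^bsub>K\<^esub> \<one>\<^bsub>K\<^esub> = \<one>\<^bsub>K\<^esub>" by simp
  then have "p \<noteq> 1" using z by auto
  moreover have "m = 1 \<or> m = p" if md: "m dvd p" for m
  proof -
    obtain k where k: "p = m * k" using md by blast
    then have mk: "m > 0" "k > 0" using assms(3) by auto
    have "[(m * k)] \<cdot>\<^bsub>K\<^esub> \<one>\<^bsub>K\<^esub> = [m] \<cdot>\<^bsub>K\<^esub> ([k] \<cdot>\<^bsub>K\<^esub> \<one>\<^bsub>K\<^esub>)"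
      using K.add.nat_pow_pow[of "\<one>\<^bsub>K\<^esub>" m k] by (simp add: mult.commute)
    also have "\<dots> = [m] \<cdot>\<^bsub>K\<^esub> \<one>\<^bsub>K\<^esub> \<otimes>\<^bsub>K\<^esub> [k] \<cdot>\<^bsub>K\<^esub> \<one>\<^bsub>K\<^esub>"
      using K.add_pow_ldistr[of "\<one>\<^bsub>K\<^esub>" "[k] \<cdot>\<^bsub>K\<^esub> \<one>\<^bsub>K\<^esub>" m] by simp
    finally have "[m] \<cdot>\<^bsub>K\<^esub> \<one>\<^bsub>K\<^esub> \<otimes>\<^bsub>K\<^esub> [k] \<cdot>\<^bsub>K\<^esub> \<one>\<^bsub>K\<^esub> = \<zero>\<^bsub>K\<^esub>" using z k by simp
    then have "[m] \<cdot>\<^bsub>K\<^esub> \<one>\<^bsub>K\<^esub> = \<zero>\<^bsub>K\<^esub> \<or> [k] \<cdot>\<^bsub>K\<^esub> \<one>\<^bsub>K\<^esub> = \<zero>\<^bsub>K\<^esub>" by (simp add: K.integral_iff)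
    then have "p \<le> m \<or> p \<le> k" using min mk by blast
    then show ?thesis
    proof
      assume "p \<le> m" then show ?thesis using md assms(3) by (meson dvd_imp_le le_antisym)
    next
      assume pk: "p \<le> k"
      have "m \<le> 1"
      proof (rule ccontr)
        assume "\<not> m \<le> 1"
        then have "2 * k \<le> m * k" by simp
        then show False using pk k mk by simp
      qed
      then show ?thesis using mk by simp
    qed
  qed
  ultimately show "Factorial_Ring.prime p" using assms(3) by (auto simp: prime_nat_iff)
qed

text \<open>With y = Th - h fixed by T, T^n h = h + n y for all n. So T^N h = h means N y = 0, and N
  is invertible in K.\<close>

lemma char_zero_shift:
  assumes "field K" "module K V" "field_char K = 0" "linear_map K V V T" "h \<in> carrier V"
    "T (T h \<ominus>\<^bsub>V\<^esub> h) = T h \<ominus>\<^bsub>V\<^esub> h" "N \<ge> 1" "(T ^^ N) h = h"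
  shows "T h = h"
proof -
  interpret K: field K by fact
  interpret V: module K V by fact
  note TD = linear_mapD[OF assms(4)]
  define y where "y = T h \<ominus>\<^bsub>V\<^esub> h"
  have y: "y \<in> carrier V" "T y = y" using TD assms(5,6) by (auto simp: y_def)
  have Th: "T h = h \<oplus>\<^bsub>V\<^esub> y"
    using module_minus_simps(3)[OF assms(2), of "T h" h] TD(1) assms(5) y(1) by (simp add: y_def V.M.a_comm)
  have nk: "[(n::nat)] \<cdot>\<^bsub>K\<^esub> \<one>\<^bsub>K\<^esub> \<in> carrier K" for n by simp
  have "(T ^^ n) h = h \<oplus>\<^bsub>V\<^esub> ([n] \<cdot>\<^bsub>K\<^esub> \<one>\<^bsub>K\<^esub>) \<odot>\<^bsub>V\<^esub> y" for n
  proof (induction n)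
    case (Suc n)
    have "(T ^^ Suc n) h = T (h \<oplus>\<^bsub>V\<^esub> ([n] \<cdot>\<^bsub>K\<^esub> \<one>\<^bsub>K\<^esub>) \<odot>\<^bsub>V\<^esub> y)" using Suc by simp
    also have "\<dots> = h \<oplus>\<^bsub>V\<^esub> y \<oplus>\<^bsub>V\<^esub> ([n] \<cdot>\<^bsub>K\<^esub> \<one>\<^bsub>K\<^esub>) \<odot>\<^bsub>V\<^esub> y"
      using y assms(5) nk[of n] by (simp add: TD Th)
    also have "\<dots> = h \<oplus>\<^bsub>V\<^esub> ([(Suc n)] \<cdot>\<^bsub>K\<^esub> \<one>\<^bsub>K\<^esub>) \<odot>\<^bsub>V\<^esub> y"
      using y assms(5) nk[of n] by (simp add: K.add.nat_pow_Suc V.smult_l_distr V.M.a_ac)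
    finally show ?case .
  qed (use y assms(5) in simp)
  from this[of N] have "h \<oplus>\<^bsub>V\<^esub> ([N] \<cdot>\<^bsub>K\<^esub> \<one>\<^bsub>K\<^esub>) \<odot>\<^bsub>V\<^esub> y = h" using assms(8) by simp
  moreover define w where "w = ([N] \<cdot>\<^bsub>K\<^esub> \<one>\<^bsub>K\<^esub>) \<odot>\<^bsub>V\<^esub> y"
  ultimately have "h \<oplus>\<^bsub>V\<^esub> w = h" by simp
  moreover have w: "w \<in> carrier V" unfolding w_def using nk y(1) by (rule V.smult_closed)
  ultimately have "w = h \<ominus>\<^bsub>V\<^esub> h" using module_minus_simps(4)[OF assms(2) w assms(5)] V.M.a_comm[OF w assms(5)] by simp
  then have z: "([N] \<cdot>\<^bsub>K\<^esub> \<one>\<^bsub>K\<^esub>) \<odot>\<^bsub>V\<^esub> y = \<zero>\<^bsub>V\<^esub>"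
    using module_minus_simps(1)[OF assms(2,5)] by (simp only: w_def)
  have c: "[N] \<cdot>\<^bsub>K\<^esub> \<one>\<^bsub>K\<^esub> \<noteq> \<zero>\<^bsub>K\<^esub>" using field_char_zeroD[OF assms(3)] assms(7) by simp
  then have ci: "inv\<^bsub>K\<^esub> ([N] \<cdot>\<^bsub>K\<^esub> \<one>\<^bsub>K\<^esub>) \<in> carrier K" "inv\<^bsub>K\<^esub> ([N] \<cdot>\<^bsub>K\<^esub> \<one>\<^bsub>K\<^esub>) \<otimes>\<^bsub>K\<^esub> [N] \<cdot>\<^bsub>K\<^esub> \<one>\<^bsub>K\<^esub> = \<one>\<^bsub>K\<^esub>"
    using nk[of N] K.field_Units by auto
  have "y = \<zero>\<^bsub>V\<^esub>"
    using V.smult_assoc1[OF ci(1) nk[of N] y(1)] ci z y(1) by simp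
  then show ?thesis using Th assms(5) by simp
qed

text \<open>Binomial expansion of T = id + D along the single vector h, with a_j = D^j h; for the
  exponent p only the extreme coefficients survive. The computation takes place on vectors, the maps
  being total functions that are linear on the carrier only.\<close>

lemma frobenius_operator:
  assumes "field K" "module K V" "field_char K = p" "p > 0" "linear_map K V V T" "h \<in> carrier V"
  shows "(T ^^ p) h \<ominus>\<^bsub>V\<^esub> h = ((\<lambda>x. T x \<ominus>\<^bsub>V\<^esub> x) ^^ p) h"
proof -
  interpret K: field K by fact
  interpret V: module K V by fact
  note TD = linear_mapD[OF assms(5)]
  let ?D = "\<lambda>x. T x \<ominus>\<^bsub>V\<^esub> x"
  define a where "a j = (?D ^^ j) h" for j
  define c where "c k j = [(k choose j)] \<cdot>\<^bsub>K\<^esub> \<one>\<^bsub>K\<^esub>" for k j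
  have ac: "a j \<in> carrier V" for j by (induction j) (auto simp: a_def assms(6) TD)
  have cc: "c k j \<in> carrier K" for k j by (simp add: c_def)
  have Ta: "T (a j) = a j \<oplus>\<^bsub>V\<^esub> a (Suc j)" for j
    using module_minus_simps(3)[OF assms(2), of "T (a j)" "a j"] ac[of j] TD(1)[OF ac[of j]]
    by (simp add: a_def V.M.a_comm)
  have c0: "c k 0 = \<one>\<^bsub>K\<^esub>" "c k k = \<one>\<^bsub>K\<^esub>" "k < j \<Longrightarrow> c k j = \<zero>\<^bsub>K\<^esub>" for k j
    by (simp_all add: c_def binomial_eq_0)
  have cS: "c (Suc k) (Suc j) = c k j \<oplus>\<^bsub>K\<^esub> c k (Suc j)" for k j
    by (simp add: c_def K.add.nat_pow_mult)
  have main: "(T ^^ k) h = (\<Oplus>\<^bsub>V\<^esub>j\<in>{..k}. c k j \<odot>\<^bsub>V\<^esub> a j)" for k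
  proof (induction k)
    case 0
    show ?case using ac[of 0] by (simp add: c0 a_def)
  next
    case (Suc k)
    have "(T ^^ Suc k) h = T (\<Oplus>\<^bsub>V\<^esub>j\<in>{..k}. c k j \<odot>\<^bsub>V\<^esub> a j)" using Suc by simp
    also have "\<dots> = (\<Oplus>\<^bsub>V\<^esub>j\<in>{..k}. T (c k j \<odot>\<^bsub>V\<^esub> a j))"
      by (rule finsum_linear[OF assms(2,2,5)]) (use ac cc in auto)
    also have "\<dots> = (\<Oplus>\<^bsub>V\<^esub>j\<in>{..k}. c k j \<odot>\<^bsub>V\<^esub> a j \<oplus>\<^bsub>V\<^esub> c k j \<odot>\<^bsub>V\<^esub> a (Suc j))"
      using ac cc by (intro V.M.finsum_cong') (auto simp: TD Ta V.smult_r_distr)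
    also have "\<dots> = (\<Oplus>\<^bsub>V\<^esub>j\<in>{..k}. c k j \<odot>\<^bsub>V\<^esub> a j) \<oplus>\<^bsub>V\<^esub> (\<Oplus>\<^bsub>V\<^esub>j\<in>{..k}. c k j \<odot>\<^bsub>V\<^esub> a (Suc j))"
      using ac cc by (intro V.M.finsum_addf) auto
    \<comment> \<open>The range is extended to k + 1, where the coefficient k choose (k + 1) is 0,
      so that splitting off the index 0 lets Pascal's rule combine the two sums.\<close>
    also have "(\<Oplus>\<^bsub>V\<^esub>j\<in>{..k}. c k j \<odot>\<^bsub>V\<^esub> a j) = (\<Oplus>\<^bsub>V\<^esub>j\<in>{..Suc k}. c k j \<odot>\<^bsub>V\<^esub> a j)"
    proof -
      have "(\<Oplus>\<^bsub>V\<^esub>j\<in>{..Suc k}. c k j \<odot>\<^bsub>V\<^esub> a j) = c k (Suc k) \<odot>\<^bsub>V\<^esub> a (Suc k) \<oplus>\<^bsub>V\<^esub> (\<Oplus>\<^bsub>V\<^esub>j\<in>{..k}. c k j \<odot>\<^bsub>V\<^esub> a j)"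
        using ac cc by (intro V.M.finsum_Suc) auto
      moreover have "(\<Oplus>\<^bsub>V\<^esub>j\<in>{..k}. c k j \<odot>\<^bsub>V\<^esub> a j) \<in> carrier V" using ac cc by (intro V.M.finsum_closed) auto
      ultimately show ?thesis using ac by (simp add: c0)
    qed
    also have "\<dots> = (\<Oplus>\<^bsub>V\<^esub>j\<in>{..k}. c k (Suc j) \<odot>\<^bsub>V\<^esub> a (Suc j)) \<oplus>\<^bsub>V\<^esub> c k 0 \<odot>\<^bsub>V\<^esub> a 0"
      using ac cc by (intro V.M.finsum_Suc2) auto
    also have "\<dots> \<oplus>\<^bsub>V\<^esub> (\<Oplus>\<^bsub>V\<^esub>j\<in>{..k}. c k j \<odot>\<^bsub>V\<^esub> a (Suc j)) =
      ((\<Oplus>\<^bsub>V\<^esub>j\<in>{..k}. c k (Suc j) \<odot>\<^bsub>V\<^esub> a (Suc j)) \<oplus>\<^bsub>V\<^esub> (\<Oplus>\<^bsub>V\<^esub>j\<in>{..k}. c k j \<odot>\<^bsub>V\<^esub> a (Suc j))) \<oplus>\<^bsub>V\<^esub> c k 0 \<odot>\<^bsub>V\<^esub> a 0"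
    proof -
      have "(\<Oplus>\<^bsub>V\<^esub>j\<in>{..k}. c k (Suc j) \<odot>\<^bsub>V\<^esub> a (Suc j)) \<in> carrier V" "(\<Oplus>\<^bsub>V\<^esub>j\<in>{..k}. c k j \<odot>\<^bsub>V\<^esub> a (Suc j)) \<in> carrier V"
        "c k 0 \<odot>\<^bsub>V\<^esub> a 0 \<in> carrier V"
        using ac cc by (auto intro!: V.M.finsum_closed)
      then show ?thesis by (simp add: V.M.a_ac)
    qed
    also have "(\<Oplus>\<^bsub>V\<^esub>j\<in>{..k}. c k (Suc j) \<odot>\<^bsub>V\<^esub> a (Suc j)) \<oplus>\<^bsub>V\<^esub> (\<Oplus>\<^bsub>V\<^esub>j\<in>{..k}. c k j \<odot>\<^bsub>V\<^esub> a (Suc j))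
      = (\<Oplus>\<^bsub>V\<^esub>j\<in>{..k}. c k (Suc j) \<odot>\<^bsub>V\<^esub> a (Suc j) \<oplus>\<^bsub>V\<^esub> c k j \<odot>\<^bsub>V\<^esub> a (Suc j))"
      using ac cc by (intro V.M.finsum_addf[symmetric]) auto
    also have "\<dots> = (\<Oplus>\<^bsub>V\<^esub>j\<in>{..k}. c (Suc k) (Suc j) \<odot>\<^bsub>V\<^esub> a (Suc j))"
      using ac cc by (intro V.M.finsum_cong') (auto simp: cS V.smult_l_distr V.M.a_comm)
    also have "\<dots> \<oplus>\<^bsub>V\<^esub> c k 0 \<odot>\<^bsub>V\<^esub> a 0 = (\<Oplus>\<^bsub>V\<^esub>j\<in>{..Suc k}. c (Suc k) j \<odot>\<^bsub>V\<^esub> a j)"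
      using V.M.finsum_Suc2[of "\<lambda>j. c (Suc k) j \<odot>\<^bsub>V\<^esub> a j" k] ac cc by (auto simp: c0)
    finally show ?case .
  qed
  note fp = field_char_pos[OF assms(1,3,4)]
  obtain q where q: "p = Suc q" using assms(4) gr0_implies_Suc by blast
  \<comment> \<open>The prime p divides the binomial coefficient, and p copies of 1 sum to
    0.\<close>
  have cz: "c p j = \<zero>\<^bsub>K\<^esub>" if "0 < j" "j < p" for j
  proof -
    have "p dvd (p choose j)" using dvd_choose_prime[OF that(2) _ _ fp(2)] that assms(4) by simp
    then obtain r where "p choose j = p * r" by blast
    then have "c p j = [r] \<cdot>\<^bsub>K\<^esub> ([p] \<cdot>\<^bsub>K\<^esub> \<one>\<^bsub>K\<^esub>)"
      unfolding c_def using K.add.nat_pow_pow[of "\<one>\<^bsub>K\<^esub>" r p] by (simp add: mult.commute)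
    then show ?thesis using fp(1) by (simp add: K.add.nat_pow_one)
  qed
  have "(T ^^ p) h = c p p \<odot>\<^bsub>V\<^esub> a p \<oplus>\<^bsub>V\<^esub> (\<Oplus>\<^bsub>V\<^esub>j\<in>{..q}. c p j \<odot>\<^bsub>V\<^esub> a j)"
    unfolding main[of p] unfolding q using ac cc by (intro V.M.finsum_Suc) auto
  also have "(\<Oplus>\<^bsub>V\<^esub>j\<in>{..q}. c p j \<odot>\<^bsub>V\<^esub> a j) = (\<Oplus>\<^bsub>V\<^esub>j\<in>{0::nat}. c p j \<odot>\<^bsub>V\<^esub> a j)"
    by (rule V.M.add.finprod_mono_neutral_cong_right) (use ac cc cz q in auto)
  also have "\<dots> = a 0" using ac by (simp add: c0)
  finally have "(T ^^ p) h = a p \<oplus>\<^bsub>V\<^esub> h" using ac by (simp add: c0 a_def)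
  then show ?thesis using module_minus_simps(4)[OF assms(2) ac assms(6)] by (simp add: a_def)
qed

text \<open>The case of exponent p is applied to T^(p^l), whose difference from id is D^(p^l) by
  induction.\<close>

lemma frobenius_operator_power:
  assumes "field K" "module K V" "field_char K = p" "p > 0" "linear_map K V V T" "h \<in> carrier V"
  shows "(T ^^ (p ^ l)) h \<ominus>\<^bsub>V\<^esub> h = ((\<lambda>x. T x \<ominus>\<^bsub>V\<^esub> x) ^^ (p ^ l)) h"
  using assms(6)
proof (induction l arbitrary: h)
  case (Suc l)
  interpret V: module K V by fact
  let ?D = "\<lambda>x. T x \<ominus>\<^bsub>V\<^esub> x"
  have Dc: "(?D ^^ n) x \<in> carrier V" if "x \<in> carrier V" for n x
    using that linear_mapD(1)[OF assms(5)] by (induction n) auto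
  have "(T ^^ (p ^ Suc l)) h \<ominus>\<^bsub>V\<^esub> h = ((T ^^ (p ^ l)) ^^ p) h \<ominus>\<^bsub>V\<^esub> h"
    by (simp add: funpow_mult mult.commute)
  also have "\<dots> = ((\<lambda>x. (T ^^ (p ^ l)) x \<ominus>\<^bsub>V\<^esub> x) ^^ p) h"
    by (rule frobenius_operator[OF assms(1-4) funpow_linear[OF assms(5)] Suc.prems])
  also have "\<dots> = ((?D ^^ (p ^ l)) ^^ p) h"
  proof -
    have "((\<lambda>x. (T ^^ (p ^ l)) x \<ominus>\<^bsub>V\<^esub> x) ^^ k) h = ((?D ^^ (p ^ l)) ^^ k) h" for k
    proof (induction k)
      case (Suc k)
      have "((?D ^^ (p ^ l)) ^^ k) h \<in> carrier V" unfolding funpow_mult using Dc Suc.prems \<open>h \<in> carrier V\<close> by blast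
      then show ?case using Suc \<open>\<And>h. h \<in> carrier V \<Longrightarrow> (T ^^ (p ^ l)) h \<ominus>\<^bsub>V\<^esub> h = (?D ^^ (p ^ l)) h\<close> by simp
    qed simp
    then show ?thesis .
  qed
  also have "\<dots> = (?D ^^ (p ^ Suc l)) h" by (simp add: funpow_mult mult.commute)
  finally show ?case .
qed simp

section \<open>The order of the antipode\<close>

text \<open>\<open>hopf_m\<close> depends only on which positive m are common multiples of the
  indices; this form serves both H and gr H.\<close>

lemma hopf_m_eqI:
  assumes "\<And>m. m > 0 \<and> (\<forall>x\<in>carrier (grouplike_group K H). \<exists>a. conj_index K H x = enat a \<and> a dvd m) \<longleftrightarrow> m > 0 \<and> Q m"
  shows "hopf_m K H = (if \<exists>m. m > 0 \<and> Q m then enat (LEAST m. m > 0 \<and> Q m) else \<infinity>)"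
  unfolding hopf_m_def Let_def assms ..

context pointed_hopf_algebra
begin

lemma pow_GL_eq: "x [^]\<^bsub>grouplike_group K H\<^esub> (n::nat) = x [^] n"
  by (simp add: nat_pow_def grouplike_group_simps)

text \<open>The elements of the cyclic group commuting with P_{x,1} form a subgroup, so
  \<open>cyclic_index_dvd_iff\<close> applies, and x^n being a power of x, its membership there is
  the commutation.\<close>

lemma conj_index_dvd_iff:
  assumes x: "x \<in> GL" and n: "n > 0"
  shows "(\<exists>a. conj_index K H x = enat a \<and> a dvd n) \<longleftrightarrow> (\<forall>h\<in>P x. x [^] n \<otimes> h = h \<otimes> x [^] n)"
proof -
  interpret G: group "grouplike_group K H" by (rule group_GL)
  let ?X = "generate (grouplike_group K H) {x}"
  let ?C = "{g \<in> ?X. \<forall>h\<in>P x. g \<otimes> h = h \<otimes> g}"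
  have sX: "subgroup ?X (grouplike_group K H)" using G.generate_is_subgroup x by blast
  have XG: "?X \<subseteq> GL" using subgroup.subset[OF sX] .
  have sC: "subgroup ?C (grouplike_group K H)"
  proof (rule G.subgroupI)
    show "?C \<subseteq> GL" using XG by blast
    have "\<one> \<in> ?X" using subgroup.one_closed[OF sX] by (simp add: grouplike_group_simps)
    then show "?C \<noteq> {}" using skewD(1) by auto
  next
    fix a assume a: "a \<in> ?C"
    then have aG: "a \<in> GL" using XG by blast
    have ac: "a \<in> carrier H" by (rule GL_closed[OF aG])
    have Sa: "S a \<in> carrier H" by (rule S_closed[OF ac])
    have inv: "inv\<^bsub>grouplike_group K H\<^esub> a = S a"
      by (rule G.inv_equality) (use aG S_GL S_GL_inverse in \<open>simp_all add: grouplike_group_simps\<close>)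
    have "inv\<^bsub>grouplike_group K H\<^esub> a \<in> ?X" using subgroup.m_inv_closed[OF sX, of a] a by blast
    then have "S a \<in> ?X" by (simp only: inv)
    moreover have "S a \<otimes> h = h \<otimes> S a" if h: "h \<in> P x" for h
    proof -
      have hc: "h \<in> carrier H" by (rule skewD(1)[OF h])
      have "a \<otimes> h = h \<otimes> a" using a h by blast
      have "S a \<otimes> h = S a \<otimes> h \<otimes> (a \<otimes> S a)" using S_GL_inverse(2)[OF aG] Sa hc by simp
      also have "\<dots> = S a \<otimes> (h \<otimes> a) \<otimes> S a" using Sa hc ac by (simp add: A.m_assoc)
      also have "\<dots> = S a \<otimes> (a \<otimes> h) \<otimes> S a" using \<open>a \<otimes> h = h \<otimes> a\<close> by simp
      also have "\<dots> = (S a \<otimes> a) \<otimes> h \<otimes> S a" using Sa hc ac by (simp add: A.m_assoc)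
      also have "\<dots> = h \<otimes> S a" using S_GL_inverse(1)[OF aG] Sa hc by simp
      finally show ?thesis .
    qed
    ultimately show "inv\<^bsub>grouplike_group K H\<^esub> a \<in> ?C" unfolding inv by blast
  next
    fix a b assume a: "a \<in> ?C" and b: "b \<in> ?C"
    have c: "a \<in> carrier H" "b \<in> carrier H" using a b XG GL_closed by blast+
    have "a \<otimes> b \<in> ?X" using subgroup.m_closed[OF sX] a b by (simp add: grouplike_group_simps)
    moreover have "a \<otimes> b \<otimes> h = h \<otimes> (a \<otimes> b)" if h: "h \<in> P x" for h
    proof -
      have hc: "h \<in> carrier H" by (rule skewD(1)[OF h])
      have ab: "a \<otimes> h = h \<otimes> a" "b \<otimes> h = h \<otimes> b" using a b h by blast+
      have "a \<otimes> b \<otimes> h = a \<otimes> h \<otimes> b" using c hc ab(2) by (simp add: A.m_assoc)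
      then show ?thesis using c hc ab(1) by (simp add: A.m_assoc)
    qed
    ultimately show "a \<otimes>\<^bsub>grouplike_group K H\<^esub> b \<in> ?C" by (simp add: grouplike_group_simps)
  qed
  have CX: "?C \<subseteq> ?X" by blast
  have "x [^] n \<in> ?X"
    using G.generate_pow[OF x] int_pow_int[of "grouplike_group K H" x n] pow_GL_eq[of x n] by (auto intro!: exI[of _ "int n"])
  then show ?thesis
    using G.cyclic_index_dvd_iff[OF x sC CX n] unfolding conj_index_def Let_def pow_GL_eq by simp
qed

lemma hopf_m_eq: "hopf_m K H = (if \<exists>m. m > 0 \<and> commuting_exponent m then enat (LEAST m. m > 0 \<and> commuting_exponent m) else \<infinity>)"
  by (rule hopf_m_eqI) (use conj_index_dvd_iff in \<open>auto simp: commuting_exponent_def\<close>)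

lemma hopf_m_enat:
  assumes "hopf_m K H = enat m"
  shows "m > 0" "commuting_exponent m" "\<And>k. \<lbrakk>k > 0; commuting_exponent k\<rbrakk> \<Longrightarrow> m \<le> k"
proof -
  let ?Q = "\<lambda>m. m > 0 \<and> commuting_exponent m"
  have ex: "\<exists>m. ?Q m" and m: "m = (LEAST m. ?Q m)" using assms by (auto simp: hopf_m_eq split: if_splits)
  show "m > 0" "commuting_exponent m" using LeastI_ex[OF ex] m by auto
  show "m \<le> k" if "k > 0" "commuting_exponent k" for k
    unfolding m by (rule Least_le[of ?Q]) (use that in blast)
qed

section \<open>Consequences for the order of the antipode\<close>

lemma finite_order_commuting:
  assumes "\<And>h. h \<in> carrier H \<Longrightarrow> (S ^^ (2 * N)) h = h" shows "commuting_exponent N"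
  using assms skewD(1) by (auto simp: commuting_exponent_iff)

text \<open>S^N = id implies S^(2N) = id, so N would be a common multiple of the indices and m_H
  finite.\<close>

lemma hopf_m_infinite:
  assumes "hopf_m K H = \<infinity>" shows "antipode_order H = \<infinity>"
proof (rule ccontr)
  assume "antipode_order H \<noteq> \<infinity>"
  then obtain N where "map_order (carrier H) S = enat N" by (auto simp: antipode_order_def)
  from map_order_enat[OF this] have N: "N > 0" "\<And>h. h \<in> carrier H \<Longrightarrow> (S ^^ N) h = h" by auto
  then have "commuting_exponent N"
    using funpow_mult_fixed[of N S _ 2] by (intro finite_order_commuting) (simp add: mult.commute)
  then have ex: "\<exists>m. m > 0 \<and> commuting_exponent m" using N(1) by blast
  show False using assms unfolding hopf_m_eq if_P[OF ex] by simp
qed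

text \<open>Induction along the filtration: Th - h lies one step lower, where T is already the
  identity, so \<open>char_zero_shift\<close> applies. It reaches all of H because the filtration is
  exhaustive.\<close>

lemma finite_order_unipotent:
  assumes char: "field_char K = 0" and T: "linear_map K H H T"
    and unip: "\<And>n h. h \<in> U (Suc n) \<Longrightarrow> T h \<ominus> h \<in> U n"
    and N: "N \<ge> 1" "\<And>h. h \<in> carrier H \<Longrightarrow> (T ^^ N) h = h" and h: "h \<in> carrier H"
  shows "T h = h"
proof -
  have "T h = h" if "h \<in> U n" for n h
    using that
  proof (induction n arbitrary: h)
    case 0
    then show ?case using linear_map_zero[OF mod_C mod_C T] by (simp add: U_simps)
  next
    case (Suc n)
    have hc: "h \<in> carrier H" by (rule U_D(1)[OF Suc.prems])
    show ?case
      by (rule char_zero_shift[OF field_K mod_C char T hc Suc.IH[OF unip[OF Suc.prems]] N(1) N(2)[OF hc]])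
  qed
  moreover obtain n where "h \<in> U n" using h exhaustive by (auto simp: W_def)
  ultimately show ?thesis by blast
qed

lemma Spow_odd_mult:
  "\<lbrakk>x \<in> carrier H; y \<in> carrier H\<rbrakk> \<Longrightarrow> (S ^^ Suc (2 * m)) (x \<otimes> y) = (S ^^ Suc (2 * m)) y \<otimes> (S ^^ Suc (2 * m)) x"
  using S2pow_mult antipode_mult Spow_closed by simp

text \<open>S^(2k) = id for every commuting exponent k, hence N \<le> 2m. N is even: an odd power of
  S reverses products, so if it is id, then H is commutative, 1 is a commuting exponent, S^2 = id
  and S = S^N = id. With N = 2j, j is a commuting exponent, so m \<le> j.\<close>

lemma finite_order_char_zero:
  assumes char: "field_char K = 0" and N: "antipode_order H = enat N" and nt: "\<exists>h\<in>carrier H. S h \<noteq> h"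
  shows "\<exists>m. hopf_m K H = enat m \<and> N = 2 * m"
proof -
  have N': "map_order (carrier H) S = enat N" using N by (simp add: antipode_order_def)
  note NN = map_order_enat[OF N']
  have "hopf_m K H \<noteq> \<infinity>" using hopf_m_infinite N by auto
  then obtain m where m: "hopf_m K H = enat m" by auto
  note mm = hopf_m_enat[OF m]
  have T: "(S ^^ (2 * k)) h = h" if "commuting_exponent k" "h \<in> carrier H" for k h
  proof (rule finite_order_unipotent[OF char Spow_linear _ NN(1) _ that(2)])
    show "((S ^^ (2 * k)) ^^ N) h = h" if "h \<in> carrier H" for h
      using funpow_mult_fixed[OF NN(2)[OF that], of "2 * k"] by (simp add: funpow_mult mult.commute)
  qed (rule S2pow_unipotent[OF that(1)])
  have "N \<le> 2 * m"
  proof -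
    have "2 * m \<ge> 1" using mm(1) by simp
    then obtain d where "map_order (carrier H) S = enat d" "d \<le> 2 * m"
      using map_order_finite[of "2 * m" "carrier H" S] T[OF mm(2)] by metis
    then show ?thesis using N' by simp
  qed
  moreover have "even N"
  proof (rule ccontr)
    assume "odd N"
    then obtain k where k: "N = Suc (2 * k)" by (metis oddE Suc_eq_plus1)
    have "x \<otimes> y = y \<otimes> x" if "x \<in> carrier H" "y \<in> carrier H" for x y
      using Spow_odd_mult[OF that, of k] NN(2) that A.m_closed unfolding k[symmetric] by simp
    then have "commuting_exponent 1" using skewD(1) GL_closed by (auto simp: commuting_exponent_def)
    then have S2: "S (S h) = h" if "h \<in> carrier H" for h using T[of 1 h] that by (simp add: numeral_2_eq_2)
    have "S h = h" if h: "h \<in> carrier H" for h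
    proof -
      have "(S ^^ 2) h = h" using S2[OF h] by (simp add: numeral_2_eq_2)
      then have "(S ^^ (2 * k)) h = h" by (rule funpow_mult_fixed)
      then show ?thesis using NN(2)[OF h] k by simp
    qed
    then show False using nt by blast
  qed
  then obtain j where j: "N = 2 * j" by blast
  have "m \<le> j" using mm(3)[of j] finite_order_commuting[of j] NN j by auto
  ultimately show ?thesis using m j by auto
qed

text \<open>For D = S^(2m) - id, already D^n vanishes on H_n: n - 1 steps lead from H_n to H_1,
  where D is 0. Hence p^l \<ge> n gives S^(2 m p^l) = id on H_n, and this even power, being
  multiplicative, is then the identity on the algebra generated by H_n.\<close>

lemma finite_order_char_p:
  assumes p: "field_char K = p" "p > 0" and m: "hopf_m K H = enat m"
    and gen: "generated_as_algebra_by K H (U (Suc n))" and l: "p ^ l \<ge> n" and n: "n \<ge> 1"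
  shows "\<exists>d. antipode_order H = enat d \<and> d dvd 2 * m * p ^ l"
proof -
  let ?T = "S ^^ (2 * m)" and ?D = "\<lambda>x. (S ^^ (2 * m)) x \<ominus> x"
  note mm = hopf_m_enat[OF m]
  note unip = S2pow_unipotent[OF mm(2)]
  \<comment> \<open>\<open>U (n - k + 1)\<close> is H_{n-k}; the bound k < n keeps the truncated
    subtraction exact.\<close>
  have D: "(?D ^^ k) h \<in> U (n - k + 1)" if "h \<in> U (Suc n)" "k < n" for h k
    using that(2)
  proof (induction k)
    case 0
    then show ?case using that(1) by simp
  next
    case (Suc k)
    then have "(?D ^^ k) h \<in> U (Suc (n - k))" by simp
    then have "(?D ^^ Suc k) h \<in> U (n - k)" using unip by simp
    then show ?case using Suc.prems by (simp add: Suc_diff_Suc)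
  qed
  have Dn: "(?D ^^ n) h = \<zero>" if h: "h \<in> U (Suc n)" for h
  proof -
    obtain q where q: "n = Suc q" using n by (cases n) auto
    have y: "(?D ^^ q) h \<in> U (Suc (Suc 0))" using D[OF h, of q] q by simp
    then show ?thesis using S2pow_fixes_U2[OF mm(2) y] U_D(1)[OF y] q by simp
  qed
  have D0: "(?D ^^ k) \<zero> = \<zero>" for k
    using linear_map_zero[OF mod_C mod_C Spow_linear] by (induction k) (auto simp: a_minus_def A.r_neg)
  have TU: "(?T ^^ (p ^ l)) h = h" if h: "h \<in> U (Suc n)" for h
  proof -
    have hc: "h \<in> carrier H" by (rule U_D(1)[OF h])
    have "(?D ^^ ((p ^ l - n) + n)) h = (?D ^^ (p ^ l - n)) ((?D ^^ n) h)" by (simp only: funpow_add comp_apply)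
    then have "(?D ^^ (p ^ l)) h = \<zero>" unfolding le_add_diff_inverse2[OF l] Dn[OF h] D0 .
    then have "(?T ^^ (p ^ l)) h \<ominus> h = \<zero>"
      using frobenius_operator_power[OF field_K mod_C p Spow_linear hc] by simp
    then show ?thesis
      using hc linear_mapD(1)[OF funpow_linear[OF Spow_linear] hc] by simp
  qed
  let ?M = "2 * m * p ^ l"
  have Teq: "(S ^^ ?M) h = (?T ^^ (p ^ l)) h" for h by (simp add: funpow_mult)
  \<comment> \<open>The exponent is displayed as even because even powers of S are multiplicative
    and fix 1, which makes the fixed space a subring.\<close>
  have Meq: "?M = 2 * (m * p ^ l)" by simp
  define B where "B = {h \<in> carrier H. (S ^^ ?M) h = h}"
  have sB: "submodule B K H" unfolding B_def by (rule fixed_submodule[OF Spow_linear])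
  note BD = submoduleD[OF mod_C sB]
  have "subring B H"
  proof (rule A.subringI)
    show "B \<subseteq> carrier H" using BD(1) by blast
    show "\<one> \<in> B" unfolding B_def Meq using S2pow_GL[OF one_GL, of "m * p ^ l"] A.one_closed by blast
    fix a b assume "a \<in> B" "b \<in> B"
    then have ab: "a \<in> carrier H" "b \<in> carrier H" "(S ^^ (2 * (m * p ^ l))) a = a" "(S ^^ (2 * (m * p ^ l))) b = b"
      unfolding B_def Meq by blast+
    show "a \<otimes> b \<in> B"
      unfolding B_def Meq mem_Collect_eq S2pow_mult[OF ab(1,2)] ab(3,4) using ab(1,2) by blast
    show "a \<oplus> b \<in> B" by (rule BD(3)) fact+
    show "\<ominus> a \<in> B" by (rule BD(4)) fact
  qed
  moreover have "U (Suc n) \<subseteq> B"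
  proof
    fix h assume h: "h \<in> U (Suc n)"
    show "h \<in> B" unfolding B_def mem_Collect_eq Teq TU[OF h] using U_D(1)[OF h] by blast
  qed
  ultimately have "(\<lambda>B. subring B H \<and> submodule B K H) hull (U (Suc n)) \<subseteq> B"
    using sB by (intro hull_minimal) auto
  then have "carrier H \<subseteq> B" using gen by (simp add: generated_as_algebra_by_def)
  then have fixed: "(S ^^ ?M) h = h" if "h \<in> carrier H" for h using that unfolding B_def by blast
  have "?M \<ge> 1" using mm(1) p(2) by simp
  then obtain d where "map_order (carrier H) S = enat d" "d dvd ?M"
    using map_order_dvd[of ?M "carrier H" S] fixed S_closed by blast
  then show ?thesis by (auto simp: antipode_order_def)
qed

end

section \<open>The associated graded coalgebra\<close>

context tensor_factors
begin

lemma functional_plus: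
  assumes "functional K M f" "functional K M g"
  shows "functional K M (\<lambda>x. f x \<oplus>\<^bsub>K\<^esub> g x)"
proof -
  interpret K: field K by (rule field_K)
  show ?thesis using functionalD[OF assms(1)] functionalD[OF assms(2)]
    by (intro functionalI) (auto simp: K.a_ac K.r_distr)
qed

lemma tensor_pair_add_left:
  assumes "functional K V f" "functional K V f'" "functional K W g" "T \<in> carrier (tensor K V W)"
  shows "tensor_pair K (\<lambda>x. f x \<oplus>\<^bsub>K\<^esub> f' x) g T = tensor_pair K f g T \<oplus>\<^bsub>K\<^esub> tensor_pair K f' g T"
proof -
  interpret K: field K by (rule field_K)
  note D = functionalD(1)[OF assms(1)] functionalD(1)[OF assms(2)] functionalD(1)[OF assms(3)]
  obtain ts where ts: "set ts \<subseteq> carrier V \<times> carrier W" "T = tsum ts" using tsum_exists[OF assms(4)] by blast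
  have "lsum K (\<lambda>(v, w). (f v \<oplus>\<^bsub>K\<^esub> f' v) \<otimes>\<^bsub>K\<^esub> g w) ts
    = lsum K (\<lambda>p. (case p of (v, w) \<Rightarrow> f v \<otimes>\<^bsub>K\<^esub> g w) \<oplus>\<^bsub>K\<^esub> (case p of (v, w) \<Rightarrow> f' v \<otimes>\<^bsub>K\<^esub> g w)) ts"
    by (rule lsum_cong) (use ts(1) D in \<open>auto simp: K.l_distr subset_iff\<close>)
  also have "\<dots> = lsum K (\<lambda>(v, w). f v \<otimes>\<^bsub>K\<^esub> g w) ts \<oplus>\<^bsub>K\<^esub> lsum K (\<lambda>(v, w). f' v \<otimes>\<^bsub>K\<^esub> g w) ts"
    by (rule K.lsum_add) (use ts(1) D in auto)
  finally show ?thesis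
    by (simp add: ts(2) tensor_pair_tsum[OF _ _ ts(1)] assms functional_plus)
qed

lemma tensor_pair_add_right:
  assumes "functional K V f" "functional K W g" "functional K W g'" "T \<in> carrier (tensor K V W)"
  shows "tensor_pair K f (\<lambda>x. g x \<oplus>\<^bsub>K\<^esub> g' x) T = tensor_pair K f g T \<oplus>\<^bsub>K\<^esub> tensor_pair K f g' T"
proof -
  interpret K: field K by (rule field_K)
  note D = functionalD(1)[OF assms(1)] functionalD(1)[OF assms(2)] functionalD(1)[OF assms(3)]
  obtain ts where ts: "set ts \<subseteq> carrier V \<times> carrier W" "T = tsum ts" using tsum_exists[OF assms(4)] by blast
  have "lsum K (\<lambda>(v, w). f v \<otimes>\<^bsub>K\<^esub> (g w \<oplus>\<^bsub>K\<^esub> g' w)) ts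
    = lsum K (\<lambda>p. (case p of (v, w) \<Rightarrow> f v \<otimes>\<^bsub>K\<^esub> g w) \<oplus>\<^bsub>K\<^esub> (case p of (v, w) \<Rightarrow> f v \<otimes>\<^bsub>K\<^esub> g' w)) ts"
    by (rule lsum_cong) (use ts(1) D in \<open>auto simp: K.r_distr subset_iff\<close>)
  also have "\<dots> = lsum K (\<lambda>(v, w). f v \<otimes>\<^bsub>K\<^esub> g w) ts \<oplus>\<^bsub>K\<^esub> lsum K (\<lambda>(v, w). f v \<otimes>\<^bsub>K\<^esub> g' w) ts"
    by (rule K.lsum_add) (use ts(1) D in auto)
  finally show ?thesis
    by (simp add: ts(2) tensor_pair_tsum[OF _ _ ts(1)] assms functional_plus)
qed

end

section \<open>gr H as a graded vector space\<close>

context pointed_hopf_algebra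
begin

text \<open>\<open>HU n\<close> is H_n as a vector space of its own; the piece of degree n is its
  quotient by \<open>U n\<close>.\<close>

abbreviation "HU n \<equiv> H\<lparr>carrier := U (Suc n)\<rparr>"
abbreviation "Ga \<equiv> gr_algebra K H"
abbreviation "cls \<equiv> gr_elem K H"
abbreviation "GaGa \<equiv> tensor K (gr_algebra K H) (gr_algebra K H)"

lemma mod_HU: "module K (HU n)"
  by (rule submodule.submodule_is_module[OF U_submodule mod_C])

lemma sub_HU: "submodule (U n) K (HU n)"
  using U_mono_Suc U_D(2,3,6) by (intro submoduleI'[OF mod_HU]) auto

lemma coset_HU: "U n +>\<^bsub>HU n\<^esub> x = U n +> x"
  by (simp add: a_r_coset_def')

lemma piece_eq: "gr_piece K H n = quot_module (HU n) (U n)"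
  by (simp add: gr_piece_def U_simps(2))

lemma mod_piece: "module K (gr_piece K H n)"
  unfolding piece_eq by (rule quot_module_module[OF mod_HU sub_HU])

lemma piece_carrier: "carrier (gr_piece K H n) = (\<lambda>x. U n +> x) ` U (Suc n)"
  unfolding piece_eq quot_carrier coset_HU by simp

lemma piece_zero: "\<zero>\<^bsub>gr_piece K H n\<^esub> = U n"
  by (simp add: piece_eq)

lemma piece_add: "\<lbrakk>x \<in> U (Suc n); y \<in> U (Suc n)\<rbrakk> \<Longrightarrow> (U n +> x) \<oplus>\<^bsub>gr_piece K H n\<^esub> (U n +> y) = U n +> (x \<oplus> y)"
  using quot_module_add[OF mod_HU sub_HU, of x n y] by (simp add: piece_eq coset_HU)

lemma piece_smult: "\<lbrakk>a \<in> carrier K; x \<in> U (Suc n)\<rbrakk> \<Longrightarrow> a \<odot>\<^bsub>gr_piece K H n\<^esub> (U n +> x) = U n +> (a \<odot> x)"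
  using quot_module_smult[OF mod_HU sub_HU, of x n a] by (simp add: piece_eq coset_HU)

lemmas cosetU_mem = coset_mem_iff[OF mod_C U_submodule]
lemmas cosetU_eq = coset_eq_iff[OF mod_C U_submodule]
lemmas cosetU_self = coset_self_mem[OF mod_C U_submodule]
lemmas cosetU_zero = coset_zero[OF mod_C U_submodule]

lemma cosetU_U: "x \<in> U n \<Longrightarrow> U n +> x = U n"
  using cosetU_eq[of x \<zero> n] cosetU_zero U_D(1) module_minus_simps(6)[OF mod_C] by simp

lemma Ga_carrier: "u \<in> carrier Ga \<longleftrightarrow> (\<forall>n. u n \<in> carrier (gr_piece K H n)) \<and> finite {n. u n \<noteq> U n}"
  by (simp add: gr_algebra_def Let_def piece_zero)

lemma Ga_simps:
  "zero Ga = (\<lambda>n. U n)" "add Ga = (\<lambda>u v n. u n \<oplus>\<^bsub>gr_piece K H n\<^esub> v n)"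
  "smult Ga = (\<lambda>a u n. a \<odot>\<^bsub>gr_piece K H n\<^esub> u n)" "one Ga = cls 0 \<one>"
  by (simp_all add: gr_algebra_def Let_def piece_zero)

lemma mod_Ga: "module K Ga"
proof -
  have p: "module K (gr_piece K H n)" for n by (rule mod_piece)
  note pa = module.axioms(2)[OF p]
  have add: "(\<lambda>n. u n \<oplus>\<^bsub>gr_piece K H n\<^esub> v n) \<in> carrier Ga" if uv: "u \<in> carrier Ga" "v \<in> carrier Ga" for u v
  proof -
    have "{n. u n \<oplus>\<^bsub>gr_piece K H n\<^esub> v n \<noteq> U n} \<subseteq> {n. u n \<noteq> U n} \<union> {n. v n \<noteq> U n}"
      using abelian_monoid.l_zero[OF abelian_group.axioms(1)[OF pa]] abelian_monoid.zero_closed[OF abelian_group.axioms(1)[OF pa]]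
      by (auto simp: piece_zero)
    then show ?thesis using uv abelian_monoid.a_closed[OF abelian_group.axioms(1)[OF pa]] unfolding Ga_carrier
      by (meson finite_UnI finite_subset)
  qed
  have smult: "(\<lambda>n. a \<odot>\<^bsub>gr_piece K H n\<^esub> u n) \<in> carrier Ga" if u: "u \<in> carrier Ga" and a: "a \<in> carrier K" for u a
  proof -
    have "{n. a \<odot>\<^bsub>gr_piece K H n\<^esub> u n \<noteq> U n} \<subseteq> {n. u n \<noteq> U n}"
      using module.smult_r_null[OF p a] by (auto simp: piece_zero)
    then show ?thesis using u module.smult_closed[OF p a] unfolding Ga_carrier by (meson finite_subset)
  qed
  have val: "u n \<in> carrier (gr_piece K H n)" if "u \<in> carrier Ga" for u n using that by (simp add: Ga_carrier)
  show ?thesis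
  proof (rule moduleI)
    show "cring K" by (rule K.is_cring)
    show "abelian_group Ga"
    proof (rule abelian_groupI)
      show "\<zero>\<^bsub>Ga\<^esub> \<in> carrier Ga"
        using abelian_monoid.zero_closed[OF abelian_group.axioms(1)[OF pa]] by (simp add: Ga_carrier Ga_simps piece_zero)
      fix u assume u: "u \<in> carrier Ga"
      show "\<zero>\<^bsub>Ga\<^esub> \<oplus>\<^bsub>Ga\<^esub> u = u"
        using abelian_monoid.l_zero[OF abelian_group.axioms(1)[OF pa] val[OF u]] by (simp add: Ga_simps piece_zero)
      have m1: "\<ominus>\<^bsub>K\<^esub> 1\<^sub>K \<in> carrier K" by simp
      have "(\<ominus>\<^bsub>K\<^esub> 1\<^sub>K) \<odot>\<^bsub>gr_piece K H n\<^esub> u n \<oplus>\<^bsub>gr_piece K H n\<^esub> u n = U n" for n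
        using module.smult_l_minus[OF p K.one_closed val[OF u]] module.smult_one[OF p val[OF u]]
          abelian_group.l_neg[OF pa val[OF u]] by (simp add: piece_zero)
      then show "\<exists>v\<in>carrier Ga. v \<oplus>\<^bsub>Ga\<^esub> u = \<zero>\<^bsub>Ga\<^esub>"
        using smult[OF u m1] by (intro bexI[of _ "\<lambda>n. (\<ominus>\<^bsub>K\<^esub> 1\<^sub>K) \<odot>\<^bsub>gr_piece K H n\<^esub> u n"]) (simp_all add: Ga_simps)
    next
      fix u v w assume uvw: "u \<in> carrier Ga" "v \<in> carrier Ga" "w \<in> carrier Ga"
      show "u \<oplus>\<^bsub>Ga\<^esub> v \<in> carrier Ga" using add uvw by (simp add: Ga_simps)
      show "u \<oplus>\<^bsub>Ga\<^esub> v = v \<oplus>\<^bsub>Ga\<^esub> u"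
        using abelian_monoid.a_comm[OF abelian_group.axioms(1)[OF pa]] val uvw by (simp add: Ga_simps)
      show "u \<oplus>\<^bsub>Ga\<^esub> v \<oplus>\<^bsub>Ga\<^esub> w = u \<oplus>\<^bsub>Ga\<^esub> (v \<oplus>\<^bsub>Ga\<^esub> w)"
        using abelian_monoid.a_assoc[OF abelian_group.axioms(1)[OF pa]] val uvw by (simp add: Ga_simps)
    qed
  qed (simp_all add: Ga_simps smult val module.smult_l_distr[OF p] module.smult_r_distr[OF p]
      module.smult_assoc1[OF p] module.smult_one[OF p])
qed

sublocale GG: tensor_factors K Ga Ga
  by (rule tensor_factorsI[OF field_K mod_Ga mod_Ga])

lemma mod_GaGa: "module K GaGa" by (rule GG.tensor_module)

lemma Ga_rep:
  assumes "u \<in> carrier Ga"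
  obtains h where "h \<in> U (Suc n)" "u n = U n +> h" "h \<in> u n"
proof -
  have "u n \<in> (\<lambda>x. U n +> x) ` U (Suc n)" using assms unfolding Ga_carrier piece_carrier by blast
  then obtain h where h: "h \<in> U (Suc n)" "u n = U n +> h" by blast
  then show thesis using that cosetU_self[OF U_D(1)[OF h(1)], of n] by simp
qed

lemma Ga_mem:
  assumes "u \<in> carrier Ga" "h \<in> u n"
  shows "h \<in> U (Suc n)" "u n = U n +> h"
proof -
  obtain x where x: "x \<in> U (Suc n)" "u n = U n +> x" using Ga_rep[OF assms(1)] by blast
  note xc = U_D(1)[OF x(1)]
  have h: "h \<in> carrier H" "h \<ominus> x \<in> U n" using assms(2) cosetU_mem[OF xc] x(2) by auto
  have "h = (h \<ominus> x) \<oplus> x" using module_minus_simps(3)[OF mod_C h(1) xc] by simp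
  moreover have "(h \<ominus> x) \<oplus> x \<in> U (Suc n)" by (rule U_D(3)[OF U_mono_Suc[OF h(2)] x(1)])
  ultimately show "h \<in> U (Suc n)" by simp
  show "u n = U n +> h" using x(2) cosetU_eq[OF h(1) xc, THEN iffD2, OF h(2)] by simp
qed

lemma gr_elem_closed: "h \<in> U (Suc n) \<Longrightarrow> cls n h \<in> carrier Ga"
proof -
  assume h: "h \<in> U (Suc n)"
  have "U i \<in> (\<lambda>x. U i +> x) ` U (Suc i)" for i using U_D(2)[of "Suc i"] cosetU_zero[of i] by force
  moreover have "finite {i. cls n h i \<noteq> U i}"
    by (rule finite_subset[of _ "{n}"]) (auto simp: gr_elem_def)
  ultimately show ?thesis using h unfolding Ga_carrier piece_carrier by (auto simp: gr_elem_def)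
qed

lemma gr_elem_linear: "linear_map K (HU n) Ga (cls n)"
proof (rule linear_mapI)
  fix x y assume xy: "x \<in> carrier (HU n)" "y \<in> carrier (HU n)"
  have "U i \<oplus>\<^bsub>gr_piece K H i\<^esub> U i = U i" for i
    using piece_add[OF U_D(2) U_D(2), of i] cosetU_zero[of i] by simp
  then show "cls n (x \<oplus>\<^bsub>HU n\<^esub> y) = cls n x \<oplus>\<^bsub>Ga\<^esub> cls n y"
    using xy piece_add[of x n y] by (auto simp: gr_elem_def Ga_simps fun_eq_iff)
next
  fix a x assume ax: "a \<in> carrier K" "x \<in> carrier (HU n)"
  have "a \<odot>\<^bsub>gr_piece K H i\<^esub> U i = U i" for i
    using piece_smult[OF ax(1) U_D(2), of i] cosetU_zero[of i] ax(1) by simp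
  then show "cls n (a \<odot>\<^bsub>HU n\<^esub> x) = a \<odot>\<^bsub>Ga\<^esub> cls n x"
    using ax piece_smult[of a x n] by (auto simp: gr_elem_def Ga_simps fun_eq_iff)
qed (simp add: gr_elem_closed)

text \<open>For \<open>\<phi>\<close> vanishing on \<open>H\<^sub>i\<^sub>-\<^sub>1\<close>, the functional induced by \<open>\<phi>\<close> on the component of degree \<open>i\<close>.\<close>

definition coord :: "nat \<Rightarrow> ('h \<Rightarrow> 'k) \<Rightarrow> (nat \<Rightarrow> 'h set) \<Rightarrow> 'k" where
  "coord i \<phi> u = \<phi> (SOME h. h \<in> u i)"

lemma coord_eq:
  assumes "perp (U i) \<phi>" "u \<in> carrier Ga" "h \<in> u i"
  shows "coord i \<phi> u = \<phi> h"
proof -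
  have "(SOME h. h \<in> u i) \<in> u i" by (rule someI[of _ h]) (rule assms(3))
  moreover define x where "x = (SOME h. h \<in> u i)"
  ultimately have x: "x \<in> u i" by simp
  have c: "x \<in> carrier H" "h \<in> carrier H" using Ga_mem(1)[OF assms(2) x] Ga_mem(1)[OF assms(2,3)] U_D(1) by auto
  have "x \<ominus> h \<in> U i" using x Ga_mem(2)[OF assms(2,3)] cosetU_mem[OF c(2)] by simp
  then have "\<phi> (x \<ominus> h) = 0\<^sub>K" by (rule perpD(2)[OF assms(1)])
  then have "\<phi> x \<ominus>\<^bsub>K\<^esub> \<phi> h = 0\<^sub>K" using functional_minus[OF field_K mod_C perpD(1)[OF assms(1)] c] by simp
  then show ?thesis using functionalD(1)[OF perpD(1)[OF assms(1)]] c by (simp add: coord_def x_def)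
qed

lemma coord_functional:
  assumes "perp (U i) \<phi>"
  shows "functional K Ga (coord i \<phi>)"
proof (rule functionalI)
  note pD = functionalD[OF perpD(1)[OF assms]]
  interpret G: module K Ga by (rule mod_Ga)
  fix u assume u: "u \<in> carrier Ga"
  obtain h where h: "h \<in> U (Suc i)" "u i = U i +> h" "h \<in> u i" using Ga_rep[OF u] by blast
  note hc = U_D(1)[OF h(1)]
  show "coord i \<phi> u \<in> carrier K" using coord_eq[OF assms u h(3)] pD(1)[OF hc] by simp
  {
    fix v assume v: "v \<in> carrier Ga"
    obtain k where k: "k \<in> U (Suc i)" "v i = U i +> k" "k \<in> v i" using Ga_rep[OF v] by blast
    note kc = U_D(1)[OF k(1)]
    have "(u \<oplus>\<^bsub>Ga\<^esub> v) i = U i +> (h \<oplus> k)" using piece_add[OF h(1) k(1)] h(2) k(2) by (simp add: Ga_simps)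
    then have "h \<oplus> k \<in> (u \<oplus>\<^bsub>Ga\<^esub> v) i" using cosetU_self[of "h \<oplus> k" i] hc kc by simp
    then have "coord i \<phi> (u \<oplus>\<^bsub>Ga\<^esub> v) = \<phi> (h \<oplus> k)" using coord_eq[OF assms] u v by simp
    then show "coord i \<phi> (u \<oplus>\<^bsub>Ga\<^esub> v) = coord i \<phi> u +\<^sub>K coord i \<phi> v"
      using coord_eq[OF assms u h(3)] coord_eq[OF assms v k(3)] pD(2)[OF hc kc] by simp
  }
  fix a assume a: "a \<in> carrier K"
  have "(a \<odot>\<^bsub>Ga\<^esub> u) i = U i +> (a \<odot> h)" using piece_smult[OF a h(1)] h(2) by (simp add: Ga_simps)
  then have "a \<odot> h \<in> (a \<odot>\<^bsub>Ga\<^esub> u) i" using cosetU_self[of "a \<odot> h" i] hc a by simp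
  then have "coord i \<phi> (a \<odot>\<^bsub>Ga\<^esub> u) = \<phi> (a \<odot> h)" using coord_eq[OF assms] u a by simp
  then show "coord i \<phi> (a \<odot>\<^bsub>Ga\<^esub> u) = a *\<^sub>K coord i \<phi> u"
    using coord_eq[OF assms u h(3)] pD(3)[OF a hc] by simp
qed

lemma coord_gr_elem:
  assumes "perp (U i) \<phi>" "h \<in> U (Suc j)"
  shows "coord i \<phi> (cls j h) = (if i = j then \<phi> h else 0\<^sub>K)"
proof (cases "i = j")
  case True
  have "h \<in> cls j h i" using True cosetU_self[OF U_D(1)[OF assms(2)]] by (simp add: gr_elem_def)
  then show ?thesis using coord_eq[OF assms(1) gr_elem_closed[OF assms(2)]] True by simp
next
  case False
  have "\<zero> \<in> cls j h i" using False U_D(2) by (simp add: gr_elem_def)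
  then show ?thesis using coord_eq[OF assms(1) gr_elem_closed[OF assms(2)]] False fnl_zero[OF perpD(1)[OF assms(1)]] by simp
qed

text \<open>The restriction of f to degree i, pulled back to H_i, vanishes on H_{i-1} and extends to
  H; so f amounts to one functional on H for each degree.\<close>

lemma functional_coords:
  assumes f: "functional K Ga f"
  obtains \<phi> where "\<And>i. perp (U i) (\<phi> i)" "\<And>i h. h \<in> U (Suc i) \<Longrightarrow> f (cls i h) = \<phi> i h"
proof -
  have "\<exists>\<phi>. perp (U i) \<phi> \<and> (\<forall>h\<in>U (Suc i). f (cls i h) = \<phi> h)" for i
  proof -
    obtain \<phi> where ph: "fnl \<phi>" "\<And>h. h \<in> U (Suc i) \<Longrightarrow> \<phi> h = f (cls i h)"
      using functional_extend[OF field_K mod_C U_submodule functional_comp[OF gr_elem_linear f]] by blast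
    have "\<phi> x = 0\<^sub>K" if x: "x \<in> U i" for x
    proof -
      have "cls i x = \<zero>\<^bsub>Ga\<^esub>" using cosetU_U[OF x] by (auto simp: gr_elem_def Ga_simps fun_eq_iff)
      then show ?thesis using ph(2)[OF U_mono_Suc[OF x]] functional_zero[OF field_K mod_Ga f] by simp
    qed
    then show ?thesis using ph by (auto simp: perp_def)
  qed
  then show thesis using that by metis
qed

text \<open>A functional on gr H may be nonzero in infinitely many degrees, so in general it is only
  a limit of these partial sums; on a given element it equals all sufficiently long ones.\<close>

primrec coord_sum :: "(nat \<Rightarrow> 'h \<Rightarrow> 'k) \<Rightarrow> nat \<Rightarrow> (nat \<Rightarrow> 'h set) \<Rightarrow> 'k" where
  "coord_sum \<phi> 0 = (\<lambda>u. 0\<^sub>K)"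
| "coord_sum \<phi> (Suc n) = (\<lambda>u. coord_sum \<phi> n u +\<^sub>K coord n (\<phi> n) u)"

lemma coord_sum_functional: "(\<And>i. perp (U i) (\<phi> i)) \<Longrightarrow> functional K Ga (coord_sum \<phi> n)"
proof (induction n)
  case 0
  show ?case by (rule functionalI) auto
next
  case (Suc n)
  then show ?case using GG.functional_plus[of Ga "coord_sum \<phi> n" "coord n (\<phi> n)"] coord_functional by simp
qed

lemma functional_coord_sum:
  assumes f: "functional K Ga f" and ph: "\<And>i. perp (U i) (\<phi> i)" "\<And>i h. h \<in> U (Suc i) \<Longrightarrow> f (cls i h) = \<phi> i h"
  shows "\<lbrakk>u \<in> carrier Ga; \<And>i. i \<ge> n \<Longrightarrow> u i = U i\<rbrakk> \<Longrightarrow> f u = coord_sum \<phi> n u"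
proof (induction n arbitrary: u)
  case 0
  then have "u = \<zero>\<^bsub>Ga\<^esub>" by (auto simp: Ga_simps)
  then show ?case using functional_zero[OF field_K mod_Ga f] by simp
next
  case (Suc n)
  interpret G: module K Ga by (rule mod_Ga)
  note fD = functionalD[OF f]
  obtain h where h: "h \<in> U (Suc n)" "u n = U n +> h" "h \<in> u n" using Ga_rep[OF Suc.prems(1)] by blast
  define v where "v = u(n := U n)"
  have Upc: "U i \<in> carrier (gr_piece K H i)" for i
    using abelian_monoid.zero_closed[OF abelian_group.axioms(1)[OF module.axioms(2)[OF mod_piece[of i]]]] by (simp add: piece_zero)
  have "finite {i. u i \<noteq> U i}" using Suc.prems(1) by (simp add: Ga_carrier)
  then have "finite {i. v i \<noteq> U i}" by (rule rev_finite_subset) (auto simp: v_def)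
  moreover have "v i \<in> carrier (gr_piece K H i)" for i using Suc.prems(1) Upc by (simp add: v_def Ga_carrier)
  ultimately have v: "v \<in> carrier Ga" by (simp add: Ga_carrier)
  note ge = gr_elem_closed[OF h(1)]
  have "v i \<oplus>\<^bsub>gr_piece K H i\<^esub> cls n h i = u i" for i
  proof (cases "i = n")
    case True
    have "u n \<in> carrier (gr_piece K H n)" using Suc.prems(1) by (simp add: Ga_carrier)
    then have "U n \<oplus>\<^bsub>gr_piece K H n\<^esub> u n = u n"
      using abelian_monoid.l_zero[OF abelian_group.axioms(1)[OF module.axioms(2)[OF mod_piece[of n]]]] by (simp add: piece_zero)
    then show ?thesis using True h(2) by (simp add: v_def gr_elem_def)
  next
    case False
    have "u i \<in> carrier (gr_piece K H i)" using Suc.prems(1) by (simp add: Ga_carrier)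
    then have "u i \<oplus>\<^bsub>gr_piece K H i\<^esub> U i = u i"
      using abelian_monoid.r_zero[OF abelian_group.axioms(1)[OF module.axioms(2)[OF mod_piece[of i]]]] by (simp add: piece_zero)
    then show ?thesis using False by (simp add: v_def gr_elem_def)
  qed
  then have u: "u = v \<oplus>\<^bsub>Ga\<^esub> cls n h" by (auto simp: Ga_simps)
  have vn: "v i = U i" if "i \<ge> n" for i using that Suc.prems(2)[of i] by (auto simp: v_def)
  have "f v = coord_sum \<phi> n v" by (rule Suc.IH[OF v vn])
  moreover have "coord_sum \<phi> n (cls n h) = 0\<^sub>K"
  proof -
    have "coord_sum \<phi> k (cls n h) = 0\<^sub>K" if "k \<le> n" for k
      using that by (induction k) (auto simp: coord_gr_elem[OF ph(1) h(1)])
    then show ?thesis by simp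
  qed
  moreover note csD = functionalD[OF coord_sum_functional[of \<phi> n, OF ph(1)]]
  ultimately have "coord_sum \<phi> n u = f v"
    unfolding u using csD(1)[OF v] csD(2)[OF v ge] by simp
  moreover have "coord n (\<phi> n) u = f (cls n h)"
    using coord_eq[OF ph(1) Suc.prems(1) h(3)] ph(2)[OF h(1)] by simp
  moreover have "f u = f v +\<^sub>K f (cls n h)" unfolding u by (rule fD(2)[OF v ge])
  ultimately show ?case by simp
qed

lemma Ga_bounded:
  assumes "u \<in> carrier Ga" obtains n where "\<And>i. i \<ge> n \<Longrightarrow> u i = U i"
proof -
  have fin: "finite {i. u i \<noteq> U i}" using assms by (simp add: Ga_carrier)
  obtain n where "\<forall>i\<in>{i. u i \<noteq> U i}. i < n" using fin[unfolded finite_nat_set_iff_bounded] ..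
  then have "u i = U i" if "i \<ge> n" for i using that by (cases "u i = U i") auto
  then show thesis by (rule that)
qed

lemma list_bounded:
  assumes "set ts \<subseteq> carrier Ga \<times> carrier Ga"
  shows "\<exists>n. \<forall>(u, v)\<in>set ts. \<forall>i\<ge>n. u i = U i \<and> v i = U i"
  using assms
proof (induction ts)
  case Nil
  show ?case by simp
next
  case (Cons p ts)
  obtain u v where p: "p = (u, v)" "u \<in> carrier Ga" "v \<in> carrier Ga" using Cons.prems by (cases p) auto
  obtain n where n: "\<forall>(u, v)\<in>set ts. \<forall>i\<ge>n. u i = U i \<and> v i = U i" using Cons by auto
  obtain a where a: "\<And>i. i \<ge> a \<Longrightarrow> u i = U i" using Ga_bounded[OF p(2)] by blast
  obtain b where b: "\<And>i. i \<ge> b \<Longrightarrow> v i = U i" using Ga_bounded[OF p(3)] by blast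
  show ?case
    by (rule exI[of _ "max n (max a b)"]) (use n a b p in auto)
qed

text \<open>The elements occurring in Y and Z have bounded degree, so arbitrary functionals can be
  replaced by long partial sums of coordinates, and the pairing is additive in both
  functionals.\<close>

lemma Ga_tensor_eqI:
  assumes Y: "Y \<in> carrier GaGa" and Z: "Z \<in> carrier GaGa"
    and eq: "\<And>i j \<alpha> \<beta>. \<lbrakk>perp (U i) \<alpha>; perp (U j) \<beta>\<rbrakk> \<Longrightarrow>
      tensor_pair K (coord i \<alpha>) (coord j \<beta>) Y = tensor_pair K (coord i \<alpha>) (coord j \<beta>) Z"
  shows "Y = Z"
proof (rule GG.tensor_eqI[OF Y Z])
  fix f g assume f: "functional K Ga f" and g: "functional K Ga g"
  obtain \<phi> where ph: "\<And>i. perp (U i) (\<phi> i)" "\<And>i h. h \<in> U (Suc i) \<Longrightarrow> f (cls i h) = \<phi> i h"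
    using functional_coords[OF f] by blast
  obtain \<psi> where ps: "\<And>i. perp (U i) (\<psi> i)" "\<And>i h. h \<in> U (Suc i) \<Longrightarrow> g (cls i h) = \<psi> i h"
    using functional_coords[OF g] by blast
  have sums: "tensor_pair K (coord_sum \<phi> n) (coord_sum \<psi> m) Y = tensor_pair K (coord_sum \<phi> n) (coord_sum \<psi> m) Z" for n m
  proof -
    have 1: "tensor_pair K (coord i (\<phi> i)) (coord_sum \<psi> m) Y = tensor_pair K (coord i (\<phi> i)) (coord_sum \<psi> m) Z" for i m
    proof (induction m)
      case 0
      have z: "tensor_pair K (coord i (\<phi> i)) (\<lambda>u. 0\<^sub>K) X = 0\<^sub>K" if XX: "X \<in> carrier GaGa" for X
      proof -
        obtain ts where ts: "set ts \<subseteq> carrier Ga \<times> carrier Ga" "X = GG.tsum ts" by (rule GG.tsum_exists[OF XX])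
        have z: "functional K Ga (\<lambda>u. 0\<^sub>K)" by (rule functionalI) auto
        show ?thesis unfolding ts(2) GG.tensor_pair_tsum[OF coord_functional[OF ph(1)] z ts(1)]
          by (rule K.lsum_zero) (use ts(1) functionalD(1)[OF coord_functional[OF ph(1)]] in auto)
      qed
      then show ?case using Y Z by simp
    next
      case (Suc m)
      note c = coord_functional[OF ph(1)] coord_sum_functional[of \<psi>, OF ps(1)] coord_functional[OF ps(1)]
      show ?case using Suc eq[OF ph(1) ps(1)] GG.tensor_pair_add_right[OF c Y] GG.tensor_pair_add_right[OF c Z] by simp
    qed
    show ?thesis
    proof (induction n)
      case 0
      have z: "tensor_pair K (\<lambda>u. 0\<^sub>K) (coord_sum \<psi> m) X = 0\<^sub>K" if XX: "X \<in> carrier GaGa" for X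
      proof -
        obtain ts where ts: "set ts \<subseteq> carrier Ga \<times> carrier Ga" "X = GG.tsum ts" by (rule GG.tsum_exists[OF XX])
        have z: "functional K Ga (\<lambda>u. 0\<^sub>K)" by (rule functionalI) auto
        show ?thesis unfolding ts(2) GG.tensor_pair_tsum[OF z coord_sum_functional[of \<psi>, OF ps(1)] ts(1)]
          by (rule K.lsum_zero) (use ts(1) functionalD(1)[OF coord_sum_functional[of \<psi>, OF ps(1)]] in auto)
      qed
      then show ?case using Y Z by simp
    next
      case (Suc n)
      note c = coord_sum_functional[of \<phi>, OF ph(1)] coord_functional[OF ph(1)] coord_sum_functional[of \<psi>, OF ps(1)]
      show ?case using Suc 1 GG.tensor_pair_add_left[OF c Y] GG.tensor_pair_add_left[OF c Z] by simp
    qed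
  qed
  have bounded: "\<exists>n. \<forall>m\<ge>n. tensor_pair K f g X = tensor_pair K (coord_sum \<phi> m) (coord_sum \<psi> m) X"
    if X: "X \<in> carrier GaGa" for X
  proof -
    obtain ts where ts: "set ts \<subseteq> carrier Ga \<times> carrier Ga" "X = GG.tsum ts" using GG.tsum_exists[OF X] by blast
    obtain n where n: "\<forall>(u, v)\<in>set ts. \<forall>i\<ge>n. u i = U i \<and> v i = U i" using list_bounded[OF ts(1)] by blast
    have "lsum K (\<lambda>(u, v). f u *\<^sub>K g v) ts = lsum K (\<lambda>(u, v). coord_sum \<phi> m u *\<^sub>K coord_sum \<psi> m v) ts" if m: "m \<ge> n" for m
    proof (rule lsum_cong)
      fix p assume p: "p \<in> set ts"
      then obtain u v where uv: "p = (u, v)" "u \<in> carrier Ga" "v \<in> carrier Ga" using ts(1) by blast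
      have "f u = coord_sum \<phi> m u" "g v = coord_sum \<psi> m v"
        using n p uv m by (intro functional_coord_sum[OF f ph] functional_coord_sum[OF g ps]; fastforce)+
      then show "(case p of (u, v) \<Rightarrow> f u *\<^sub>K g v) = (case p of (u, v) \<Rightarrow> coord_sum \<phi> m u *\<^sub>K coord_sum \<psi> m v)"
        using uv(1) by simp
    qed
    then show ?thesis
      unfolding ts(2) GG.tensor_pair_tsum[OF f g ts(1)]
        GG.tensor_pair_tsum[OF coord_sum_functional[of \<phi>, OF ph(1)] coord_sum_functional[of \<psi>, OF ps(1)] ts(1)] by blast
  qed
  obtain a where a: "\<forall>m\<ge>a. tensor_pair K f g Y = tensor_pair K (coord_sum \<phi> m) (coord_sum \<psi> m) Y" using bounded[OF Y] by blast
  obtain b where b: "\<forall>m\<ge>b. tensor_pair K f g Z = tensor_pair K (coord_sum \<phi> m) (coord_sum \<psi> m) Z" using bounded[OF Z] by blast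
  show "tensor_pair K f g Y = tensor_pair K f g Z"
    using a[rule_format, of "max a b"] b[rule_format, of "max a b"] sums by simp
qed

text \<open>The summands are split off one degree at a time. After k steps the remainder has its
  right factors in \<open>U (Suc n - k)\<close>; separating it against \<open>U (Suc k)\<close> and
  \<open>U (n - k)\<close> yields a part in H_k \<otimes> H_{n-k} and a new remainder one step lower
  on the right. After n + 1 steps the right factors are 0.\<close>

lemma comult_filtered:
  assumes h: "h \<in> U (Suc n)"
  obtains ts where "\<And>i. i \<le> n \<Longrightarrow> set (ts i) \<subseteq> U (Suc i) \<times> U (Suc (n - i))"
    "comult H h = (\<Oplus>\<^bsub>CC\<^esub>i\<in>{..n}. CC.tsum (ts i))"
proof -
  interpret T: module K CC by (rule mod_CC)
  have hc: "h \<in> carrier H" by (rule U_D(1)[OF h])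
  have UH: "U k \<subseteq> carrier H" for k using U_D(1) by blast
  have main: "\<exists>ts r. (\<forall>i<k. set (ts i) \<subseteq> U (Suc i) \<times> U (Suc (n - i))) \<and> set r \<subseteq> carrier H \<times> U (Suc n - k) \<and>
    comult H h = (\<Oplus>\<^bsub>CC\<^esub>i\<in>{..<k}. CC.tsum (ts i)) \<oplus>\<^bsub>CC\<^esub> CC.tsum r" if "k \<le> Suc n" for k
    using that
  proof (induction k)
    case 0
    obtain ts where ts: "set ts \<subseteq> carrier H \<times> carrier H" "comult H h = CC.tsum ts" by (rule comult_rep[OF hc])
    have "tensor_pair K f g (CC.tsum ts) = 0\<^sub>K" if "fnl f" "fnl g" "\<forall>x\<in>U (Suc n). g x = 0\<^sub>K" for f g
    proof -
      have "perp (U (Suc n)) (cnv f g)" using conv_perp[of "Suc n" g f] that by (simp add: perp_def)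
      then show ?thesis using perpD(2) h unfolding conv_def ts(2)[symmetric] by blast
    qed
    then obtain t1 t2 where t: "set t1 \<subseteq> {\<zero>} \<times> carrier H" "set t2 \<subseteq> carrier H \<times> U (Suc n)"
      "CC.tsum ts = CC.tsum t1 \<oplus>\<^bsub>CC\<^esub> CC.tsum t2"
      using CC.tensor_separate[OF zero_submodule[OF mod_C] carrier_is_submodule _ U_submodule carrier_is_submodule UH ts(1)] by blast
    have "CC.tsum t1 = \<zero>\<^bsub>CC\<^esub>" by (rule T.M.lsum_zero) (use t(1) in \<open>auto simp: CC.tens_zero\<close>)
    moreover have "(\<Oplus>\<^bsub>CC\<^esub>i\<in>{..<0::nat}. CC.tsum ([])) = \<zero>\<^bsub>CC\<^esub>" by simp
    ultimately show ?case using t ts(2) by (intro exI[of _ "\<lambda>i. []"] exI[of _ t2]) simp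
  next
    case (Suc k)
    then have kn: "k \<le> n" by simp
    obtain ts r where ts: "\<forall>i<k. set (ts i) \<subseteq> U (Suc i) \<times> U (Suc (n - i))" "set r \<subseteq> carrier H \<times> U (Suc n - k)"
      "comult H h = (\<Oplus>\<^bsub>CC\<^esub>i\<in>{..<k}. CC.tsum (ts i)) \<oplus>\<^bsub>CC\<^esub> CC.tsum r"
      using Suc by auto
    have tc: "set (ts i) \<subseteq> carrier H \<times> carrier H" if "i < k" for i
      using ts(1) that UH[of "Suc i"] UH[of "Suc (n - i)"] by blast
    have rc: "set r \<subseteq> carrier H \<times> carrier H" using ts(2) UH by blast
    have tcl: "CC.tsum (ts i) \<in> carrier CC" if "i < k" for i by (rule CC.tsum_closed[OF tc[OF that]])
    have sc: "(\<Oplus>\<^bsub>CC\<^esub>i\<in>{..<k}. CC.tsum (ts i)) \<in> carrier CC" using tcl by (intro T.M.finsum_closed) auto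
    have Snk: "Suc n - k = Suc (n - k)" using kn by simp
    have "tensor_pair K f g (CC.tsum r) = 0\<^sub>K"
      if fg: "fnl f" "fnl g" "\<forall>x\<in>U (Suc k). f x = 0\<^sub>K" "\<forall>x\<in>U (n - k). g x = 0\<^sub>K" for f g
    proof -
      note pD = functionalD[OF CC.tensor_pair_functional[OF fg(1,2)]]
      \<comment> \<open>h lies in the wedge of \<open>U (Suc k)\<close> and
        \<open>U (n - k)\<close>, as Suc k + (n - k) = Suc n. The summands already split off
        contribute nothing, because f vanishes on \<open>U (Suc i)\<close> for i < k.\<close>
      have "cnv f g h = 0\<^sub>K"
        using h U_add_iff[of h "Suc k" "n - k"] fg kn by (simp add: perp_def)
      then have "tensor_pair K f g (\<Oplus>\<^bsub>CC\<^esub>i\<in>{..<k}. CC.tsum (ts i)) +\<^sub>K tensor_pair K f g (CC.tsum r) = 0\<^sub>K"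
        unfolding conv_def ts(3) using pD(2)[OF sc CC.tsum_closed[OF rc]] by simp
      moreover have "tensor_pair K f g (\<Oplus>\<^bsub>CC\<^esub>i\<in>{..<k}. CC.tsum (ts i)) = 0\<^sub>K"
      proof -
        have "tensor_pair K f g (CC.tsum (ts i)) = 0\<^sub>K" if i: "i < k" for i
          unfolding CC.tensor_pair_tsum[OF fg(1,2) tc[OF i]]
        proof (rule K.lsum_zero)
          fix p assume p: "p \<in> set (ts i)"
          then have "p \<in> U (Suc i) \<times> U (Suc (n - i))" "p \<in> carrier H \<times> carrier H" using ts(1) i tc[OF i] by blast+
          then have "fst p \<in> U (Suc i)" "snd p \<in> carrier H" by auto
          moreover have "U (Suc i) \<subseteq> U (Suc k)" using i by (intro U_mono) simp
          ultimately show "(case p of (v, w) \<Rightarrow> f v *\<^sub>K g w) = 0\<^sub>K"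
            using fg(3) functionalD(1)[OF fg(2)] by (auto simp: split_def)
        qed
        then show ?thesis
          using finsum_linear[OF mod_CC mod_K CC.tensor_pair_functional[OF fg(1,2), unfolded functional_def], of "{..<k}" "\<lambda>i. CC.tsum (ts i)"] tcl
            finsum_submodule[OF mod_K zero_submodule[OF mod_K], of "{..<k}" "\<lambda>i. tensor_pair K f g (CC.tsum (ts i))"] by simp
      qed
      ultimately show ?thesis using pD(1)[OF CC.tsum_closed[OF rc]] by simp
    qed
    then obtain t1 t2 where t: "set t1 \<subseteq> U (Suc k) \<times> U (Suc (n - k))" "set t2 \<subseteq> carrier H \<times> U (n - k)"
      "CC.tsum r = CC.tsum t1 \<oplus>\<^bsub>CC\<^esub> CC.tsum t2"
      using CC.tensor_separate[OF U_submodule[of "Suc k"] carrier_is_submodule UH U_submodule[of "n - k"] U_submodule _ ts(2)[unfolded Snk]]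
        U_mono[of "n - k" "Suc (n - k)"] by auto
    define ts' where "ts' = ts(k := t1)"
    have t1c: "CC.tsum t1 \<in> carrier CC" using t(1) UH by (intro CC.tsum_closed) blast
    have t2c: "CC.tsum t2 \<in> carrier CC" using t(2) UH by (intro CC.tsum_closed) blast
    have "(\<Oplus>\<^bsub>CC\<^esub>i\<in>{..<Suc k}. CC.tsum (ts' i)) = CC.tsum (ts' k) \<oplus>\<^bsub>CC\<^esub> (\<Oplus>\<^bsub>CC\<^esub>i\<in>{..<k}. CC.tsum (ts' i))"
      unfolding lessThan_Suc using tcl t1c by (intro T.M.finsum_insert) (auto simp: ts'_def)
    also have "(\<Oplus>\<^bsub>CC\<^esub>i\<in>{..<k}. CC.tsum (ts' i)) = (\<Oplus>\<^bsub>CC\<^esub>i\<in>{..<k}. CC.tsum (ts i))"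
      using tcl by (intro T.M.finsum_cong') (auto simp: ts'_def)
    finally have "comult H h = (\<Oplus>\<^bsub>CC\<^esub>i\<in>{..<Suc k}. CC.tsum (ts' i)) \<oplus>\<^bsub>CC\<^esub> CC.tsum t2"
      unfolding ts(3) t(3) using sc t1c t2c by (simp add: ts'_def T.M.a_ac)
    moreover have "\<forall>i<Suc k. set (ts' i) \<subseteq> U (Suc i) \<times> U (Suc (n - i))" using ts(1) t(1) by (auto simp: ts'_def less_Suc_eq)
    moreover have "set t2 \<subseteq> carrier H \<times> U (Suc n - Suc k)" using t(2) by simp
    ultimately show ?case by blast
  qed
  obtain ts r where ts: "\<forall>i<Suc n. set (ts i) \<subseteq> U (Suc i) \<times> U (Suc (n - i))" "set r \<subseteq> carrier H \<times> U (Suc n - Suc n)"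
    "comult H h = (\<Oplus>\<^bsub>CC\<^esub>i\<in>{..<Suc n}. CC.tsum (ts i)) \<oplus>\<^bsub>CC\<^esub> CC.tsum r"
    using main[of "Suc n"] by blast
  have "CC.tsum r = \<zero>\<^bsub>CC\<^esub>" by (rule T.M.lsum_zero) (use ts(2) in \<open>auto simp: CC.tens_zero U_simps(1)\<close>)
  moreover have "set (ts i) \<subseteq> carrier H \<times> carrier H" if "i < Suc n" for i
    using ts(1) that UH[of "Suc i"] UH[of "Suc (n - i)"] by blast
  then have "(\<Oplus>\<^bsub>CC\<^esub>i\<in>{..<Suc n}. CC.tsum (ts i)) \<in> carrier CC"
    by (intro T.M.finsum_closed) (auto intro: CC.tsum_closed)
  ultimately have "comult H h = (\<Oplus>\<^bsub>CC\<^esub>i\<in>{..n}. CC.tsum (ts i))" using ts(3) by (simp add: lessThan_Suc_atMost)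
  moreover have "set (ts i) \<subseteq> U (Suc i) \<times> U (Suc (n - i))" if "i \<le> n" for i
    using ts(1)[rule_format, of i] that by simp
  ultimately show thesis by (intro that[of ts])
qed

section \<open>Well-definedness of the coproduct of gr H\<close>

definition gr_comult_rel :: "nat \<Rightarrow> 'h \<Rightarrow> (nat \<Rightarrow> ('h \<times> 'h \<Rightarrow> 'k) set) \<Rightarrow> bool" where
  "gr_comult_rel n h t \<longleftrightarrow> (\<forall>i\<le>n. t i \<in> carrier (tensor K (HU i) (HU (n - i)))) \<and>
     comult H h = (\<Oplus>\<^bsub>CC\<^esub>i\<in>{..n}. tensor_map K H H (\<lambda>x. x) (\<lambda>x. x) (t i))"

definition gr_comult_term :: "nat \<Rightarrow> (nat \<Rightarrow> ('h \<times> 'h \<Rightarrow> 'k) set) \<Rightarrow> ((nat \<Rightarrow> 'h set) \<times> (nat \<Rightarrow> 'h set) \<Rightarrow> 'k) set" where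
  "gr_comult_term n t = (\<Oplus>\<^bsub>GaGa\<^esub>i\<in>{..n}. tensor_map K Ga Ga (cls i) (cls (n - i)) (t i))"

lemma gr_comult_piece_eq: "gr_comult_piece K H n X = the_elem {gr_comult_term n t |h t. h \<in> X \<and> gr_comult_rel n h t}"
  unfolding gr_comult_piece_def Let_def gr_comult_term_def gr_comult_rel_def U_simps(2) by simp

lemma HU_factors: "tensor_factors K (HU i) (HU j)"
  by (rule tensor_factorsI[OF field_K mod_HU mod_HU])

lemma incl_bilinear: "bilinear_map K (HU i) (HU j) CC (\<lambda>x y. tens K H H x y)"
proof -
  note tD = bilinear_mapD[OF CC.tens_bilinear]
  show ?thesis using U_D(1) by (intro bilinear_mapI linear_mapI) (auto simp: tD)
qed

lemma gr_bilinear: "bilinear_map K (HU i) (HU j) GaGa (\<lambda>x y. tens K Ga Ga (cls i x) (cls j y))"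
  by (intro bilinear_mapI linear_map_bilinear1[OF GG.tens_bilinear gr_elem_linear]
      linear_map_bilinear2[OF GG.tens_bilinear gr_elem_linear] linear_mapD(1)[OF gr_elem_linear])

lemma tensor_map_closed:
  assumes "t \<in> carrier (tensor K (HU i) (HU j))"
  shows "tensor_map K H H (\<lambda>x. x) (\<lambda>x. x) t \<in> carrier CC"
    "tensor_map K Ga Ga (cls i) (cls j) t \<in> carrier GaGa"
proof -
  interpret X: tensor_factors K "HU i" "HU j" by (rule HU_factors)
  show "tensor_map K H H (\<lambda>x. x) (\<lambda>x. x) t \<in> carrier CC"
    unfolding tensor_map_def by (rule linear_mapD(1)[OF X.tensor_lift_linear[OF mod_CC incl_bilinear] assms])
  show "tensor_map K Ga Ga (cls i) (cls j) t \<in> carrier GaGa"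
    unfolding tensor_map_def by (rule linear_mapD(1)[OF X.tensor_lift_linear[OF mod_GaGa gr_bilinear] assms])
qed

lemma pair_tensor_maps:
  assumes t: "t \<in> carrier (tensor K (HU k) (HU l))"
  obtains ts where "set ts \<subseteq> U (Suc k) \<times> U (Suc l)"
    "\<And>f g. \<lbrakk>fnl f; fnl g\<rbrakk> \<Longrightarrow> tensor_pair K f g (tensor_map K H H (\<lambda>x. x) (\<lambda>x. x) t) = lsum K (\<lambda>(a, b). f a *\<^sub>K g b) ts"
    "\<And>f g. \<lbrakk>functional K Ga f; functional K Ga g\<rbrakk> \<Longrightarrow>
      tensor_pair K f g (tensor_map K Ga Ga (cls k) (cls l) t)
        = lsum K (\<lambda>(a, b). f (cls k a) *\<^sub>K g (cls l b)) ts"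
proof -
  interpret X: tensor_factors K "HU k" "HU l" by (rule HU_factors)
  obtain ts where ts: "set ts \<subseteq> U (Suc k) \<times> U (Suc l)" "t = X.tsum ts" using X.tsum_exists[OF t] by auto
  have tc: "set ts \<subseteq> carrier (HU k) \<times> carrier (HU l)" using ts(1) by simp
  have th: "set ts \<subseteq> carrier H \<times> carrier H" using ts(1) U_D(1) by blast
  have 1: "tensor_map K H H (\<lambda>x. x) (\<lambda>x. x) t = CC.tsum ts"
    unfolding tensor_map_def ts(2) X.tensor_lift_tsum[OF mod_CC incl_bilinear tc] ..
  let ?us = "map (\<lambda>(a, b). (cls k a, cls l b)) ts"
  have "tensor_map K Ga Ga (cls k) (cls l) t
    = lsum GaGa (\<lambda>(a, b). tens K Ga Ga (cls k a) (cls l b)) ts"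
    unfolding tensor_map_def ts(2) by (rule X.tensor_lift_tsum[OF mod_GaGa gr_bilinear tc])
  then have 2: "tensor_map K Ga Ga (cls k) (cls l) t = GG.tsum ?us"
    by (simp add: lsum_map split_def)
  have uc: "set ?us \<subseteq> carrier Ga \<times> carrier Ga" using ts(1) gr_elem_closed by auto
  show thesis
  proof (rule that[OF ts(1)])
    show "tensor_pair K f g (tensor_map K H H (\<lambda>x. x) (\<lambda>x. x) t) = lsum K (\<lambda>(a, b). f a *\<^sub>K g b) ts"
      if "fnl f" "fnl g" for f g unfolding 1 by (rule CC.tensor_pair_tsum[OF that th])
    show "tensor_pair K f g (tensor_map K Ga Ga (cls k) (cls l) t)
        = lsum K (\<lambda>(a, b). f (cls k a) *\<^sub>K g (cls l b)) ts"
      if "functional K Ga f" "functional K Ga g" for f g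
      unfolding 2 GG.tensor_pair_tsum[OF that uc] by (simp add: lsum_map split_def)
  qed
qed

lemma gr_comult_term_closed:
  assumes "gr_comult_rel n h t" shows "gr_comult_term n t \<in> carrier GaGa"
proof -
  interpret G: module K GaGa by (rule mod_GaGa)
  show ?thesis unfolding gr_comult_term_def
    using assms tensor_map_closed(2) by (intro G.M.finsum_closed) (auto simp: gr_comult_rel_def)
qed

text \<open>Pairing with coordinates of degrees i and j picks out the summand k = i. For i + j = n
  the other summands of \<Delta>(h) are killed by \<alpha> \<otimes> \<beta> in H as well, so both
  computations leave the same term. The value does not involve t, which is the independence of
  choices.\<close>

lemma gr_comult_term_pair:
  assumes rel: "gr_comult_rel n h t" and h: "h \<in> carrier H" and a: "perp (U i) \<alpha>" and b: "perp (U j) \<beta>"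
  shows "tensor_pair K (coord i \<alpha>) (coord j \<beta>) (gr_comult_term n t) = (if i + j = n then cnv \<alpha> \<beta> h else 0\<^sub>K)"
proof -
  have tc: "t k \<in> carrier (tensor K (HU k) (HU (n - k)))" if "k \<le> n" for k using rel that by (simp add: gr_comult_rel_def)
  note fa = perpD(1)[OF a] and fb = perpD(1)[OF b]
  note ca = coord_functional[OF a] and cb = coord_functional[OF b]
  let ?q = "\<lambda>k. tensor_pair K (coord i \<alpha>) (coord j \<beta>) (tensor_map K Ga Ga (cls k) (cls (n - k)) (t k))"
  let ?r = "\<lambda>k. tensor_pair K \<alpha> \<beta> (tensor_map K H H (\<lambda>x. x) (\<lambda>x. x) (t k))"
  have q: "?q k = (if k = i \<and> n - k = j then ?r k else 0\<^sub>K)"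
    and r: "i + j = n \<Longrightarrow> k \<noteq> i \<Longrightarrow> ?r k = 0\<^sub>K" and rc: "?r k \<in> carrier K" if k: "k \<le> n" for k
  proof -
    obtain ts where ts: "set ts \<subseteq> U (Suc k) \<times> U (Suc (n - k))"
      "\<And>f g. \<lbrakk>fnl f; fnl g\<rbrakk> \<Longrightarrow> tensor_pair K f g (tensor_map K H H (\<lambda>x. x) (\<lambda>x. x) (t k)) = lsum K (\<lambda>(a, b). f a *\<^sub>K g b) ts"
      "\<And>f g. \<lbrakk>functional K Ga f; functional K Ga g\<rbrakk> \<Longrightarrow>
        tensor_pair K f g (tensor_map K Ga Ga (cls k) (cls (n - k)) (t k))
          = lsum K (\<lambda>(a, b). f (cls k a) *\<^sub>K g (cls (n - k) b)) ts"
      using pair_tensor_maps[OF tc[OF k]] by blast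
    have mem: "fst p \<in> U (Suc k)" "snd p \<in> U (Suc (n - k))" if "p \<in> set ts" for p using that ts(1) by auto
    have val: "\<alpha> (fst p) \<in> carrier K" "\<beta> (snd p) \<in> carrier K" if "p \<in> set ts" for p
      using mem[OF that] U_D(1) functionalD(1)[OF fa] functionalD(1)[OF fb] by auto
    show "?r k \<in> carrier K" unfolding ts(2)[OF fa fb] by (rule K.lsum_closed) (use val in \<open>auto simp: split_def\<close>)
    have "?q k = lsum K (\<lambda>p. (if i = k then \<alpha> (fst p) else 0\<^sub>K) *\<^sub>K (if j = n - k then \<beta> (snd p) else 0\<^sub>K)) ts"
      unfolding ts(3)[OF ca cb]
      by (rule lsum_cong) (simp add: split_def coord_gr_elem[OF a mem(1)] coord_gr_elem[OF b mem(2)])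
    also have "\<dots> = (if k = i \<and> n - k = j then ?r k else 0\<^sub>K)"
    proof (cases "k = i \<and> n - k = j")
      case True
      then show ?thesis unfolding ts(2)[OF fa fb] by (auto simp: split_def)
    next
      case False
      have "lsum K (\<lambda>p. (if i = k then \<alpha> (fst p) else 0\<^sub>K) *\<^sub>K (if j = n - k then \<beta> (snd p) else 0\<^sub>K)) ts = 0\<^sub>K"
        by (rule K.lsum_zero) (use False val in auto)
      then show ?thesis unfolding if_not_P[OF False] .
    qed
    finally show "?q k = (if k = i \<and> n - k = j then ?r k else 0\<^sub>K)" .
    \<comment> \<open>k < i puts the left factor into H_k \<subseteq> H_{i-1}, where \<alpha>
      vanishes; k > i puts the right factor into H_{n-k} \<subseteq> H_{j-1}, where \<beta>
      does.\<close>
    assume ij: "i + j = n" and ne: "k \<noteq> i"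
    show "?r k = 0\<^sub>K" unfolding ts(2)[OF fa fb]
    proof (rule K.lsum_zero)
      fix p assume p: "p \<in> set ts"
      have "\<alpha> (fst p) = 0\<^sub>K \<or> \<beta> (snd p) = 0\<^sub>K"
      proof (cases "k < i")
        case True
        then have "fst p \<in> U i" using mem(1)[OF p] U_mono[of "Suc k" i] by auto
        then show ?thesis using perpD(2)[OF a] by blast
      next
        case False
        then have "Suc (n - k) \<le> j" using ne ij k by simp
        then have "snd p \<in> U j" using mem(2)[OF p] U_mono[of "Suc (n - k)" j] by auto
        then show ?thesis using perpD(2)[OF b] by blast
      qed
      then show "(case p of (a, b) \<Rightarrow> \<alpha> a *\<^sub>K \<beta> b) = 0\<^sub>K" using val[OF p] by (auto simp: split_def)
    qed
  qed
  have lin: "tensor_pair K (coord i \<alpha>) (coord j \<beta>) (gr_comult_term n t) = finsum (scalar_module K) ?q {..n}"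
    unfolding gr_comult_term_def
    by (rule finsum_linear[OF mod_GaGa mod_K GG.tensor_pair_functional[OF ca cb, unfolded functional_def]])
       (use tensor_map_closed(2) tc in auto)
  interpret S: module K "scalar_module K" by (rule mod_K)
  have sing: "finsum (scalar_module K) (\<lambda>k. if i = k then ?r i else 0\<^sub>K) {..n} = ?r i" if "i \<le> n"
    using S.M.add.finprod_singleton[of i "{..n}" "\<lambda>k. ?r i", unfolded scalar_module_simps] that rc[OF that] by simp
  show ?thesis
  proof (cases "i + j = n")
    case True
    then have i: "i \<le> n" by simp
    have "finsum (scalar_module K) ?q {..n} = finsum (scalar_module K) (\<lambda>k. if i = k then ?r i else 0\<^sub>K) {..n}"
      by (rule S.M.finsum_cong') (use q True rc[OF i] in auto)
    moreover have "cnv \<alpha> \<beta> h = finsum (scalar_module K) ?r {..n}"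
    proof -
      have "comult H h = (\<Oplus>\<^bsub>CC\<^esub>k\<in>{..n}. tensor_map K H H (\<lambda>x. x) (\<lambda>x. x) (t k))" using rel by (simp add: gr_comult_rel_def)
      then have "cnv \<alpha> \<beta> h = tensor_pair K \<alpha> \<beta> (\<Oplus>\<^bsub>CC\<^esub>k\<in>{..n}. tensor_map K H H (\<lambda>x. x) (\<lambda>x. x) (t k))"
        by (simp add: conv_def)
      also have "\<dots> = finsum (scalar_module K) ?r {..n}"
        by (rule finsum_linear[OF mod_CC mod_K CC.tensor_pair_functional[OF fa fb, unfolded functional_def]])
           (use tensor_map_closed(1)[OF tc] in auto)
      finally show ?thesis .
    qed
    moreover have "finsum (scalar_module K) ?r {..n} = finsum (scalar_module K) (\<lambda>k. if i = k then ?r i else 0\<^sub>K) {..n}"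
      by (rule S.M.finsum_cong') (use r True rc[OF i] in auto)
    ultimately show ?thesis using True lin by simp
  next
    case False
    have "finsum (scalar_module K) ?q {..n} = finsum (scalar_module K) (\<lambda>k. \<zero>\<^bsub>scalar_module K\<^esub>) {..n}"
      by (rule S.M.finsum_cong') (use q False in auto)
    also have "\<dots> = \<zero>\<^bsub>scalar_module K\<^esub>" by (rule S.M.finsum_zero)
    finally show ?thesis using False lin by simp
  qed
qed

lemma gr_comult_rel_exists:
  assumes "h \<in> U (Suc n)" shows "\<exists>t. gr_comult_rel n h t"
proof -
  obtain ts where ts: "\<And>i. i \<le> n \<Longrightarrow> set (ts i) \<subseteq> U (Suc i) \<times> U (Suc (n - i))"
    "comult H h = (\<Oplus>\<^bsub>CC\<^esub>i\<in>{..n}. CC.tsum (ts i))" using comult_filtered[OF assms] by blast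
  define t where "t i = lsum (tensor K (HU i) (HU (n - i))) (\<lambda>(v, w). tens K (HU i) (HU (n - i)) v w) (ts i)" for i
  interpret T: module K CC by (rule mod_CC)
  have t: "t i \<in> carrier (tensor K (HU i) (HU (n - i))) \<and> tensor_map K H H (\<lambda>x. x) (\<lambda>x. x) (t i) = CC.tsum (ts i)" if i: "i \<le> n" for i
  proof -
    interpret X: tensor_factors K "HU i" "HU (n - i)" by (rule HU_factors)
    have tc: "set (ts i) \<subseteq> carrier (HU i) \<times> carrier (HU (n - i))" using ts(1)[OF i] by simp
    show ?thesis unfolding t_def tensor_map_def
      using X.tsum_closed[OF tc] X.tensor_lift_tsum[OF mod_CC incl_bilinear tc] by simp
  qed
  have "(\<Oplus>\<^bsub>CC\<^esub>i\<in>{..n}. tensor_map K H H (\<lambda>x. x) (\<lambda>x. x) (t i)) = (\<Oplus>\<^bsub>CC\<^esub>i\<in>{..n}. CC.tsum (ts i))"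
  proof (rule T.M.finsum_cong')
    have "CC.tsum (ts i) \<in> carrier CC" if "i \<le> n" for i
      using t[OF that] tensor_map_closed(1)[of "t i" i "n - i"] by simp
    then show "(\<lambda>i. CC.tsum (ts i)) \<in> {..n} \<rightarrow> carrier CC" by simp
    show "tensor_map K H H (\<lambda>x. x) (\<lambda>x. x) (t i) = CC.tsum (ts i)" if "i \<in> {..n}" for i
      using t[of i] that by simp
  qed simp
  then have "gr_comult_rel n h t" unfolding gr_comult_rel_def using t ts(2) by simp
  then show ?thesis by blast
qed

text \<open>All choices give tensors with the same coordinates: replacing h by h' changes it by an
  element of \<open>U (i + j)\<close>, on which \<alpha> * \<beta> vanishes. So the set in the
  definition is a singleton.\<close>

lemma gr_comult_piece:
  assumes h: "h \<in> U (Suc n)"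
  shows "gr_comult_piece K H n (U n +> h) \<in> carrier GaGa"
    "\<lbrakk>perp (U i) \<alpha>; perp (U j) \<beta>\<rbrakk> \<Longrightarrow> tensor_pair K (coord i \<alpha>) (coord j \<beta>) (gr_comult_piece K H n (U n +> h))
      = (if i + j = n then cnv \<alpha> \<beta> h else 0\<^sub>K)"
proof -
  have hc: "h \<in> carrier H" by (rule U_D(1)[OF h])
  obtain t where t: "gr_comult_rel n h t" using gr_comult_rel_exists[OF h] by blast
  have uniq: "gr_comult_term n t' = gr_comult_term n t" if h': "h' \<in> U n +> h" and t': "gr_comult_rel n h' t'" for h' t'
  proof (rule Ga_tensor_eqI[OF gr_comult_term_closed[OF t'] gr_comult_term_closed[OF t]])
    fix i j \<alpha> \<beta> assume ab: "perp (U i) \<alpha>" "perp (U j) \<beta>"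
    have d: "h' \<in> carrier H" "h' \<ominus> h \<in> U n" using h' cosetU_mem[OF hc] by auto
    have "cnv \<alpha> \<beta> h' = cnv \<alpha> \<beta> h" if "i + j = n"
    proof -
      note fn = conv_fnl[OF perpD(1)[OF ab(1)] perpD(1)[OF ab(2)]]
      have "cnv \<alpha> \<beta> (h' \<ominus> h) = 0\<^sub>K" using d(2) U_add_iff[of "h' \<ominus> h" i j] ab that by blast
      then show ?thesis using functional_minus[OF field_K mod_C fn d(1) hc] functionalD(1)[OF fn] d(1) hc by simp
    qed
    then show "tensor_pair K (coord i \<alpha>) (coord j \<beta>) (gr_comult_term n t')
      = tensor_pair K (coord i \<alpha>) (coord j \<beta>) (gr_comult_term n t)"
      using gr_comult_term_pair[OF t' d(1) ab] gr_comult_term_pair[OF t hc ab] by simp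
  qed
  have "{gr_comult_term n t' |h' t'. h' \<in> U n +> h \<and> gr_comult_rel n h' t'} = {gr_comult_term n t}"
    using uniq t cosetU_self[OF hc, of n] by blast
  then have eq: "gr_comult_piece K H n (U n +> h) = gr_comult_term n t" unfolding gr_comult_piece_eq by simp
  show "gr_comult_piece K H n (U n +> h) \<in> carrier GaGa" unfolding eq by (rule gr_comult_term_closed[OF t])
  show "tensor_pair K (coord i \<alpha>) (coord j \<beta>) (gr_comult_piece K H n (U n +> h))
      = (if i + j = n then cnv \<alpha> \<beta> h else 0\<^sub>K)" if "perp (U i) \<alpha>" "perp (U j) \<beta>"
    unfolding eq by (rule gr_comult_term_pair[OF t hc that])
qed

text \<open>Only the component of degree i + j contributes. If it is zero and hence missing from the
  sum, h lies in \<open>U (i + j)\<close> and \<alpha> * \<beta> vanishes at h.\<close>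

lemma gr_comult:
  assumes u: "u \<in> carrier Ga"
  shows "gr_comult K H u \<in> carrier GaGa"
    "\<lbrakk>perp (U i) \<alpha>; perp (U j) \<beta>; h \<in> u (i + j)\<rbrakk> \<Longrightarrow> tensor_pair K (coord i \<alpha>) (coord j \<beta>) (gr_comult K H u) = cnv \<alpha> \<beta> h"
proof -
  let ?A = "{n. u n \<noteq> U n}"
  have fin: "finite ?A" using u by (simp add: Ga_carrier)
  have eq: "gr_comult K H u = (\<Oplus>\<^bsub>GaGa\<^esub>n\<in>?A. gr_comult_piece K H n (u n))"
    by (simp add: gr_comult_def Let_def piece_zero)
  have pc: "gr_comult_piece K H n (u n) \<in> carrier GaGa" for n
  proof -
    obtain h where "h \<in> U (Suc n)" "u n = U n +> h" using Ga_rep[OF u] by blast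
    then show ?thesis using gr_comult_piece(1) by simp
  qed
  interpret G: module K GaGa by (rule mod_GaGa)
  interpret S: module K "scalar_module K" by (rule mod_K)
  show "gr_comult K H u \<in> carrier GaGa" unfolding eq using pc by (intro G.M.finsum_closed) auto
  assume ab: "perp (U i) \<alpha>" "perp (U j) \<beta>" and h: "h \<in> u (i + j)"
  note hU = Ga_mem[OF u h]
  have hc: "h \<in> carrier H" by (rule U_D(1)[OF hU(1)])
  have cc: "cnv \<alpha> \<beta> h \<in> carrier K" using functionalD(1)[OF conv_fnl[OF perpD(1)[OF ab(1)] perpD(1)[OF ab(2)]] hc] .
  let ?q = "\<lambda>n. tensor_pair K (coord i \<alpha>) (coord j \<beta>) (gr_comult_piece K H n (u n))"
  have q: "?q n = (if n = i + j then cnv \<alpha> \<beta> h else 0\<^sub>K)" for n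
  proof (cases "n = i + j")
    case True
    then show ?thesis using gr_comult_piece(2)[OF hU(1) ab] hU(2) by simp
  next
    case False
    obtain x where "x \<in> U (Suc n)" "u n = U n +> x" using Ga_rep[OF u] by blast
    then show ?thesis using gr_comult_piece(2)[OF _ ab, of x n] False by auto
  qed
  have "tensor_pair K (coord i \<alpha>) (coord j \<beta>) (gr_comult K H u) = finsum (scalar_module K) ?q ?A"
    unfolding eq
    by (rule finsum_linear[OF mod_GaGa mod_K GG.tensor_pair_functional[OF coord_functional[OF ab(1)] coord_functional[OF ab(2)], unfolded functional_def] pc])
  also have "\<dots> = finsum (scalar_module K) (\<lambda>n. if i + j = n then cnv \<alpha> \<beta> h else 0\<^sub>K) ?A"
    by (rule S.M.finsum_cong') (use q cc in auto)
  also have "\<dots> = cnv \<alpha> \<beta> h"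
  proof (cases "i + j \<in> ?A")
    case True
    then show ?thesis using S.M.add.finprod_singleton[of "i + j" ?A "\<lambda>n. cnv \<alpha> \<beta> h", unfolded scalar_module_simps] fin cc by simp
  next
    case False
    then have "h \<in> U (i + j)" using h by auto
    then have z: "cnv \<alpha> \<beta> h = 0\<^sub>K" using U_add_iff[of h i j] ab by blast
    have "finsum (scalar_module K) (\<lambda>n. if i + j = n then cnv \<alpha> \<beta> h else 0\<^sub>K) ?A = finsum (scalar_module K) (\<lambda>n. \<zero>\<^bsub>scalar_module K\<^esub>) ?A"
      by (rule S.M.finsum_cong') (auto simp: z)
    also have "\<dots> = \<zero>\<^bsub>scalar_module K\<^esub>" by (rule S.M.finsum_zero)
    finally show ?thesis using z by simp
  qed
  finally show "tensor_pair K (coord i \<alpha>) (coord j \<beta>) (gr_comult K H u) = cnv \<alpha> \<beta> h" .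
qed

section \<open>The associated graded Hopf algebra\<close>

abbreviation "grH \<equiv> gr K H"
abbreviation "G_gr \<equiv> grouplike_group K (gr K H)"
abbreviation "P_gr \<equiv> skew_primitives K (gr K H)"

lemma sw_filtered_zero:
  assumes Z: "module K Z" and b: "bilinear_map K H H Z b" and h: "h \<in> U (Suc n)"
    and z: "\<And>i x y. \<lbrakk>i \<le> n; x \<in> U (Suc i); y \<in> U (Suc (n - i))\<rbrakk> \<Longrightarrow> b x y = \<zero>\<^bsub>Z\<^esub>"
  shows "sw Z b h = \<zero>\<^bsub>Z\<^esub>"
proof -
  interpret Z: module K Z by (rule Z)
  obtain ts where ts: "\<And>i. i \<le> n \<Longrightarrow> set (ts i) \<subseteq> U (Suc i) \<times> U (Suc (n - i))"
    "comult H h = (\<Oplus>\<^bsub>CC\<^esub>i\<in>{..n}. CC.tsum (ts i))" using comult_filtered[OF h] by blast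
  have tc: "set (ts i) \<subseteq> carrier H \<times> carrier H" if "i \<le> n" for i using ts(1)[OF that] U_D(1) by blast
  have "sw Z b h = (\<Oplus>\<^bsub>Z\<^esub>i\<in>{..n}. tensor_lift K Z b (CC.tsum (ts i)))"
    unfolding sweedler_def ts(2)
    by (rule finsum_linear[OF mod_CC Z CC.tensor_lift_linear[OF Z b]]) (use CC.tsum_closed[OF tc] in auto)
  also have "\<dots> \<in> {\<zero>\<^bsub>Z\<^esub>}"
  proof (rule finsum_submodule[OF Z zero_submodule[OF Z]])
    fix i assume "i \<in> {..n}"
    then have i: "i \<le> n" by simp
    have "lsum Z (\<lambda>(x, y). b x y) (ts i) = \<zero>\<^bsub>Z\<^esub>"
      by (rule Z.M.lsum_zero) (use ts(1)[OF i] z[OF i] in auto)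
    then show "tensor_lift K Z b (CC.tsum (ts i)) \<in> {\<zero>\<^bsub>Z\<^esub>}"
      using CC.tensor_lift_tsum[OF Z b tc[OF i]] by simp
  qed
  finally show ?thesis by simp
qed

section \<open>The filtration is multiplicative\<close>

lemma mult_U1: assumes x: "x \<in> U (Suc 0)" and y: "y \<in> U (Suc 0)" shows "x \<otimes> y \<in> U (Suc 0)"
proof (rule linear_preserves_U1[OF mult_linear1[OF linear_map_id U_D(1)[OF y]] _ x])
  fix g assume g: "g \<in> GL"
  show "g \<otimes> y \<in> U (Suc 0)"
    by (rule linear_preserves_U1[OF mult_linear2[OF linear_map_id GL_closed[OF g]] _ y]) (rule GL_U1[OF mult_GL[OF g]])
qed

text \<open>For f annihilating H_0 and g annihilating H_{a+b-1}, (f * g)(xy) is a sum over terms pr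
  \<otimes> qs with p in H_i and r in H_j. For i = j = 0 the left factor is in H_0 by
  \<open>mult_U1\<close>; otherwise the right one lies in H_{a+b-i-j} by induction, hence in
  H_{a+b-1}.\<close>

lemma mult_U: "\<lbrakk>x \<in> U (Suc a); y \<in> U (Suc b)\<rbrakk> \<Longrightarrow> x \<otimes> y \<in> U (Suc (a + b))"
proof (induction "a + b" arbitrary: a b x y rule: less_induct)
  case less
  note x = less.prems(1) and y = less.prems(2)
  note xc = U_D(1)[OF x] and yc = U_D(1)[OF y]
  show ?case
  proof (cases "a + b = 0")
    case True
    then show ?thesis using mult_U1 x y by simp
  next
    case False
    show ?thesis
    proof (subst U_Suc_iff, intro conjI allI impI)
      show "x \<otimes> y \<in> carrier H" using xc yc by simp
      fix f g assume fg: "perp (U (Suc 0)) f" "perp (U (a + b)) g"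
      note ff = perpD(1)[OF fg(1)] and gg = perpD(1)[OF fg(2)]
      note fgb = fnl_bilinear[OF ff gg]
      note t4 = mult4_bilinear[OF fgb]
      let ?Z = "scalar_module K"
      have b: "bilinear_map K H H ?Z (\<lambda>p q. sw ?Z (\<lambda>r s. f (p \<otimes> r) *\<^sub>K g (q \<otimes> s)) y)"
        by (intro bilinear_mapI sw_param[OF mod_K mod_C] yc t4(1)
          bilinear_mapD(1)[OF t4(2)] bilinear_mapD(2)[OF t4(2)])
      have "sw ?Z (\<lambda>p q. sw ?Z (\<lambda>r s. f (p \<otimes> r) *\<^sub>K g (q \<otimes> s)) y) x = \<zero>\<^bsub>?Z\<^esub>"
      proof (rule sw_filtered_zero[OF mod_K b x])
        fix i p q assume pq: "i \<le> a" "p \<in> U (Suc i)" "q \<in> U (Suc (a - i))"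
        note c = U_D(1)[OF pq(2)] U_D(1)[OF pq(3)]
        show "sw ?Z (\<lambda>r s. f (p \<otimes> r) *\<^sub>K g (q \<otimes> s)) y = \<zero>\<^bsub>?Z\<^esub>"
        proof (rule sw_filtered_zero[OF mod_K t4(1)[OF c] y])
          fix j r s assume rs: "j \<le> b" "r \<in> U (Suc j)" "s \<in> U (Suc (b - j))"
          note c' = U_D(1)[OF rs(2)] U_D(1)[OF rs(3)]
          have "f (p \<otimes> r) = 0\<^sub>K \<or> g (q \<otimes> s) = 0\<^sub>K"
          proof (cases "i + j = 0")
            case True
            then have "p \<otimes> r \<in> U (Suc 0)" using pq(2) rs(2) by (intro mult_U1) auto
            then show ?thesis using perpD(2)[OF fg(1)] by blast
          next
            case ne: False
            have "q \<otimes> s \<in> U (Suc ((a - i) + (b - j)))"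
              by (rule less.hyps[OF _ pq(3) rs(3)]) (use ne False pq(1) rs(1) in linarith)
            moreover have "Suc ((a - i) + (b - j)) \<le> a + b" using ne False pq(1) rs(1) by linarith
            ultimately have "q \<otimes> s \<in> U (a + b)" using U_mono[of "Suc ((a - i) + (b - j))" "a + b"] by blast
            then show ?thesis using perpD(2)[OF fg(2)] by blast
          qed
          moreover have "f (p \<otimes> r) \<in> carrier K" "g (q \<otimes> s) \<in> carrier K"
            using functionalD(1)[OF ff] functionalD(1)[OF gg] c c' by auto
          ultimately show "f (p \<otimes> r) *\<^sub>K g (q \<otimes> s) = \<zero>\<^bsub>?Z\<^esub>" by auto
        qed
      qed
      then show "cnv f g (x \<otimes> y) = 0\<^sub>K"
        unfolding conv_sw sw_mult[OF mod_K fgb xc yc] by simp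
    qed
  qed
qed

text \<open>The form with H_{-1} included, for products in which one factor is a difference of two
  representatives.\<close>

lemma mult_U_left: "\<lbrakk>x \<in> U i; y \<in> U (Suc j)\<rbrakk> \<Longrightarrow> x \<otimes> y \<in> U (i + j)"
  using mult_U[of x "i - 1" y j] U_D(1)[of y] U_D(2) by (cases i) (auto simp: U_simps(1))

lemma mult_U_right: "\<lbrakk>x \<in> U (Suc i); y \<in> U j\<rbrakk> \<Longrightarrow> x \<otimes> y \<in> U (i + j)"
  using mult_U[of x i y "j - 1"] U_D(1)[of x] U_D(2) by (cases j) (auto simp: U_simps(1))

lemma gr_simps:
  "carrier grH = carrier Ga" "zero grH = zero Ga" "add grH = add Ga" "smult grH = smult Ga"
  "one grH = cls 0 \<one>" "monoid.mult grH = monoid.mult Ga" "comult grH = gr_comult K H"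
  "antipode grH = (\<lambda>u n. \<Union>h\<in>u n. U n +> S h)"
  by (simp_all add: gr_def module.defs hopf_alg.defs Ga_simps)

lemma tensor_gr: "tensor K grH grH = GaGa" "tens K grH grH = tens K Ga Ga"
proof -
  have F: "free_on_pairs K grH grH = free_on_pairs K Ga Ga"
    by (simp add: free_on_pairs_def gr_simps)
  have "bilinear_relations K grH grH = bilinear_relations K Ga Ga"
    by (simp add: bilinear_relations_def F gr_simps)
  then have N: "tensor_null K grH grH = tensor_null K Ga Ga" by (simp add: tensor_null_def F)
  show "tensor K grH grH = GaGa" by (simp add: tensor_def F N)
  show "tens K grH grH = tens K Ga Ga" by (simp add: tens_def F N fun_eq_iff)
qed

lemma gr_piece_mult:
  assumes u: "u \<in> carrier Ga" "x \<in> u i" and v: "v \<in> carrier Ga" "y \<in> v j"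
  shows "gr_piece_mult K H i j (u i) (v j) = U (i + j) +> (x \<otimes> y)"
proof -
  have "U (i + j) +> (x' \<otimes> y') = U (i + j) +> (x \<otimes> y)" if x': "x' \<in> u i" and y': "y' \<in> v j" for x' y'
  proof -
    note xx = Ga_mem[OF u] Ga_mem(1)[OF u(1) x'] and yy = Ga_mem[OF v] Ga_mem(1)[OF v(1) y']
    note c = U_D(1)[OF xx(1)] U_D(1)[OF xx(3)] U_D(1)[OF yy(1)] U_D(1)[OF yy(3)]
    have dx: "x' \<ominus> x \<in> U i" using x' xx(2) cosetU_mem[OF c(1)] by simp
    have dy: "y' \<ominus> y \<in> U j" using y' yy(2) cosetU_mem[OF c(3)] by simp
    have "x' \<otimes> y' \<ominus> x \<otimes> y = (x' \<ominus> x) \<otimes> y' \<oplus> x \<otimes> (y' \<ominus> y)"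
      using c by (simp add: a_minus_def A.l_distr A.r_distr A.l_minus A.r_minus A.a_assoc A.r_neg1)
    also have "\<dots> \<in> U (i + j)" by (intro U_D(3) mult_U_left[OF dx yy(3)] mult_U_right[OF xx(1) dy])
    finally show ?thesis using cosetU_eq c by simp
  qed
  then show ?thesis unfolding gr_piece_mult_def using u(2) v(2) by blast
qed

lemma gr_elem_mem:
  assumes "x \<in> U (Suc n)" shows "x \<in> cls n x n" "i \<noteq> n \<Longrightarrow> \<zero> \<in> cls n x i"
  using cosetU_self[OF U_D(1)[OF assms]] U_D(2) by (auto simp: gr_elem_def)

lemma piece_abelian: "abelian_group (gr_piece K H n)"
  by (rule module.axioms(2)[OF mod_piece])

lemma coset_piece: "x \<in> U (Suc n) \<Longrightarrow> U n +> x \<in> carrier (gr_piece K H n)"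
  by (auto simp: piece_carrier)

lemma gr_mult_degree_0:
  assumes x: "x \<in> U (Suc 0)" and u: "u \<in> carrier Ga" and h: "h \<in> u n"
  shows "monoid.mult Ga (cls 0 x) u n = U n +> (x \<otimes> h)"
    "monoid.mult Ga u (cls 0 x) n = U n +> (h \<otimes> x)"
proof -
  interpret Pn: abelian_group "gr_piece K H n" by (rule piece_abelian)
  note xe = gr_elem_closed[OF x]
  note hU = Ga_mem[OF u h]
  have c: "x \<in> carrier H" "h \<in> carrier H" using U_D(1) x hU(1) by auto
  have mem: "x \<otimes> h \<in> U (Suc n)" "h \<otimes> x \<in> U (Suc n)" using mult_U[OF x hU(1)] mult_U[OF hU(1) x] by auto
  have 1: "gr_piece_mult K H i (n - i) (cls 0 x i) (u (n - i)) = (if 0 = i then U n +> (x \<otimes> h) else \<zero>\<^bsub>gr_piece K H n\<^esub>)"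
    if i: "i \<in> {..n}" for i
  proof (cases "i = 0")
    case True
    then show ?thesis using gr_piece_mult[OF xe gr_elem_mem(1)[OF x] u h] by simp
  next
    case False
    obtain k where k: "k \<in> U (Suc (n - i))" "k \<in> u (n - i)" using Ga_rep[OF u] by blast
    have "\<zero> \<otimes> k = \<zero>" using U_D(1)[OF k(1)] by simp
    then show ?thesis using gr_piece_mult[OF xe gr_elem_mem(2)[OF x False] u k(2)] False i cosetU_zero by (simp add: piece_zero)
  qed
  have 2: "gr_piece_mult K H i (n - i) (u i) (cls 0 x (n - i)) = (if n = i then U n +> (h \<otimes> x) else \<zero>\<^bsub>gr_piece K H n\<^esub>)"
    if i: "i \<in> {..n}" for i
  proof (cases "n = i")
    case True
    then show ?thesis using gr_piece_mult[OF u h xe gr_elem_mem(1)[OF x]] by simp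
  next
    case False
    then have ne: "n - i \<noteq> 0" using i by simp
    obtain k where k: "k \<in> U (Suc i)" "k \<in> u i" using Ga_rep[OF u] by blast
    have "k \<otimes> \<zero> = \<zero>" using U_D(1)[OF k(1)] by simp
    then show ?thesis using gr_piece_mult[OF u k(2) xe gr_elem_mem(2)[OF x ne]] False i cosetU_zero by (simp add: piece_zero)
  qed
  have "monoid.mult Ga (cls 0 x) u n = (\<Oplus>\<^bsub>gr_piece K H n\<^esub>i\<in>{..n}. if 0 = i then U n +> (x \<otimes> h) else \<zero>\<^bsub>gr_piece K H n\<^esub>)"
    unfolding gr_algebra_def Let_def by simp (rule Pn.finsum_cong'; use 1 coset_piece[OF mem(1)] in \<open>auto simp: Pi_iff\<close>)
  then show "monoid.mult Ga (cls 0 x) u n = U n +> (x \<otimes> h)"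
    using Pn.add.finprod_singleton[of 0 "{..n}" "\<lambda>i. U n +> (x \<otimes> h)"] coset_piece[OF mem(1)] by simp
  have "monoid.mult Ga u (cls 0 x) n = (\<Oplus>\<^bsub>gr_piece K H n\<^esub>i\<in>{..n}. if n = i then U n +> (h \<otimes> x) else \<zero>\<^bsub>gr_piece K H n\<^esub>)"
    unfolding gr_algebra_def Let_def by simp (rule Pn.finsum_cong'; use 2 coset_piece[OF mem(2)] in \<open>auto simp: Pi_iff\<close>)
  then show "monoid.mult Ga u (cls 0 x) n = U n +> (h \<otimes> x)"
    using Pn.add.finprod_singleton[of n "{..n}" "\<lambda>i. U n +> (h \<otimes> x)"] coset_piece[OF mem(2)] by simp
qed

lemma gr_elem_mult:
  assumes x: "x \<in> U (Suc 0)" and y: "y \<in> U (Suc 0)"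
  shows "monoid.mult Ga (cls 0 x) (cls 0 y) = cls 0 (x \<otimes> y)"
proof
  fix n
  have c: "x \<in> carrier H" using U_D(1)[OF x] .
  show "monoid.mult Ga (cls 0 x) (cls 0 y) n = cls 0 (x \<otimes> y) n"
  proof (cases "n = 0")
    case True
    then show ?thesis using gr_mult_degree_0(1)[OF x gr_elem_closed[OF y] gr_elem_mem(1)[OF y]] by (simp add: gr_elem_def)
  next
    case False
    then show ?thesis using gr_mult_degree_0(1)[OF x gr_elem_closed[OF y] gr_elem_mem(2)[OF y False]] c cosetU_zero
      by (simp add: gr_elem_def)
  qed
qed

lemma gr_elem_commutes_iff:
  assumes x: "x \<in> U (Suc 0)" and u: "u \<in> carrier Ga"
  shows "monoid.mult Ga (cls 0 x) u = monoid.mult Ga u (cls 0 x) \<longleftrightarrow> (\<forall>n. \<forall>h\<in>u n. x \<otimes> h \<ominus> h \<otimes> x \<in> U n)"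
proof -
  have "monoid.mult Ga (cls 0 x) u n = monoid.mult Ga u (cls 0 x) n \<longleftrightarrow> (\<forall>h\<in>u n. x \<otimes> h \<ominus> h \<otimes> x \<in> U n)" for n
  proof -
    have "monoid.mult Ga (cls 0 x) u n = monoid.mult Ga u (cls 0 x) n \<longleftrightarrow> x \<otimes> h \<ominus> h \<otimes> x \<in> U n" if h: "h \<in> u n" for h
      using cosetU_eq[of "x \<otimes> h" "h \<otimes> x" n] U_D(1)[OF x] U_D(1)[OF Ga_mem(1)[OF u h]]
      unfolding gr_mult_degree_0[OF x u h] by simp
    moreover obtain h where "h \<in> u n" using Ga_rep[OF u] by blast
    ultimately show ?thesis by blast
  qed
  then show ?thesis by (simp add: fun_eq_iff)
qed

lemma gr_comult_eq_iff:
  assumes u: "u \<in> carrier Ga" and T: "T \<in> carrier GaGa"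
  shows "gr_comult K H u = T \<longleftrightarrow> (\<forall>i j \<alpha> \<beta>. perp (U i) \<alpha> \<longrightarrow> perp (U j) \<beta> \<longrightarrow>
    (\<forall>h\<in>u (i + j). cnv \<alpha> \<beta> h = tensor_pair K (coord i \<alpha>) (coord j \<beta>) T))"
proof
  assume "gr_comult K H u = T"
  then show "\<forall>i j \<alpha> \<beta>. perp (U i) \<alpha> \<longrightarrow> perp (U j) \<beta> \<longrightarrow>
    (\<forall>h\<in>u (i + j). cnv \<alpha> \<beta> h = tensor_pair K (coord i \<alpha>) (coord j \<beta>) T)"
    using gr_comult(2)[OF u] by metis
next
  assume *: "\<forall>i j \<alpha> \<beta>. perp (U i) \<alpha> \<longrightarrow> perp (U j) \<beta> \<longrightarrow>
    (\<forall>h\<in>u (i + j). cnv \<alpha> \<beta> h = tensor_pair K (coord i \<alpha>) (coord j \<beta>) T)"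
  show "gr_comult K H u = T"
  proof (rule Ga_tensor_eqI[OF gr_comult(1)[OF u] T])
    fix i j \<alpha> \<beta> assume ab: "perp (U i) \<alpha>" "perp (U j) \<beta>"
    obtain h where h: "h \<in> u (i + j)" using Ga_rep[OF u] by blast
    show "tensor_pair K (coord i \<alpha>) (coord j \<beta>) (gr_comult K H u) = tensor_pair K (coord i \<alpha>) (coord j \<beta>) T"
      using gr_comult(2)[OF u ab h] * ab h by metis
  qed
qed

lemma gr_grouplike: "carrier (G_gr) = cls 0 ` GL"
proof (intro equalityI subsetI)
  fix X assume "X \<in> cls 0 ` GL"
  then obtain g where g: "g \<in> GL" and X: "X = cls 0 g" by blast
  note gU = GL_U1[OF g]
  have Xc: "X \<in> carrier Ga" unfolding X by (rule gr_elem_closed[OF gU])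
  have "X \<noteq> \<zero>\<^bsub>Ga\<^esub>"
  proof
    assume "X = \<zero>\<^bsub>Ga\<^esub>"
    then have "g \<in> U 0" using gr_elem_mem(1)[OF gU] by (simp add: X Ga_simps)
    then show False using g by (simp add: U_simps GL_iff)
  qed
  moreover have "gr_comult K H X = tens K Ga Ga X X"
  proof (rule gr_comult_eq_iff[OF Xc bilinear_mapD(3)[OF GG.tens_bilinear Xc Xc], THEN iffD2], intro allI impI ballI)
    fix i j \<alpha> \<beta> h assume ab: "perp (U i) \<alpha>" "perp (U j) \<beta>" and h: "h \<in> X (i + j)"
    note ff = perpD(1)[OF ab(1)] perpD(1)[OF ab(2)]
    have r: "tensor_pair K (coord i \<alpha>) (coord j \<beta>) (tens K Ga Ga X X)
      = (if i = 0 then \<alpha> g else 0\<^sub>K) *\<^sub>K (if j = 0 then \<beta> g else 0\<^sub>K)"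
      using GG.tensor_pair_tens[OF coord_functional[OF ab(1)] coord_functional[OF ab(2)] Xc Xc]
        coord_gr_elem[OF ab(1) gU] coord_gr_elem[OF ab(2) gU] by (simp add: X)
    note v = functionalD(1)[OF ff(1) GL_closed[OF g]] functionalD(1)[OF ff(2) GL_closed[OF g]]
    show "cnv \<alpha> \<beta> h = tensor_pair K (coord i \<alpha>) (coord j \<beta>) (tens K Ga Ga X X)"
    proof (cases "i + j = 0")
      case True
      have "h \<ominus> g \<in> U 0" using h True cosetU_mem[OF GL_closed[OF g]] by (simp add: X gr_elem_def)
      moreover have "h \<in> carrier H" by (rule U_D(1)[OF Ga_mem(1)[OF Xc h]])
      ultimately have "h = g" using GL_closed[OF g] by (simp add: U_simps)
      then show ?thesis unfolding r using True conv_GL[OF ff g] by simp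
    next
      case False
      then have "h \<in> U (i + j)" using h by (auto simp: X gr_elem_def split: if_splits)
      then have "cnv \<alpha> \<beta> h = 0\<^sub>K" using U_add_iff[of h i j] ab by blast
      then show ?thesis unfolding r using False v by auto
    qed
  qed
  ultimately show "X \<in> carrier (G_gr)"
    using Xc by (simp add: grouplike_group_def gr_simps tensor_gr)
next
  fix X assume "X \<in> carrier (G_gr)"
  then have X: "X \<in> carrier Ga" "X \<noteq> \<zero>\<^bsub>Ga\<^esub>" "gr_comult K H X = tens K Ga Ga X X"
    by (simp_all add: grouplike_group_def gr_simps tensor_gr)
  have cop: "cnv \<alpha> \<beta> h = \<alpha> x *\<^sub>K \<beta> y"
    if ab: "perp (U i) \<alpha>" "perp (U j) \<beta>" and h: "h \<in> X (i + j)" "x \<in> X i" "y \<in> X j" for i j \<alpha> \<beta> h x y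
    using gr_comult(2)[OF X(1) ab h(1)] coord_eq[OF ab(1) X(1) h(2)] coord_eq[OF ab(2) X(1) h(3)]
      GG.tensor_pair_tens[OF coord_functional[OF ab(1)] coord_functional[OF ab(2)] X(1) X(1)] X(3) by simp
  have pos: "X n = U n" if "n > 0" for n
  proof (rule ccontr)
    assume "X n \<noteq> U n"
    define A where "A = {n. X n \<noteq> U n}"
    have A: "finite A" "n \<in> A" using X(1) \<open>X n \<noteq> U n\<close> by (auto simp: A_def Ga_carrier)
    define N where "N = Max A"
    have N: "N \<in> A" "N > 0" unfolding N_def using A \<open>n > 0\<close> by (auto intro: Max_in order.strict_trans2[OF _ Max_ge])
    have "2 * N \<notin> A" using Max_ge[OF A(1), of "2 * N"] N(2) by (auto simp: N_def[symmetric])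
    then have "\<zero> \<in> X (N + N)" using U_D(2) by (simp add: A_def mult_2)
    obtain h where h: "h \<in> U (Suc N)" "X N = U N +> h" "h \<in> X N" using Ga_rep[OF X(1)] by blast
    have "h \<notin> U N" using h(2) cosetU_U N(1) by (auto simp: A_def)
    then obtain \<phi> where ph: "perp (U N) \<phi>" "\<phi> h \<noteq> 0\<^sub>K" using U_perp_perp[OF U_D(1)[OF h(1)]] by blast
    note c = conv_fnl[OF perpD(1)[OF ph(1)] perpD(1)[OF ph(1)]]
    have "\<phi> h *\<^sub>K \<phi> h = 0\<^sub>K"
      using cop[OF ph(1) ph(1) \<open>\<zero> \<in> X (N + N)\<close> h(3) h(3)] fnl_zero[OF c] by simp
    then show False using ph(2) functionalD(1)[OF perpD(1)[OF ph(1)] U_D(1)[OF h(1)]] by (simp add: K.integral_iff)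
  qed
  obtain h where h: "h \<in> U (Suc 0)" "X 0 = U 0 +> h" "h \<in> X 0" using Ga_rep[OF X(1)] by blast
  have Xh: "X = cls 0 h" by (rule ext) (simp add: gr_elem_def h(2) pos)
  have hc: "h \<in> carrier H" by (rule U_D(1)[OF h(1)])
  have "h \<noteq> \<zero>"
  proof
    assume "h = \<zero>"
    then have "X n = U n" for n using pos[of n] h(2) cosetU_zero by (cases "n = 0") auto
    then show False using X(2) by (simp add: Ga_simps fun_eq_iff)
  qed
  moreover have "comult H h = tens K H H h h"
  proof (rule CC.tensor_eqI[OF comult_closed[OF hc] bilinear_mapD(3)[OF CC.tens_bilinear hc hc]])
    fix f g assume fg: "fnl f" "fnl g"
    have p: "perp (U 0) f" "perp (U 0) g"
      using fg fnl_zero[OF fg(1)] fnl_zero[OF fg(2)] by (simp_all add: perp_def U_simps)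
    have h0: "h \<in> X (0 + 0)" using h(3) by simp
    show "tensor_pair K f g (comult H h) = tensor_pair K f g (tens K H H h h)"
      using cop[OF p h0 h(3) h(3)] CC.tensor_pair_tens[OF fg hc hc] by (simp add: conv_def)
  qed
  ultimately have "h \<in> GL" using hc by (simp add: GL_iff)
  then show "X \<in> cls 0 ` GL" using Xh by blast
qed

lemma gr_grouplike_mult:
  assumes "g \<in> GL" "g' \<in> GL"
  shows "cls 0 g \<otimes>\<^bsub>G_gr\<^esub> cls 0 g' = cls 0 (g \<otimes> g')"
  using gr_elem_mult[OF GL_U1 GL_U1] assms by (simp add: grouplike_group_simps gr_simps)

lemma gr_grouplike_one: "\<one>\<^bsub>G_gr\<^esub> = cls 0 \<one>"
  by (simp add: grouplike_group_simps gr_simps)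

lemma group_gr: "group (G_gr)"
proof (rule groupI)
  show "\<one>\<^bsub>G_gr\<^esub> \<in> carrier (G_gr)"
    using one_GL by (auto simp: gr_grouplike gr_grouplike_one)
next
  fix X assume "X \<in> carrier (G_gr)"
  then obtain g where g: "g \<in> GL" "X = cls 0 g" by (auto simp: gr_grouplike)
  note c = GL_closed[OF g(1)]
  show "\<one>\<^bsub>G_gr\<^esub> \<otimes>\<^bsub>G_gr\<^esub> X = X"
    unfolding gr_grouplike_one g(2) gr_grouplike_mult[OF one_GL g(1)] using c by simp
  show "\<exists>Y\<in>carrier (G_gr). Y \<otimes>\<^bsub>G_gr\<^esub> X = \<one>\<^bsub>G_gr\<^esub>"
    using gr_grouplike_mult[OF S_GL[OF g(1)] g(1)] S_GL[OF g(1)] S_GL_inverse[OF g(1)]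
    by (auto simp: gr_grouplike gr_grouplike_one g(2) intro!: bexI[of _ "cls 0 (S g)"])
next
  fix X Y assume "X \<in> carrier (G_gr)" "Y \<in> carrier (G_gr)"
  then obtain g k where g: "g \<in> GL" "X = cls 0 g" "k \<in> GL" "Y = cls 0 k" by (auto simp: gr_grouplike)
  show "X \<otimes>\<^bsub>G_gr\<^esub> Y \<in> carrier (G_gr)"
    unfolding g(2,4) gr_grouplike_mult[OF g(1,3)] gr_grouplike using mult_GL[OF g(1,3)] by blast
  fix Z assume "Z \<in> carrier (G_gr)"
  then obtain l where l: "l \<in> GL" "Z = cls 0 l" by (auto simp: gr_grouplike)
  show "X \<otimes>\<^bsub>G_gr\<^esub> Y \<otimes>\<^bsub>G_gr\<^esub> Z
    = X \<otimes>\<^bsub>G_gr\<^esub> (Y \<otimes>\<^bsub>G_gr\<^esub> Z)"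
    unfolding g(2,4) l(2) using g(1,3) l(1) GL_closed
    by (simp add: gr_grouplike_mult mult_GL A.m_assoc)
qed

lemma gr_grouplike_pow:
  "g \<in> GL \<Longrightarrow> cls 0 g [^]\<^bsub>G_gr\<^esub> (n::nat) = cls 0 (g [^] n)"
proof (induction n)
  case 0
  then show ?case by (simp add: nat_pow_def gr_grouplike_one)
next
  case (Suc n)
  interpret G: group "G_gr" by (rule group_gr)
  show ?case using Suc gr_grouplike_mult[OF pow_GL[OF Suc.prems] Suc.prems, of n] by simp
qed

lemma gr_antipode:
  assumes u: "u \<in> carrier Ga"
  shows "(antipode grH ^^ k) u \<in> carrier Ga" "h \<in> u n \<Longrightarrow> (antipode grH ^^ k) u n = U n +> (S ^^ k) h"
proof -
  have step: "antipode grH v n = U n +> S h" if v: "v \<in> carrier Ga" and h: "h \<in> v n" for v h n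
  proof -
    note hU = Ga_mem[OF v h]
    note hc = U_D(1)[OF hU(1)]
    have "U n +> S x = U n +> S h" if x: "x \<in> v n" for x
    proof -
      have xc: "x \<in> carrier H" by (rule U_D(1)[OF Ga_mem(1)[OF v x]])
      have "x \<ominus> h \<in> U n" using x hU(2) cosetU_mem[OF hc] by simp
      then have "S (x \<ominus> h) \<in> U n" by (rule S_U)
      then have "S x \<ominus> S h \<in> U n" using linear_map_minus[OF mod_C mod_C S_linear xc hc] by simp
      then show ?thesis using cosetU_eq S_closed xc hc by simp
    qed
    then show ?thesis unfolding gr_simps using h by blast
  qed
  have closed: "antipode grH v \<in> carrier Ga" if v: "v \<in> carrier Ga" for v
  proof -
    have "antipode grH v n \<in> carrier (gr_piece K H n)" for n
    proof -
      obtain h where h: "h \<in> U (Suc n)" "h \<in> v n" using Ga_rep[OF v] by blast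
      show ?thesis unfolding step[OF v h(2)] by (rule coset_piece[OF S_U[OF h(1)]])
    qed
    moreover have "antipode grH v n = U n" if "v n = U n" for n
    proof -
      have "\<zero> \<in> v n" using that U_D(2) by simp
      then show ?thesis using step[OF v, of \<zero> n] cosetU_zero linear_map_zero[OF mod_C mod_C S_linear] by simp
    qed
    then have "{n. antipode grH v n \<noteq> U n} \<subseteq> {n. v n \<noteq> U n}" by blast
    moreover have "finite {n. v n \<noteq> U n}" using v by (simp add: Ga_carrier)
    ultimately show ?thesis unfolding Ga_carrier using finite_subset by blast
  qed
  show *: "(antipode grH ^^ k) u \<in> carrier Ga" for k by (induction k) (simp_all add: u closed)
  show "(antipode grH ^^ k) u n = U n +> (S ^^ k) h" if h: "h \<in> u n"
  proof (induction k)
    case 0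
    then show ?case using Ga_mem(2)[OF u h] by simp
  next
    case (Suc k)
    have "(S ^^ k) h \<in> (antipode grH ^^ k) u n"
      unfolding Suc using cosetU_self[OF Spow_closed[OF U_D(1)[OF Ga_mem(1)[OF u h]]]] by simp
    then show ?case using step[OF *[of k]] by simp
  qed
qed

lemma gr_antipode_order:
  assumes char: "field_char K = 0" and N: "N \<ge> 1" "\<And>h. h \<in> carrier H \<Longrightarrow> (S ^^ N) h = h"
  shows "antipode_order grH = antipode_order H"
  unfolding antipode_order_def
proof (rule map_order_cong)
  fix k
  show "(\<forall>u\<in>carrier grH. (antipode grH ^^ k) u = u) \<longleftrightarrow> (\<forall>h\<in>carrier H. (S ^^ k) h = h)"
  proof
    assume *: "\<forall>h\<in>carrier H. (S ^^ k) h = h"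
    show "\<forall>u\<in>carrier grH. (antipode grH ^^ k) u = u"
    proof
      fix u assume "u \<in> carrier grH"
      then have u: "u \<in> carrier Ga" by (simp add: gr_simps)
      show "(antipode grH ^^ k) u = u"
      proof
        fix n
        obtain h where h: "h \<in> U (Suc n)" "u n = U n +> h" "h \<in> u n" using Ga_rep[OF u] by blast
        show "(antipode grH ^^ k) u n = u n"
          unfolding gr_antipode(2)[OF u h(3)] using * h(2) U_D(1)[OF h(1)] by simp
      qed
    qed
  next
    assume *: "\<forall>u\<in>carrier grH. (antipode grH ^^ k) u = u"
    have unip: "(S ^^ k) h \<ominus> h \<in> U n" if h: "h \<in> U (Suc n)" for h n
    proof -
      note e = gr_elem_closed[OF h] gr_elem_mem(1)[OF h]
      have "U n +> (S ^^ k) h = U n +> h"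
        using gr_antipode(2)[OF e, of k] * e(1) by (simp add: gr_simps(1) gr_elem_def)
      then show ?thesis using cosetU_eq[OF Spow_closed] U_D(1)[OF h] by simp
    qed
    have "((S ^^ k) ^^ N) h = h" if "h \<in> carrier H" for h
      using funpow_mult_fixed[of N S h k] N(2)[OF that] by (simp add: funpow_mult mult.commute)
    then show "\<forall>h\<in>carrier H. (S ^^ k) h = h"
      using finite_order_unipotent[OF char Spow_linear unip N(1)] by blast
  qed
qed

lemma P_U2: assumes "x \<in> GL" "h \<in> P x" shows "h \<in> U (Suc (Suc 0))"
proof -
  note xc = GL_closed[OF assms(1)] and hc = skewD(1)[OF assms(2)]
  have "cnv f g h = 0\<^sub>K" if fg: "perp (U (Suc 0)) f" "perp (U (Suc 0)) g" for f g
  proof -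
    note ff = perpD(1)[OF fg(1)] perpD(1)[OF fg(2)]
    have "f \<one> = 0\<^sub>K" "g x = 0\<^sub>K"
      using perpD(2)[OF fg(1) GL_U1[OF one_GL]] perpD(2)[OF fg(2) GL_U1[OF assms(1)]] by auto
    then show ?thesis unfolding conv_sw
      using sw_two[OF mod_K fnl_bilinear[OF ff] hc xc A.one_closed hc skewD(2)[OF assms(2)]]
        functionalD(1)[OF ff(1) hc] functionalD(1)[OF ff(2) hc] by simp
  qed
  then show ?thesis using hc U_Suc_iff[of h "Suc 0"] by blast
qed

lemma gr_skew_iff:
  assumes x: "x \<in> GL"
  shows "u \<in> P_gr (cls 0 x) \<longleftrightarrow> u \<in> carrier Ga \<and>
    (\<forall>i j \<alpha> \<beta>. perp (U i) \<alpha> \<longrightarrow> perp (U j) \<beta> \<longrightarrow> (\<forall>h\<in>u (i + j). cnv \<alpha> \<beta> h =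
      coord i \<alpha> u *\<^sub>K (if j = 0 then \<beta> x else 0\<^sub>K) +\<^sub>K (if i = 0 then \<alpha> \<one> else 0\<^sub>K) *\<^sub>K coord j \<beta> u))"
proof (cases "u \<in> carrier Ga")
  case u: True
  note xe = gr_elem_closed[OF GL_U1[OF x]] and oe = gr_elem_closed[OF GL_U1[OF one_GL]]
  note t = bilinear_mapD(3)[OF GG.tens_bilinear u xe] bilinear_mapD(3)[OF GG.tens_bilinear oe u]
  interpret G: module K GaGa by (rule mod_GaGa)
  have "tensor_pair K (coord i \<alpha>) (coord j \<beta>) (tens K Ga Ga u (cls 0 x) \<oplus>\<^bsub>GaGa\<^esub> tens K Ga Ga (cls 0 \<one>) u) =
    coord i \<alpha> u *\<^sub>K (if j = 0 then \<beta> x else 0\<^sub>K) +\<^sub>K (if i = 0 then \<alpha> \<one> else 0\<^sub>K) *\<^sub>K coord j \<beta> u"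
    if ab: "perp (U i) \<alpha>" "perp (U j) \<beta>" for i j \<alpha> \<beta>
  proof -
    note c = coord_functional[OF ab(1)] coord_functional[OF ab(2)]
    show ?thesis
      using functionalD(2)[OF GG.tensor_pair_functional[OF c] t] GG.tensor_pair_tens[OF c u xe] GG.tensor_pair_tens[OF c oe u]
        coord_gr_elem[OF ab(2) GL_U1[OF x]] coord_gr_elem[OF ab(1) GL_U1[OF one_GL]] by simp
  qed
  then show ?thesis
    using gr_comult_eq_iff[OF u G.M.a_closed[OF t]] u by (simp add: skew_primitives_def gr_simps tensor_gr)
qed (simp add: skew_primitives_def gr_simps)

lemma gr_elem_skew:
  assumes x: "x \<in> GL" and h: "h \<in> P x"
  shows "cls (Suc 0) h \<in> P_gr (cls 0 x)"
proof (rule gr_skew_iff[OF x, THEN iffD2], intro conjI allI impI ballI)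
  note hU = P_U2[OF x h] and hc = skewD(1)[OF h] and xc = GL_closed[OF x]
  show u: "cls (Suc 0) h \<in> carrier Ga" by (rule gr_elem_closed[OF hU])
  fix i j \<alpha> \<beta> h' assume ab: "perp (U i) \<alpha>" "perp (U j) \<beta>" and h': "h' \<in> cls (Suc 0) h (i + j)"
  note ff = perpD(1)[OF ab(1)] perpD(1)[OF ab(2)]
  have one: "\<alpha> \<one> = 0\<^sub>K" if "i > 0"
    using that perpD(2)[OF ab(1)] GL_U1[OF one_GL] U_mono[of "Suc 0" i] by (auto simp: Suc_le_eq)
  have bx: "\<beta> x = 0\<^sub>K" if "j > 0"
    using that perpD(2)[OF ab(2)] GL_U1[OF x] U_mono[of "Suc 0" j] by (auto simp: Suc_le_eq)
  note v = functionalD(1)[OF ff(1) hc] functionalD(1)[OF ff(2) hc] functionalD(1)[OF ff(1) A.one_closed] functionalD(1)[OF ff(2) xc]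
  have "cnv \<alpha> \<beta> h' = (if i + j = Suc 0 then \<alpha> h *\<^sub>K \<beta> x +\<^sub>K \<alpha> \<one> *\<^sub>K \<beta> h else 0\<^sub>K)"
  proof (cases "i + j = Suc 0")
    case True
    have "tensor_pair K (coord i \<alpha>) (coord j \<beta>) (gr_comult K H (cls (Suc 0) h)) = cnv \<alpha> \<beta> h"
      by (rule gr_comult(2)[OF u ab]) (use gr_elem_mem(1)[OF hU] True in simp)
    then have "cnv \<alpha> \<beta> h' = cnv \<alpha> \<beta> h" using gr_comult(2)[OF u ab h'] by simp
    also have "\<dots> = \<alpha> h *\<^sub>K \<beta> x +\<^sub>K \<alpha> \<one> *\<^sub>K \<beta> h"
      unfolding conv_sw
      using sw_two[OF mod_K fnl_bilinear[OF ff] hc xc A.one_closed hc skewD(2)[OF h]] by simp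
    finally show ?thesis using True by simp
  next
    case False
    then have "h' \<in> U (i + j)" using h' by (simp add: gr_elem_def)
    then show ?thesis using U_add_iff[of h' i j] ab False by auto
  qed
  then show "cnv \<alpha> \<beta> h' = coord i \<alpha> (cls (Suc 0) h) *\<^sub>K (if j = 0 then \<beta> x else 0\<^sub>K) +\<^sub>K
      (if i = 0 then \<alpha> \<one> else 0\<^sub>K) *\<^sub>K coord j \<beta> (cls (Suc 0) h)"
    unfolding coord_gr_elem[OF ab(1) hU] coord_gr_elem[OF ab(2) hU] using one bx v
    by (cases "i = 0"; cases "j = 0") auto
qed

text \<open>Modulo the coradical, \<open>\<Delta>(h) = h \<otimes> x + 1 \<otimes> h\<close> still determines \<open>S(h)\<close>.\<close>

lemma antipode_mod_U1:
  assumes x: "x \<in> GL" and h: "h \<in> carrier H"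
    and l: "\<And>f g. \<lbrakk>perp (U (Suc 0)) f; fnl g\<rbrakk> \<Longrightarrow> cnv f g h = f h *\<^sub>K g x"
    and r: "\<And>f g. \<lbrakk>fnl f; perp (U (Suc 0)) g\<rbrakk> \<Longrightarrow> cnv f g h = f \<one> *\<^sub>K g h"
  shows "S h \<otimes> x \<oplus> h \<in> U (Suc 0)"
proof -
  interpret T: module K CC by (rule mod_CC)
  note xc = GL_closed[OF x]
  have UH: "U k \<subseteq> carrier H" for k using U_D(1) by blast
  obtain ts where ts: "set ts \<subseteq> carrier H \<times> carrier H" "comult H h = CC.tsum ts" by (rule comult_rep[OF h])
  define us where "us = ts @ [(\<ominus> h, x), (\<ominus> \<one>, h)]"
  have uc: "set us \<subseteq> carrier H \<times> carrier H" using ts(1) h xc by (auto simp: us_def)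
  have pair: "tensor_pair K f g (CC.tsum us) = cnv f g h \<ominus>\<^bsub>K\<^esub> (f h *\<^sub>K g x) \<ominus>\<^bsub>K\<^esub> (f \<one> *\<^sub>K g h)" if fg: "fnl f" "fnl g" for f g
  proof -
    note v = functionalD(1)[OF fg(1)] functionalD(1)[OF fg(2)]
    have neg: "f (\<ominus> y) = \<ominus>\<^bsub>K\<^esub> f y" if y: "y \<in> carrier H" for y
    proof -
      have "f (\<zero> \<ominus> y) = f \<zero> \<ominus>\<^bsub>K\<^esub> f y" by (rule functional_minus[OF field_K mod_C fg(1) A.zero_closed y])
      then show ?thesis using y fnl_zero[OF fg(1)] v(1)[OF y] by (simp add: a_minus_def)
    qed
    have tv: "(case p of (a, b) \<Rightarrow> f a *\<^sub>K g b) \<in> carrier K" if "p \<in> set ts" for p using that ts(1) v by auto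
    have "tensor_pair K f g (CC.tsum us) = lsum K (\<lambda>(a, b). f a *\<^sub>K g b) us" by (rule CC.tensor_pair_tsum[OF fg uc])
    also have "\<dots> = lsum K (\<lambda>(a, b). f a *\<^sub>K g b) ts +\<^sub>K lsum K (\<lambda>(a, b). f a *\<^sub>K g b) [(\<ominus> h, x), (\<ominus> \<one>, h)]"
      unfolding us_def by (rule K.lsum_append) (use tv h xc v in auto)
    also have "\<dots> = cnv f g h \<ominus>\<^bsub>K\<^esub> (f h *\<^sub>K g x) \<ominus>\<^bsub>K\<^esub> (f \<one> *\<^sub>K g h)"
      using h xc v conv_lsum[OF fg ts] functionalD(1)[OF conv_fnl[OF fg] h] neg
      by (simp add: a_minus_def K.l_minus K.a_assoc)
    finally show ?thesis .
  qed
  have p1: "tensor_pair K f g (CC.tsum us) = 0\<^sub>K" if fg: "perp (U (Suc 0)) f" "fnl g" for f g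
    using pair[OF perpD(1)[OF fg(1)] fg(2)] l[OF fg] perpD(2)[OF fg(1) GL_U1[OF one_GL]]
      functionalD(1)[OF perpD(1)[OF fg(1)]] functionalD(1)[OF fg(2)] h xc by (simp add: a_minus_def K.r_neg)
  have p2: "tensor_pair K f g (CC.tsum us) = 0\<^sub>K" if fg: "fnl f" "perp (U (Suc 0)) g" for f g
    using pair[OF fg(1) perpD(1)[OF fg(2)]] r[OF fg] perpD(2)[OF fg(2) GL_U1[OF x]]
      functionalD(1)[OF perpD(1)[OF fg(2)]] functionalD(1)[OF fg(1)] h xc by (simp add: a_minus_def K.r_neg)
  have z: "submodule {\<zero>} K H" by (rule zero_submodule[OF mod_C])
  have zH: "{\<zero>} \<subseteq> carrier H" by simp
  obtain t1 t2 where t: "set t1 \<subseteq> U (Suc 0) \<times> carrier H" "set t2 \<subseteq> carrier H \<times> {\<zero>}"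
    "CC.tsum us = CC.tsum t1 \<oplus>\<^bsub>CC\<^esub> CC.tsum t2"
    using CC.tensor_separate[OF U_submodule[of "Suc 0"] carrier_is_submodule UH z carrier_is_submodule zH uc] p1
    unfolding perp_def by blast
  have t1c: "set t1 \<subseteq> carrier H \<times> carrier H" using t(1) UH by blast
  have "CC.tsum t2 = \<zero>\<^bsub>CC\<^esub>" by (rule T.M.lsum_zero) (use t(2) in \<open>auto simp: CC.tens_zero\<close>)
  then have us1: "CC.tsum us = CC.tsum t1" using t(3) CC.tsum_closed[OF t1c] by simp
  have zU: "{\<zero>} \<subseteq> U (Suc 0)" using U_D(2) by simp
  have p3: "tensor_pair K f g (CC.tsum t1) = 0\<^sub>K" if "fnl f" "fnl g" "\<forall>x\<in>U (Suc 0). g x = 0\<^sub>K" for f g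
    using p2[of f g] that unfolding us1 perp_def by blast
  obtain t3 t4 where t': "set t3 \<subseteq> {\<zero>} \<times> carrier H" "set t4 \<subseteq> U (Suc 0) \<times> U (Suc 0)"
    "CC.tsum t1 = CC.tsum t3 \<oplus>\<^bsub>CC\<^esub> CC.tsum t4"
    using CC.tensor_separate[OF z U_submodule[of "Suc 0"] zU U_submodule[of "Suc 0"] carrier_is_submodule UH t(1)] p3 by blast
  have t4c: "set t4 \<subseteq> carrier H \<times> carrier H" using t'(2) UH by blast
  have "CC.tsum t3 = \<zero>\<^bsub>CC\<^esub>" by (rule T.M.lsum_zero) (use t'(1) in \<open>auto simp: CC.tens_zero\<close>)
  then have us4: "CC.tsum us = CC.tsum t4" using t'(3) us1 CC.tsum_closed[OF t4c] by simp
  have b: "bilinear_map K H H H (\<lambda>a b. S a \<otimes> b)"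
    by (intro bilinear_mapI mult_linear1[OF S_linear] mult_linear2[OF linear_map_id] S_closed)
  let ?b = "\<lambda>(a, b). S a \<otimes> b"
  have tsc: "?b p \<in> carrier H" if "p \<in> set ts" for p using that ts(1) S_closed by auto
  have neg: "S (\<ominus> y) = \<ominus> S y" if y: "y \<in> carrier H" for y
  proof -
    have "S (\<zero> \<ominus> y) = S \<zero> \<ominus> S y" by (rule linear_map_minus[OF mod_C mod_C S_linear A.zero_closed y])
    then show ?thesis using y linear_map_zero[OF mod_C mod_C S_linear] S_closed[OF y] by (simp add: a_minus_def)
  qed
  have Sh: "S h \<in> carrier H" by (rule S_closed[OF h])
  have "lsum H ?b us = lsum H ?b ts \<oplus> lsum H ?b [(\<ominus> h, x), (\<ominus> \<one>, h)]"
    unfolding us_def by (rule A.lsum_append) (use tsc h xc S_closed in auto)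
  also have "lsum H ?b ts = eps h \<odot> \<one>" using sw_lsum[OF mod_C b ts] antipode_left_sw[OF h] by simp
  also have "lsum H ?b [(\<ominus> h, x), (\<ominus> \<one>, h)] = \<ominus> (S h \<otimes> x \<oplus> h)"
    using h xc Sh by (simp add: neg antipode_one A.l_minus A.minus_add)
  finally have e1: "lsum H ?b us = eps h \<odot> \<one> \<oplus> \<ominus> (S h \<otimes> x \<oplus> h)" .
  have "lsum H ?b us = lsum H ?b t4"
    using CC.tensor_lift_tsum[OF mod_C b uc] CC.tensor_lift_tsum[OF mod_C b t4c] us4 by simp
  also have "\<dots> \<in> U (Suc 0)"
    by (rule lsum_submodule[OF mod_C U_submodule]) (use t'(2) mult_U1[OF S_U] in auto)
  finally have e2: "lsum H ?b us \<in> U (Suc 0)" .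
  have e3: "eps h \<odot> \<one> \<in> U (Suc 0)" by (rule U_D(6)[OF eps_closed[OF h] GL_U1[OF one_GL]])
  have "S h \<otimes> x \<oplus> h = eps h \<odot> \<one> \<ominus> lsum H ?b us"
    unfolding e1 using Sh h xc U_D(1)[OF e3] by (simp add: a_minus_def A.minus_add A.a_ac A.r_neg A.r_neg2 A.r_neg1)
  then show ?thesis using U_D(5)[OF e3 e2] by simp
qed

lemma S2_mod_U1:
  assumes x: "x \<in> GL" and h: "h \<in> carrier H" and m: "S h \<otimes> x \<oplus> h \<in> U (Suc 0)"
  shows "S (S h) \<ominus> x \<otimes> h \<otimes> S x \<in> U (Suc 0)"
proof -
  note xc = GL_closed[OF x] and Sx = S_closed[OF GL_closed[OF x]] and Sh = S_closed[OF h]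
  note SSh = S_closed[OF Sh]
  define c where "c = S h \<otimes> x \<oplus> h"
  have cc: "c \<in> carrier H" using U_D(1)[OF m] by (simp add: c_def)
  have "S c = S x \<otimes> S (S h) \<oplus> S h"
    unfolding c_def using linear_mapD(2)[OF S_linear] antipode_mult[OF Sh xc] Sh xc h by simp
  then have "x \<otimes> S c = (x \<otimes> S x) \<otimes> S (S h) \<oplus> x \<otimes> S h" using xc Sx Sh SSh by (simp add: A.r_distr A.m_assoc)
  then have 1: "x \<otimes> S c = S (S h) \<oplus> x \<otimes> S h" using S_GL_inverse(2)[OF x] SSh by simp
  have "x \<otimes> c \<otimes> S x = x \<otimes> S h \<otimes> (x \<otimes> S x) \<oplus> x \<otimes> h \<otimes> S x"
    unfolding c_def using xc Sx Sh h by (simp add: A.l_distr A.r_distr A.m_assoc)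
  then have 2: "x \<otimes> c \<otimes> S x = x \<otimes> S h \<oplus> x \<otimes> h \<otimes> S x" using S_GL_inverse(2)[OF x] xc Sh by simp
  have "S (S h) \<ominus> x \<otimes> h \<otimes> S x = x \<otimes> S c \<ominus> x \<otimes> c \<otimes> S x"
    unfolding 1 2 using xc Sx Sh SSh h by (simp add: a_minus_def A.minus_add A.a_ac A.r_neg2 A.r_neg1)
  moreover have "x \<otimes> S c \<ominus> x \<otimes> c \<otimes> S x \<in> U (Suc 0)"
    using m unfolding c_def[symmetric] by (intro U_D(5) mult_U1 S_U GL_U1[OF x] GL_U1[OF S_GL[OF x]])
  ultimately show ?thesis by simp
qed

lemma S2pow_mod_U1:
  assumes x: "x \<in> GL" and h: "h \<in> carrier H" and m: "S h \<otimes> x \<oplus> h \<in> U (Suc 0)"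
  shows "(S ^^ (2 * n)) h \<ominus> x [^] n \<otimes> h \<otimes> (S x) [^] n \<in> U (Suc 0)"
proof (induction n)
  case 0
  show ?case using h U_D(2) by (simp add: a_minus_def A.r_neg)
next
  case (Suc n)
  note xc = GL_closed[OF x] and Sx = S_closed[OF GL_closed[OF x]]
  let ?y = "x [^] n" and ?z = "(S x) [^] n"
  have yG: "?y \<in> GL" and zG: "?z \<in> GL" using pow_GL x S_GL[OF x] by auto
  note c = GL_closed[OF yG] GL_closed[OF zG] Spow_closed[OF h, of "2 * n"] S_closed[OF S_closed[OF h]]
  have SSc: "S (S w) \<in> carrier H" if "w \<in> carrier H" for w using that S_closed by simp
  have SSm: "S (S (a \<otimes> b)) = S (S a) \<otimes> S (S b)" if "a \<in> carrier H" "b \<in> carrier H" for a b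
    using that by (simp add: antipode_mult S_closed)
  have "S (S ((S ^^ (2 * n)) h \<ominus> ?y \<otimes> h \<otimes> ?z)) \<in> U (Suc 0)" by (intro S_U Suc)
  moreover have "S (S ((S ^^ (2 * n)) h \<ominus> ?y \<otimes> h \<otimes> ?z)) = S (S ((S ^^ (2 * n)) h)) \<ominus> ?y \<otimes> S (S h) \<otimes> ?z"
    using c h linear_map_minus[OF mod_C mod_C S_linear] SSm SS_GL[OF yG] SS_GL[OF zG] S_closed by simp
  ultimately have 1: "S (S ((S ^^ (2 * n)) h)) \<ominus> ?y \<otimes> S (S h) \<otimes> ?z \<in> U (Suc 0)" by simp
  have "?y \<otimes> (S (S h) \<ominus> x \<otimes> h \<otimes> S x) \<otimes> ?z \<in> U (Suc 0)"
    by (intro mult_U1 GL_U1 yG zG S2_mod_U1[OF x h m])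
  moreover have "?y \<otimes> (S (S h) \<ominus> x \<otimes> h \<otimes> S x) \<otimes> ?z = ?y \<otimes> S (S h) \<otimes> ?z \<ominus> x [^] Suc n \<otimes> h \<otimes> (S x) [^] Suc n"
  proof -
    have "(S x) [^] Suc n = S x \<otimes> ?z" using Sx A.nat_pow_Suc2 by blast
    then show ?thesis using c xc Sx h
      by (simp add: a_minus_def A.l_distr A.r_distr A.l_minus A.r_minus A.m_assoc)
  qed
  ultimately have 2: "?y \<otimes> S (S h) \<otimes> ?z \<ominus> x [^] Suc n \<otimes> h \<otimes> (S x) [^] Suc n \<in> U (Suc 0)" by simp
  have pc: "x [^] Suc n \<otimes> h \<otimes> (S x) [^] Suc n \<in> carrier H" "?y \<otimes> S (S h) \<otimes> ?z \<in> carrier H" using c xc Sx h by auto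
  show ?case using U_D(3)[OF 1 2] module_minus_simps(5)[OF mod_C SSc[OF c(3)] pc(2,1)] by simp
qed

lemma commutator_U1_iff:
  assumes x: "x \<in> GL" and h: "h \<in> carrier H"
  shows "x [^] (n::nat) \<otimes> h \<ominus> h \<otimes> x [^] n \<in> U (Suc 0) \<longleftrightarrow> x [^] n \<otimes> h \<otimes> (S x) [^] n \<ominus> h \<in> U (Suc 0)"
proof -
  have yG: "x [^] n \<in> GL" and zG: "(S x) [^] n \<in> GL" using pow_GL x S_GL[OF x] by auto
  note c = GL_closed[OF yG] GL_closed[OF zG] and i = pow_inverse[OF x, of n]
  have 1: "(x [^] n \<otimes> h \<ominus> h \<otimes> x [^] n) \<otimes> (S x) [^] n = x [^] n \<otimes> h \<otimes> (S x) [^] n \<ominus> h"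
    using c h i by (simp add: a_minus_def A.l_distr A.l_minus A.m_assoc)
  have 2: "(x [^] n \<otimes> h \<otimes> (S x) [^] n \<ominus> h) \<otimes> x [^] n = x [^] n \<otimes> h \<ominus> h \<otimes> x [^] n"
    using c h i by (simp add: a_minus_def A.l_distr A.l_minus A.m_assoc)
  show ?thesis using mult_U1[OF _ GL_U1[OF zG], of "x [^] n \<otimes> h \<ominus> h \<otimes> x [^] n"]
      mult_U1[OF _ GL_U1[OF yG], of "x [^] n \<otimes> h \<otimes> (S x) [^] n \<ominus> h"] unfolding 1 2 by blast
qed

lemma gr_skew_components:
  assumes x: "x \<in> GL" and u: "u \<in> P_gr (cls 0 x)" and h: "h \<in> u n"
  shows "n = 0 \<Longrightarrow> h \<in> P x" "n = Suc 0 \<Longrightarrow> S h \<otimes> x \<oplus> h \<in> U (Suc 0)" "n \<ge> 2 \<Longrightarrow> h \<in> U n"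
proof -
  have uc: "u \<in> carrier Ga" using u gr_skew_iff[OF x] by blast
  have co: "cnv \<alpha> \<beta> k = coord i \<alpha> u *\<^sub>K (if j = 0 then \<beta> x else 0\<^sub>K) +\<^sub>K (if i = 0 then \<alpha> \<one> else 0\<^sub>K) *\<^sub>K coord j \<beta> u"
    if "perp (U i) \<alpha>" "perp (U j) \<beta>" "k \<in> u (i + j)" for i j \<alpha> \<beta> k
    using u that unfolding gr_skew_iff[OF x] by blast
  have cc: "coord i \<alpha> u \<in> carrier K" if "perp (U i) \<alpha>" for i \<alpha> using functionalD(1)[OF coord_functional[OF that] uc] .
  have hc: "h \<in> carrier H" by (rule U_D(1)[OF Ga_mem(1)[OF uc h]])
  note xc = GL_closed[OF x]
  have p0: "perp (U 0) f" if "fnl f" for f using that fnl_zero by (simp add: perp_def U_simps)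
  show "h \<in> P x" if n: "n = 0"
  proof -
    have h0: "h \<in> u (0 + 0)" "h \<in> u 0" using h n by auto
    interpret T: module K CC by (rule mod_CC)
    note t = bilinear_mapD(3)[OF CC.tens_bilinear hc xc] bilinear_mapD(3)[OF CC.tens_bilinear A.one_closed hc]
    have "comult H h = tens K H H h x \<oplus>\<^bsub>CC\<^esub> tens K H H \<one> h"
    proof (rule CC.tensor_eqI[OF comult_closed[OF hc] T.M.a_closed[OF t]])
      fix f g assume fg: "fnl f" "fnl g"
      show "tensor_pair K f g (comult H h) = tensor_pair K f g (tens K H H h x \<oplus>\<^bsub>CC\<^esub> tens K H H \<one> h)"
        using co[OF p0[OF fg(1)] p0[OF fg(2)] h0(1)] coord_eq[OF p0[OF fg(1)] uc h0(2)] coord_eq[OF p0[OF fg(2)] uc h0(2)]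
          functionalD(2)[OF CC.tensor_pair_functional[OF fg] t] CC.tensor_pair_tens[OF fg hc xc] CC.tensor_pair_tens[OF fg A.one_closed hc]
        by (simp add: conv_def)
    qed
    then show ?thesis using hc by (simp add: skew_primitives_def)
  qed
  show "S h \<otimes> x \<oplus> h \<in> U (Suc 0)" if n: "n = Suc 0"
  proof (rule antipode_mod_U1[OF x hc])
    fix f g assume fg: "perp (U (Suc 0)) f" "fnl g"
    note v = functionalD(1)[OF perpD(1)[OF fg(1)] hc] functionalD(1)[OF fg(2) xc] cc[OF p0[OF fg(2)]]
    show "cnv f g h = f h *\<^sub>K g x"
      using co[OF fg(1) p0[OF fg(2)], of h] coord_eq[OF fg(1) uc] h n v by simp
  next
    fix f g assume fg: "fnl f" "perp (U (Suc 0)) g"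
    note v = functionalD(1)[OF perpD(1)[OF fg(2)] hc] functionalD(1)[OF fg(1) A.one_closed] cc[OF p0[OF fg(1)]]
    show "cnv f g h = f \<one> *\<^sub>K g h"
      using co[OF p0[OF fg(1)] fg(2), of h] coord_eq[OF fg(2) uc] h n v by simp
  qed
  show "h \<in> U n" if n: "n \<ge> 2"
  proof -
    obtain k where k: "n = Suc 0 + Suc k" using n by (metis One_nat_def Suc_1 add_Suc_right le_Suc_ex plus_1_eq_Suc add_Suc)
    have "cnv f g h = 0\<^sub>K" if fg: "perp (U (Suc 0)) f" "perp (U (Suc k)) g" for f g
      using co[OF fg, of h] h k cc[OF fg(1)] cc[OF fg(2)] by simp
    then show ?thesis unfolding k using U_add_iff[of h "Suc 0" "Suc k"] hc by blast
  qed
qed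

definition gr_commuting_exponent :: "nat \<Rightarrow> bool" where
  "gr_commuting_exponent m \<longleftrightarrow> (\<forall>x\<in>GL. \<forall>u\<in>P_gr (cls 0 x).
    monoid.mult Ga (cls 0 (x [^] m)) u = monoid.mult Ga u (cls 0 (x [^] m)))"

lemma gr_commuting_exponent_iff:
  assumes char: "field_char K = 0" and N: "N \<ge> 1" "\<And>h. h \<in> carrier H \<Longrightarrow> (S ^^ N) h = h"
  shows "gr_commuting_exponent m \<longleftrightarrow> commuting_exponent m"
proof
  assume m: "commuting_exponent m"
  show "gr_commuting_exponent m" unfolding gr_commuting_exponent_def
  proof (intro ballI)
    fix x u assume x: "x \<in> GL" and u: "u \<in> P_gr (cls 0 x)"
    have uc: "u \<in> carrier Ga" using u gr_skew_iff[OF x] by blast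
    have y: "x [^] m \<in> GL" by (rule pow_GL[OF x])
    show "monoid.mult Ga (cls 0 (x [^] m)) u = monoid.mult Ga u (cls 0 (x [^] m))"
    proof (subst gr_elem_commutes_iff[OF GL_U1[OF y] uc], intro allI ballI)
      fix n h assume h: "h \<in> u n"
      note hU = Ga_mem(1)[OF uc h]
      note hc = U_D(1)[OF hU] and comp = gr_skew_components[OF x u h] and yc = GL_closed[OF y]
      consider "n = 0" | "n = Suc 0" | "n \<ge> 2" by linarith
      then show "x [^] m \<otimes> h \<ominus> h \<otimes> x [^] m \<in> U n"
      proof cases
        case 1
        then have "x [^] m \<otimes> h = h \<otimes> x [^] m" using m x comp(1) by (auto simp: commuting_exponent_def)
        then have "x [^] m \<otimes> h \<ominus> h \<otimes> x [^] m = \<zero>" using hc yc by (simp add: a_minus_def A.r_neg)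
        then show ?thesis using U_D(2) by metis
      next
        case 2
        have zc: "x [^] m \<otimes> h \<otimes> (S x) [^] m \<in> carrier H" using hc yc S_closed[OF GL_closed[OF x]] by simp
        have "(S ^^ (2 * m)) h = h" using S2pow_fixes_U2[OF m] hU 2 by simp
        then have "h \<ominus> x [^] m \<otimes> h \<otimes> (S x) [^] m \<in> U (Suc 0)" using S2pow_mod_U1[OF x hc comp(2)[OF 2], of m] by simp
        then have "\<ominus> (h \<ominus> x [^] m \<otimes> h \<otimes> (S x) [^] m) \<in> U (Suc 0)" by (rule U_D(4))
        then have "x [^] m \<otimes> h \<otimes> (S x) [^] m \<ominus> h \<in> U (Suc 0)" using module_minus_simps(2)[OF mod_C hc zc] by simp
        then show ?thesis using commutator_U1_iff[OF x hc] 2 by simp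
      next
        case 3
        have "x [^] m \<otimes> h \<in> U (0 + n)" "h \<otimes> x [^] m \<in> U (n + 0)"
          using mult_U_right[OF GL_U1[OF y] comp(3)[OF 3]] mult_U_left[OF comp(3)[OF 3] GL_U1[OF y]] .
        then show ?thesis using U_D(5) by simp
      qed
    qed
  qed
next
  assume gm: "gr_commuting_exponent m"
  let ?T = "S ^^ (2 * m)"
  show "commuting_exponent m" unfolding commuting_exponent_def
  proof (intro ballI)
    fix x h assume x: "x \<in> GL" and h: "h \<in> P x"
    note hU = P_U2[OF x h]
    note hc = U_D(1)[OF hU]
    have y: "x [^] m \<in> GL" by (rule pow_GL[OF x])
    note u = gr_elem_closed[OF hU]
    have "monoid.mult Ga (cls 0 (x [^] m)) (cls (Suc 0) h) = monoid.mult Ga (cls (Suc 0) h) (cls 0 (x [^] m))"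
      using gm x gr_elem_skew[OF x h] by (auto simp: gr_commuting_exponent_def)
    then have "x [^] m \<otimes> h \<ominus> h \<otimes> x [^] m \<in> U (Suc 0)"
      using gr_elem_commutes_iff[OF GL_U1[OF y] u] gr_elem_mem(1)[OF hU] by blast
    then have d: "?T h \<ominus> h \<in> U (Suc 0)" using commutator_U1_iff[OF x hc] S2pow_skew[OF x h] by simp
    have fixed: "?T (?T h \<ominus> h) = ?T h \<ominus> h" by (rule fixed_U1[OF Spow_linear S2pow_GL d])
    have "(?T ^^ N) h = h" using funpow_mult_fixed[of N S h "2 * m"] N(2)[OF hc] by (simp add: funpow_mult mult.commute mult.left_commute)
    then have "?T h = h" by (rule char_zero_shift[OF field_K mod_C char Spow_linear hc fixed N(1)])
    then show "x [^] m \<otimes> h = h \<otimes> x [^] m" using S2pow_skew_fixed_iff[OF x h] by simp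
  qed
qed

lemma gr_conj_index_dvd_iff:
  assumes x: "x \<in> GL" and n: "n > 0"
  shows "(\<exists>a. conj_index K grH (cls 0 x) = enat a \<and> a dvd n) \<longleftrightarrow>
    (\<forall>u\<in>P_gr (cls 0 x).
      monoid.mult Ga (cls 0 (x [^] n)) u = monoid.mult Ga u (cls 0 (x [^] n)))"
proof -
  let ?G = "G_gr" and ?x = "cls 0 x"
  interpret G: group ?G by (rule group_gr)
  let ?X = "generate ?G {?x}" and ?P = "P_gr ?x"
  let ?C = "{g \<in> ?X. \<forall>u\<in>?P. g \<otimes>\<^bsub>gr K H\<^esub> u = u \<otimes>\<^bsub>gr K H\<^esub> g}"
  have xG: "?x \<in> carrier ?G" using x by (simp add: gr_grouplike)
  have sX: "subgroup ?X ?G" using G.generate_is_subgroup xG by blast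
  have XG: "?X \<subseteq> cls 0 ` GL" using subgroup.subset[OF sX] by (simp add: gr_grouplike)
  have Pc: "u \<in> carrier Ga" if "u \<in> ?P" for u using that gr_skew_iff[OF x] by blast
  define D where "D = {g \<in> GL. \<forall>u\<in>?P. \<forall>k. \<forall>h\<in>u k. g \<otimes> h \<ominus> h \<otimes> g \<in> U k}"
  have CD: "cls 0 g \<in> ?C \<longleftrightarrow> cls 0 g \<in> ?X \<and> g \<in> D" if g: "g \<in> GL" for g
    using gr_elem_commutes_iff[OF GL_U1[OF g] Pc] g by (auto simp: D_def gr_simps)
  have sC: "subgroup ?C ?G"
  proof (rule G.subgroupI)
    show "?C \<subseteq> carrier ?G" using subgroup.subset[OF sX] by blast
    have "\<one> \<in> D"
    proof -
      have "\<one> \<otimes> h \<ominus> h \<otimes> \<one> \<in> U k" if u: "u \<in> ?P" and h: "h \<in> u k" for u h k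
      proof -
        have "h \<in> carrier H" by (rule U_D(1)[OF Ga_mem(1)[OF Pc[OF u] h]])
        then show ?thesis using U_D(2) by (simp add: a_minus_def A.r_neg)
      qed
      then show ?thesis using one_GL by (auto simp: D_def)
    qed
    moreover have "cls 0 \<one> \<in> ?X" using subgroup.one_closed[OF sX] by (simp add: gr_grouplike_one)
    ultimately show "?C \<noteq> {}" using CD[OF one_GL] by blast
  next
    fix a assume a: "a \<in> ?C"
    then obtain g where g: "g \<in> GL" "a = cls 0 g" using XG by blast
    note gc = GL_closed[OF g(1)] and Sc = S_closed[OF GL_closed[OF g(1)]]
    have gD: "g \<in> D" using CD[OF g(1)] a g(2) by blast
    have inv: "inv\<^bsub>?G\<^esub> a = cls 0 (S g)"
      unfolding g(2) by (rule G.inv_equality) (use g S_GL S_GL_inverse in \<open>simp_all add: gr_grouplike gr_grouplike_mult gr_grouplike_one\<close>)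
    have "S g \<otimes> h \<ominus> h \<otimes> S g \<in> U k" if u: "u \<in> ?P" and h: "h \<in> u k" for u k h
    proof -
      have hc: "h \<in> carrier H" by (rule U_D(1)[OF Ga_mem(1)[OF Pc[OF u] h]])
      have d: "g \<otimes> h \<ominus> h \<otimes> g \<in> U k" using gD u h by (auto simp: D_def)
      have SU: "S g \<in> U (Suc 0)" by (rule GL_U1[OF S_GL[OF g(1)]])
      have "S g \<otimes> (g \<otimes> h \<ominus> h \<otimes> g) \<otimes> S g \<in> U k"
        using mult_U_left[OF mult_U_right[OF SU d] SU] by simp
      moreover have "S g \<otimes> (g \<otimes> h \<ominus> h \<otimes> g) \<otimes> S g = h \<otimes> S g \<ominus> S g \<otimes> h"
      proof -
        have "S g \<otimes> (g \<otimes> h \<ominus> h \<otimes> g) \<otimes> S g = (S g \<otimes> g) \<otimes> h \<otimes> S g \<ominus> S g \<otimes> h \<otimes> (g \<otimes> S g)"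
          using hc gc Sc by (simp add: a_minus_def A.l_distr A.r_distr A.l_minus A.r_minus A.m_assoc)
        then show ?thesis using S_GL_inverse[OF g(1)] hc Sc by simp
      qed
      ultimately have "\<ominus> (h \<otimes> S g \<ominus> S g \<otimes> h) \<in> U k" using U_D(4) by simp
      then show ?thesis using module_minus_simps(2)[OF mod_C] hc Sc by simp
    qed
    then have "S g \<in> D" using S_GL[OF g(1)] by (auto simp: D_def)
    moreover have "inv\<^bsub>?G\<^esub> a \<in> ?X" using subgroup.m_inv_closed[OF sX, of a] a by blast
    ultimately show "inv\<^bsub>?G\<^esub> a \<in> ?C" unfolding inv using CD[OF S_GL[OF g(1)]] by blast
  next
    fix a b assume a: "a \<in> ?C" and b: "b \<in> ?C"
    then obtain g g' where g: "g \<in> GL" "a = cls 0 g" and g': "g' \<in> GL" "b = cls 0 g'" using XG by blast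
    note c = GL_closed[OF g(1)] GL_closed[OF g'(1)]
    have D: "g \<in> D" "g' \<in> D" using CD[OF g(1)] CD[OF g'(1)] a b g(2) g'(2) by blast+
    have "g \<otimes> g' \<otimes> h \<ominus> h \<otimes> (g \<otimes> g') \<in> U k" if u: "u \<in> ?P" and h: "h \<in> u k" for u k h
    proof -
      have hc: "h \<in> carrier H" by (rule U_D(1)[OF Ga_mem(1)[OF Pc[OF u] h]])
      have d: "g \<otimes> h \<ominus> h \<otimes> g \<in> U k" "g' \<otimes> h \<ominus> h \<otimes> g' \<in> U k" using D u h by (auto simp: D_def)
      have "g \<otimes> (g' \<otimes> h \<ominus> h \<otimes> g') \<oplus> (g \<otimes> h \<ominus> h \<otimes> g) \<otimes> g' \<in> U k"
        using U_D(3)[OF mult_U_right[OF GL_U1[OF g(1)] d(2)]] mult_U_left[OF d(1) GL_U1[OF g'(1)]] by simp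
      moreover have "g \<otimes> (g' \<otimes> h \<ominus> h \<otimes> g') \<oplus> (g \<otimes> h \<ominus> h \<otimes> g) \<otimes> g' = g \<otimes> g' \<otimes> h \<ominus> h \<otimes> (g \<otimes> g')"
        using hc c by (simp add: a_minus_def A.l_distr A.r_distr A.l_minus A.r_minus A.m_assoc A.a_assoc A.r_neg1)
      ultimately show ?thesis by simp
    qed
    then have "g \<otimes> g' \<in> D" using mult_GL[OF g(1) g'(1)] by (auto simp: D_def)
    moreover have "a \<otimes>\<^bsub>?G\<^esub> b \<in> ?X" using subgroup.m_closed[OF sX] a b by blast
    ultimately show "a \<otimes>\<^bsub>?G\<^esub> b \<in> ?C"
      unfolding g(2) g'(2) gr_grouplike_mult[OF g(1) g'(1)] using CD[OF mult_GL[OF g(1) g'(1)]] by blast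
  qed
  have CX: "?C \<subseteq> ?X" by blast
  have pw: "?x [^]\<^bsub>?G\<^esub> n = cls 0 (x [^] n)" by (rule gr_grouplike_pow[OF x])
  have "?x [^]\<^bsub>?G\<^esub> n \<in> ?X"
    using G.generate_pow[OF xG] int_pow_int[of ?G ?x n] by (auto intro!: exI[of _ "int n"])
  then show ?thesis
    using G.cyclic_index_dvd_iff[OF xG sC CX n] unfolding conj_index_def Let_def pw by (simp add: gr_simps)
qed

lemma gr_hopf_m:
  assumes char: "field_char K = 0" and N: "N \<ge> 1" "\<And>h. h \<in> carrier H \<Longrightarrow> (S ^^ N) h = h"
  shows "hopf_m K grH = hopf_m K H"
  unfolding hopf_m_eq
proof (rule hopf_m_eqI)
  fix m :: nat
  show "(m > 0 \<and> (\<forall>X\<in>carrier (G_gr). \<exists>a. conj_index K grH X = enat a \<and> a dvd m)) \<longleftrightarrow>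
    m > 0 \<and> commuting_exponent m"
    using gr_commuting_exponent_iff[OF char N, of m] gr_conj_index_dvd_iff[of _ m]
    by (auto simp: gr_grouplike gr_commuting_exponent_def)
qed

end

theorem theorem1p1:
  fixes K :: "'k ring" and H :: "('k, 'h) hopf_alg"
  assumes "hopf_algebra K H" and "pointed K H"
  shows
    "(hopf_m K H = \<infinity> \<longrightarrow> antipode_order H = \<infinity>) \<and>
     (\<forall>m. hopf_m K H = enat m \<longrightarrow>
        (\<forall>n\<ge>1. \<forall>h\<in>corad_filt K H n.
           (antipode H ^^ (2 * m)) h \<ominus>\<^bsub>H\<^esub> h \<in> corad_filt K H (n - 1))) \<and>
     (field_char K = 0 \<longrightarrow> antipode_order H < \<infinity> \<longrightarrow>
        (\<forall>h\<in>carrier H. antipode H h = h) \<or>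
        (antipode_order H = 2 * hopf_m K H \<and>
         2 * hopf_m K H = 2 * hopf_m K (gr K H) \<and>
         2 * hopf_m K (gr K H) = antipode_order (gr K H))) \<and>
     (\<forall>p m n l. field_char K = p \<longrightarrow> p > 0 \<longrightarrow> hopf_m K H = enat m \<longrightarrow>
        generated_as_algebra_by K H (corad_filt K H n) \<longrightarrow>
        p ^ l \<ge> n \<longrightarrow> real n \<ge> real p powi (int l - 1) \<longrightarrow>
        (\<exists>d. antipode_order H = enat d \<and> d dvd 2 * m * p ^ l))"
proof -
  interpret pointed_hopf_algebra K H
    using assms by (simp add: pointed_hopf_algebra_def pointed_hopf_algebra_axioms_def)
  show ?thesis
  proof (intro conjI allI impI ballI)
    assume "hopf_m K H = \<infinity>"
    then show "antipode_order H = \<infinity>" by (rule hopf_m_infinite)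
  next
    fix m n h assume m: "hopf_m K H = enat m" and n: "n \<ge> 1" and h: "h \<in> corad_filt K H n"
    obtain q where q: "n = Suc q" using n by (cases n) auto
    have "(S ^^ (2 * m)) h \<ominus>\<^bsub>H\<^esub> h \<in> U n"
      by (rule S2pow_unipotent[OF hopf_m_enat(2)[OF m]]) (use h in \<open>simp add: U_simps(2)\<close>)
    then show "(S ^^ (2 * m)) h \<ominus>\<^bsub>H\<^esub> h \<in> corad_filt K H (n - 1)" by (simp add: q U_simps(2))
  next
    assume char: "field_char K = 0" and fin: "antipode_order H < \<infinity>"
    obtain N where N: "antipode_order H = enat N" using fin by (cases "antipode_order H") auto
    then have "map_order (carrier H) S = enat N" by (simp add: antipode_order_def)
    note NN = map_order_enat[OF this]
    have gr: "hopf_m K (gr K H) = hopf_m K H" "antipode_order (gr K H) = antipode_order H"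
      by (rule gr_hopf_m[OF char NN(1)], erule NN(2)) (rule gr_antipode_order[OF char NN(1)], erule NN(2))
    show "(\<forall>h\<in>carrier H. S h = h) \<or>
      (antipode_order H = 2 * hopf_m K H \<and> 2 * hopf_m K H = 2 * hopf_m K (gr K H) \<and>
       2 * hopf_m K (gr K H) = antipode_order (gr K H))"
    proof (cases "\<forall>h\<in>carrier H. S h = h")
      case False
      then obtain m where "hopf_m K H = enat m" "N = 2 * m" using finite_order_char_zero[OF char N] by blast
      then show ?thesis unfolding gr using N by (simp add: numeral_eq_enat)
    qed simp
  next
    fix p m n l
    assume p: "field_char K = p" "p > 0" and m: "hopf_m K H = enat m"
      and gen: "generated_as_algebra_by K H (corad_filt K H n)"
      and l: "p ^ l \<ge> n" and n: "real n \<ge> real p powi (int l - 1)"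
    have "real p powi (int l - 1) > 0" using p(2) by simp
    then have "n \<ge> 1" using n by (cases n) auto
    then show "\<exists>d. antipode_order H = enat d \<and> d dvd 2 * m * p ^ l"
      by (intro finite_order_char_p[OF p m _ l]) (use gen in \<open>simp_all add: U_simps(2)\<close>)
  qed
qed

end
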